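(* Assume that $Q_\star$ has full rank, that $(X_n)_{n\ge1}$ is irreducible and aperiodic, that $\pi^\star$ is the stationary distribution, that the family of emission densities $\mathfrak F^\star=\{f^\star_1,\dots,f^\star_K\}$ is linearly independent, and that $f^\star_x\in\mathrm L^2(\mathcal Y,\mathcal L^D)$ for all $x\in\mathcal X$. Then there exist positive constants $u(Q_\star)$, $\mathcal C(Q_\star,\mathfrak F^\star)$ and $\mathbf N(Q_\star,\mathfrak F^\star)$ such that for any $u\ge u(Q_\star)$, any $\delta\in(0,1)$ and any $M\ge M_{\mathfrak F^\star}$, there exists a permutation $\tau_M\in\mathcal S_K$ such that the spectral estimators $\widehat f_{M,x}$, $\widehat\pi$ and $\widehat Q$ satisfy, for any $p\ge\mathbf N(Q_\star,\mathfrak F^\star)\,\eta_3(\Phi_M)^2\,u(-\log\delta)/\delta^2$, with probability greater than $1-2\delta-4e^{-u}$, $$\max_{x\in\mathcal X}\|f^\star_{M,x}-\widehat f_{M,\tau_M(x)}\|_2\le\mathcal C(Q_\star,\mathfrak F^\star)\frac{\sqrt{-\log\delta}}{\delta}\frac{\eta_3(\Phi_M)}{\sqrt p}\sqrt u,$$ $$\|\pi^\star-\mathbb P_{\tau_M}\widehat\pi\|_2\le\mathcal C(Q_\star,\mathfrak F^\star)\frac{\sqrt{-\log\delta}}{\delta}\frac{\eta_3(\Phi_M)}{\sqrt p}\sqrt u,$$ $$\|Q_\star-\mathbb P_{\tau_M}\widehat Q\,\mathbb P_{\tau_M}^\top\|\le\mathcal C(Q_\star,\mathfrak F^\star)\frac{\sqrt{-\log\delta}}{\delta}\frac{\eta_3(\Phi_M)}{\sqrt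 p}\sqrt u.$$
   Context: Setting. $\mathcal X=\{1,\dots,K\}$ with $K$ known, $\mathcal Y\subset\mathbb R^D$ for a positive integer $D$, $\mathcal L^D$ is Lebesgue measure on $\mathcal Y$. $(X_j,Y_j)_{j\ge1}$ is a hidden Markov model: $(X_j)$ is a Markov chain on $\mathcal X$ with initial distribution $\pi^\star$ and transition matrix $Q_\star$; conditionally on $(X_j)$ the $\mathcal Y$-valued $Y_j$ are independent, the conditional law of $Y_\ell$ depends only on $X_\ell$, and given $X_\ell=x$ it has density $f^\star_x$ with respect to $\mathcal L^D$. Approximation spaces. $(M_r)_{r\ge1}$ is an increasing sequence of integers, $(\mathfrak P_{M_r})_{r\ge1}$ is a sequence of nested subspaces of $\mathrm L^2(\mathcal Y,\mathcal L^D)$ whose union is dense, and $\Phi_{M_r}=\{\varphi_1,\dots,\varphi_{M_r}\}$ is an orthonormal basis of $\mathfrak P_{M_r}$ (all basis functions may change with $r$). The index $r$ is dropped and $M$ is written for $M_r$. $f^\star_{M,x}=\sum_{m=1}^M\langle f^\star_x,\varphi_m\rangle\varphi_m$, and $$\eta_3^2(\Phi_M)=\sup_{y,y'\in\mathcal Y^3}\sum_{a,b,c=1}^M\big(\varphi_a(y_1)\varphi_b(y_2)\varphi_c(y_3)-\varphi_a(y'_1)\varphi_b(y'_2)\varphi_c(y'_3)\big)^2.$$ The integer $M_{\mathfrak F^\star}$. Let $G$ be the $K\times K$ Gram matrix $(\langle f^\star_{x_1},f^\star_{x_2}\rangle)_{x_1,x_2\in\mathcal X}$ and $G_M=(\langle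 f^\star_{M,x_1},f^\star_{M,x_2}\rangle)_{x_1,x_2\in\mathcal X}$. $M_{\mathfrak F^\star}\ge1$ is an integer such that for all $M\ge M_{\mathfrak F^\star}$ the operator norm of $G_M-G$ is at most $3\lambda_K(G)/4$, where $\lambda_K(G)>0$ is the smallest eigenvalue of $G$ (such an integer exists under the linear independence assumption). Spectral algorithm (input: $Y_1,\dots,Y_{p+2}$ and $K$; output: $\widehat\pi$, $\widehat Q$, $(\widehat f_{M,x})_{x\in\mathcal X}$). 1. For $a,b,c\in\{1,\dots,M\}$: $\widehat L(a)=\frac1p\sum_{s=1}^p\varphi_a(Y_s)$, $\widehat{\mathbf M}(a,b,c)=\frac1p\sum_{s=1}^p\varphi_a(Y_s)\varphi_b(Y_{s+1})\varphi_c(Y_{s+2})$, $\widehat N(a,b)=\frac1p\sum_{s=1}^p\varphi_a(Y_s)\varphi_b(Y_{s+1})$, $\widehat P(a,c)=\frac1p\sum_{s=1}^p\varphi_a(Y_s)\varphi_c(Y_{s+2})$. 2. $\widehat U$ is the $M\times K$ matrix of orthonormal right singular vectors of $\widehat P$ corresponding to its top $K$ singular values. 3. For all $b\in\{1,\dots,M\}$, $\widehat B(b)=(\widehat U^\top\widehat P\widehat U)^{-1}\widehat U^\top\widehat{\mathbf M}(\cdot,b,\cdot)\widehat U$. 4. $\Theta$ is a $K\times K$ unitary matrix uniformly drawn; for $x\in\mathcal X$, $\widehat C(x)=\sum_{b=1}^M(\widehat U\Theta)(b,x)\widehat B(b)$. 5. $\widehat R$ is a $K\times K$ matrix with unit Euclidean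 norm columns that diagonalizes $\widehat C(1)$: $\widehat R^{-1}\widehat C(1)\widehat R$ is diagonal. 6. For $x,x'\in\mathcal X$, $\widehat\Lambda(x,x')=(\widehat R^{-1}\widehat C(x)\widehat R)(x',x')$, and $\widehat O=\widehat U\Theta\widehat\Lambda$. 7. $\widehat f_{M,x}=\sum_{m=1}^M\widehat O(m,x)\varphi_m$. 8. $\tilde\pi=(\widehat U^\top\widehat O)^{-1}\widehat U^\top\widehat L$. 9. $\widehat Q=\Pi_{\mathrm{TM}}\big((\widehat U^\top\widehat O\,\mathrm{Diag}[\tilde\pi])^{-1}\widehat U^\top\widehat N\widehat U(\widehat O^\top\widehat U)^{-1}\big)$, where $\mathrm{Diag}[v]$ is the diagonal matrix with diagonal entries $v_i$ and $\Pi_{\mathrm{TM}}$ is the projection, with respect to the Frobenius scalar product, onto the convex set of transition matrices; $\widehat\pi$ is the stationary distribution of $\widehat Q$. $\mathcal S_K$ is the set of permutations of $\{1,\dots,K\}$; $\mathbb P_\tau$ is the permutation matrix associated with $\tau$. $\|\cdot\|_2$ is the Euclidean norm for vectors and the $\mathrm L^2(\mathcal Y,\mathcal L^D)$ norm for functions; $\|\cdot\|$ is the operator norm of matrices.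
   Formalization: The permutation may depend on p and the sample (a fixed one is impossible: replacing Θ by −Θ can swap labels); constants are chosen per type of sample space, harmless by passing to the joint law; Θ is real orthogonal and Û a measurable function of the observations. *)

theory Defs
  imports "HOL-Probability.Probability"
begin

(* The state space {1,...,K} is a finite type 'k with K = CARD('k), together with a distinguished
   element playing the role of the state 1.  Since M varies while K is fixed, a K x K matrix is a
   real^'k^'k, whereas an M x K matrix is a function nat => real^'k giving its rows 1,...,M, and
   M x M and M x M x M arrays are functions on nat, used at the indices 1,...,M only. *)

definition transition_matrix :: "real^'k^'k \<Rightarrow> bool" where
  "transition_matrix Q \<longleftrightarrow> (\<forall>x x'. 0 \<le> Q $ x $ x') \<and> (\<forall>x. (\<Sum>x'\<in>UNIV. Q $ x $ x') = 1)"

definition mat_pow :: "real^'k^'k \<Rightarrow> nat \<Rightarrow> real^'k^'k" where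
  "mat_pow Q n = ((\<lambda>A. Q ** A) ^^ n) (mat 1)"

definition irreducible_chain :: "real^'k^'k \<Rightarrow> bool" where
  "irreducible_chain Q \<longleftrightarrow> (\<forall>x x'. \<exists>n. 0 < mat_pow Q n $ x $ x')"

definition aperiodic_chain :: "real^'k^'k \<Rightarrow> bool" where
  "aperiodic_chain Q \<longleftrightarrow> (\<forall>x. Gcd {n. 1 \<le> n \<and> 0 < mat_pow Q n $ x $ x} = 1)"

definition stationary_distribution :: "real^'k^'k \<Rightarrow> real^'k \<Rightarrow> bool" where
  "stationary_distribution Q \<pi> \<longleftrightarrow>
     (\<forall>x. 0 \<le> \<pi> $ x) \<and> (\<Sum>x\<in>UNIV. \<pi> $ x) = 1 \<and> \<pi> v* Q = \<pi>"

definition leb :: "(real^'d) set \<Rightarrow> (real^'d) measure" where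
  "leb \<Y> = restrict_space lborel \<Y>"

definition L2_fun :: "(real^'d) set \<Rightarrow> (real^'d \<Rightarrow> real) \<Rightarrow> bool" where
  "L2_fun \<Y> g \<longleftrightarrow> g \<in> borel_measurable (leb \<Y>) \<and> integrable (leb \<Y>) (\<lambda>y. (g y)\<^sup>2)"

definition L2_inner :: "(real^'d) set \<Rightarrow> (real^'d \<Rightarrow> real) \<Rightarrow> (real^'d \<Rightarrow> real) \<Rightarrow> real" where
  "L2_inner \<Y> g h = (LINT y|leb \<Y>. g y * h y)"

definition L2_norm :: "(real^'d) set \<Rightarrow> (real^'d \<Rightarrow> real) \<Rightarrow> real" where
  "L2_norm \<Y> g = sqrt (L2_inner \<Y> g g)"

definition prob_density :: "(real^'d) set \<Rightarrow> (real^'d \<Rightarrow> real) \<Rightarrow> bool" where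
  "prob_density \<Y> g \<longleftrightarrow> (\<forall>y\<in>\<Y>. 0 \<le> g y) \<and> integrable (leb \<Y>) g \<and> (LINT y|leb \<Y>. g y) = 1"

text \<open>Linear independence of a family of functions modulo null sets.\<close>

definition lin_indep_family :: "(real^'d) set \<Rightarrow> ('k::finite \<Rightarrow> real^'d \<Rightarrow> real) \<Rightarrow> bool" where
  "lin_indep_family \<Y> f \<longleftrightarrow>
     (\<forall>c. (AE y in leb \<Y>. (\<Sum>x\<in>UNIV. c x * f x y) = 0) \<longrightarrow> (\<forall>x. c x = 0))"

definition markov_chain :: "'w measure \<Rightarrow> real^'k \<Rightarrow> real^'k^'k \<Rightarrow> (nat \<Rightarrow> 'w \<Rightarrow> 'k) \<Rightarrow> bool" where
  "markov_chain \<Omega> \<pi> Q X \<longleftrightarrow>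
     (\<forall>j\<ge>1. X j \<in> measurable \<Omega> (count_space UNIV)) \<and>
     (\<forall>x. \<P>(\<omega> in \<Omega>. X 1 \<omega> = x) = \<pi> $ x) \<and>
     (\<forall>n\<ge>1. \<forall>x x'. 0 < \<P>(\<omega> in \<Omega>. \<forall>i\<in>{1..n}. X i \<omega> = x i) \<longrightarrow>
        \<P>(\<omega> in \<Omega>. X (Suc n) \<omega> = x' \<bar> \<forall>i\<in>{1..n}. X i \<omega> = x i) = Q $ x n $ x')"

text \<open>
  The last conjunct says that, conditionally on the chain, the observations are independent and
  the one at time \<open>i\<close> has density \<open>f (X i)\<close>. Conditioning on the first \<open>n\<close> states for
  every \<open>n\<close> amounts to conditioning on the whole chain, since some of the \<open>A i\<close> may
  be all of \<open>\<Y>\<close>.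
\<close>

definition hidden_markov_model ::
  "'w measure \<Rightarrow> real^'k \<Rightarrow> real^'k^'k \<Rightarrow> (real^'d) set \<Rightarrow> ('k \<Rightarrow> real^'d \<Rightarrow> real) \<Rightarrow>
   (nat \<Rightarrow> 'w \<Rightarrow> 'k) \<Rightarrow> (nat \<Rightarrow> 'w \<Rightarrow> real^'d) \<Rightarrow> bool" where
  "hidden_markov_model \<Omega> \<pi> Q \<Y> f X Y \<longleftrightarrow>
     prob_space \<Omega> \<and> markov_chain \<Omega> \<pi> Q X \<and>
     (\<forall>j\<ge>1. Y j \<in> measurable \<Omega> (leb \<Y>)) \<and>
     (\<forall>n x A. (\<forall>i\<in>{1..n}. A i \<in> sets (leb \<Y>)) \<and> 0 < \<P>(\<omega> in \<Omega>. \<forall>i\<in>{1..n}. X i \<omega> = x i) \<longrightarrow>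
        \<P>(\<omega> in \<Omega>. (\<forall>i\<in>{1..n}. Y i \<omega> \<in> A i) \<bar> \<forall>i\<in>{1..n}. X i \<omega> = x i)
          = (\<Prod>i=1..n. LINT y:A i|leb \<Y>. f (x i) y))"

definition L2_span :: "(real^'d) set \<Rightarrow> nat \<Rightarrow> (nat \<Rightarrow> real^'d \<Rightarrow> real) \<Rightarrow> (real^'d \<Rightarrow> real) set" where
  "L2_span \<Y> M \<phi> = {g. L2_fun \<Y> g \<and> (\<exists>c. AE y in leb \<Y>. g y = (\<Sum>m=1..M. c m * \<phi> m y))}"

text \<open>
  \<open>\<phi> r 1, \<dots>, \<phi> r (Ms r)\<close> is an orthonormal basis of the \<open>r\<close>-th approximation space, which is
  therefore \<open>L2_span \<Y> (Ms r) (\<phi> r)\<close>.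
\<close>

definition approximation_spaces ::
  "(real^'d) set \<Rightarrow> (nat \<Rightarrow> nat) \<Rightarrow> (nat \<Rightarrow> nat \<Rightarrow> real^'d \<Rightarrow> real) \<Rightarrow> bool" where
  "approximation_spaces \<Y> Ms \<phi> \<longleftrightarrow>
     mono Ms \<and>
     (\<forall>r. \<forall>m\<in>{1..Ms r}. L2_fun \<Y> (\<phi> r m)) \<and>
     (\<forall>r. \<forall>m\<in>{1..Ms r}. \<forall>n\<in>{1..Ms r}. L2_inner \<Y> (\<phi> r m) (\<phi> r n) = (if m = n then 1 else 0)) \<and>
     (\<forall>r s. r \<le> s \<longrightarrow> L2_span \<Y> (Ms r) (\<phi> r) \<subseteq> L2_span \<Y> (Ms s) (\<phi> s)) \<and>
     (\<forall>g \<epsilon>. L2_fun \<Y> g \<and> 0 < \<epsilon> \<longrightarrow>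
        (\<exists>r. \<exists>h\<in>L2_span \<Y> (Ms r) (\<phi> r). L2_norm \<Y> (\<lambda>y. g y - h y) < \<epsilon>))"

definition L2_proj ::
  "(real^'d) set \<Rightarrow> nat \<Rightarrow> (nat \<Rightarrow> real^'d \<Rightarrow> real) \<Rightarrow> (real^'d \<Rightarrow> real) \<Rightarrow> real^'d \<Rightarrow> real" where
  "L2_proj \<Y> M \<phi> g = (\<lambda>y. \<Sum>m=1..M. L2_inner \<Y> g (\<phi> m) * \<phi> m y)"

text \<open>
  The supremum may be infinite, hence the extended value of \<open>eta3_sq\<close>; \<open>eta3\<close> is meaningful
  only if \<open>eta3_sq\<close> is finite.
\<close>

definition eta3_sq :: "(real^'d) set \<Rightarrow> nat \<Rightarrow> (nat \<Rightarrow> real^'d \<Rightarrow> real) \<Rightarrow> ennreal" where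
  "eta3_sq \<Y> M \<phi> =
     (SUP (y1, y2, y3, z1, z2, z3) \<in> \<Y> \<times> \<Y> \<times> \<Y> \<times> \<Y> \<times> \<Y> \<times> \<Y>.
        ennreal (\<Sum>a=1..M. \<Sum>b=1..M. \<Sum>c=1..M.
          (\<phi> a y1 * \<phi> b y2 * \<phi> c y3 - \<phi> a z1 * \<phi> b z2 * \<phi> c z3)\<^sup>2))"

definition eta3 :: "(real^'d) set \<Rightarrow> nat \<Rightarrow> (nat \<Rightarrow> real^'d \<Rightarrow> real) \<Rightarrow> real" where
  "eta3 \<Y> M \<phi> = sqrt (enn2real (eta3_sq \<Y> M \<phi>))"

definition gram_matrix :: "(real^'d) set \<Rightarrow> ('k \<Rightarrow> real^'d \<Rightarrow> real) \<Rightarrow> real^'k^'k" where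
  "gram_matrix \<Y> f = (\<chi> x x'. L2_inner \<Y> (f x) (f x'))"

definition smallest_eigenvalue :: "real^'k^'k \<Rightarrow> real" where
  "smallest_eigenvalue A = Min {l. \<exists>v. v \<noteq> 0 \<and> A *v v = l *\<^sub>R v}"

definition op_norm :: "real^'k^'k \<Rightarrow> real" where
  "op_norm A = onorm (\<lambda>v. A *v v)"

text \<open>The property required of the integer denoted \<open>M\<close> with index \<open>\<FF>\<^sup>\<star>\<close>.\<close>

definition gram_threshold ::
  "(real^'d) set \<Rightarrow> ('k::finite \<Rightarrow> real^'d \<Rightarrow> real) \<Rightarrow> (nat \<Rightarrow> nat) \<Rightarrow> (nat \<Rightarrow> nat \<Rightarrow> real^'d \<Rightarrow> real) \<Rightarrow> nat \<Rightarrow> bool" where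
  "gram_threshold \<Y> f Ms \<phi> M0 \<longleftrightarrow>
     1 \<le> M0 \<and>
     (\<forall>r. M0 \<le> Ms r \<longrightarrow>
        op_norm (gram_matrix \<Y> (\<lambda>x. L2_proj \<Y> (Ms r) (\<phi> r) (f x)) - gram_matrix \<Y> f)
          \<le> 3 * smallest_eigenvalue (gram_matrix \<Y> f) / 4)"

definition L_hat :: "(nat \<Rightarrow> 'y \<Rightarrow> real) \<Rightarrow> nat \<Rightarrow> (nat \<Rightarrow> 'y) \<Rightarrow> nat \<Rightarrow> real" where
  "L_hat \<phi> p y a = (\<Sum>s=1..p. \<phi> a (y s)) / real p"

definition M_hat :: "(nat \<Rightarrow> 'y \<Rightarrow> real) \<Rightarrow> nat \<Rightarrow> (nat \<Rightarrow> 'y) \<Rightarrow> nat \<Rightarrow> nat \<Rightarrow> nat \<Rightarrow> real" where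
  "M_hat \<phi> p y a b c = (\<Sum>s=1..p. \<phi> a (y s) * \<phi> b (y (s + 1)) * \<phi> c (y (s + 2))) / real p"

definition N_hat :: "(nat \<Rightarrow> 'y \<Rightarrow> real) \<Rightarrow> nat \<Rightarrow> (nat \<Rightarrow> 'y) \<Rightarrow> nat \<Rightarrow> nat \<Rightarrow> real" where
  "N_hat \<phi> p y a b = (\<Sum>s=1..p. \<phi> a (y s) * \<phi> b (y (s + 1))) / real p"

definition P_hat :: "(nat \<Rightarrow> 'y \<Rightarrow> real) \<Rightarrow> nat \<Rightarrow> (nat \<Rightarrow> 'y) \<Rightarrow> nat \<Rightarrow> nat \<Rightarrow> real" where
  "P_hat \<phi> p y a c = (\<Sum>s=1..p. \<phi> a (y s) * \<phi> c (y (s + 2))) / real p"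

definition orthonormal_vectors :: "nat \<Rightarrow> (nat \<Rightarrow> nat \<Rightarrow> real) \<Rightarrow> bool" where
  "orthonormal_vectors M v \<longleftrightarrow>
     (\<forall>i\<in>{1..M}. \<forall>j\<in>{1..M}. (\<Sum>a=1..M. v i a * v j a) = (if i = j then 1 else 0))"

text \<open>
  The columns of \<open>U\<close> are, in some order, the first \<open>K\<close> right singular vectors of a singular value
  decomposition of the \<open>M\<close> by \<open>M\<close> matrix \<open>P\<close> with nonincreasing singular values.
\<close>

definition top_right_singular_vectors :: "nat \<Rightarrow> (nat \<Rightarrow> nat \<Rightarrow> real) \<Rightarrow> (nat \<Rightarrow> real^'k) \<Rightarrow> bool" where
  "top_right_singular_vectors M P U \<longleftrightarrow>
     CARD('k) \<le> M \<and>
     (\<exists>\<sigma> w v e.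
        orthonormal_vectors M w \<and> orthonormal_vectors M v \<and>
        (\<forall>i\<in>{1..M}. 0 \<le> \<sigma> i) \<and> (\<forall>i\<in>{1..M}. \<forall>j\<in>{1..M}. i \<le> j \<longrightarrow> \<sigma> j \<le> \<sigma> i) \<and>
        (\<forall>a\<in>{1..M}. \<forall>c\<in>{1..M}. P a c = (\<Sum>i=1..M. \<sigma> i * w i a * v i c)) \<and>
        bij_betw e (UNIV :: 'k set) {1..CARD('k)} \<and>
        (\<forall>b\<in>{1..M}. \<forall>x. U b $ x = v (e x) b))"

text \<open>The products \<open>U\<^sup>T v\<close>, \<open>U\<^sup>T A U\<close> and \<open>U\<^sup>T V\<close> with \<open>v\<close> of size \<open>M\<close>, \<open>A\<close> of size \<open>M\<close> by \<open>M\<close>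
  and \<open>U\<close>, \<open>V\<close> of size \<open>M\<close> by \<open>K\<close>.\<close>

definition tr_mult_vec :: "nat \<Rightarrow> (nat \<Rightarrow> real^'k) \<Rightarrow> (nat \<Rightarrow> real) \<Rightarrow> real^'k" where
  "tr_mult_vec M U v = (\<chi> x. \<Sum>a=1..M. U a $ x * v a)"

definition compress :: "nat \<Rightarrow> (nat \<Rightarrow> real^'k) \<Rightarrow> (nat \<Rightarrow> nat \<Rightarrow> real) \<Rightarrow> real^'k^'k" where
  "compress M U A = (\<chi> x x'. \<Sum>a=1..M. \<Sum>c=1..M. U a $ x * A a c * U c $ x')"

definition tr_mult :: "nat \<Rightarrow> (nat \<Rightarrow> real^'k) \<Rightarrow> (nat \<Rightarrow> real^'k) \<Rightarrow> real^'k^'k" where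
  "tr_mult M U V = (\<chi> x x'. \<Sum>a=1..M. U a $ x * V a $ x')"

definition diag_mat :: "real^'k \<Rightarrow> real^'k^'k" where
  "diag_mat v = (\<chi> x x'. if x = x' then v $ x else 0)"

definition B_hat :: "(nat \<Rightarrow> 'y \<Rightarrow> real) \<Rightarrow> nat \<Rightarrow> nat \<Rightarrow> (nat \<Rightarrow> 'y) \<Rightarrow> (nat \<Rightarrow> real^'k) \<Rightarrow> nat \<Rightarrow> real^'k^'k" where
  "B_hat \<phi> M p y U b =
     matrix_inv (compress M U (P_hat \<phi> p y)) ** compress M U (\<lambda>a c. M_hat \<phi> p y a b c)"

definition C_hat ::
  "(nat \<Rightarrow> 'y \<Rightarrow> real) \<Rightarrow> nat \<Rightarrow> nat \<Rightarrow> (nat \<Rightarrow> 'y) \<Rightarrow> (nat \<Rightarrow> real^'k) \<Rightarrow> real^'k^'k \<Rightarrow> 'k \<Rightarrow> real^'k^'k" where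
  "C_hat \<phi> M p y U \<Theta> x = (\<Sum>b=1..M. ((U b v* \<Theta>) $ x) *\<^sub>R B_hat \<phi> M p y U b)"

definition Lambda_hat ::
  "(nat \<Rightarrow> 'y \<Rightarrow> real) \<Rightarrow> nat \<Rightarrow> nat \<Rightarrow> (nat \<Rightarrow> 'y) \<Rightarrow> (nat \<Rightarrow> real^'k) \<Rightarrow> real^'k^'k \<Rightarrow> real^'k^'k \<Rightarrow> real^'k^'k" where
  "Lambda_hat \<phi> M p y U \<Theta> R =
     (\<chi> x x'. (matrix_inv R ** C_hat \<phi> M p y U \<Theta> x ** R) $ x' $ x')"

definition O_hat ::
  "(nat \<Rightarrow> 'y \<Rightarrow> real) \<Rightarrow> nat \<Rightarrow> nat \<Rightarrow> (nat \<Rightarrow> 'y) \<Rightarrow> (nat \<Rightarrow> real^'k) \<Rightarrow> real^'k^'k \<Rightarrow> real^'k^'k \<Rightarrow> nat \<Rightarrow> real^'k" where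
  "O_hat \<phi> M p y U \<Theta> R = (\<lambda>m. U m v* (\<Theta> ** Lambda_hat \<phi> M p y U \<Theta> R))"

text \<open>
  \<open>spectral_output \<phi> M p x1 y U \<Theta> fh \<pi>h Qh\<close>: with observations \<open>y\<close>, singular vectors \<open>U\<close> and
  orthogonal matrix \<open>\<Theta>\<close>, all the inverses taken by the algorithm exist, \<open>C_hat x1\<close> is
  diagonalizable over the reals, and \<open>fh\<close>, \<open>\<pi>h\<close>, \<open>Qh\<close> are an output of the algorithm. The output
  depends on the choice of \<open>R\<close>, which at best is unique up to the order and signs of its columns.
  The norm of \<open>real^'k^'k\<close>, with respect to which \<open>closest_point\<close> projects, is the Frobenius norm.
\<close>

definition spectral_output ::
  "(nat \<Rightarrow> real^'d \<Rightarrow> real) \<Rightarrow> nat \<Rightarrow> nat \<Rightarrow> 'k \<Rightarrow> (nat \<Rightarrow> real^'d) \<Rightarrow> (nat \<Rightarrow> real^'k) \<Rightarrow> real^'k^'k \<Rightarrow>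
   ('k \<Rightarrow> real^'d \<Rightarrow> real) \<Rightarrow> real^'k \<Rightarrow> real^'k^'k \<Rightarrow> bool" where
  "spectral_output \<phi> M p x1 y U \<Theta> fh \<pi>h Qh \<longleftrightarrow>
     invertible (compress M U (P_hat \<phi> p y)) \<and>
     (\<exists>R Oh \<pi>t.
        invertible R \<and> (\<forall>x. norm (column x R) = 1) \<and>
        (\<forall>x x'. x \<noteq> x' \<longrightarrow> (matrix_inv R ** C_hat \<phi> M p y U \<Theta> x1 ** R) $ x $ x' = 0) \<and>
        Oh = O_hat \<phi> M p y U \<Theta> R \<and>
        fh = (\<lambda>x z. \<Sum>m=1..M. Oh m $ x * \<phi> m z) \<and>
        invertible (tr_mult M U Oh) \<and>
        \<pi>t = matrix_inv (tr_mult M U Oh) *v tr_mult_vec M U (L_hat \<phi> p y) \<and>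
        invertible (tr_mult M U Oh ** diag_mat \<pi>t) \<and>
        Qh = closest_point {A. transition_matrix A}
               (matrix_inv (tr_mult M U Oh ** diag_mat \<pi>t) ** compress M U (N_hat \<phi> p y) **
                matrix_inv (tr_mult M Oh U)) \<and>
        stationary_distribution Qh \<pi>h)"

definition sample_space :: "(real^'d) set \<Rightarrow> nat \<Rightarrow> (nat \<Rightarrow> real^'d) measure" where
  "sample_space \<Y> p = PiM {1..p + 2} (\<lambda>_. leb \<Y>)"

text \<open>
  \<open>Uh\<close> is a measurable choice of the singular vectors as a function of the observations; it does not
  depend on \<open>\<Theta>\<close>, which is drawn afterwards. The estimators are functions of the observations and of
  \<open>\<Theta>\<close> that are an output of the algorithm wherever it can be carried out; elsewhere they are
  arbitrary.
\<close>

definition spectral_estimators ::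
  "(real^'d) set \<Rightarrow> (nat \<Rightarrow> real^'d \<Rightarrow> real) \<Rightarrow> nat \<Rightarrow> nat \<Rightarrow> 'k::finite \<Rightarrow>
   ((nat \<Rightarrow> real^'d) \<Rightarrow> nat \<Rightarrow> real^'k) \<Rightarrow>
   ((nat \<Rightarrow> real^'d) \<Rightarrow> real^'k^'k \<Rightarrow> 'k \<Rightarrow> real^'d \<Rightarrow> real) \<Rightarrow>
   ((nat \<Rightarrow> real^'d) \<Rightarrow> real^'k^'k \<Rightarrow> real^'k) \<Rightarrow>
   ((nat \<Rightarrow> real^'d) \<Rightarrow> real^'k^'k \<Rightarrow> real^'k^'k) \<Rightarrow> bool" where
  "spectral_estimators \<Y> \<phi> M p x1 Uh fh \<pi>h Qh \<longleftrightarrow>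
     (\<forall>b\<in>{1..M}. (\<lambda>y. Uh y b) \<in> borel_measurable (sample_space \<Y> p)) \<and>
     (\<forall>y\<in>space (sample_space \<Y> p).
        top_right_singular_vectors M (P_hat \<phi> p y) (Uh y) \<and>
        (\<forall>\<Theta>. orthogonal_matrix \<Theta> \<and> (\<exists>f' \<pi>' Q'. spectral_output \<phi> M p x1 y (Uh y) \<Theta> f' \<pi>' Q') \<longrightarrow>
           spectral_output \<phi> M p x1 y (Uh y) \<Theta> (fh y \<Theta>) (\<pi>h y \<Theta>) (Qh y \<Theta>)))"

text \<open>
  The law of \<open>\<Theta>\<close> is the Haar probability measure of the orthogonal group, i.e. the only one that
  is invariant under left multiplication.
\<close>

definition uniform_orthogonal :: "'w measure \<Rightarrow> ('w \<Rightarrow> real^'k^'k) \<Rightarrow> bool" where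
  "uniform_orthogonal \<Omega> \<Theta> \<longleftrightarrow>
     \<Theta> \<in> borel_measurable \<Omega> \<and> (\<forall>\<omega>\<in>space \<Omega>. orthogonal_matrix (\<Theta> \<omega>)) \<and>
     (\<forall>V. orthogonal_matrix V \<longrightarrow> distr \<Omega> borel (\<lambda>\<omega>. V ** \<Theta> \<omega>) = distr \<Omega> borel \<Theta>)"

definition indep_of_observations ::
  "'w measure \<Rightarrow> (real^'d) set \<Rightarrow> (nat \<Rightarrow> 'w \<Rightarrow> real^'d) \<Rightarrow> ('w \<Rightarrow> real^'k^'k) \<Rightarrow> bool" where
  "indep_of_observations \<Omega> \<Y> Y \<Theta> \<longleftrightarrow>
     prob_space.indep_set \<Omega>
       (sets (vimage_algebra (space \<Omega>) (\<lambda>\<omega>. \<lambda>j\<in>{1..}. Y j \<omega>) (PiM {1..} (\<lambda>_. leb \<Y>))))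
       (sets (vimage_algebra (space \<Omega>) \<Theta> borel))"

text \<open>With this convention the \<open>x\<close>-th entry of \<open>perm_mat \<tau> *v v\<close> is \<open>v $ \<tau> x\<close>, in accordance with
  the matching of the state \<open>x\<close> with the estimated state \<open>\<tau> x\<close>.\<close>

definition perm_mat :: "('k \<Rightarrow> 'k) \<Rightarrow> real^'k^'k" where
  "perm_mat \<tau> = (\<chi> x x'. if x' = \<tau> x then 1 else 0)"

end

(* In the basis given by the rows of W = Q O^T U the matrices C(x) of the algorithm become diagonal,
with entries (Theta^T U^T O)(x, .), up to an error proportional to the distance e between the
empirical moments and their expectations. If the first row has pairwise distinct entries with gap g,
the eigenvectors of C(1), and hence all the outputs, are perturbed by O(e / g).

The gap is at least of order delta with probability 1 - delta, because the first column of Theta is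
uniform on the sphere and independent of U. The bound on e uses a martingale: the solution h of the
Poisson equation h - Q h = g turns the centred sum of the features of three consecutive observations
into a martingale with bounded increments in a Euclidean space, to which Pinelis' bound
E cosh |v + d| <= exp(c^2) cosh |v| for centred d with |d| <= c applies. It is free of the dimension,
so no constant depends on M. *)
theory Submission
  imports Defs
begin

subsection \<open>Frobenius norm of matrices\<close>

text \<open>The only dimension allowed in a constant is K. Therefore no population counterpart of
  the singular vectors is introduced: the span of U is merely shown to contain the columns of O up
  to a small residual, which makes A = U^T O well conditioned. The rest happens among K x K
  matrices, where passing between operator and Frobenius norm costs at most a factor K.

  The algorithm leaves R unspecified, so the bounds have to hold for every admissible R. Because the
  spectrum of C(1) is simple, two diagonalizations differ only by the order and the scaling of the
  columns, and the diagonal entries read off from the other C(x) do not see the scaling. The order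
  is the permutation of the result.

  The quantity eta3 controls the oscillation of the feature tensor and says nothing directly about
  its size. Every conditional expectation is therefore compared with values of the tensor instead of
  being bounded by itself. The four empirical moments are slices of one extended tensor and so share
  a single deviation event.\<close>

lemma norm_mat_sq: "(norm (A::real^'n^'m))\<^sup>2 = (\<Sum>i\<in>UNIV. (norm (A $ i))\<^sup>2)"
  by (simp add: norm_vec_def L2_set_def sum_nonneg)

lemma norm_vec_sq: "(norm (x::real^'n))\<^sup>2 = (\<Sum>i\<in>UNIV. (x $ i)\<^sup>2)"
  by (simp add: norm_vec_def L2_set_def sum_nonneg)

lemma norm_transpose [simp]: "norm (transpose A) = norm (A::real^'n^'m)"
proof -
  have "(norm (transpose A))\<^sup>2 = (norm A)\<^sup>2"
    unfolding norm_mat_sq norm_vec_sq transpose_def by (subst sum.swap) simp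
  then show ?thesis by simp
qed

lemma norm_matrix_vector_mult_le: "norm (A *v x) \<le> norm A * norm (x::real^'n)"
proof -
  have "(norm (A *v x))\<^sup>2 = (\<Sum>i\<in>UNIV. (A $ i \<bullet> x)\<^sup>2)"
    unfolding norm_vec_sq by (simp add: matrix_vector_mult_def inner_vec_def)
  also have "\<dots> \<le> (\<Sum>i\<in>UNIV. (norm (A $ i))\<^sup>2 * (norm x)\<^sup>2)"
    by (rule sum_mono) (metis Cauchy_Schwarz_ineq2 abs_le_square_iff abs_norm_cancel abs_mult power_mult_distrib)
  also have "\<dots> = (norm A * norm x)\<^sup>2"
    by (simp add: norm_mat_sq power_mult_distrib sum_distrib_right)
  finally show ?thesis by (rule power2_le_imp_le) simp
qed

lemma norm_vector_matrix_mult_le: "norm (x v* A) \<le> norm (x::real^'n) * norm A"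
  using norm_matrix_vector_mult_le[of "transpose A" x] by (simp add: mult.commute)

lemma norm_matrix_mult_le: "norm (A ** B) \<le> norm (A::real^'n^'m) * norm (B::real^'l^'n)"
proof -
  have row: "(A ** B) $ i = A $ i v* B" for i
    by (simp add: vec_eq_iff matrix_matrix_mult_def vector_matrix_mult_def mult.commute)
  have "(norm (A ** B))\<^sup>2 = (\<Sum>i\<in>UNIV. (norm (A $ i v* B))\<^sup>2)"
    unfolding norm_mat_sq row ..
  also have "\<dots> \<le> (\<Sum>i\<in>UNIV. (norm (A $ i))\<^sup>2 * (norm B)\<^sup>2)"
    by (rule sum_mono) (metis norm_vector_matrix_mult_le norm_ge_zero power_mono power_mult_distrib)
  also have "\<dots> = (norm A * norm B)\<^sup>2"
    by (simp add: norm_mat_sq[of A] power_mult_distrib sum_distrib_right)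
  finally show ?thesis by (rule power2_le_imp_le) simp
qed

lemma norm_matrix_mult_le_mono:
  "norm (A::real^'n^'m) \<le> a \<Longrightarrow> norm (B::real^'l^'n) \<le> b \<Longrightarrow> norm (A ** B) \<le> a * b"
  by (meson norm_matrix_mult_le mult_mono norm_ge_zero order_trans)

lemma matrix_entry_le_norm: "\<bar>A $ i $ j\<bar> \<le> norm (A::real^'n^'m)"
  by (meson Finite_Cartesian_Product.norm_nth_le component_le_norm_cart order_trans)

lemma norm_vec_le_entries:
  assumes "\<And>i. \<bar>x $ i\<bar> \<le> b" shows "norm (x::real^'n) \<le> real CARD('n) * b"
  using norm_le_l1_cart[of x] sum_bounded_above[of UNIV "\<lambda>i. \<bar>x $ i\<bar>" b] assms by simp

lemma norm_matrix_le_entries: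
  assumes "\<And>i j. \<bar>A $ i $ j\<bar> \<le> b" shows "norm (A::real^'n^'n) \<le> real CARD('n) * b"
proof -
  have b: "0 \<le> b" using assms by (meson abs_ge_zero order_trans)
  have "(norm A)\<^sup>2 = (\<Sum>i\<in>UNIV. \<Sum>j\<in>UNIV. (A $ i $ j)\<^sup>2)"
    unfolding norm_mat_sq norm_vec_sq ..
  also have "\<dots> \<le> (\<Sum>i\<in>(UNIV::'n set). \<Sum>j\<in>(UNIV::'n set). b\<^sup>2)"
    using assms by (intro sum_mono) (metis abs_ge_zero power2_abs power_mono)
  also have "\<dots> = (real CARD('n) * b)\<^sup>2"
    by (simp add: power2_eq_square)
  finally show ?thesis by (rule power2_le_imp_le) (simp add: b)
qed

lemma norm_matrix_le_operator:
  assumes "\<And>v. norm (A *v v) \<le> b * norm v" shows "norm (A::real^'n^'n) \<le> real CARD('n) * b"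
proof (rule norm_matrix_le_entries)
  fix i j
  have "\<bar>A $ i $ j\<bar> = \<bar>(A *v axis j 1) $ i\<bar>"
    by (simp add: matrix_vector_mul_component inner_axis)
  also have "\<dots> \<le> norm (A *v axis j 1)" by (rule component_le_norm_cart)
  also have "\<dots> \<le> b" using assms[of "axis j 1"] by (simp add: norm_axis_1)
  finally show "\<bar>A $ i $ j\<bar> \<le> b" .
qed

section \<open>Inverses and well-conditioned matrices\<close>

lemma matrix_inv_mult:
  assumes "invertible (A::real^'n^'n)"
  shows "A ** matrix_inv A = mat 1" "matrix_inv A ** A = mat 1"
  using assms someI_ex[of "\<lambda>A'. A ** A' = mat 1 \<and> A' ** A = mat 1"]
  unfolding invertible_def matrix_inv_def by blast+

lemma matrix_inv_eqI:
  fixes A B :: "real^'n^'n"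
  assumes "A ** B = mat 1" shows "matrix_inv A = B" "invertible A"
proof -
  show inv: "invertible A" using assms invertible_right_inverse[of A] by auto
  have "matrix_inv A = matrix_inv A ** (A ** B)" using assms by simp
  also have "\<dots> = B" by (simp add: matrix_mul_assoc matrix_inv_mult inv)
  finally show "matrix_inv A = B" .
qed

lemma matrix_inv_mult_distrib:
  fixes A B :: "real^'n^'n"
  assumes "invertible A" "invertible B"
  shows "matrix_inv (A ** B) = matrix_inv B ** matrix_inv A"
proof (rule matrix_inv_eqI)
  have "A ** B ** (matrix_inv B ** matrix_inv A) = A ** (B ** matrix_inv B) ** matrix_inv A"
    by (simp only: matrix_mul_assoc)
  also have "\<dots> = mat 1"
    by (simp only: matrix_inv_mult assms matrix_mul_rid)
  finally show "A ** B ** (matrix_inv B ** matrix_inv A) = mat 1" .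
qed

lemma matrix_inv_transpose:
  assumes "invertible (A::real^'n^'n)"
  shows "matrix_inv (transpose A) = transpose (matrix_inv A)"
  by (rule matrix_inv_eqI) (metis assms matrix_inv_mult(2) matrix_transpose_mul transpose_mat)

lemma invertible_matrix_inv:
  assumes "invertible (A::real^'n^'n)" shows "invertible (matrix_inv A)"
  using matrix_inv_mult[OF assms] invertible_def by blast

text \<open>A lower bound on \<open>A *v v\<close> survives small perturbations, so it serves as the
  notion of conditioning throughout. The factor K is the price of passing from the operator norm of
  the inverse to its Frobenius norm.\<close>

lemma bounded_below_invertible:
  fixes A :: "real^'n^'n"
  assumes "0 < a" and "\<And>v. a * norm v \<le> norm (A *v v)"
  shows "invertible A" "norm (matrix_inv A) \<le> real CARD('n) / a"
proof -
  have "A *v x = 0 \<Longrightarrow> x = 0" for x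
    using assms(2)[of x] assms(1) by (simp add: mult_le_0_iff)
  then show inv: "invertible A"
    using matrix_left_invertible_ker invertible_left_inverse by metis
  have "norm (matrix_inv A) \<le> real CARD('n) * (1 / a)"
  proof (rule norm_matrix_le_operator)
    fix v
    have "A *v (matrix_inv A *v v) = v"
      by (simp add: matrix_vector_mul_assoc matrix_inv_mult inv)
    with assms(2)[of "matrix_inv A *v v"] assms(1)
    show "norm (matrix_inv A *v v) \<le> 1 / a * norm v" by (simp add: field_simps)
  qed
  then show "norm (matrix_inv A) \<le> real CARD('n) / a" by simp
qed

lemma op_norm_le_norm: "op_norm A \<le> norm A"
  unfolding op_norm_def by (rule onorm_le) (rule norm_matrix_vector_mult_le)

lemma norm_orthogonal_mult:
  assumes "orthogonal_matrix (U::real^'n^'n)" shows "norm (U *v x) = norm x"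
  using assms orthogonal_transformation_matrix[of "(*v) U"]
  by (simp add: orthogonal_transformation_norm)

lemma norm_orthogonal_le:
  assumes "orthogonal_matrix (U::real^'n^'n)" shows "norm U \<le> real CARD('n)"
  using norm_matrix_le_operator[of U 1] norm_orthogonal_mult[OF assms] by simp

lemma diag_mat_mult_left: "(diag_mat v ** A) $ i $ j = v $ i * A $ i $ j"
  by (simp add: diag_mat_def matrix_matrix_mult_def if_distrib if_distribR cong: if_cong)

lemma diag_mat_mult_right: "(A ** diag_mat v) $ i $ j = A $ i $ j * v $ j"
  by (simp add: diag_mat_def matrix_matrix_mult_def if_distrib cong: if_cong)

lemma diag_mat_mult_vec: "(diag_mat v *v x) $ i = v $ i * x $ i"
  by (simp add: diag_mat_def matrix_vector_mult_def if_distrib if_distribR cong: if_cong)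

lemma norm_diag_mat [simp]: "norm (diag_mat v) = norm v"
proof -
  have "(norm (diag_mat v))\<^sup>2 = (norm v)\<^sup>2"
    unfolding norm_mat_sq norm_vec_sq by (simp add: diag_mat_def if_distrib if_distribR cong: if_cong)
  then show ?thesis by simp
qed

lemma norm_mat_1: "norm (mat 1 :: real^'n^'n) \<le> real CARD('n)"
  using norm_orthogonal_le orthogonal_matrix_id by blast

text \<open>No series is summed: \<open>F\<close> at least halves the length of every vector, so
  \<open>mat 1 + F\<close> is bounded below by 1/2.\<close>

lemma neumann_inverse:
  fixes F :: "real^'n^'n"
  assumes "norm F \<le> 1 / 2"
  shows "invertible (mat 1 + F)" "norm (matrix_inv (mat 1 + F)) \<le> 2 * real CARD('n)"
proof -
  have "1 / 2 * norm v \<le> norm ((mat 1 + F) *v v)" for v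
  proof -
    have "norm (F *v v) \<le> 1 / 2 * norm v"
      using norm_matrix_vector_mult_le[of F v] assms by (meson mult_right_mono norm_ge_zero order_trans)
    moreover have "norm v \<le> norm ((mat 1 + F) *v v) + norm (F *v v)"
      using norm_triangle_ineq4[of "(mat 1 + F) *v v" "F *v v"]
      by (simp add: matrix_vector_mult_add_rdistrib)
    ultimately show ?thesis by simp
  qed
  from bounded_below_invertible[of "1/2", OF _ this]
  show "invertible (mat 1 + F)" "norm (matrix_inv (mat 1 + F)) \<le> 2 * real CARD('n)" by auto
qed

lemma matrix_mult_add_left: "((A::real^'n^'m) + B) ** C = A ** C + B ** (C::real^'l^'n)"
  by (simp add: vec_eq_iff matrix_matrix_mult_def sum.distrib algebra_simps)

lemma matrix_mult_diff_left: "((A::real^'n^'m) - B) ** C = A ** C - B ** (C::real^'l^'n)"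
  by (simp add: vec_eq_iff matrix_matrix_mult_def sum_subtractf algebra_simps)

lemma matrix_mult_diff_right: "(A::real^'n^'m) ** (B - C) = A ** B - A ** (C::real^'l^'n)"
  by (simp add: vec_eq_iff matrix_matrix_mult_def sum_subtractf algebra_simps)

lemmas matrix_mult_distribs = matrix_add_ldistrib matrix_mult_add_left matrix_mult_diff_left matrix_mult_diff_right

subsection \<open>Perturbation of eigenvalues\<close>

text \<open>Fix the coordinate \<open>k\<close> to be 1 and apply Brouwer's theorem to the eigenvalue equation
  solved for the others.\<close>

lemma perturbed_eigenvector:
  fixes D :: "real^'k" and E :: "real^'k^'k"
  assumes g: "0 < g" and gap: "\<And>i j. i \<noteq> j \<Longrightarrow> g \<le> \<bar>D $ i - D $ j\<bar>"
    and e: "norm E \<le> e" and small: "2 * real CARD('k) * e \<le> g"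
  obtains v where "v $ k = 1" "\<And>i. i \<noteq> k \<Longrightarrow> \<bar>v $ i\<bar> \<le> 2 * real CARD('k) * e / g"
    "(diag_mat D + E) *v v = (D $ k + (E *v v) $ k) *\<^sub>R v" "\<bar>(E *v v) $ k\<bar> \<le> real CARD('k) * e"
proof -
  define r where "r = 2 * real CARD('k) * e / g"
  have e0: "0 \<le> e" using e norm_ge_zero order_trans by blast
  have r0: "0 \<le> r" and r1: "r \<le> 1" using e0 g small by (auto simp: r_def field_simps)
  \<comment> \<open>The side of the box in direction \<open>k\<close> is degenerate, which encodes
    the normalization \<open>v $ k = 1\<close>.\<close>
  define a b :: "real^'k" where "a = (\<chi> i. if i = k then 1 else - r)" and "b = (\<chi> i. if i = k then 1 else r)"
  \<comment> \<open>Row \<open>i \<noteq> k\<close> of the eigenvalue equation with eigenvalue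
    \<open>D $ k + (E *v v) $ k\<close>, solved for the \<open>v $ i\<close> of its diagonal term.
    Row \<open>k\<close> holds by itself once \<open>v $ k = 1\<close>.\<close>
  define F where "F v = (\<chi> i. if i = k then 1 else - (E *v v) $ i / (D $ i - D $ k - (E *v v) $ k))" for v
  have mem: "v \<in> cbox a b \<longleftrightarrow> v $ k = 1 \<and> (\<forall>i. i \<noteq> k \<longrightarrow> \<bar>v $ i\<bar> \<le> r)" for v
  proof -
    have "(a $ i \<le> v $ i \<and> v $ i \<le> b $ i) = (if i = k then v $ i = 1 else \<bar>v $ i\<bar> \<le> r)" for i
      unfolding a_def b_def by (cases "i = k") (simp_all, linarith+)
    then show ?thesis unfolding mem_box_cart by auto
  qed
  have bound: "\<bar>(E *v v) $ i\<bar> \<le> real CARD('k) * e" if "v \<in> cbox a b" for v i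
  proof -
    have "\<bar>v $ i\<bar> \<le> 1" for i using that r1 by (cases "i = k") (auto simp: mem intro: order_trans)
    then have "norm v \<le> real CARD('k)" using norm_vec_le_entries[of v 1] by simp
    then have "norm (E *v v) \<le> e * real CARD('k)"
      using norm_matrix_vector_mult_le[of E v] e by (meson mult_mono norm_ge_zero order_trans e0)
    then show ?thesis using component_le_norm_cart[of "E *v v" i] by (simp add: mult.commute)
  qed
  \<comment> \<open>The difference of the \<open>D\<close> is at least \<open>g\<close> and the last
    term at most K e <= g / 2; hence the quotient in \<open>F\<close> is at most K e / (g / 2),
    which is \<open>r\<close>.\<close>
  have den: "g / 2 \<le> \<bar>D $ i - D $ k - (E *v v) $ k\<bar>" if "v \<in> cbox a b" "i \<noteq> k" for v i
    using bound[OF that(1), of k] gap[OF that(2)] small by linarith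
  have "compact (cbox a b)" "convex (cbox a b)" by (auto simp: compact_cbox)
  moreover have "cbox a b \<noteq> {}" using mem[of b] r0 by (auto simp: b_def)
  moreover have "continuous_on (cbox a b) F"
    unfolding F_def
  proof (rule continuous_on_vec_lambda)
    fix i
    show "continuous_on (cbox a b)
      (\<lambda>v. if i = k then 1 else - (E *v v) $ i / (D $ i - D $ k - (E *v v) $ k))"
    proof (cases "i = k")
      case False
      have "D $ i - D $ k - (E *v v) $ k \<noteq> 0" if "v \<in> cbox a b" for v
        using den[OF that False] g by auto
      moreover have "continuous_on (cbox a b) (\<lambda>v. (E *v v) $ j)" for j
        by (intro continuous_intros linear_continuous_on matrix_vector_mul_bounded_linear)
      ultimately show ?thesis using False by (auto intro!: continuous_intros)
    qed auto
  qed
  moreover have "F \<in> cbox a b \<rightarrow> cbox a b"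
  proof
    fix v assume v: "v \<in> cbox a b"
    have "\<bar>F v $ i\<bar> \<le> r" if "i \<noteq> k" for i
    proof -
      have "\<bar>(E *v v) $ i\<bar> / \<bar>D $ i - D $ k - (E *v v) $ k\<bar> \<le> real CARD('k) * e / (g / 2)"
        using bound[OF v, of i] den[OF v that] g e0 by (intro frac_le) auto
      then show ?thesis using that by (simp add: F_def r_def mult.commute mult.left_commute)
    qed
    then show "F v \<in> cbox a b" unfolding mem by (auto simp: F_def)
  qed
  ultimately obtain v where v: "v \<in> cbox a b" and fixpt: "F v = v" by (rule brouwer)
  have "(diag_mat D + E) *v v = (D $ k + (E *v v) $ k) *\<^sub>R v"
  proof (subst vec_eq_iff, rule allI)
    fix i
    have 1: "((diag_mat D + E) *v v) $ i = D $ i * v $ i + (E *v v) $ i"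
      by (simp add: matrix_vector_mult_add_rdistrib diag_mat_mult_vec)
    show "((diag_mat D + E) *v v) $ i = ((D $ k + (E *v v) $ k) *\<^sub>R v) $ i"
    proof (cases "i = k")
      case True
      then show ?thesis unfolding 1 using v by (simp add: mem)
    next
      case False
      have "v $ i = - (E *v v) $ i / (D $ i - D $ k - (E *v v) $ k)"
        using arg_cong[OF fixpt, of "\<lambda>w. w $ i"] False by (simp add: F_def)
      moreover have "D $ i - D $ k - (E *v v) $ k \<noteq> 0" using den[OF v False] g by auto
      ultimately have "v $ i * (D $ i - D $ k - (E *v v) $ k) = - (E *v v) $ i" by simp
      then show ?thesis unfolding 1 by (simp add: algebra_simps)
    qed
  qed
  with that[of v] v bound[OF v, of k] show ?thesis unfolding mem r_def by blast
qed

text \<open>One eigenvector from \<open>perturbed_eigenvector\<close> for each coordinate, taken as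
  columns. Each eigenvalue moves by at most K e <= g / 4, so the new ones are still pairwise
  distinct. The smallness 4 K^2 e <= g also gives \<open>V - mat 1\<close> norm at most 1/2, so that
  \<open>neumann_inverse\<close> later applies to \<open>V\<close>.\<close>

lemma perturbed_eigenbasis:
  fixes D :: "real^'k" and E :: "real^'k^'k"
  assumes g: "0 < g" and gap: "\<And>i j. i \<noteq> j \<Longrightarrow> g \<le> \<bar>D $ i - D $ j\<bar>"
    and e: "norm E \<le> e" and small: "4 * (real CARD('k))\<^sup>2 * e \<le> g"
  obtains V D' where "norm (V - mat 1) \<le> 2 * (real CARD('k))\<^sup>2 * e / g"
    "(diag_mat D + E) ** V = V ** diag_mat D'" "inj (($) D')"
proof -
  have e0: "0 \<le> e" using e norm_ge_zero order_trans by blast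
  have K: "1 \<le> real CARD('k)" by (simp add: Suc_leI)
  then have "real CARD('k) * e \<le> (real CARD('k))\<^sup>2 * e"
    using e0 by (simp add: power2_eq_square mult_right_mono)
  then have small': "4 * real CARD('k) * e \<le> g" using small by linarith
  have "2 * real CARD('k) * e \<le> g" using small' mult_nonneg_nonneg[of "real CARD('k)" e] e0 by linarith
  from perturbed_eigenvector[OF g gap e this]
  have "\<forall>k. \<exists>v. v $ k = 1 \<and> (\<forall>i. i \<noteq> k \<longrightarrow> \<bar>v $ i\<bar> \<le> 2 * real CARD('k) * e / g) \<and>
    (diag_mat D + E) *v v = (D $ k + (E *v v) $ k) *\<^sub>R v \<and> \<bar>(E *v v) $ k\<bar> \<le> real CARD('k) * e"
    by metis
  then obtain w where w: "\<And>k. w k $ k = 1" "\<And>k i. i \<noteq> k \<Longrightarrow> \<bar>w k $ i\<bar> \<le> 2 * real CARD('k) * e / g"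
    "\<And>k. (diag_mat D + E) *v w k = (D $ k + (E *v w k) $ k) *\<^sub>R w k"
    "\<And>k. \<bar>(E *v w k) $ k\<bar> \<le> real CARD('k) * e" by metis
  define V where "V = (\<chi> i k. w k $ i)"
  define D' where "D' = (\<chi> k. D $ k + (E *v w k) $ k)"
  have "norm (V - mat 1) \<le> real CARD('k) * (2 * real CARD('k) * e / g)"
  proof (rule norm_matrix_le_entries)
    fix i j show "\<bar>(V - mat 1) $ i $ j\<bar> \<le> 2 * real CARD('k) * e / g"
      using w(1)[of j] w(2)[of i j] e0 g by (auto simp: V_def mat_def)
  qed
  then have 1: "norm (V - mat 1) \<le> 2 * (real CARD('k))\<^sup>2 * e / g"
    by (simp add: power2_eq_square algebra_simps)
  have "((diag_mat D + E) ** V) $ i $ k = (V ** diag_mat D') $ i $ k" for i k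
  proof -
    have "((diag_mat D + E) ** V) $ i $ k = ((diag_mat D + E) *v w k) $ i"
      by (simp add: matrix_matrix_mult_def matrix_vector_mult_def V_def)
    also have "\<dots> = (V ** diag_mat D') $ i $ k"
      unfolding w(3) by (simp add: diag_mat_mult_right V_def D'_def)
    finally show ?thesis .
  qed
  then have 2: "(diag_mat D + E) ** V = V ** diag_mat D'" by (simp add: vec_eq_iff)
  have "D' $ i \<noteq> D' $ j" if "i \<noteq> j" for i j
    using gap[OF that] w(4)[of i] w(4)[of j] small' g unfolding D'_def by (auto simp: abs_le_iff)
  then have "inj (($) D')" by (meson injI)
  with that 1 2 show ?thesis by blast
qed

text \<open>The columns of \<open>S\<close> are those of \<open>V\<close>, reordered by \<open>\<sigma>\<close> and rescaled.\<close>

lemma diagonalization_unique: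
  fixes S V M :: "real^'k^'k"
  assumes V: "invertible V" and S: "invertible S" and MV: "M ** V = V ** diag_mat D'" and inj: "inj (($) D')"
    and off: "\<And>i j. i \<noteq> j \<Longrightarrow> (matrix_inv S ** M ** S) $ i $ j = 0"
  obtains \<sigma> where "\<sigma> permutes UNIV"
    "\<And>B j. (matrix_inv S ** B ** S) $ j $ j = (matrix_inv V ** B ** V) $ \<sigma> j $ \<sigma> j"
proof -
  define T where "T = matrix_inv V ** S"
  define L where "L = matrix_inv S ** M ** S"
  have T: "invertible T" unfolding T_def by (intro invertible_mult invertible_matrix_inv V S)
  have VT: "V ** T = S" unfolding T_def by (simp add: matrix_mul_assoc matrix_inv_mult V)
  have "diag_mat D' ** T = matrix_inv V ** (V ** diag_mat D') ** T"
    by (simp add: matrix_mul_assoc matrix_inv_mult V)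
  also have "\<dots> = matrix_inv V ** (M ** S)" by (simp only: MV[symmetric] matrix_mul_assoc VT[symmetric])
  also have "M ** S = S ** L" unfolding L_def by (simp add: matrix_mul_assoc matrix_inv_mult S)
  finally have DT: "diag_mat D' ** T = T ** L" by (simp add: T_def matrix_mul_assoc)
  have "L = diag_mat (\<chi> j. L $ j $ j)" using off by (simp add: vec_eq_iff diag_mat_def L_def)
  then obtain l where l: "L = diag_mat l" by blast
  \<comment> \<open>An entry \<open>T $ i $ j \<noteq> 0\<close> forces
    \<open>D' $ i = l $ j\<close>. Since the entries of \<open>D'\<close> are distinct and
    \<open>T\<close> is invertible, each column of \<open>T\<close> has exactly one non-zero
    entry.\<close>
  have ent: "D' $ i * T $ i $ j = T $ i $ j * l $ j" for i j
    using arg_cong[OF DT, of "\<lambda>A. A $ i $ j"] by (simp add: l diag_mat_mult_left diag_mat_mult_right)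
  have T0: "x = 0" if "T *v x = 0" for x
    using T that by (metis matrix_inv_mult(2) matrix_vector_mul_assoc matrix_vector_mul_lid matrix_vector_mult_0_right)
  have col: "T *v axis j c = (\<chi> i. T $ i $ j * c)" for j c
    by (simp add: vec_eq_iff matrix_vector_mult_def axis_def if_distrib cong: if_cong)
  have "\<exists>i. T $ i $ j \<noteq> 0" for j
  proof (rule ccontr)
    assume "\<not> ?thesis"
    then have "T *v axis j 1 = 0" by (simp add: col vec_eq_iff)
    from T0[OF this] show False by (simp add: axis_eq_0_iff)
  qed
  then obtain \<sigma> where \<sigma>: "\<And>j. T $ \<sigma> j $ j \<noteq> 0" by metis
  have nz: "i = \<sigma> j" if "T $ i $ j \<noteq> 0" for i j
    using ent[of i j] ent[of "\<sigma> j" j] that \<sigma>[of j] inj by (simp add: inj_def)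
  have "inj \<sigma>"
  proof (rule injI, rule ccontr)
    fix j j' assume eq: "\<sigma> j = \<sigma> j'" and ne: "j \<noteq> j'"
    \<comment> \<open>Columns \<open>j\<close> and \<open>j'\<close> of \<open>T\<close> would be
      multiples of the same basis vector; this combination of them vanishes.\<close>
    let ?x = "axis j (T $ \<sigma> j $ j') - axis j' (T $ \<sigma> j $ j)"
    have "T *v ?x = 0"
    proof -
      have "T $ i $ j * T $ \<sigma> j $ j' = T $ i $ j' * T $ \<sigma> j $ j" for i
      proof (cases "i = \<sigma> j")
        case False
        then have "T $ i $ j = 0" "T $ i $ j' = 0" using nz eq by metis+
        then show ?thesis by simp
      qed simp
      then show ?thesis unfolding matrix_vector_mult_diff_distrib col by (simp add: vec_eq_iff)
    qed
    from T0[OF this] have "?x $ j' = 0" by simp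
    then show False using \<sigma>[of j] ne by (simp add: axis_def)
  qed
  then have perm: "\<sigma> permutes UNIV"
    by (meson bij_betw_def bij_imp_permutes finite_UNIV_inj_surj finite_class.finite_UNIV UNIV_I bij_def)
  \<comment> \<open>The two conjugates of \<open>B\<close> satisfy \<open>T ** ?H = ?G ** T\<close>.
    At the position \<open>\<sigma> j\<close>, \<open>j\<close>, where \<open>T\<close> has the only
    non-zero entry of its row and column, the same factor appears on both sides and cancels,
    whatever the scaling.\<close>
  have "(matrix_inv S ** B ** S) $ j $ j = (matrix_inv V ** B ** V) $ \<sigma> j $ \<sigma> j" for B j
  proof -
    let ?H = "matrix_inv S ** B ** S" and ?G = "matrix_inv V ** B ** V"
    have "T ** ?H = matrix_inv V ** (S ** matrix_inv S) ** B ** S" unfolding T_def by (simp only: matrix_mul_assoc)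
    also have "\<dots> = matrix_inv V ** B ** (V ** T)" by (simp only: matrix_inv_mult(1)[OF S] matrix_mul_rid VT)
    also have "\<dots> = ?G ** T" by (simp only: matrix_mul_assoc)
    finally have "(T ** ?H) $ \<sigma> j $ j = (?G ** T) $ \<sigma> j $ j" by simp
    moreover have "(T ** ?H) $ \<sigma> j $ j = T $ \<sigma> j $ j * ?H $ j $ j"
    proof -
      have "(T ** ?H) $ \<sigma> j $ j = (\<Sum>l\<in>UNIV. T $ \<sigma> j $ l * ?H $ l $ j)" by (simp add: matrix_matrix_mult_def)
      also have "\<dots> = (\<Sum>l\<in>{j}. T $ \<sigma> j $ l * ?H $ l $ j)"
      proof (rule sum.mono_neutral_right)
        have "T $ \<sigma> j $ l = 0" if "l \<noteq> j" for l
          using nz[of "\<sigma> j" l] injD[OF \<open>inj \<sigma>\<close>, of j l] that by blast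
        then show "\<forall>l\<in>UNIV - {j}. T $ \<sigma> j $ l * ?H $ l $ j = 0" by simp
      qed auto
      finally show ?thesis by simp
    qed
    moreover have "(?G ** T) $ \<sigma> j $ j = ?G $ \<sigma> j $ \<sigma> j * T $ \<sigma> j $ j"
    proof -
      have "(?G ** T) $ \<sigma> j $ j = (\<Sum>l\<in>UNIV. ?G $ \<sigma> j $ l * T $ l $ j)" by (simp add: matrix_matrix_mult_def)
      also have "\<dots> = (\<Sum>l\<in>{\<sigma> j}. ?G $ \<sigma> j $ l * T $ l $ j)"
      proof (rule sum.mono_neutral_right)
        have "T $ l $ j = 0" if "l \<noteq> \<sigma> j" for l using nz[of l j] that by blast
        then show "\<forall>l\<in>UNIV - {\<sigma> j}. ?G $ \<sigma> j $ l * T $ l $ j = 0" by simp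
      qed auto
      finally show ?thesis by simp
    qed
    ultimately show ?thesis using \<sigma>[of j] by simp
  qed
  with that perm show ?thesis by blast
qed

text \<open>In the coordinates given by \<open>W\<close>, the eigenbasis of \<open>C x1\<close> is
  within O(e / g) of the identity, so it nearly diagonalizes every other \<open>C x\<close> as well.
  A gap is needed for \<open>x1\<close> only, and a single \<open>\<sigma>\<close> serves all
  \<open>x\<close>, because the order of the columns is fixed by \<open>C x1\<close>.\<close>

lemma joint_eigenvalue_perturbation:
  fixes D :: "'k \<Rightarrow> real^'k" and E C :: "'k::finite \<Rightarrow> real^'k^'k" and W :: "real^'k^'k"
  defines "K \<equiv> real CARD('k)"
  assumes g: "0 < g" "g \<le> 1" and gap: "\<And>i j. i \<noteq> j \<Longrightarrow> g \<le> \<bar>D x1 $ i - D x1 $ j\<bar>"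
    and e: "\<And>x. norm (E x) \<le> e" and small: "4 * K\<^sup>2 * e \<le> g" and b: "\<And>x. norm (D x) \<le> b"
    and W: "invertible W" and C: "\<And>x. C x = matrix_inv W ** (diag_mat (D x) + E x) ** W"
  shows "\<exists>R :: real^'k^'k. invertible R \<and> (\<forall>x. norm (column x R) = 1) \<and>
      (\<forall>i j. i \<noteq> j \<longrightarrow> (matrix_inv R ** C x1 ** R) $ i $ j = 0)"
    and "\<And>R :: real^'k^'k. invertible R \<Longrightarrow> (\<And>i j. i \<noteq> j \<Longrightarrow> (matrix_inv R ** C x1 ** R) $ i $ j = 0) \<Longrightarrow>
      \<exists>\<sigma>. \<sigma> permutes UNIV \<and> (\<forall>x j. \<bar>(matrix_inv R ** C x ** R) $ j $ j - D x $ \<sigma> j\<bar> \<le> (8 * K^3 * b + 4 * K\<^sup>2) * e / g)"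
proof -
  have e0: "0 \<le> e" using e norm_ge_zero order_trans by blast
  have b0: "0 \<le> b" using b norm_ge_zero order_trans by blast
  have K: "1 \<le> K" unfolding K_def by (simp add: Suc_leI)
  obtain V D' where V: "norm (V - mat 1) \<le> 2 * K\<^sup>2 * e / g"
    and MV: "(diag_mat (D x1) + E x1) ** V = V ** diag_mat D'" and inj: "inj (($) D')"
    using perturbed_eigenbasis[OF g(1) gap e small[unfolded K_def]] unfolding K_def by metis
  have "2 * K\<^sup>2 * e / g \<le> 1 / 2" using small g(1) by (simp add: field_simps)
  with V have V2: "norm (V - mat 1) \<le> 1 / 2" by linarith
  then have Vinv: "invertible V" "norm (matrix_inv V) \<le> 2 * K"
    using neumann_inverse[of "V - mat 1"] by (simp_all add: K_def)
  have conj: "matrix_inv R ** C x ** R = matrix_inv (W ** R) ** (diag_mat (D x) + E x) ** (W ** R)"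
    if "invertible R" for R :: "real^'k^'k" and x
    unfolding C matrix_inv_mult_distrib[OF W that] by (simp only: matrix_mul_assoc)
  show "\<exists>R :: real^'k^'k. invertible R \<and> (\<forall>x. norm (column x R) = 1) \<and>
      (\<forall>i j. i \<noteq> j \<longrightarrow> (matrix_inv R ** C x1 ** R) $ i $ j = 0)"
  proof -
    define R0 where "R0 = matrix_inv W ** V"
    have R0: "invertible R0" unfolding R0_def by (intro invertible_mult invertible_matrix_inv W Vinv)
    define n where "n = (\<chi> x. 1 / norm (column x R0))"
    have col: "column x R0 \<noteq> 0" for x
    proof
      assume "column x R0 = 0"
      then have "R0 *v axis x 1 = 0" by (simp add: matrix_vector_mult_basis)
      then have "axis x (1::real) = (0::real^'k)"
        using R0 by (metis matrix_inv_mult(2) matrix_vector_mul_assoc matrix_vector_mul_lid matrix_vector_mult_0_right)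
      then show False by (simp add: axis_eq_0_iff)
    qed
    \<comment> \<open>Scaling the columns by a diagonal matrix, which commutes with
      \<open>diag_mat D'\<close>, produces unit columns without spoiling the
      diagonalization.\<close>
    define R where "R = R0 ** diag_mat n"
    have "(diag_mat n ** diag_mat (\<chi> x. norm (column x R0))) $ i $ j = (mat 1 :: real^'k^'k) $ i $ j" for i j
      unfolding diag_mat_mult_left using col by (auto simp: diag_mat_def n_def mat_def)
    then have nd: "diag_mat n ** diag_mat (\<chi> x. norm (column x R0)) = mat 1"
      unfolding vec_eq_iff by blast
    have n: "invertible (diag_mat n)" using matrix_inv_eqI(2)[OF nd] .
    have R: "invertible R" unfolding R_def by (intro invertible_mult R0 n)
    have "column x R = (1 / norm (column x R0)) *\<^sub>R column x R0" for x
      by (simp add: vec_eq_iff column_def R_def diag_mat_mult_right n_def)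
    then have unit: "norm (column x R) = 1" for x using col[of x] by simp
    have WR: "W ** R = V ** diag_mat n"
      unfolding R_def R0_def by (simp add: matrix_mul_assoc matrix_inv_mult W)
    have "matrix_inv R ** C x1 ** R = matrix_inv (diag_mat n) ** (matrix_inv V ** ((diag_mat (D x1) + E x1) ** V)) ** diag_mat n"
      unfolding conj[OF R] WR matrix_inv_mult_distrib[OF Vinv(1) n] by (simp only: matrix_mul_assoc)
    also have "\<dots> = matrix_inv (diag_mat n) ** diag_mat D' ** diag_mat n"
      unfolding MV by (simp add: matrix_mul_assoc matrix_inv_mult Vinv)
    also have "matrix_inv (diag_mat n) = diag_mat (\<chi> x. norm (column x R0))" by (rule matrix_inv_eqI(1)[OF nd])
    finally have "(matrix_inv R ** C x1 ** R) $ i $ j = 0" if "i \<noteq> j" for i j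
      using that by (simp only: diag_mat_mult_left diag_mat_mult_right) (simp add: diag_mat_def)
    with R unit show ?thesis by blast
  qed
  fix R :: "real^'k^'k" assume R: "invertible R" and off: "\<And>i j. i \<noteq> j \<Longrightarrow> (matrix_inv R ** C x1 ** R) $ i $ j = 0"
  obtain \<sigma> where \<sigma>: "\<sigma> permutes UNIV"
    and eq: "\<And>B j. (matrix_inv (W ** R) ** B ** (W ** R)) $ j $ j = (matrix_inv V ** B ** V) $ \<sigma> j $ \<sigma> j"
    using diagonalization_unique[OF Vinv(1) invertible_mult[OF W R] MV inj] off unfolding conj[OF R] by metis
  have "\<bar>(matrix_inv R ** C x ** R) $ j $ j - D x $ \<sigma> j\<bar> \<le> (8 * K^3 * b + 4 * K\<^sup>2) * e / g" for x j
  proof -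
    define Z where "Z = V - mat 1"
    have VZ: "V = mat 1 + Z" by (simp add: Z_def)
    \<comment> \<open>Besides the error term only the commutator of \<open>diag_mat (D x)\<close>
      with \<open>Z\<close> survives, so the distance of \<open>V\<close> from the identity is what
      counts. With |Z| <= z = 2 K^2 e / g the total is 2 K (2 b z + 2 K e / g), the claimed
      constant.\<close>
    have "matrix_inv V ** (diag_mat (D x) + E x) ** V - diag_mat (D x)
      = matrix_inv V ** (diag_mat (D x) ** V + E x ** V - V ** diag_mat (D x))"
      by (simp add: matrix_mult_distribs matrix_mul_assoc matrix_inv_mult Vinv)
    also have "\<dots> = matrix_inv V ** (diag_mat (D x) ** Z - Z ** diag_mat (D x) + E x ** V)"
      by (simp add: VZ matrix_mult_distribs)
    finally have id: "matrix_inv V ** (diag_mat (D x) + E x) ** V - diag_mat (D x)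
      = matrix_inv V ** (diag_mat (D x) ** Z - Z ** diag_mat (D x) + E x ** V)" .
    define z where "z = 2 * K\<^sup>2 * e / g"
    have nV: "norm V \<le> 2 * K"
      using norm_triangle_ineq[of "mat 1" Z] norm_mat_1[where 'n='k] V2[folded Z_def] K unfolding VZ K_def by linarith
    have "norm (diag_mat (D x) ** Z - Z ** diag_mat (D x) + E x ** V) \<le> b * z + z * b + e * (2 * K)"
      by (intro norm_triangle_le norm_triangle_le_diff add_mono norm_matrix_mult_le_mono)
        (use b e V nV in \<open>auto simp: z_def Z_def\<close>)
    then have "norm (matrix_inv V ** (diag_mat (D x) + E x) ** V - diag_mat (D x)) \<le> 2 * K * (b * z + z * b + e * (2 * K))"
      unfolding id by (intro norm_matrix_mult_le_mono Vinv)
    also have "\<dots> \<le> 2 * K * (b * z + z * b + (e / g) * (2 * K))"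
    proof -
      have "e \<le> e / g" using e0 g by (simp add: field_simps mult_left_le)
      then show ?thesis using K by (intro mult_left_mono add_left_mono mult_right_mono) auto
    qed
    also have "\<dots> = (8 * K^3 * b + 4 * K\<^sup>2) * e / g"
      by (simp add: z_def power2_eq_square power3_eq_cube algebra_simps add_divide_distrib)
    finally have "\<bar>(matrix_inv V ** (diag_mat (D x) + E x) ** V - diag_mat (D x)) $ \<sigma> j $ \<sigma> j\<bar> \<le> \<dots>"
      using matrix_entry_le_norm order_trans by blast
    then show ?thesis unfolding conj[OF R] eq by (simp add: diag_mat_def)
  qed
  with \<sigma> show "\<exists>\<sigma>. \<sigma> permutes UNIV \<and> (\<forall>x j. \<bar>(matrix_inv R ** C x ** R) $ j $ j - D x $ \<sigma> j\<bar> \<le> (8 * K^3 * b + 4 * K\<^sup>2) * e / g)"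
    by blast
qed

subsection \<open>The compressed algorithm\<close>

lemma transition_matrix_entry_le_1:
  assumes "transition_matrix Q" shows "Q $ x $ y \<le> 1" "0 \<le> Q $ x $ y"
proof -
  show "0 \<le> Q $ x $ y" using assms by (simp add: transition_matrix_def)
  have "Q $ x $ y \<le> (\<Sum>z\<in>UNIV. Q $ x $ z)"
    using assms by (intro member_le_sum) (auto simp: transition_matrix_def)
  then show "Q $ x $ y \<le> 1" using assms by (simp add: transition_matrix_def)
qed

lemma norm_transition_matrix_le:
  assumes "transition_matrix (Q::real^'k^'k)" shows "norm Q \<le> real CARD('k)"
  using norm_matrix_le_entries[of Q 1] transition_matrix_entry_le_1[OF assms] by simp

lemma closed_transition_matrices: "closed {Q::real^'k^'k. transition_matrix Q}"
  unfolding transition_matrix_def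
  by (intro closed_Collect_conj closed_Collect_all closed_Collect_le closed_Collect_eq continuous_intros)

lemma convex_transition_matrices: "convex {Q::real^'k^'k. transition_matrix Q}"
proof (rule convexI)
  fix A B :: "real^'k^'k" and u v :: real
  assume *: "A \<in> {Q. transition_matrix Q}" "B \<in> {Q. transition_matrix Q}" "0 \<le> u" "0 \<le> v" "u + v = 1"
  then have "(\<Sum>y\<in>UNIV. u * A $ x $ y + v * B $ x $ y) = 1" for x
    by (simp add: transition_matrix_def sum.distrib flip: sum_distrib_left)
  with * show "u *\<^sub>R A + v *\<^sub>R B \<in> {Q. transition_matrix Q}"
    by (simp add: transition_matrix_def)
qed

text \<open>The projection onto a closed convex set is 1-Lipschitz and fixes \<open>Q\<close>, so
  projecting the raw estimate cannot increase its distance from \<open>Q\<close>.\<close>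

lemma closest_transition_matrix:
  fixes A Q :: "real^'k^'k"
  assumes "transition_matrix Q"
  shows "transition_matrix (closest_point {Q. transition_matrix Q} A)"
    and "norm (closest_point {Q. transition_matrix Q} A - Q) \<le> norm (A - Q)"
proof -
  have "Q \<in> {Q. transition_matrix Q}" using assms by simp
  then show "transition_matrix (closest_point {Q. transition_matrix Q} A)"
    "norm (closest_point {Q. transition_matrix Q} A - Q) \<le> norm (A - Q)"
    using closest_point_in_set[OF closed_transition_matrices, of A]
      closest_point_lipschitz[OF convex_transition_matrices closed_transition_matrices, of A Q]
      closest_point_self[of Q "{Q. transition_matrix Q}"]
    by (auto simp: dist_norm)
qed

lemma diag_mat_inverse:
  fixes v :: "real^'n"
  assumes "0 < q" and "\<And>i. q \<le> v $ i"
  shows "invertible (diag_mat v)" "norm (matrix_inv (diag_mat v)) \<le> real CARD('n) / q"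
proof -
  have v: "v $ i \<noteq> 0" for i using assms(1) assms(2)[of i] by auto
  have "(diag_mat v ** diag_mat (\<chi> i. 1 / v $ i)) $ i $ j = (mat 1 :: real^'n^'n) $ i $ j" for i j
    unfolding diag_mat_mult_left using v by (auto simp: diag_mat_def mat_def)
  then have 1: "diag_mat v ** diag_mat (\<chi> i. 1 / v $ i) = mat 1" unfolding vec_eq_iff by blast
  show "invertible (diag_mat v)" by (rule matrix_inv_eqI(2)[OF 1])
  have "\<bar>(\<chi> i. 1 / v $ i) $ i\<bar> \<le> 1 / q" for i
    using assms(2)[of i] assms(1) by (simp add: frac_le)
  from norm_vec_le_entries[OF this]
  show "norm (matrix_inv (diag_mat v)) \<le> real CARD('n) / q" by (simp add: matrix_inv_eqI(1)[OF 1])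
qed

lemma transpose_matrix_diff: "transpose (A - B) = transpose A - transpose (B::real^'n^'m)"
  by (simp add: transpose_def vec_eq_iff)

lemma matrix_diag_mat_diff: "diag_mat (u - v) = diag_mat u - diag_mat v"
  by (simp add: diag_mat_def vec_eq_iff)

lemma norm_diff4_le:
  fixes A B C D :: "'a::real_normed_vector"
  assumes "norm A \<le> a" "norm B \<le> b" "norm C \<le> c" "norm D \<le> d"
  shows "norm (A - B - C - D) \<le> a + b + c + d"
  using assms norm_triangle_ineq4[of "A - B - C" D] norm_triangle_ineq4[of "A - B" C] norm_triangle_ineq4[of A B]
  by linarith

text \<open>In the population L = A \<pi> and N = A diag(\<pi>) Q A^T, so \<open>Q\<close> is
  recovered by inverting \<open>A\<close> on both sides. The estimate \<open>\<pi>t\<close> need not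
  be a probability vector; its entries only have to stay above q / 2 for
  \<open>diag_mat \<pi>t\<close> to be safely invertible, and this is what the second smallness
  condition ensures.\<close>

lemma transition_recovery_perturbation:
  fixes A Ah Q N :: "real^'k^'k" and \<pi> L :: "real^'k"
  defines "K \<equiv> real CARD('k)" and "\<pi>t \<equiv> matrix_inv Ah *v L"
  defines "Qh \<equiv> closest_point {A. transition_matrix A}
    (matrix_inv (Ah ** diag_mat \<pi>t) ** N ** matrix_inv (transpose Ah))"
  assumes a0: "0 < a0" and q: "0 < q"
    and A: "\<And>v. a0 * norm v \<le> norm (A *v v)" "norm A \<le> a1" and Q: "transition_matrix Q"
    and \<pi>: "\<And>x. q \<le> \<pi> $ x" "\<And>x. \<pi> $ x \<le> 1"
    and e: "norm (Ah - A) \<le> e" "norm (L - A *v \<pi>) \<le> e" "norm (N - A ** diag_mat \<pi> ** Q ** transpose A) \<le> e"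
    and small: "e \<le> a0 / 2" "2 * K / a0 * (1 + K) * e \<le> q / 2"
  shows "invertible Ah" "invertible (Ah ** diag_mat \<pi>t)"
    "norm (Qh - Q) \<le> K / (q / 2) * (2 * K / a0) *
       (1 + K * K * a1 + (a1 + a0) * (2 * K / a0 * (1 + K)) * K * a1 + (a1 + a0) * (K + q) * K) * (2 * K / a0) * e"
proof -
  have e0: "0 \<le> e" using e(1) norm_ge_zero order_trans by blast
  have a1: "0 \<le> a1" using A(2) norm_ge_zero order_trans by blast
  have K: "1 \<le> K" unfolding K_def by (simp add: Suc_leI)
  define b where "b = 2 * K / a0"
  define C1 where "C1 = b * (1 + K)"
  have b: "0 \<le> b" unfolding b_def using a0 K by simp
  have low: "a0 / 2 * norm v \<le> norm (Ah *v v)" for v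
  proof -
    have "norm ((Ah - A) *v v) \<le> a0 / 2 * norm v"
      using norm_matrix_vector_mult_le[of "Ah - A" v] e(1) small(1)
      by (meson mult_right_mono norm_ge_zero order_trans)
    moreover have "norm (A *v v) \<le> norm (Ah *v v) + norm ((Ah - A) *v v)"
      using norm_triangle_ineq4[of "Ah *v v" "(Ah - A) *v v"] by (simp add: matrix_vector_mult_diff_rdistrib)
    ultimately show ?thesis using A(1)[of v] by (simp add: field_simps)
  qed
  have Ah: "invertible Ah" "norm (matrix_inv Ah) \<le> b"
    using bounded_below_invertible[of "a0 / 2" Ah, OF _ low] a0 by (auto simp: b_def K_def mult.commute)
  show "invertible Ah" by fact
  have npi: "norm \<pi> \<le> K"
  proof -
    have "\<bar>\<pi> $ x\<bar> \<le> 1" for x using \<pi>(1)[of x] \<pi>(2)[of x] q by linarith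
    from norm_vec_le_entries[OF this] show ?thesis by (simp add: K_def)
  qed
  have "\<pi>t - \<pi> = matrix_inv Ah *v (L - Ah *v \<pi>)"
    unfolding \<pi>t_def by (simp add: matrix_vector_mult_diff_distrib matrix_vector_mul_assoc matrix_inv_mult Ah)
  also have "L - Ah *v \<pi> = (L - A *v \<pi>) - (Ah - A) *v \<pi>"
    by (simp add: matrix_vector_mult_diff_rdistrib)
  finally have pd: "\<pi>t - \<pi> = matrix_inv Ah *v ((L - A *v \<pi>) - (Ah - A) *v \<pi>)" .
  have n1: "norm ((L - A *v \<pi>) - (Ah - A) *v \<pi>) \<le> e + e * K"
    by (rule order_trans[OF norm_triangle_ineq4], rule add_mono[OF e(2)], rule order_trans[OF norm_matrix_vector_mult_le])
      (intro mult_mono e(1) npi e0 norm_ge_zero)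
  have "norm (\<pi>t - \<pi>) \<le> b * (e + e * K)"
    unfolding pd by (rule order_trans[OF norm_matrix_vector_mult_le], rule mult_mono) (use Ah(2) b n1 in auto)
  then have C1: "norm (\<pi>t - \<pi>) \<le> C1 * e" by (simp add: C1_def algebra_simps)
  have C1e: "C1 * e \<le> q / 2" using small(2) by (simp add: C1_def b_def)
  have pt: "q / 2 \<le> \<pi>t $ x" for x
    using component_le_norm_cart[of "\<pi>t - \<pi>" x] C1 C1e \<pi>(1)[of x] by simp
  have D: "invertible (diag_mat \<pi>t)" "norm (matrix_inv (diag_mat \<pi>t)) \<le> K / (q / 2)"
    using diag_mat_inverse[of "q / 2" \<pi>t] q pt by (auto simp: K_def)
  show inv: "invertible (Ah ** diag_mat \<pi>t)" by (intro invertible_mult Ah D)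
  have nAh: "norm Ah \<le> a1 + a0"
    using norm_triangle_ineq[of A "Ah - A"] A(2) e(1) small(1) a0 by simp
  have nt: "norm \<pi>t \<le> K + q"
    using norm_triangle_ineq[of \<pi> "\<pi>t - \<pi>"] npi C1 C1e q by simp
  note nQ = norm_transition_matrix_le[OF Q, folded K_def]
  let ?D = "diag_mat \<pi>" and ?Dt = "diag_mat \<pi>t"
  \<comment> \<open>Telescoping: \<open>A\<close>, \<open>diag_mat \<pi>\<close> and
    \<open>transpose A\<close> are replaced by their estimates one at a time.\<close>
  have "N - Ah ** ?Dt ** Q ** transpose Ah = (N - A ** ?D ** Q ** transpose A)
    - (Ah - A) ** ?D ** Q ** transpose A - Ah ** diag_mat (\<pi>t - \<pi>) ** Q ** transpose A - Ah ** ?Dt ** Q ** (transpose (Ah - A))"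
    by (simp add: matrix_mult_distribs transpose_matrix_diff matrix_diag_mat_diff)
  moreover have "norm \<dots> \<le> e + e * K * K * a1 + (a1 + a0) * (C1 * e) * K * a1 + (a1 + a0) * (K + q) * K * e"
    by (rule norm_diff4_le; (intro norm_matrix_mult_le_mono)?)
      (use e npi nQ A(2) nAh C1 nt in \<open>simp_all only: norm_transpose norm_diag_mat\<close>)
  ultimately have n: "norm (N - Ah ** ?Dt ** Q ** transpose Ah)
      \<le> e + e * K * K * a1 + (a1 + a0) * (C1 * e) * K * a1 + (a1 + a0) * (K + q) * K * e" by (simp only:)
  have tA: "invertible (transpose Ah)" using Ah(1) by (rule transpose_invertible)
  let ?Qt = "matrix_inv (Ah ** ?Dt) ** N ** matrix_inv (transpose Ah)"
  have "?Qt - Q = matrix_inv ?Dt ** matrix_inv Ah ** (N - Ah ** ?Dt ** Q ** transpose Ah) ** matrix_inv (transpose Ah)"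
  proof -
    have "matrix_inv ?Dt ** matrix_inv Ah ** (Ah ** ?Dt ** Q ** transpose Ah) ** matrix_inv (transpose Ah)
      = matrix_inv ?Dt ** (matrix_inv Ah ** Ah) ** ?Dt ** Q ** (transpose Ah ** matrix_inv (transpose Ah))"
      by (simp only: matrix_mul_assoc)
    also have "\<dots> = Q" by (simp add: matrix_inv_mult Ah D tA)
    finally show ?thesis
      by (simp add: matrix_inv_mult_distrib Ah D matrix_mult_distribs)
  qed
  moreover have "norm \<dots> \<le> K / (q / 2) * b * (e + e * K * K * a1 + (a1 + a0) * (C1 * e) * K * a1 + (a1 + a0) * (K + q) * K * e) * b"
    by (intro norm_matrix_mult_le_mono D(2) Ah(2) n) (simp add: matrix_inv_transpose Ah)
  ultimately have "norm (?Qt - Q) \<le> K / (q / 2) * b * (e + e * K * K * a1 + (a1 + a0) * (C1 * e) * K * a1 + (a1 + a0) * (K + q) * K * e) * b"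
    by (simp only:)
  also have "\<dots> = K / (q / 2) * b * (1 + K * K * a1 + (a1 + a0) * C1 * K * a1 + (a1 + a0) * (K + q) * K) * b * e"
    by (simp add: algebra_simps)
  finally show "norm (Qh - Q) \<le> K / (q / 2) * (2 * K / a0) *
       (1 + K * K * a1 + (a1 + a0) * (2 * K / a0 * (1 + K)) * K * a1 + (a1 + a0) * (K + q) * K) * (2 * K / a0) * e"
    using closest_transition_matrix(2)[OF Q, of ?Qt] unfolding Qh_def C1_def b_def by linarith
qed

section \<open>Relabelling of the states\<close>

lemma perm_mat_mult: "(perm_mat \<tau> ** M) $ x $ y = M $ \<tau> x $ y"
  by (simp add: perm_mat_def matrix_matrix_mult_def if_distrib if_distribR cong: if_cong)

lemma mult_perm_mat_transpose: "(M ** transpose (perm_mat \<tau>)) $ x $ y = M $ x $ \<tau> y"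
  by (simp add: perm_mat_def transpose_def matrix_matrix_mult_def if_distrib if_distribR cong: if_cong)

lemma perm_mat_mult_vec: "(perm_mat \<tau> *v v) $ x = v $ \<tau> x"
  by (simp add: perm_mat_def matrix_vector_mult_def if_distrib if_distribR cong: if_cong)

lemma perm_mat_transpose_mult:
  assumes "\<tau> permutes UNIV" shows "transpose (perm_mat \<tau>) ** perm_mat \<tau> = mat 1"
proof -
  have "(perm_mat \<tau> ** transpose (perm_mat \<tau>)) $ x $ y = (mat 1 :: real^'a^'a) $ x $ y" for x y
    unfolding mult_perm_mat_transpose using permutes_inj[OF assms]
    by (auto simp: perm_mat_def mat_def inj_def)
  then have "perm_mat \<tau> ** transpose (perm_mat \<tau>) = mat 1" unfolding vec_eq_iff by blast
  then show ?thesis using matrix_left_right_inverse by blast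
qed

lemma orthogonal_perm_mat: "\<tau> permutes UNIV \<Longrightarrow> orthogonal_matrix (perm_mat \<tau>)"
  by (simp add: orthogonal_matrix perm_mat_transpose_mult)

lemma sum_permute: "\<tau> permutes UNIV \<Longrightarrow> (\<Sum>i\<in>UNIV. g (\<tau> i)) = (\<Sum>i\<in>UNIV. g i)"
  using sum.permute[of \<tau> UNIV g] by (simp only: comp_def)

lemma norm_perm_conj:
  assumes "\<tau> permutes UNIV"
  shows "norm (perm_mat \<tau> ** M ** transpose (perm_mat \<tau>)) = norm M"
proof -
  have "(norm (perm_mat \<tau> ** M ** transpose (perm_mat \<tau>)))\<^sup>2 = (norm M)\<^sup>2"
    unfolding norm_mat_sq norm_vec_sq mult_perm_mat_transpose perm_mat_mult
      sum_permute[OF assms, of "\<lambda>j. (M $ i $ j)\<^sup>2" for i] sum_permute[OF assms, of "\<lambda>i. \<Sum>j\<in>UNIV. (M $ i $ j)\<^sup>2"] ..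
  then show ?thesis by simp
qed

text \<open>With X = A diag(\<pi>) Q and W = Q A^T the population matrices are X W and X diag(D x)
  W, where D x is row x of \<Theta>^T A. If the errors are written inside, P = X (1 + F) W and T x =
  X (diag(D x) + G x) W, the factor X cancels in P^-1 T x, and what is left is conjugate by W to a
  perturbed diagonal matrix. The matrix \<open>A\<close> influences the constants only through
  \<open>a0\<close> and \<open>a1\<close>, so neither the singular vectors nor M enter.\<close>

lemma compressed_spectral_algorithm:
  fixes Q :: "real^'k^'k" and \<pi> :: "real^'k" and x1 :: 'k
  assumes Q: "transition_matrix Q" "invertible Q" and q: "0 < q" and \<pi>: "\<And>x. q \<le> \<pi> $ x" "\<And>x. \<pi> $ x \<le> 1"
    and a0: "0 < a0" and a1: "0 < a1"
  obtains C e0 where "0 < C" "0 < e0"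
    "\<And>A \<Theta> P T N L g e.
      (\<And>v. a0 * norm v \<le> norm (A *v v)) \<Longrightarrow> norm A \<le> a1 \<Longrightarrow> orthogonal_matrix \<Theta> \<Longrightarrow>
      0 < g \<Longrightarrow> g \<le> 1 \<Longrightarrow>
      (\<And>i j. i \<noteq> j \<Longrightarrow> g \<le> \<bar>(transpose \<Theta> ** A) $ x1 $ i - (transpose \<Theta> ** A) $ x1 $ j\<bar>) \<Longrightarrow>
      norm (P - A ** diag_mat \<pi> ** Q ** Q ** transpose A) \<le> e \<Longrightarrow>
      (\<And>x. norm (T x - A ** diag_mat \<pi> ** Q ** diag_mat ((transpose \<Theta> ** A) $ x) ** Q ** transpose A) \<le> e) \<Longrightarrow>
      norm (N - A ** diag_mat \<pi> ** Q ** transpose A) \<le> e \<Longrightarrow> norm (L - A *v \<pi>) \<le> e \<Longrightarrow>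
      e \<le> e0 * g \<Longrightarrow>
      invertible P \<and>
      (\<exists>R :: real^'k^'k. invertible R \<and> (\<forall>x. norm (column x R) = 1) \<and>
        (\<forall>i j. i \<noteq> j \<longrightarrow> (matrix_inv R ** (matrix_inv P ** T x1) ** R) $ i $ j = 0)) \<and>
      (\<forall>R :: real^'k^'k. invertible R \<and> (\<forall>i j. i \<noteq> j \<longrightarrow> (matrix_inv R ** (matrix_inv P ** T x1) ** R) $ i $ j = 0) \<longrightarrow>
        (let Ah = \<Theta> ** (\<chi> x j. (matrix_inv R ** (matrix_inv P ** T x) ** R) $ j $ j);
             \<pi>t = matrix_inv Ah *v L;
             Qh = closest_point {A. transition_matrix A}
               (matrix_inv (Ah ** diag_mat \<pi>t) ** N ** matrix_inv (transpose Ah))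
         in invertible Ah \<and> invertible (Ah ** diag_mat \<pi>t) \<and>
           (\<exists>\<tau>. \<tau> permutes UNIV \<and> (\<forall>x. norm (column (\<tau> x) Ah - column x A) \<le> C * e / g) \<and>
             norm (perm_mat \<tau> ** Qh ** transpose (perm_mat \<tau>) - Q) \<le> C * e / g)))"
proof -
  define K where "K = real CARD('k)"
  have K: "1 \<le> K" unfolding K_def by (simp add: Suc_leI)
  define nQ where "nQ = norm (matrix_inv Q)"
  \<comment> \<open>In this order: \<open>w\<close> bounds the inverse of W, \<open>z\<close> that
    of X, \<open>b\<close> the diagonals D x, \<open>c0 * e\<close> the errors \<open>E x\<close>;
    \<open>c1\<close> is the constant of \<open>joint_eigenvalue_perturbation\<close>,
    \<open>c2 * e / g\<close> bounds the error of the estimate of \<open>A\<close>, and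
    \<open>c3\<close> is the constant of \<open>transition_recovery_perturbation\<close> with norm
    bound \<open>a1 * K\<close>.\<close>
  define w where "w = (K / a0) * nQ"
  define z where "z = nQ * (K / q) * (K / a0)"
  define b where "b = K * a1"
  define c0 where "c0 = 2 * K * (z * w + z * w * b)"
  define c1 where "c1 = 8 * K^3 * b + 4 * K\<^sup>2"
  define c2 where "c2 = K * (K * (c1 * c0)) + 1"
  define c3 where "c3 = K / (q / 2) * (2 * K / a0) *
       (1 + K * K * (a1 * K) + (a1 * K + a0) * (2 * K / a0 * (1 + K)) * K * (a1 * K) + (a1 * K + a0) * (K + q) * K) * (2 * K / a0)"
  have pos: "0 \<le> nQ" "0 \<le> w" "0 \<le> z" "0 \<le> b" "0 \<le> c0" "0 \<le> c1" "1 \<le> c2" "0 \<le> c3"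
  proof -
    show 1: "0 \<le> nQ" by (simp add: nQ_def)
    show 2: "0 \<le> w" using 1 K a0 by (simp add: w_def)
    show 3: "0 \<le> z" using 1 K a0 q by (simp add: z_def)
    show 4: "0 \<le> b" using K a1 by (simp add: b_def)
    show 5: "0 \<le> c0" using 2 3 4 K by (simp add: c0_def)
    show 6: "0 \<le> c1" using 4 K by (simp add: c1_def)
    show "1 \<le> c2" using 5 6 K by (simp add: c2_def)
    show "0 \<le> c3" using K a0 a1 q by (simp add: c3_def)
  qed
  define C where "C = c2 + c3 * c2"
  \<comment> \<open>The entries guarantee, respectively, |F| <= 1/2, the smallness of
    \<open>E x\<close> relative to the gap, and the two smallness conditions of
    \<open>transition_recovery_perturbation\<close>.\<close>
  define e0 where "e0 = Min {1 / (2 * (z * w + 1)), 1 / (4 * K\<^sup>2 * (c0 + 1)), a0 / 2 / c2, q / 2 / (2 * K / a0 * (1 + K) * c2)}"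
  have e0_pos: "0 < e0" unfolding e0_def using pos K a0 q by (auto intro!: divide_pos_pos mult_pos_pos add_nonneg_pos)
  have e0_le: "e0 \<le> 1 / (2 * (z * w + 1))" "e0 \<le> 1 / (4 * K\<^sup>2 * (c0 + 1))" "e0 \<le> a0 / 2 / c2"
     "e0 \<le> q / 2 / (2 * K / a0 * (1 + K) * c2)" unfolding e0_def by auto
  show ?thesis
  proof (rule that[of C e0])
    show "0 < C" using pos by (simp add: C_def add_pos_nonneg)
    show "0 < e0" by fact
    fix A \<Theta> P N :: "real^'k^'k" and T :: "'k \<Rightarrow> real^'k^'k" and L :: "real^'k" and g e :: real
    assume A: "\<And>v. a0 * norm v \<le> norm (A *v v)" "norm A \<le> a1" and \<Theta>: "orthogonal_matrix \<Theta>"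
      and g: "0 < g" "g \<le> 1"
      and gap: "\<And>i j. i \<noteq> j \<Longrightarrow> g \<le> \<bar>(transpose \<Theta> ** A) $ x1 $ i - (transpose \<Theta> ** A) $ x1 $ j\<bar>"
      and P: "norm (P - A ** diag_mat \<pi> ** Q ** Q ** transpose A) \<le> e"
      and T: "\<And>x. norm (T x - A ** diag_mat \<pi> ** Q ** diag_mat ((transpose \<Theta> ** A) $ x) ** Q ** transpose A) \<le> e"
      and N: "norm (N - A ** diag_mat \<pi> ** Q ** transpose A) \<le> e" and L: "norm (L - A *v \<pi>) \<le> e"
      and e: "e \<le> e0 * g"
    have en: "0 \<le> e" using P norm_ge_zero order_trans by blast
    have ee0: "e \<le> e0" using e g e0_pos by (meson mult_left_le less_imp_le order_trans)
    have eg: "e / g \<le> e0" using e g by (simp add: field_simps)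
    have eeg: "e \<le> e / g" using en g by (simp add: field_simps mult_left_le)
    have Ai: "invertible A" "norm (matrix_inv A) \<le> K / a0"
      using bounded_below_invertible[OF a0, of A] A(1) by (auto simp: K_def)
    have Di: "invertible (diag_mat \<pi>)" "norm (matrix_inv (diag_mat \<pi>)) \<le> K / q"
      using diag_mat_inverse[OF q, of \<pi>] \<pi>(1) by (auto simp: K_def)
    define W where "W = Q ** transpose A"
    define X where "X = A ** diag_mat \<pi> ** Q"
    have W: "invertible W" unfolding W_def by (intro invertible_mult Q transpose_invertible Ai)
    have X: "invertible X" unfolding X_def by (intro invertible_mult Q Ai Di)
    have nW: "norm (matrix_inv W) \<le> w"
      unfolding W_def w_def matrix_inv_mult_distrib[OF Q(2) transpose_invertible[OF Ai(1)]]
      by (intro norm_matrix_mult_le_mono) (simp_all add: matrix_inv_transpose Ai nQ_def)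
    have "matrix_inv X = matrix_inv Q ** (matrix_inv (diag_mat \<pi>) ** matrix_inv A)"
      unfolding X_def by (simp add: matrix_inv_mult_distrib invertible_mult Q Ai Di)
    moreover have "norm \<dots> \<le> nQ * (K / q * (K / a0))"
      by (intro norm_matrix_mult_le_mono Ai Di) (simp add: nQ_def)
    ultimately have nX: "norm (matrix_inv X) \<le> z" by (simp add: z_def mult.assoc)
    define D where "D x = (transpose \<Theta> ** A) $ x" for x
    define F where "F = matrix_inv X ** (P - X ** W) ** matrix_inv W"
    define G where "G x = matrix_inv X ** (T x - X ** diag_mat (D x) ** W) ** matrix_inv W" for x
    have XFW: "X ** (matrix_inv X ** M ** matrix_inv W) ** W = M" for M
    proof -
      have "X ** (matrix_inv X ** M ** matrix_inv W) ** W = (X ** matrix_inv X) ** M ** (matrix_inv W ** W)"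
        by (simp only: matrix_mul_assoc)
      then show ?thesis by (simp add: matrix_inv_mult W X)
    qed
    have P': "P = X ** (mat 1 + F) ** W"
      by (simp add: matrix_mult_distribs XFW F_def)
    have T': "T x = X ** (diag_mat (D x) + G x) ** W" for x
      by (simp add: matrix_mult_distribs XFW G_def)
    have nF: "norm F \<le> z * e * w"
      unfolding F_def by (intro norm_matrix_mult_le_mono nX nW) (use P in \<open>simp add: X_def W_def matrix_mul_assoc\<close>)
    have nG: "norm (G x) \<le> z * e * w" for x
      unfolding G_def by (intro norm_matrix_mult_le_mono nX nW) (use T in \<open>simp add: X_def W_def D_def matrix_mul_assoc\<close>)
    have "(z * w) * e \<le> (z * w + 1) * (1 / (2 * (z * w + 1)))"
      using pos en e0_le(1) ee0 by (intro mult_mono) (auto intro: add_nonneg_nonneg)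
    also have "\<dots> = 1 / 2" using pos(2,3) by (simp add: add_nonneg_eq_0_iff)
    finally have "norm F \<le> 1 / 2" using nF by (simp add: mult_ac)
    note F = neumann_inverse[OF this, folded K_def]
    have Pi: "invertible P" unfolding P' by (intro invertible_mult X F W)
    \<comment> \<open>What remains after (1 + F)^-1 is multiplied into the second factor. It equals
      (1 + F)^-1 (G x - F diag(D x)) and is therefore of order \<open>e\<close>.\<close>
    define E where "E x = matrix_inv (mat 1 + F) ** (diag_mat (D x) + G x) - diag_mat (D x)" for x
    have "matrix_inv (mat 1 + F) ** ((mat 1 + F) ** M) = M" for M :: "real^'k^'k"
      unfolding matrix_mul_assoc by (simp add: matrix_inv_mult F)
    then have FD: "diag_mat (D x) = matrix_inv (mat 1 + F) ** diag_mat (D x) + matrix_inv (mat 1 + F) ** (F ** diag_mat (D x))" for x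
      by (simp add: matrix_mult_distribs)
    have "E x = matrix_inv (mat 1 + F) ** (G x - F ** diag_mat (D x))" for x
      unfolding E_def by (subst (2) FD) (simp add: matrix_mult_distribs)
    moreover have nD: "norm (D x) \<le> b" for x
    proof -
      have "norm (D x) \<le> norm (transpose \<Theta> ** A)" unfolding D_def by (rule Finite_Cartesian_Product.norm_nth_le)
      also have "\<dots> \<le> K * a1"
        by (intro norm_matrix_mult_le_mono A(2)) (simp add: norm_orthogonal_le[OF \<Theta>] K_def)
      finally show ?thesis by (simp add: b_def)
    qed
    moreover have "norm (matrix_inv (mat 1 + F) ** (G x - F ** diag_mat (D x))) \<le> 2 * K * (z * e * w + z * e * w * b)" for x
      by (intro norm_matrix_mult_le_mono F order_trans[OF norm_triangle_ineq4] add_mono nG nF) (simp add: nD)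
    ultimately have nE: "norm (E x) \<le> c0 * e" for x by (simp add: c0_def algebra_simps)
    have C': "matrix_inv P ** T x = matrix_inv W ** (diag_mat (D x) + E x) ** W" for x
    proof -
      have "matrix_inv P = matrix_inv W ** (matrix_inv (mat 1 + F) ** matrix_inv X)"
        unfolding P' by (simp add: matrix_inv_mult_distrib invertible_mult X F W)
      then have "matrix_inv P ** T x = matrix_inv W ** matrix_inv (mat 1 + F) ** (matrix_inv X ** X) ** (diag_mat (D x) + G x) ** W"
        unfolding T' by (simp only: matrix_mul_assoc)
      then show ?thesis by (simp add: matrix_inv_mult X E_def matrix_mul_assoc)
    qed
    have "c0 * (e / g) \<le> (c0 + 1) * (1 / (4 * K\<^sup>2 * (c0 + 1)))"
      using pos en g e0_le(2) eg by (intro mult_mono) auto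
    also have "\<dots> = 1 / (4 * K\<^sup>2)" using pos K by simp
    finally have small: "4 * K\<^sup>2 * (c0 * e) \<le> g" using g K by (simp add: field_simps)
    have gap': "i \<noteq> j \<Longrightarrow> g \<le> \<bar>D x1 $ i - D x1 $ j\<bar>" for i j using gap by (simp add: D_def)
    note jep = joint_eigenvalue_perturbation[where D = D and E = E and C = "\<lambda>x. matrix_inv P ** T x" and ?x1.0 = x1, OF g gap' nE small[unfolded K_def] nD W C', folded K_def, folded c1_def]
    have R_ok: "let Ah = \<Theta> ** (\<chi> x j. (matrix_inv R ** (matrix_inv P ** T x) ** R) $ j $ j);
             \<pi>t = matrix_inv Ah *v L;
             Qh = closest_point {A. transition_matrix A}
               (matrix_inv (Ah ** diag_mat \<pi>t) ** N ** matrix_inv (transpose Ah))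
         in invertible Ah \<and> invertible (Ah ** diag_mat \<pi>t) \<and>
           (\<exists>\<tau>. \<tau> permutes UNIV \<and> (\<forall>x. norm (column (\<tau> x) Ah - column x A) \<le> C * e / g) \<and>
             norm (perm_mat \<tau> ** Qh ** transpose (perm_mat \<tau>) - Q) \<le> C * e / g)"
      if R: "invertible R" and off: "\<And>i j. i \<noteq> j \<Longrightarrow> (matrix_inv R ** (matrix_inv P ** T x1) ** R) $ i $ j = 0"
      for R :: "real^'k^'k"
    proof -
      define Lam where "Lam = (\<chi> x j. (matrix_inv R ** (matrix_inv P ** T x) ** R) $ j $ j)"
      define Ah where "Ah = \<Theta> ** Lam"
      define \<pi>t where "\<pi>t = matrix_inv Ah *v L"
      define Qh where "Qh = closest_point {A. transition_matrix A}
               (matrix_inv (Ah ** diag_mat \<pi>t) ** N ** matrix_inv (transpose Ah))"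
      obtain \<sigma> where \<sigma>: "\<sigma> permutes UNIV" and
        ev: "\<And>x j. \<bar>(matrix_inv R ** (matrix_inv P ** T x) ** R) $ j $ j - D x $ \<sigma> j\<bar> \<le> c1 * (c0 * e) / g"
        using jep(2)[OF _ R off] by blast
      define p where "p = perm_mat \<sigma>"
      have pp: "transpose p ** p = mat 1" unfolding p_def by (rule perm_mat_transpose_mult[OF \<sigma>])
      have np: "norm (transpose p) \<le> K"
        using norm_orthogonal_le[OF orthogonal_perm_mat[OF \<sigma>]] by (simp add: p_def K_def)
      have pM: "M ** transpose p ** p = M" "M ** transpose p ** p ** M' = M ** M'" for M M' :: "real^'k^'k"
        by (simp_all add: pp flip: matrix_mul_assoc)
      \<comment> \<open>The model with its states relabelled by \<open>\<sigma>\<close>. It has the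
        same population moments, and its matrix \<open>A'\<close> is close to \<open>Ah\<close>
        without a permutation in between, so the recovery lemma applies to it directly.\<close>
      define A' where "A' = A ** transpose p"
      define \<pi>' where "\<pi>' = p *v \<pi>"
      define Q' where "Q' = p ** Q ** transpose p"
      have Dp: "diag_mat \<pi>' = p ** diag_mat \<pi> ** transpose p"
        using permutes_inj[OF \<sigma>]
        by (simp add: vec_eq_iff \<pi>'_def p_def mult_perm_mat_transpose perm_mat_mult perm_mat_mult_vec diag_mat_def inj_eq)
      have m1: "A' *v \<pi>' = A *v \<pi>"
        unfolding A'_def \<pi>'_def by (simp add: matrix_vector_mul_assoc pM)
      have m2: "A' ** diag_mat \<pi>' ** Q' ** transpose A' = A ** diag_mat \<pi> ** Q ** transpose A"
        unfolding A'_def Q'_def Dp by (simp add: matrix_transpose_mul matrix_mul_assoc pM)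
      have Q'tm: "transition_matrix Q'"
        unfolding transition_matrix_def Q'_def p_def mult_perm_mat_transpose perm_mat_mult
        using Q(1) sum_permute[OF \<sigma>, of "\<lambda>j. Q $ i $ j" for i] by (simp add: transition_matrix_def)
      have "norm (Lam - transpose \<Theta> ** A') \<le> K * (c1 * (c0 * e) / g)"
        unfolding K_def
      proof (rule norm_matrix_le_entries)
        fix i j
        have "(transpose \<Theta> ** A') $ i $ j = D i $ \<sigma> j"
          unfolding A'_def matrix_mul_assoc p_def mult_perm_mat_transpose D_def ..
        then show "\<bar>(Lam - transpose \<Theta> ** A') $ i $ j\<bar> \<le> c1 * (c0 * e) / g"
          using ev[of i j] by (simp add: Lam_def)
      qed
      then have "norm (\<Theta> ** (Lam - transpose \<Theta> ** A')) \<le> K * (K * (c1 * (c0 * e) / g))"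
        by (rule norm_matrix_mult_le_mono[OF norm_orthogonal_le[OF \<Theta>, folded K_def]])
      moreover have "\<Theta> ** (Lam - transpose \<Theta> ** A') = Ah - A'"
        using \<Theta> by (simp add: matrix_mult_distribs Ah_def matrix_mul_assoc orthogonal_matrix_def)
      ultimately have "norm (Ah - A') \<le> K * (K * (c1 * c0)) * (e / g)" by simp
      also have "\<dots> \<le> c2 * (e / g)"
        unfolding c2_def using en g by (intro mult_right_mono) auto
      finally have AhA: "norm (Ah - A') \<le> c2 * (e / g)" .
      have "e \<le> c2 * (e / g)"
        using eeg mult_right_mono[OF pos(7), of "e / g"] en g by simp
      then have LN: "norm (L - A' *v \<pi>') \<le> c2 * (e / g)" "norm (N - A' ** diag_mat \<pi>' ** Q' ** transpose A') \<le> c2 * (e / g)"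
        unfolding m1 m2 using L N by linarith+
      have lowA': "a0 * norm v \<le> norm (A' *v v)" for v
      proof -
        have "norm (transpose p *v v) = norm v"
          by (rule norm_orthogonal_mult) (simp add: p_def orthogonal_perm_mat[OF \<sigma>])
        then show ?thesis using A(1)[of "transpose p *v v"]
          by (simp only: A'_def matrix_vector_mul_assoc)
      qed
      have nA': "norm A' \<le> a1 * K" unfolding A'_def by (intro norm_matrix_mult_le_mono A np)
      have \<pi>b: "q \<le> \<pi>' $ x" "\<pi>' $ x \<le> 1" for x
        using \<pi> by (simp_all add: \<pi>'_def p_def perm_mat_mult_vec)
      have "c2 * (e / g) \<le> c2 * (a0 / 2 / c2)"
        using pos eg e0_le(3) by (intro mult_left_mono) auto
      then have s1: "c2 * (e / g) \<le> a0 / 2" using pos(7) by simp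
      have "(2 * K / a0 * (1 + K) * c2) * (e / g) \<le> (2 * K / a0 * (1 + K) * c2) * (q / 2 / (2 * K / a0 * (1 + K) * c2))"
        using pos(7) K a0 order_trans[OF eg e0_le(4)] by (intro mult_left_mono) auto
      also have "\<dots> = q / 2" using pos(7) K a0 by simp
      finally have s2: "2 * K / a0 * (1 + K) * (c2 * (e / g)) \<le> q / 2" by (simp add: mult.assoc)
      note rec = transition_recovery_perturbation[OF a0 q lowA' nA' Q'tm \<pi>b AhA LN s1 s2[unfolded K_def],
          folded K_def, folded c3_def, folded \<pi>t_def, folded Qh_def]
      \<comment> \<open>\<open>\<sigma>\<close> sends an estimated state to the true one, whereas
        the result matches a true state with its estimate.\<close>
      define \<tau> where "\<tau> = inv \<sigma>"
      have \<tau>: "\<tau> permutes UNIV" unfolding \<tau>_def by (rule permutes_inv[OF \<sigma>])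
      have \<sigma>\<tau>: "\<sigma> (\<tau> x) = x" for x unfolding \<tau>_def using permutes_inverses(1)[OF \<sigma>] .
      have cc: "0 \<le> c3 * c2 * (e / g)" "0 \<le> c2 * (e / g)" using pos en g by simp_all
      have "norm (column (\<tau> x) Ah - column x A) \<le> C * e / g" for x
      proof -
        have "column x A = column (\<tau> x) A'"
          by (simp add: column_def A'_def p_def mult_perm_mat_transpose \<sigma>\<tau>)
        then have "column (\<tau> x) Ah - column x A = (Ah - A') *v axis (\<tau> x) 1"
          by (simp add: matrix_vector_mult_basis column_def vec_eq_iff)
        then have "norm (column (\<tau> x) Ah - column x A) \<le> norm (Ah - A')"
          using norm_matrix_vector_mult_le[of "Ah - A'" "axis (\<tau> x) 1"] by simp
        also have "\<dots> \<le> C * (e / g)"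
          using AhA cc unfolding C_def distrib_right by linarith
        finally show ?thesis by simp
      qed
      moreover have "norm (perm_mat \<tau> ** Qh ** transpose (perm_mat \<tau>) - Q) \<le> C * e / g"
      proof -
        have "perm_mat \<tau> ** Q' ** transpose (perm_mat \<tau>) = Q"
          by (simp add: vec_eq_iff mult_perm_mat_transpose perm_mat_mult Q'_def p_def \<sigma>\<tau>)
        then have "perm_mat \<tau> ** Qh ** transpose (perm_mat \<tau>) - Q = perm_mat \<tau> ** (Qh - Q') ** transpose (perm_mat \<tau>)"
          by (simp add: matrix_mult_distribs)
        then have "norm (perm_mat \<tau> ** Qh ** transpose (perm_mat \<tau>) - Q) \<le> c3 * (c2 * (e / g))"
          using rec(3) by (simp add: norm_perm_conj[OF \<tau>])
        also have "\<dots> \<le> C * (e / g)"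
          using cc unfolding C_def distrib_right mult.assoc by linarith
        finally show ?thesis by simp
      qed
      ultimately show ?thesis
        using rec(1,2) \<tau> unfolding Let_def Lam_def[symmetric] Ah_def[symmetric] \<pi>t_def[symmetric] Qh_def[symmetric] by blast
    qed
    show "invertible P \<and>
      (\<exists>R :: real^'k^'k. invertible R \<and> (\<forall>x. norm (column x R) = 1) \<and>
        (\<forall>i j. i \<noteq> j \<longrightarrow> (matrix_inv R ** (matrix_inv P ** T x1) ** R) $ i $ j = 0)) \<and>
      (\<forall>R :: real^'k^'k. invertible R \<and> (\<forall>i j. i \<noteq> j \<longrightarrow> (matrix_inv R ** (matrix_inv P ** T x1) ** R) $ i $ j = 0) \<longrightarrow>
        (let Ah = \<Theta> ** (\<chi> x j. (matrix_inv R ** (matrix_inv P ** T x) ** R) $ j $ j);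
             \<pi>t = matrix_inv Ah *v L;
             Qh = closest_point {A. transition_matrix A}
               (matrix_inv (Ah ** diag_mat \<pi>t) ** N ** matrix_inv (transpose Ah))
         in invertible Ah \<and> invertible (Ah ** diag_mat \<pi>t) \<and>
           (\<exists>\<tau>. \<tau> permutes UNIV \<and> (\<forall>x. norm (column (\<tau> x) Ah - column x A) \<le> C * e / g) \<and>
             norm (perm_mat \<tau> ** Qh ** transpose (perm_mat \<tau>) - Q) \<le> C * e / g)))"
      apply (intro conjI allI impI)
      subgoal by (rule Pi)
      subgoal by (rule jep(1))
      subgoal by (rule R_ok) blast+
      done
  qed
qed

subsection \<open>Top singular vectors\<close>

declare One_nat_def [simp del]

lemma L2_set_sq: "(L2_set f I)\<^sup>2 = (\<Sum>i\<in>I. (f i)\<^sup>2)"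
  by (simp add: L2_set_def sum_nonneg)

lemma L2_set_le_iff: "0 \<le> b \<Longrightarrow> L2_set f I \<le> b \<longleftrightarrow> (\<Sum>i\<in>I. (f i)\<^sup>2) \<le> b\<^sup>2"
  using abs_le_square_iff[of "L2_set f I" b] by (simp add: L2_set_sq)

lemma sum_mult_le_L2_set: "\<bar>\<Sum>i\<in>I. f i * g i\<bar> \<le> L2_set f I * L2_set g I"
proof -
  have "\<bar>\<Sum>i\<in>I. f i * g i\<bar> \<le> (\<Sum>i\<in>I. \<bar>f i\<bar> * \<bar>g i\<bar>)" by (metis (no_types, lifting) abs_mult sum.cong sum_abs)
  then show ?thesis using L2_set_mult_ineq order_trans by blast
qed

lemma L2_set_diff_triangle: "L2_set (\<lambda>i. f i - g i) I \<le> L2_set f I + L2_set g I"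
  using L2_set_triangle_ineq[of f "\<lambda>i. - g i" I] by (simp add: L2_set_def)

lemma L2_set_matrix_apply:
  assumes "finite J"
  shows "L2_set (\<lambda>a. \<Sum>c\<in>J. E a c * z c) I \<le> L2_set (\<lambda>(a, c). E a c) (I \<times> J) * L2_set z J"
proof (subst L2_set_le_iff)
  have "(\<Sum>a\<in>I. (\<Sum>c\<in>J. E a c * z c)\<^sup>2) \<le> (\<Sum>a\<in>I. (\<Sum>c\<in>J. (E a c)\<^sup>2) * (\<Sum>c\<in>J. (z c)\<^sup>2))"
  proof (rule sum_mono)
    fix a
    have "(\<Sum>c\<in>J. E a c * z c)\<^sup>2 \<le> (L2_set (E a) J * L2_set z J)\<^sup>2"
      using sum_mult_le_L2_set[of "E a" z J] by (metis abs_ge_zero power2_abs power_mono)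
    then show "(\<Sum>c\<in>J. E a c * z c)\<^sup>2 \<le> (\<Sum>c\<in>J. (E a c)\<^sup>2) * (\<Sum>c\<in>J. (z c)\<^sup>2)"
      by (simp add: power_mult_distrib L2_set_sq)
  qed
  also have "\<dots> = (L2_set (\<lambda>(a, c). E a c) (I \<times> J) * L2_set z J)\<^sup>2"
    by (simp add: power_mult_distrib L2_set_sq sum_distrib_right sum.cartesian_product split_def)
  finally show "(\<Sum>a\<in>I. (\<Sum>c\<in>J. E a c * z c)\<^sup>2) \<le> (L2_set (\<lambda>(a, c). E a c) (I \<times> J) * L2_set z J)\<^sup>2" .
qed simp

lemma orthonormal_combination:
  assumes "orthonormal_vectors M w" "J \<subseteq> {1..M}"
  shows "(\<Sum>a=1..M. (\<Sum>i\<in>J. x i * w i a)\<^sup>2) = (\<Sum>i\<in>J. (x i)\<^sup>2)"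
    and "j \<in> {1..M} \<Longrightarrow> (\<Sum>a=1..M. w j a * (\<Sum>i\<in>J. x i * w i a)) = (if j \<in> J then x j else 0)"
proof -
  have fin: "finite J" using assms(2) finite_subset by blast
  show 2: "(\<Sum>a=1..M. w j a * (\<Sum>i\<in>J. x i * w i a)) = (if j \<in> J then x j else 0)" if j: "j \<in> {1..M}" for j
  proof -
    have "(\<Sum>a=1..M. w j a * (\<Sum>i\<in>J. x i * w i a)) = (\<Sum>i\<in>J. x i * (\<Sum>a=1..M. w j a * w i a))"
      by (subst sum_distrib_left, subst sum.swap) (simp add: sum_distrib_left mult_ac)
    also have "\<dots> = (\<Sum>i\<in>J. if i = j then x i else 0)"
      using assms j unfolding orthonormal_vectors_def by (intro sum.cong) auto
    finally show ?thesis using fin by simp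
  qed
  have "(\<Sum>a=1..M. (\<Sum>i\<in>J. x i * w i a)\<^sup>2) = (\<Sum>a=1..M. \<Sum>j\<in>J. x j * (w j a * (\<Sum>i\<in>J. x i * w i a)))"
    by (simp add: power2_eq_square sum_distrib_right mult.assoc)
  also have "\<dots> = (\<Sum>j\<in>J. x j * (\<Sum>a=1..M. w j a * (\<Sum>i\<in>J. x i * w i a)))"
    by (subst sum.swap) (simp add: sum_distrib_left)
  also have "\<dots> = (\<Sum>j\<in>J. (x j)\<^sup>2)"
    using 2 assms(2) by (intro sum.cong) (auto simp: power2_eq_square)
  finally show "(\<Sum>a=1..M. (\<Sum>i\<in>J. x i * w i a)\<^sup>2) = (\<Sum>i\<in>J. (x i)\<^sup>2)" .
qed

lemma bessel_inequality:
  assumes "orthonormal_vectors M v"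
  shows "(\<Sum>i=1..M. (\<Sum>c=1..M. v i c * z c)\<^sup>2) \<le> (\<Sum>c=1..M. (z c)\<^sup>2)"
proof -
  define x where "x i = (\<Sum>c=1..M. v i c * z c)" for i
  note oc = orthonormal_combination[where x = x, OF assms order_refl]
  have "0 \<le> (\<Sum>c=1..M. (z c - (\<Sum>i=1..M. x i * v i c))\<^sup>2)" by (simp add: sum_nonneg)
  also have "\<dots> = (\<Sum>c=1..M. (z c)\<^sup>2) - 2 * (\<Sum>c=1..M. z c * (\<Sum>i=1..M. x i * v i c)) + (\<Sum>i=1..M. (x i)\<^sup>2)"
    unfolding oc(1)[symmetric] by (simp add: power2_diff sum.distrib sum_subtractf sum_distrib_left mult.assoc)
  also have "(\<Sum>c=1..M. z c * (\<Sum>i=1..M. x i * v i c)) = (\<Sum>i=1..M. (x i)\<^sup>2)"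
  proof -
    have "(\<Sum>c=1..M. z c * (\<Sum>i=1..M. x i * v i c)) = (\<Sum>i=1..M. x i * (\<Sum>c=1..M. v i c * z c))"
      by (subst sum_distrib_left, subst sum.swap) (simp add: sum_distrib_left mult_ac)
    then show ?thesis by (simp add: power2_eq_square x_def)
  qed
  finally show ?thesis by (simp add: x_def)
qed

text \<open>K + 1 vectors of a K-dimensional space are dependent. They come as a family and not as a
  set, so a repeated vector is a relation of its own and is treated in the second case.\<close>

lemma normalized_linear_relation:
  fixes b :: "nat \<Rightarrow> real^'k"
  obtains \<alpha> where "(\<Sum>i=1..CARD('k) + 1. (\<alpha> i)\<^sup>2) = (1::real)" "(\<Sum>i=1..CARD('k) + 1. \<alpha> i *\<^sub>R b i) = 0"
proof -
  let ?J = "{1..CARD('k) + 1}"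
  have "\<exists>\<beta>::nat \<Rightarrow> real. (\<exists>i\<in>?J. \<beta> i \<noteq> 0) \<and> (\<Sum>i\<in>?J. \<beta> i *\<^sub>R b i) = 0"
  proof (cases "inj_on b ?J")
    case True
    then have "card (b ` ?J) = CARD('k) + 1" by (simp add: card_image)
    then have "dependent (b ` ?J)" by (intro dependent_biggerset) auto
    then obtain u v where u: "v \<in> b ` ?J" "u v \<noteq> 0" "(\<Sum>v\<in>b ` ?J. u v *\<^sub>R v) = 0"
      using dependent_finite[of "b ` ?J"] by auto
    then show ?thesis using True by (intro exI[of _ "u \<circ> b"]) (auto simp: sum.reindex)
  next
    case False
    then obtain i j where ij: "i \<in> ?J" "j \<in> ?J" "i \<noteq> j" "b i = b j" by (auto simp: inj_on_def)
    let ?\<beta> = "\<lambda>l. if l = i then 1 else if l = j then - 1 else (0::real)"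
    have "(\<Sum>l\<in>?J. ?\<beta> l *\<^sub>R b l) = (\<Sum>l\<in>{i, j}. ?\<beta> l *\<^sub>R b l)"
      using ij by (intro sum.mono_neutral_right) auto
    also have "\<dots> = 0" using ij by simp
    finally show ?thesis using ij by (intro exI[of _ ?\<beta>]) auto
  qed
  then obtain \<beta> where \<beta>: "\<exists>i\<in>?J. \<beta> i \<noteq> (0::real)" "(\<Sum>i\<in>?J. \<beta> i *\<^sub>R b i) = 0" by blast
  define n where "n = L2_set \<beta> ?J"
  have "n \<noteq> 0" unfolding n_def using \<beta>(1) by (auto simp: L2_set_eq_0_iff)
  show ?thesis
  proof (rule that[of "\<lambda>i. \<beta> i / n"])
    show "(\<Sum>i\<in>?J. (\<beta> i / n)\<^sup>2) = 1"
    proof -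
      have "(\<Sum>i\<in>?J. (\<beta> i)\<^sup>2) = n\<^sup>2" by (simp only: n_def L2_set_sq)
      then show ?thesis using \<open>n \<noteq> 0\<close> by (simp only: power_divide sum_divide_distrib[symmetric]) simp
    qed
    have "(\<Sum>i\<in>?J. (\<beta> i / n) *\<^sub>R b i) = (1 / n) *\<^sub>R (\<Sum>i\<in>?J. \<beta> i *\<^sub>R b i)"
      unfolding scaleR_sum_right by (intro sum.cong) auto
    then show "(\<Sum>i\<in>?J. (\<beta> i / n) *\<^sub>R b i) = 0" by (simp only: \<beta>(2) scaleR_zero_right)
  qed
qed

lemma top_right_singular_vectorsE:
  fixes U :: "nat \<Rightarrow> real^'k"
  assumes "top_right_singular_vectors M P U"
  obtains s w v and e :: "'k \<Rightarrow> nat" where "CARD('k) \<le> M" "orthonormal_vectors M w" "orthonormal_vectors M v"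
    "\<And>i. i \<in> {1..M} \<Longrightarrow> 0 \<le> s i" "\<And>i j. i \<in> {1..M} \<Longrightarrow> j \<in> {1..M} \<Longrightarrow> i \<le> j \<Longrightarrow> s j \<le> s i"
    "\<And>a c. a \<in> {1..M} \<Longrightarrow> c \<in> {1..M} \<Longrightarrow> P a c = (\<Sum>i=1..M. s i * w i a * v i c)"
    "bij_betw e (UNIV :: 'k set) {1..CARD('k)}" "\<And>b x. b \<in> {1..M} \<Longrightarrow> U b $ x = v (e x) b"
proof -
  from assms obtain s w v and e :: "'k \<Rightarrow> nat" where M: "CARD('k) \<le> M" and *: "orthonormal_vectors M w \<and> orthonormal_vectors M v \<and>
        (\<forall>i\<in>{1..M}. 0 \<le> s i) \<and> (\<forall>i\<in>{1..M}. \<forall>j\<in>{1..M}. i \<le> j \<longrightarrow> s j \<le> s i) \<and>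
        (\<forall>a\<in>{1..M}. \<forall>c\<in>{1..M}. P a c = (\<Sum>i=1..M. s i * w i a * v i c)) \<and>
        bij_betw e (UNIV :: 'k set) {1..CARD('k)} \<and>
        (\<forall>b\<in>{1..M}. \<forall>x. U b $ x = v (e x) b)"
    unfolding top_right_singular_vectors_def
    by (elim conjE exE) (rule that, assumption, intro conjI, (assumption, assumption, assumption, assumption, assumption, assumption, assumption))
  show thesis
    by (rule that[where s = s and w = w and v = v and e = e]) (insert M *, (elim conjE, blast)+)
qed

lemma tr_mult_orthonormal:
  assumes "top_right_singular_vectors M P (U :: nat \<Rightarrow> real^'k)"
  shows "tr_mult M U U = mat 1"
proof -
  obtain v :: "nat \<Rightarrow> nat \<Rightarrow> real" and e where v: "orthonormal_vectors M v"
    and e: "bij_betw e (UNIV :: 'k set) {1..CARD('k)}" and U: "\<And>b x. b \<in> {1..M} \<Longrightarrow> U b $ x = v (e x) b"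
    and M: "CARD('k) \<le> M"
    using assms by (rule top_right_singular_vectorsE) (rule that)
  have "e x \<in> {1..M}" for x using bij_betwE[OF e] M by fastforce
  moreover have "e x = e x' \<longleftrightarrow> x = x'" for x x' using bij_betw_imp_inj_on[OF e] by (auto simp: inj_on_def)
  ultimately show ?thesis
    using v by (simp add: vec_eq_iff tr_mult_def mat_def U orthonormal_vectors_def)
qed

text \<open>Weyl's inequality bounds the singular values of the noisy matrix beyond the first \<open>K\<close> by the
  noise, because the noiseless matrix has rank at most \<open>K\<close>; so vectors orthogonal to the top
  singular vectors are almost annihilated.\<close>

lemma top_singular_vectors_residual:
  fixes U X :: "nat \<Rightarrow> real^'k" and B :: "real^'k^'k"
  assumes svd: "top_right_singular_vectors M Ph U"
    and close: "L2_set (\<lambda>(a, c). Ph a c - X a \<bullet> (B *v X c)) ({1..M} \<times> {1..M}) \<le> e"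
    and c0: "0 < c0" and low: "\<And>v. c0 * norm v \<le> L2_set (\<lambda>a. X a \<bullet> v) {1..M}"
    and b0: "0 < b0" and B: "\<And>v. b0 * norm v \<le> norm (B *v v)"
  shows "L2_set (\<lambda>a. X a \<bullet> v - U a \<bullet> (tr_mult M U X *v v)) {1..M} \<le> 2 * e / (c0 * b0) * norm v"
proof -
  let ?I = "{1..M}"
  obtain s w vv and en :: "'k \<Rightarrow> nat" where M: "CARD('k) \<le> M" and w: "orthonormal_vectors M w" and vo: "orthonormal_vectors M vv"
    and s0: "\<And>i. i \<in> ?I \<Longrightarrow> 0 \<le> s i" and dec: "\<And>i j. i \<in> ?I \<Longrightarrow> j \<in> ?I \<Longrightarrow> i \<le> j \<Longrightarrow> s j \<le> s i"
    and Ph: "\<And>a c. a \<in> ?I \<Longrightarrow> c \<in> ?I \<Longrightarrow> Ph a c = (\<Sum>i=1..M. s i * w i a * vv i c)"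
    and en: "bij_betw en (UNIV :: 'k set) {1..CARD('k)}" and U: "\<And>b x. b \<in> {1..M} \<Longrightarrow> U b $ x = vv (en x) b"
    using svd by (rule top_right_singular_vectorsE) (rule that)
  have e0: "0 \<le> e" using close L2_set_nonneg order_trans by blast
  define ip where "ip z i = (\<Sum>c=1..M. vv i c * z c)" for z :: "nat \<Rightarrow> real" and i
  define Y where "Y z = (\<Sum>c=1..M. z c *\<^sub>R X c)" for z :: "nat \<Rightarrow> real"
  have Phz: "(\<Sum>a=1..M. (\<Sum>c=1..M. Ph a c * z c)\<^sup>2) = (\<Sum>i=1..M. (s i * ip z i)\<^sup>2)" for z
  proof -
    have "(\<Sum>c=1..M. Ph a c * z c) = (\<Sum>i=1..M. (s i * ip z i) * w i a)" if "a \<in> ?I" for a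
    proof -
      have "(\<Sum>c=1..M. Ph a c * z c) = (\<Sum>c=1..M. \<Sum>i=1..M. s i * w i a * vv i c * z c)"
        using that by (simp add: Ph sum_distrib_right)
      also have "\<dots> = (\<Sum>i=1..M. (s i * ip z i) * w i a)"
        by (subst sum.swap) (simp add: ip_def sum_distrib_left sum_distrib_right mult_ac)
      finally show ?thesis .
    qed
    then have "(\<Sum>a=1..M. (\<Sum>c=1..M. Ph a c * z c)\<^sup>2) = (\<Sum>a=1..M. (\<Sum>i=1..M. (s i * ip z i) * w i a)\<^sup>2)"
      by (intro sum.cong refl) simp
    then show ?thesis by (simp only: orthonormal_combination(1)[OF w order_refl])
  qed
  have PXz: "(\<Sum>c=1..M. X a \<bullet> (B *v X c) * z c) = X a \<bullet> (B *v Y z)" for a z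
    unfolding Y_def by (simp add: linear_sum[OF matrix_vector_mul_linear] inner_sum_right matrix_vector_mult_scaleR mult.commute)
  have Ez: "L2_set (\<lambda>a. (\<Sum>c=1..M. Ph a c * z c) - X a \<bullet> (B *v Y z)) ?I \<le> e * L2_set z ?I" for z
  proof -
    have "(\<Sum>c=1..M. Ph a c * z c) - X a \<bullet> (B *v Y z) = (\<Sum>c=1..M. (Ph a c - X a \<bullet> (B *v X c)) * z c)" for a
      by (simp add: left_diff_distrib sum_subtractf PXz)
    then have "L2_set (\<lambda>a. (\<Sum>c=1..M. Ph a c * z c) - X a \<bullet> (B *v Y z)) ?I
      \<le> L2_set (\<lambda>(a, c). Ph a c - X a \<bullet> (B *v X c)) (?I \<times> ?I) * L2_set z ?I"
      using L2_set_matrix_apply[of ?I "\<lambda>a c. Ph a c - X a \<bullet> (B *v X c)" z ?I] by simp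
    then show ?thesis using close by (meson L2_set_nonneg mult_right_mono order_trans)
  qed
  \<comment> \<open>Some unit combination \<open>z\<close> of the first K + 1 right singular vectors
    is killed by the noiseless matrix, which factors through a K-dimensional space. Hence
    \<open>s (CARD('k) + 1)\<close> <= |Ph z| <= e.\<close>
  have weyl: "s i \<le> e" if i: "i \<in> ?I" "CARD('k) < i" for i
  proof -
    let ?J = "{1..CARD('k) + 1}"
    have J: "?J \<subseteq> ?I" and KI: "CARD('k) + 1 \<in> ?I" using i by auto
    obtain \<alpha> where \<alpha>: "(\<Sum>i\<in>?J. (\<alpha> i)\<^sup>2) = (1::real)" "(\<Sum>i\<in>?J. \<alpha> i *\<^sub>R (\<Sum>c=1..M. vv i c *\<^sub>R X c)) = 0"
      using normalized_linear_relation[of "\<lambda>i. \<Sum>c=1..M. vv i c *\<^sub>R X c"] by blast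
    define z where "z c = (\<Sum>i\<in>?J. \<alpha> i * vv i c)" for c
    have "Y z = (\<Sum>i\<in>?J. \<alpha> i *\<^sub>R (\<Sum>c=1..M. vv i c *\<^sub>R X c))"
      unfolding Y_def z_def by (subst scaleR_sum_left, subst sum.swap) (simp add: scaleR_sum_right)
    then have Yz: "Y z = 0" using \<alpha>(2) by simp
    have nz: "L2_set z ?I = 1"
      unfolding L2_set_def z_def orthonormal_combination(1)[OF vo J] \<alpha>(1) by simp
    have ipz: "ip z j = (if j \<in> ?J then \<alpha> j else 0)" if "j \<in> ?I" for j
      unfolding ip_def z_def by (rule orthonormal_combination(2)[OF vo J that])
    have "(s (CARD('k) + 1))\<^sup>2 = (\<Sum>j\<in>?J. (s (CARD('k) + 1))\<^sup>2 * (\<alpha> j)\<^sup>2)"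
      by (simp only: \<alpha>(1) mult_1_right flip: sum_distrib_left)
    also have "\<dots> \<le> (\<Sum>j\<in>?J. (s j * ip z j)\<^sup>2)"
    proof (rule sum_mono)
      fix j assume j: "j \<in> ?J"
      then have "s (CARD('k) + 1) \<le> s j" using dec[of j "CARD('k) + 1"] J KI by auto
      then have "(s (CARD('k) + 1))\<^sup>2 \<le> (s j)\<^sup>2" using s0[OF KI] by (rule power_mono)
      moreover have "ip z j = \<alpha> j" using ipz[of j] j J by auto
      ultimately show "(s (CARD('k) + 1))\<^sup>2 * (\<alpha> j)\<^sup>2 \<le> (s j * ip z j)\<^sup>2"
        by (simp add: power_mult_distrib mult_right_mono)
    qed
    also have "\<dots> \<le> (\<Sum>j\<in>?I. (s j * ip z j)\<^sup>2)" using J by (intro sum_mono2) auto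
    also have "\<dots> = (L2_set (\<lambda>a. (\<Sum>c=1..M. Ph a c * z c) - X a \<bullet> (B *v Y z)) ?I)\<^sup>2"
      by (simp add: L2_set_sq Yz Phz)
    also have "\<dots> \<le> e\<^sup>2" using Ez[of z] nz by (intro power_mono) auto
    finally have "s (CARD('k) + 1) \<le> e" by (rule power2_le_imp_le) (rule e0)
    moreover have "s i \<le> s (CARD('k) + 1)" using dec[OF KI i(1)] i(2) by simp
    ultimately show ?thesis by simp
  qed
  \<comment> \<open>On vectors orthogonal to the columns of \<open>U\<close> the noisy matrix has
    norm at most \<open>e\<close> by \<open>weyl\<close>, hence the noiseless one at most 2 e. The
    lower bounds \<open>low\<close> and \<open>B\<close> pass this on to \<open>Y z\<close>, which
    is X^T z.\<close>
  have perp: "c0 * b0 * norm (Y z) \<le> 2 * e * L2_set z ?I" if z: "\<And>x. (\<Sum>a=1..M. U a $ x * z a) = 0" for z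
  proof -
    have ip0: "ip z i = 0" if "i \<in> {1..CARD('k)}" for i
    proof -
      have "i \<in> range en" unfolding bij_betw_imp_surj_on[OF en] by (rule that)
      then obtain x where x: "i = en x" by (rule rangeE)
      have "ip z i = (\<Sum>a=1..M. U a $ x * z a)" unfolding ip_def x by (intro sum.cong refl) (simp add: U)
      then show ?thesis using z[of x] by simp
    qed
    have "(\<Sum>i=1..M. (s i * ip z i)\<^sup>2) \<le> (\<Sum>i=1..M. e\<^sup>2 * (ip z i)\<^sup>2)"
    proof (rule sum_mono)
      fix i assume i: "i \<in> ?I"
      show "(s i * ip z i)\<^sup>2 \<le> e\<^sup>2 * (ip z i)\<^sup>2"
      proof (cases "i \<le> CARD('k)")
        case False
        then show ?thesis using weyl[OF i] s0[OF i] by (simp add: power_mult_distrib mult_right_mono power_mono)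
      qed (use i ip0 in simp)
    qed
    also have "\<dots> \<le> e\<^sup>2 * (\<Sum>c=1..M. (z c)\<^sup>2)"
      unfolding sum_distrib_left[symmetric] ip_def by (intro mult_left_mono bessel_inequality vo) simp
    also have "\<dots> = (e * L2_set z ?I)\<^sup>2" by (simp add: power_mult_distrib L2_set_sq)
    finally have "L2_set (\<lambda>a. \<Sum>c=1..M. Ph a c * z c) ?I \<le> e * L2_set z ?I"
      using e0 by (subst L2_set_le_iff) (simp_all add: Phz)
    moreover have "L2_set (\<lambda>a. X a \<bullet> (B *v Y z)) ?I \<le> L2_set (\<lambda>a. \<Sum>c=1..M. Ph a c * z c) ?I + e * L2_set z ?I"
      using L2_set_diff_triangle[of "\<lambda>a. \<Sum>c=1..M. Ph a c * z c" "\<lambda>a. (\<Sum>c=1..M. Ph a c * z c) - X a \<bullet> (B *v Y z)" ?I] Ez[of z] by simp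
    moreover have "c0 * (b0 * norm (Y z)) \<le> L2_set (\<lambda>a. X a \<bullet> (B *v Y z)) ?I"
      using low[of "B *v Y z"] mult_left_mono[OF B[of "Y z"], of c0] c0 by linarith
    ultimately show ?thesis by (simp add: mult.assoc)
  qed
  \<comment> \<open>The component of X v orthogonal to the columns of \<open>U\<close>. Hence |r|^2
    = <r, X v> = <Y r, v>, and \<open>perp\<close> bounds \<open>Y r\<close> by a multiple of |r|
    itself.\<close>
  define r where "r a = X a \<bullet> v - U a \<bullet> (tr_mult M U X *v v)" for a
  have UU: "(\<Sum>a=1..M. U a $ x * U a $ y) = (if x = y then 1 else 0)" for x y
    using arg_cong[OF tr_mult_orthonormal[OF svd], of "\<lambda>A. A $ x $ y"] by (simp add: tr_mult_def mat_def)
  have Av: "(tr_mult M U X *v v) $ x = (\<Sum>a=1..M. U a $ x * (X a \<bullet> v))" for x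
    by (simp add: tr_mult_def matrix_vector_mult_def inner_vec_def sum_distrib_left sum_distrib_right mult.assoc)
      (rule sum.swap)
  have r_perp: "(\<Sum>a=1..M. U a $ x * r a) = 0" for x
  proof -
    have "(\<Sum>a=1..M. U a $ x * (U a \<bullet> u)) = u $ x" for u :: "real^'k"
    proof -
      have "(\<Sum>a=1..M. U a $ x * (U a \<bullet> u)) = (\<Sum>y\<in>UNIV. (\<Sum>a=1..M. U a $ x * U a $ y) * u $ y)"
        by (simp add: inner_vec_def sum_distrib_left sum_distrib_right mult.assoc) (rule sum.swap)
      then show ?thesis unfolding UU by (simp add: if_distrib if_distribR cong: if_cong)
    qed
    then show ?thesis by (simp add: r_def right_diff_distrib sum_subtractf Av)
  qed
  have "(L2_set r ?I)\<^sup>2 = (\<Sum>a=1..M. r a * (X a \<bullet> v)) - (\<Sum>a=1..M. r a * (U a \<bullet> (tr_mult M U X *v v)))"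
    unfolding L2_set_sq by (simp add: power2_eq_square flip: sum_subtractf right_diff_distrib) (simp add: r_def)
  also have "(\<Sum>a=1..M. r a * (U a \<bullet> u)) = 0" for u :: "real^'k"
  proof -
    have "(\<Sum>a=1..M. r a * (U a \<bullet> u)) = (\<Sum>x\<in>UNIV. (\<Sum>a=1..M. U a $ x * r a) * u $ x)"
      by (simp add: inner_vec_def sum_distrib_left sum_distrib_right mult_ac) (rule sum.swap)
    then show ?thesis by (simp add: r_perp)
  qed
  also have "(\<Sum>a=1..M. r a * (X a \<bullet> v)) = Y r \<bullet> v" by (simp add: Y_def inner_sum_left)
  finally have r2: "(L2_set r ?I)\<^sup>2 \<le> norm (Y r) * norm v" using norm_cauchy_schwarz[of "Y r" v] by simp
  have "norm (Y r) \<le> 2 * e / (c0 * b0) * L2_set r ?I"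
    using perp[OF r_perp] c0 b0 by (simp add: field_simps)
  then have "(L2_set r ?I)\<^sup>2 \<le> (2 * e / (c0 * b0) * L2_set r ?I) * norm v"
    using r2 mult_right_mono[OF _ norm_ge_zero[of v]] order_trans by blast
  then have "L2_set r ?I * L2_set r ?I \<le> L2_set r ?I * (2 * e / (c0 * b0) * norm v)"
    by (simp add: power2_eq_square mult_ac)
  then have "L2_set r ?I \<le> 2 * e / (c0 * b0) * norm v"
  proof (cases "L2_set r ?I = 0")
    case True
    then show ?thesis using e0 c0 b0 by simp
  next
    case False
    then have "0 < L2_set r ?I" using L2_set_nonneg[of r ?I] by linarith
    with \<open>L2_set r ?I * L2_set r ?I \<le> _\<close> show ?thesis using mult_le_cancel_left_pos by blast
  qed
  then show ?thesis unfolding r_def .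
qed

text \<open>Brouwer's theorem on the simplex. The projected estimate of \<open>Q\<close> may be
  reducible, so to show that the algorithm has an output, existence is required for every transition
  matrix.\<close>

lemma stationary_distribution_exists:
  fixes Q :: "real^'k^'k"
  assumes "transition_matrix Q" shows "\<exists>\<pi>. stationary_distribution Q \<pi>"
proof -
  let ?S = "{v::real^'k. (\<forall>x. 0 \<le> v $ x) \<and> (\<Sum>x\<in>UNIV. v $ x) = 1}"
  have "closed ?S"
    by (intro closed_Collect_conj closed_Collect_all closed_Collect_le closed_Collect_eq continuous_intros)
  moreover have "norm v \<le> real CARD('k)" if "v \<in> ?S" for v
  proof -
    have "v $ x \<le> (\<Sum>x\<in>UNIV. v $ x)" for x using that by (intro member_le_sum) auto
    then have "\<bar>v $ x\<bar> \<le> 1" for x using that by simp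
    from norm_vec_le_entries[OF this] show ?thesis by simp
  qed
  then have "bounded ?S" by (rule boundedI)
  ultimately have "compact ?S" by (simp add: compact_eq_bounded_closed)
  moreover have "convex ?S"
  proof (rule convexI)
    fix v w :: "real^'k" and a b :: real
    assume *: "v \<in> ?S" "w \<in> ?S" "0 \<le> a" "0 \<le> b" "a + b = 1"
    then have "(\<Sum>x\<in>UNIV. a * v $ x + b * w $ x) = 1" by (simp add: sum.distrib flip: sum_distrib_left)
    with * show "a *\<^sub>R v + b *\<^sub>R w \<in> ?S" by simp
  qed
  moreover have "(\<chi> x. 1 / real CARD('k)) \<in> ?S" by simp
  then have "?S \<noteq> {}" by blast
  moreover have "continuous_on ?S (\<lambda>v. v v* Q)"
    unfolding transpose_matrix_vector[symmetric]
    by (intro linear_continuous_on matrix_vector_mul_bounded_linear)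
  moreover have "(\<lambda>v. v v* Q) \<in> ?S \<rightarrow> ?S"
  proof
    fix v assume v: "v \<in> ?S"
    have "(\<Sum>y\<in>UNIV. \<Sum>x\<in>UNIV. v $ x * Q $ x $ y) = (\<Sum>x\<in>UNIV. v $ x * (\<Sum>y\<in>UNIV. Q $ x $ y))"
      by (subst sum.swap) (simp add: sum_distrib_left)
    then show "v v* Q \<in> ?S"
      using v assms by (simp add: vector_matrix_mult_def transition_matrix_def sum_nonneg)
  qed
  ultimately obtain v where "v \<in> ?S" "v v* Q = v" by (rule brouwer)
  then show ?thesis unfolding stationary_distribution_def by blast
qed

section \<open>Compression by a matrix with orthonormal columns\<close>

lemma L2_set_prod: "finite I \<Longrightarrow> L2_set (\<lambda>(a, c). f a * g c) (I \<times> J) = L2_set f I * L2_set g J"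
  by (simp add: L2_set_def power_mult_distrib real_sqrt_mult[symmetric] sum_product sum.cartesian_product split_def)

context
  fixes M :: nat and U :: "nat \<Rightarrow> real^'k"
  assumes UU: "tr_mult M U U = mat 1"
begin

lemma orthonormal_columns: "(\<Sum>a=1..M. U a $ x * U a $ y) = (if x = y then 1 else 0)"
  using arg_cong[OF UU, of "\<lambda>A. A $ x $ y"] by (simp add: tr_mult_def mat_def)

lemma L2_set_column [simp]: "L2_set (\<lambda>a. U a $ x) {1..M} = 1"
  using orthonormal_columns[of x x] by (simp add: L2_set_def power2_eq_square)

lemma sum_U_inner: "(\<Sum>a=1..M. U a $ x * (U a \<bullet> u)) = u $ x"
proof -
  have "(\<Sum>a=1..M. U a $ x * (U a \<bullet> u)) = (\<Sum>y\<in>UNIV. (\<Sum>a=1..M. U a $ x * U a $ y) * u $ y)"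
    by (simp add: inner_vec_def sum_distrib_left sum_distrib_right mult.assoc) (rule sum.swap)
  then show ?thesis unfolding orthonormal_columns by (simp add: if_distrib if_distribR cong: if_cong)
qed

lemma L2_set_U_inner: "L2_set (\<lambda>a. U a \<bullet> u) {1..M} = norm u"
proof -
  have "(L2_set (\<lambda>a. U a \<bullet> u) {1..M})\<^sup>2 = (\<Sum>a=1..M. \<Sum>x\<in>UNIV. u $ x * (U a $ x * (U a \<bullet> u)))"
    unfolding L2_set_sq by (simp add: power2_eq_square inner_vec_def[of _ u] sum_distrib_right mult_ac)
  also have "\<dots> = (\<Sum>x\<in>UNIV. u $ x * (\<Sum>a=1..M. U a $ x * (U a \<bullet> u)))"
    by (subst sum.swap) (simp add: sum_distrib_left)
  also have "\<dots> = (norm u)\<^sup>2" unfolding norm_vec_sq by (simp add: sum_U_inner power2_eq_square)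
  finally show ?thesis by simp
qed

lemma tr_mult_apply: "(tr_mult M U X *v v) $ x = (\<Sum>a=1..M. U a $ x * (X a \<bullet> v))"
  by (simp add: tr_mult_def matrix_vector_mult_def inner_vec_def sum_distrib_left sum_distrib_right mult.assoc)
    (rule sum.swap)

lemma norm_tr_mult_apply: "norm (tr_mult M U X *v v) \<le> L2_set (\<lambda>a. X a \<bullet> v) {1..M}"
proof -
  let ?w = "tr_mult M U X *v v"
  have "(norm ?w)\<^sup>2 = (\<Sum>x\<in>UNIV. ?w $ x * (\<Sum>a=1..M. U a $ x * (X a \<bullet> v)))"
    unfolding norm_vec_sq by (simp add: power2_eq_square tr_mult_apply)
  also have "\<dots> = (\<Sum>a=1..M. (U a \<bullet> ?w) * (X a \<bullet> v))"
    by (simp add: inner_vec_def[of _ ?w] sum_distrib_left sum_distrib_right mult_ac) (rule sum.swap)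
  also have "\<dots> \<le> L2_set (\<lambda>a. U a \<bullet> ?w) {1..M} * L2_set (\<lambda>a. X a \<bullet> v) {1..M}"
    using sum_mult_le_L2_set[of "\<lambda>a. U a \<bullet> ?w" "\<lambda>a. X a \<bullet> v" "{1..M}"] by linarith
  finally have "norm ?w * norm ?w \<le> norm ?w * L2_set (\<lambda>a. X a \<bullet> v) {1..M}"
    by (simp add: L2_set_U_inner power2_eq_square)
  then show ?thesis
    by (cases "norm ?w = 0") (auto simp: L2_set_nonneg)
qed

lemma tr_mult_self: "tr_mult M U (\<lambda>m. U m v* X) = X"
proof -
  have "(U m v* X) $ y = U m \<bullet> column y X" for m y
    by (simp add: vector_matrix_mult_def inner_vec_def column_def mult.commute)
  then show ?thesis by (simp add: vec_eq_iff tr_mult_def sum_U_inner column_def)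
qed

lemma tr_mult_transpose: "tr_mult M (\<lambda>m. U m v* X) U = transpose X"
proof -
  have "tr_mult M (\<lambda>m. U m v* X) U = transpose (tr_mult M U (\<lambda>m. U m v* X))"
    by (simp add: tr_mult_def transpose_def vec_eq_iff mult.commute)
  then show ?thesis by (simp add: tr_mult_self)
qed

lemma norm_compress_le: "norm (compress M U E) \<le> real CARD('k) * L2_set (\<lambda>(a, c). E a c) ({1..M} \<times> {1..M})"
proof (rule norm_matrix_le_entries)
  fix x y
  have "compress M U E $ x $ y = (\<Sum>i\<in>{1..M}\<times>{1..M}. (\<lambda>(a, c). U a $ x * U c $ y) i * (\<lambda>(a, c). E a c) i)"
    by (simp add: compress_def sum.cartesian_product split_def mult_ac)
  then show "\<bar>compress M U E $ x $ y\<bar> \<le> L2_set (\<lambda>(a, c). E a c) ({1..M} \<times> {1..M})"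
    using sum_mult_le_L2_set[of "\<lambda>(a, c). U a $ x * U c $ y" "\<lambda>(a, c). E a c" "{1..M}\<times>{1..M}"]
    by (simp add: L2_set_prod)
qed

text \<open>Each entry is the inner product of \<open>E\<close> with a tensor product of three unit
  vectors, namely \<open>w\<close> and two columns of \<open>U\<close>. This is why the constant is
  free of M.\<close>

lemma norm_compress_sum_le:
  assumes "L2_set w {1..M} = 1"
  shows "norm (\<Sum>b=1..M. w b *\<^sub>R compress M U (\<lambda>a c. E a b c))
    \<le> real CARD('k) * L2_set (\<lambda>(a, b, c). E a b c) ({1..M} \<times> {1..M} \<times> {1..M})"
proof (rule norm_matrix_le_entries)
  fix x y
  have "(\<Sum>b=1..M. w b *\<^sub>R compress M U (\<lambda>a c. E a b c)) $ x $ y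
    = (\<Sum>b=1..M. \<Sum>a=1..M. \<Sum>c=1..M. U a $ x * (w b * U c $ y) * E a b c)"
    by (simp add: compress_def sum_distrib_left mult_ac)
  also have "\<dots> = (\<Sum>i\<in>{1..M}\<times>{1..M}\<times>{1..M}. (\<lambda>(a, b, c). U a $ x * (w b * U c $ y)) i * (\<lambda>(a, b, c). E a b c) i)"
    by (subst sum.swap) (simp add: sum.cartesian_product split_def)
  finally have 1: "\<bar>(\<Sum>b=1..M. w b *\<^sub>R compress M U (\<lambda>a c. E a b c)) $ x $ y\<bar>
     \<le> L2_set (\<lambda>(a, b, c). U a $ x * (w b * U c $ y)) ({1..M}\<times>{1..M}\<times>{1..M}) * L2_set (\<lambda>(a, b, c). E a b c) ({1..M}\<times>{1..M}\<times>{1..M})"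
    using sum_mult_le_L2_set[of "\<lambda>(a, b, c). U a $ x * (w b * U c $ y)" "\<lambda>(a, b, c). E a b c" "{1..M}\<times>{1..M}\<times>{1..M}"] by simp
  have "L2_set (\<lambda>(a, b, c). U a $ x * (w b * U c $ y)) ({1..M}\<times>{1..M}\<times>{1..M}) = 1"
  proof -
    have "(\<lambda>(a, b, c). U a $ x * (w b * U c $ y)) = (\<lambda>(a, q). U a $ x * (\<lambda>(b, c). w b * U c $ y) q)" by auto
    then show ?thesis by (simp only: L2_set_prod finite_atLeastAtMost assms L2_set_column mult_1)
  qed
  with 1 show "\<bar>(\<Sum>b=1..M. w b *\<^sub>R compress M U (\<lambda>a c. E a b c)) $ x $ y\<bar>
     \<le> L2_set (\<lambda>(a, b, c). E a b c) ({1..M}\<times>{1..M}\<times>{1..M})" by simp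
qed

lemma norm_tr_mult_vec_le: "norm (tr_mult_vec M U l) \<le> real CARD('k) * L2_set l {1..M}"
proof (rule norm_vec_le_entries)
  fix x show "\<bar>tr_mult_vec M U l $ x\<bar> \<le> L2_set l {1..M}"
    using sum_mult_le_L2_set[of "\<lambda>a. U a $ x" l "{1..M}"] by (simp add: tr_mult_vec_def)
qed

lemma compress_diff: "compress M U (\<lambda>a c. E a c - F a c) = compress M U E - compress M U F"
  by (simp add: compress_def vec_eq_iff sum_subtractf algebra_simps)

lemma tr_mult_vec_diff: "tr_mult_vec M U (\<lambda>a. l a - l' a) = tr_mult_vec M U l - tr_mult_vec M U l'"
  by (simp add: tr_mult_vec_def vec_eq_iff sum_subtractf algebra_simps)

lemma tr_mult_vec_inner: "tr_mult_vec M U (\<lambda>a. X a \<bullet> v) = tr_mult M U X *v v"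
  by (simp add: vec_eq_iff tr_mult_vec_def tr_mult_apply)

text \<open>After compression the population moments depend on \<open>X\<close> only through the K x
  K matrix \<open>tr_mult M U X\<close>; here M disappears from the problem.\<close>

lemma compress_sandwich: "compress M U (\<lambda>a c. X a \<bullet> (B *v X c)) = tr_mult M U X ** B ** transpose (tr_mult M U X)"
proof -
  have "compress M U (\<lambda>a c. X a \<bullet> (B *v X c)) $ x $ y = (tr_mult M U X ** B ** transpose (tr_mult M U X)) $ x $ y" for x y
  proof -
    have "B *v column y (transpose (tr_mult M U X)) = (\<Sum>c=1..M. U c $ y *\<^sub>R (B *v X c))"
    proof -
      have "column y (transpose (tr_mult M U X)) = (\<Sum>c=1..M. U c $ y *\<^sub>R X c)"
        by (simp add: vec_eq_iff column_def transpose_def tr_mult_def)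
      then show ?thesis by (simp add: linear_sum[OF matrix_vector_mul_linear] matrix_vector_mult_scaleR)
    qed
    note B = this
    have "(tr_mult M U X ** B ** transpose (tr_mult M U X)) $ x $ y
      = (tr_mult M U X *v (B *v column y (transpose (tr_mult M U X)))) $ x"
      by (simp add: matrix_vector_mul_assoc) (simp add: matrix_matrix_mult_def matrix_vector_mult_def column_def row_def transpose_def)
    also have "\<dots> = (\<Sum>a=1..M. \<Sum>c=1..M. U a $ x * (X a \<bullet> (B *v X c)) * U c $ y)"
      unfolding B tr_mult_apply by (simp add: inner_sum_right sum_distrib_left mult_ac)
    finally show ?thesis by (simp add: compress_def)
  qed
  then show ?thesis by (simp add: vec_eq_iff)
qed

lemma L2_set_U_vector_mult:
  assumes "orthogonal_matrix \<Theta>" shows "L2_set (\<lambda>b. (U b v* \<Theta>) $ x) {1..M} = 1"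
proof -
  have "(U b v* \<Theta>) $ x = U b \<bullet> (\<Theta> *v axis x 1)" for b
    by (simp add: matrix_vector_mult_basis vector_matrix_mult_def inner_vec_def column_def mult.commute)
  then show ?thesis using norm_orthogonal_mult[OF assms] by (simp add: L2_set_U_inner)
qed

lemma sum_U_vector_mult: "(\<Sum>b=1..M. (U b v* \<Theta>) $ x * X b $ k) = (transpose \<Theta> ** tr_mult M U X) $ x $ k"
  by (simp add: vector_matrix_mult_def matrix_matrix_mult_def transpose_def tr_mult_def sum_distrib_left sum_distrib_right mult_ac)
    (rule sum.swap)

end

lemma sum_scaleR_diag_sandwich:
  fixes X Y :: "real^'k^'k"
  shows "(\<Sum>b\<in>I. c b *\<^sub>R (X ** diag_mat (v b) ** Y)) = X ** diag_mat (\<Sum>b\<in>I. c b *\<^sub>R v b) ** Y"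
proof -
  have e: "(X ** diag_mat w ** Y) $ i $ j = (\<Sum>k\<in>UNIV. X $ i $ k * w $ k * Y $ k $ j)" for w i j
    by (simp add: matrix_matrix_mult_def[of "X ** diag_mat w"] diag_mat_mult_right)
  show ?thesis
    unfolding vec_eq_iff
  proof (intro allI)
    fix i j
    have "(\<Sum>b\<in>I. c b *\<^sub>R (X ** diag_mat (v b) ** Y)) $ i $ j = (\<Sum>b\<in>I. \<Sum>k\<in>UNIV. X $ i $ k * (c b * v b $ k) * Y $ k $ j)"
      by (simp add: e sum_distrib_left mult_ac)
    also have "\<dots> = (X ** diag_mat (\<Sum>b\<in>I. c b *\<^sub>R v b) ** Y) $ i $ j"
      by (subst sum.swap) (simp add: e sum_distrib_left sum_distrib_right)
    finally show "(\<Sum>b\<in>I. c b *\<^sub>R (X ** diag_mat (v b) ** Y)) $ i $ j = (X ** diag_mat (\<Sum>b\<in>I. c b *\<^sub>R v b) ** Y) $ i $ j" .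
  qed
qed

lemma matrix_mult_scaleR_right: "(A::real^'k^'k) ** (c *\<^sub>R (B::real^'k^'k)) = c *\<^sub>R (A ** B)"
  by (simp add: vec_eq_iff matrix_matrix_mult_def sum_distrib_left mult_ac)

lemma matrix_mult_sum_right: "(A::real^'k^'k) ** (\<Sum>b\<in>I. c b *\<^sub>R F b) = (\<Sum>b\<in>I. c b *\<^sub>R (A ** (F b :: real^'k^'k)))"
  by (induction I rule: infinite_finite_induct) (simp_all add: matrix_add_ldistrib matrix_mult_scaleR_right)

subsection \<open>The error of the algorithm\<close>

text \<open>This and the next two definitions are the expectations of \<open>P_hat\<close>,
  \<open>N_hat\<close> and \<open>M_hat\<close> for the stationary chain when \<open>X a $ x\<close>
  is the mean of feature \<open>a\<close> in state \<open>x\<close>: each transition contributes a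
  factor \<open>Q\<close>, and an observation in between a diagonal matrix.\<close>

definition population_P :: "real^'k \<Rightarrow> real^'k^'k \<Rightarrow> (nat \<Rightarrow> real^'k) \<Rightarrow> nat \<Rightarrow> nat \<Rightarrow> real" where
  "population_P \<pi> Q X a c = X a \<bullet> ((diag_mat \<pi> ** Q ** Q) *v X c)"

definition population_N :: "real^'k \<Rightarrow> real^'k^'k \<Rightarrow> (nat \<Rightarrow> real^'k) \<Rightarrow> nat \<Rightarrow> nat \<Rightarrow> real" where
  "population_N \<pi> Q X a b = X a \<bullet> ((diag_mat \<pi> ** Q) *v X b)"

definition population_M :: "real^'k \<Rightarrow> real^'k^'k \<Rightarrow> (nat \<Rightarrow> real^'k) \<Rightarrow> nat \<Rightarrow> nat \<Rightarrow> nat \<Rightarrow> real" where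
  "population_M \<pi> Q X a b c = X a \<bullet> ((diag_mat \<pi> ** Q ** diag_mat (X b) ** Q) *v X c)"

lemma invertible_bounded_below:
  fixes B :: "real^'k^'k"
  assumes "invertible B"
  obtains b where "0 < b" "\<And>v. b * norm v \<le> norm (B *v v)"
proof (rule that[of "1 / (norm (matrix_inv B) + 1)"])
  have n: "0 < norm (matrix_inv B) + 1" by (simp add: add_nonneg_pos)
  then show "0 < 1 / (norm (matrix_inv B) + 1)" by simp
  fix v
  have "norm v = norm (matrix_inv B *v (B *v v))"
    by (simp add: matrix_vector_mul_assoc matrix_inv_mult assms)
  also have "\<dots> \<le> norm (matrix_inv B) * norm (B *v v)" by (rule norm_matrix_vector_mult_le)
  also have "\<dots> \<le> (norm (matrix_inv B) + 1) * norm (B *v v)" by (simp add: distrib_right)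
  finally show "1 / (norm (matrix_inv B) + 1) * norm v \<le> norm (B *v v)"
    using n by (simp add: field_simps)
qed

text \<open>\<open>X\<close> is the matrix O of the coordinates of the emission densities. Its
  compression A = U^T O keeps half of the lower bound \<open>c0\<close>, because the part of O
  outside the span of \<open>U\<close> is small; the compressed algorithm then applies to A.
  Existence of an output is claimed along with the bound, since estimators are arbitrary where the
  algorithm cannot be carried out.\<close>

lemma spectral_algorithm_error:
  fixes Q :: "real^'k^'k" and \<pi> :: "real^'k" and x1 :: 'k
  assumes Q: "transition_matrix Q" "invertible Q" and q: "0 < q" and \<pi>: "\<And>x. q \<le> \<pi> $ x" "\<And>x. \<pi> $ x \<le> 1"
    and c0: "0 < c0" and C0: "0 < C0"
  obtains C e0 where "0 < C" "0 < e0"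
    "\<And>M (\<phi> :: nat \<Rightarrow> real^'d \<Rightarrow> real) p y (U :: nat \<Rightarrow> real^'k) \<Theta> X t e.
      top_right_singular_vectors M (P_hat \<phi> p y) U \<Longrightarrow> orthogonal_matrix \<Theta> \<Longrightarrow>
      (\<And>v. c0 * norm v \<le> L2_set (\<lambda>a. X a \<bullet> v) {1..M}) \<Longrightarrow>
      (\<And>v. L2_set (\<lambda>a. X a \<bullet> v) {1..M} \<le> C0 * norm v) \<Longrightarrow>
      0 < t \<Longrightarrow> t \<le> 1 \<Longrightarrow>
      (\<And>i j. i \<noteq> j \<Longrightarrow> t * norm (tr_mult M U X *v (axis i 1 - axis j 1)) \<le>
         \<bar>column x1 \<Theta> \<bullet> (tr_mult M U X *v (axis i 1 - axis j 1))\<bar>) \<Longrightarrow>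
      L2_set (\<lambda>a. L_hat \<phi> p y a - X a \<bullet> \<pi>) {1..M} \<le> e \<Longrightarrow>
      L2_set (\<lambda>(a, b). N_hat \<phi> p y a b - population_N \<pi> Q X a b) ({1..M} \<times> {1..M}) \<le> e \<Longrightarrow>
      L2_set (\<lambda>(a, c). P_hat \<phi> p y a c - population_P \<pi> Q X a c) ({1..M} \<times> {1..M}) \<le> e \<Longrightarrow>
      L2_set (\<lambda>(a, b, c). M_hat \<phi> p y a b c - population_M \<pi> Q X a b c) ({1..M} \<times> {1..M} \<times> {1..M}) \<le> e \<Longrightarrow>
      e \<le> e0 * t \<Longrightarrow>
      (\<exists>f' \<pi>' Q'. spectral_output \<phi> M p x1 y U \<Theta> f' \<pi>' Q') \<and>
      (\<forall>f' \<pi>' Q'. spectral_output \<phi> M p x1 y U \<Theta> f' \<pi>' Q' \<longrightarrow>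
         transition_matrix Q' \<and> stationary_distribution Q' \<pi>' \<and>
         (\<exists>\<tau>. \<tau> permutes UNIV \<and>
           (\<forall>x. \<exists>w. f' (\<tau> x) = (\<lambda>z. \<Sum>m=1..M. w m * \<phi> m z) \<and> L2_set (\<lambda>m. X m $ x - w m) {1..M} \<le> C * e / t) \<and>
           norm (perm_mat \<tau> ** Q' ** transpose (perm_mat \<tau>) - Q) \<le> C * e / t))"
proof -
  define K where "K = real CARD('k)"
  have K: "1 \<le> K" unfolding K_def by (simp add: Suc_leI One_nat_def)
  have a0: "0 < c0 / 2" using c0 by simp
  have a1: "0 < K * C0" using C0 K by simp
  define B where "B = diag_mat \<pi> ** Q ** Q"
  have "invertible B" unfolding B_def by (intro invertible_mult Q diag_mat_inverse(1)[OF q \<pi>(1)])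
  then obtain b0 where b0: "0 < b0" "\<And>v. b0 * norm v \<le> norm (B *v v)" by (rule invertible_bounded_below) blast
  define r where "r = 2 / (c0 * b0)"
  have r: "0 < r" using c0 b0 by (simp add: r_def)
  obtain C' e' where C': "0 < C'" and e': "0 < e'" and
    core: "\<And>A \<Theta> P T N L g e.
      (\<And>v. (c0 / 2) * norm v \<le> norm (A *v v)) \<Longrightarrow> norm A \<le> K * C0 \<Longrightarrow> orthogonal_matrix \<Theta> \<Longrightarrow>
      0 < g \<Longrightarrow> g \<le> 1 \<Longrightarrow>
      (\<And>i j. i \<noteq> j \<Longrightarrow> g \<le> \<bar>(transpose \<Theta> ** A) $ x1 $ i - (transpose \<Theta> ** A) $ x1 $ j\<bar>) \<Longrightarrow>
      norm (P - A ** diag_mat \<pi> ** Q ** Q ** transpose A) \<le> e \<Longrightarrow>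
      (\<And>x. norm (T x - A ** diag_mat \<pi> ** Q ** diag_mat ((transpose \<Theta> ** A) $ x) ** Q ** transpose A) \<le> e) \<Longrightarrow>
      norm (N - A ** diag_mat \<pi> ** Q ** transpose A) \<le> e \<Longrightarrow> norm (L - A *v \<pi>) \<le> e \<Longrightarrow>
      e \<le> e' * g \<Longrightarrow>
      invertible P \<and>
      (\<exists>R :: real^'k^'k. invertible R \<and> (\<forall>x. norm (column x R) = 1) \<and>
        (\<forall>i j. i \<noteq> j \<longrightarrow> (matrix_inv R ** (matrix_inv P ** T x1) ** R) $ i $ j = 0)) \<and>
      (\<forall>R :: real^'k^'k. invertible R \<and> (\<forall>i j. i \<noteq> j \<longrightarrow> (matrix_inv R ** (matrix_inv P ** T x1) ** R) $ i $ j = 0) \<longrightarrow>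
        (let Ah = \<Theta> ** (\<chi> x j. (matrix_inv R ** (matrix_inv P ** T x) ** R) $ j $ j);
             \<pi>t = matrix_inv Ah *v L;
             Qh = closest_point {A. transition_matrix A}
               (matrix_inv (Ah ** diag_mat \<pi>t) ** N ** matrix_inv (transpose Ah))
         in invertible Ah \<and> invertible (Ah ** diag_mat \<pi>t) \<and>
           (\<exists>\<tau>. \<tau> permutes UNIV \<and> (\<forall>x. norm (column (\<tau> x) Ah - column x A) \<le> C' * e / g) \<and>
             norm (perm_mat \<tau> ** Qh ** transpose (perm_mat \<tau>) - Q) \<le> C' * e / g)))"
  proof (rule compressed_spectral_algorithm[where ?x1.0 = x1, OF Q q \<pi> a0 a1], goal_cases)
    case (1 C e0)
    show ?case by (rule 1(1)[OF 1(2,3)], rule 1(4)) blast+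
  qed
  \<comment> \<open>Since |A (e_i - e_j)| >= c0 / 2, the gap hypothesis separates the entries of row
    \<open>x1\<close> of \<Theta>^T A by t s. The minimum with 1 keeps this gap at most 1.\<close>
  define s where "s = min 1 (c0 / 2)"
  have s: "0 < s" "s \<le> 1" "s \<le> c0 / 2" using c0 by (auto simp: s_def)
  define e0 where "e0 = min (e' * s / K) (c0 / 2 / r)"
  \<comment> \<open>The first part is the error of the compressed algorithm, run with moment error K
    e and gap t s; the second is the residual of O outside the span of \<open>U\<close>.\<close>
  define C where "C = C' * K / s + r"
  show ?thesis
  proof (rule that[of C e0])
    show "0 < C" using C' K s r by (simp add: C_def add_pos_pos)
    show "0 < e0" using e' K s c0 r by (simp add: e0_def)
    fix M p and \<phi> :: "nat \<Rightarrow> real^'d \<Rightarrow> real" and y and U X :: "nat \<Rightarrow> real^'k" and \<Theta> :: "real^'k^'k" and t e :: real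
    assume svd: "top_right_singular_vectors M (P_hat \<phi> p y) U" and \<Theta>: "orthogonal_matrix \<Theta>"
      and low: "\<And>v. c0 * norm v \<le> L2_set (\<lambda>a. X a \<bullet> v) {1..M}"
      and up: "\<And>v. L2_set (\<lambda>a. X a \<bullet> v) {1..M} \<le> C0 * norm v"
      and t: "0 < t" "t \<le> 1"
      and gap: "\<And>i j. i \<noteq> j \<Longrightarrow> t * norm (tr_mult M U X *v (axis i 1 - axis j 1)) \<le>
         \<bar>column x1 \<Theta> \<bullet> (tr_mult M U X *v (axis i 1 - axis j 1))\<bar>"
      and L: "L2_set (\<lambda>a. L_hat \<phi> p y a - X a \<bullet> \<pi>) {1..M} \<le> e"
      and N: "L2_set (\<lambda>(a, b). N_hat \<phi> p y a b - population_N \<pi> Q X a b) ({1..M} \<times> {1..M}) \<le> e"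
      and P: "L2_set (\<lambda>(a, c). P_hat \<phi> p y a c - population_P \<pi> Q X a c) ({1..M} \<times> {1..M}) \<le> e"
      and Mh: "L2_set (\<lambda>(a, b, c). M_hat \<phi> p y a b c - population_M \<pi> Q X a b c) ({1..M} \<times> {1..M} \<times> {1..M}) \<le> e"
      and e: "e \<le> e0 * t"
    have en: "0 \<le> e" using L L2_set_nonneg order_trans by blast
    note UU = tr_mult_orthonormal[OF svd]
    define A where "A = tr_mult M U X"
    have e1: "e \<le> e' * s / K * t" "e \<le> c0 / 2 / r * t"
      using e t mult_right_mono[of e0 "e' * s / K" t] mult_right_mono[of e0 "c0 / 2 / r" t]
      by (auto simp: e0_def)
    have "c0 / 2 / r * t \<le> c0 / 2 / r" using t c0 r by (intro mult_left_le) auto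
    with e1 have re: "r * e \<le> c0 / 2" using r by (simp add: field_simps)
    have res: "L2_set (\<lambda>a. X a \<bullet> v - U a \<bullet> (A *v v)) {1..M} \<le> r * e * norm v" for v
      using top_singular_vectors_residual[OF svd P[unfolded population_P_def, folded B_def] c0 low b0]
      by (simp add: A_def r_def)
    have Alow: "c0 / 2 * norm v \<le> norm (A *v v)" for v
    proof -
      have "L2_set (\<lambda>a. X a \<bullet> v) {1..M} \<le> norm (A *v v) + r * e * norm v"
        using L2_set_triangle_ineq[of "\<lambda>a. U a \<bullet> (A *v v)" "\<lambda>a. X a \<bullet> v - U a \<bullet> (A *v v)" "{1..M}"] res[of v]
        by (simp add: L2_set_U_inner[OF UU])
      moreover have "r * e * norm v \<le> c0 / 2 * norm v" using re by (intro mult_right_mono) auto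
      ultimately show ?thesis using low[of v] by (simp add: field_simps)
    qed
    have nA: "norm A \<le> K * C0"
      unfolding K_def A_def by (rule norm_matrix_le_operator) (rule order_trans[OF norm_tr_mult_apply[OF UU] up])
    define g where "g = t * s"
    have g: "0 < g" "g \<le> 1" using t s by (auto simp: g_def mult_le_one)
    have gap': "g \<le> \<bar>(transpose \<Theta> ** A) $ x1 $ i - (transpose \<Theta> ** A) $ x1 $ j\<bar>" if "i \<noteq> j" for i j
    proof -
      let ?d = "axis i 1 - axis j 1 :: real^'k"
      have "1 \<le> norm ?d" using component_le_norm_cart[of ?d i] that by (simp add: axis_def)
      then have "s * 1 \<le> c0 / 2 * norm ?d" using s by (intro mult_mono) auto
      then have "s \<le> norm (A *v ?d)" using Alow[of ?d] by linarith
      then have "g \<le> t * norm (A *v ?d)" unfolding g_def using t by (intro mult_left_mono) auto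
      also have "\<dots> \<le> \<bar>column x1 \<Theta> \<bullet> (A *v ?d)\<bar>" using gap[OF that] by (simp add: A_def)
      also have "column x1 \<Theta> \<bullet> (A *v ?d) = (transpose \<Theta> ** A) $ x1 $ i - (transpose \<Theta> ** A) $ x1 $ j"
        by (simp add: matrix_vector_mult_diff_distrib matrix_vector_mult_basis inner_diff_right)
          (simp add: matrix_matrix_mult_def transpose_def column_def inner_vec_def)
      finally show ?thesis .
    qed
    define P' where "P' = compress M U (P_hat \<phi> p y)"
    define T where "T x = (\<Sum>b=1..M. (U b v* \<Theta>) $ x *\<^sub>R compress M U (\<lambda>a c. M_hat \<phi> p y a b c))" for x
    define N' where "N' = compress M U (N_hat \<phi> p y)"
    define L' where "L' = tr_mult_vec M U (L_hat \<phi> p y)"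
    have P1: "norm (P' - A ** diag_mat \<pi> ** Q ** Q ** transpose A) \<le> K * e"
    proof -
      have "P' - A ** diag_mat \<pi> ** Q ** Q ** transpose A = compress M U (\<lambda>a c. P_hat \<phi> p y a c - population_P \<pi> Q X a c)"
        unfolding compress_diff[OF UU] population_P_def compress_sandwich[OF UU] P'_def A_def by (simp add: matrix_mul_assoc)
      then show ?thesis unfolding K_def
        using norm_compress_le[OF UU, of "\<lambda>a c. P_hat \<phi> p y a c - population_P \<pi> Q X a c"] P
        by (metis (no_types, lifting) mult_left_mono of_nat_0_le_iff order_trans)
    qed
    have N1: "norm (N' - A ** diag_mat \<pi> ** Q ** transpose A) \<le> K * e"
    proof -
      have "N' - A ** diag_mat \<pi> ** Q ** transpose A = compress M U (\<lambda>a c. N_hat \<phi> p y a c - population_N \<pi> Q X a c)"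
        unfolding compress_diff[OF UU] population_N_def compress_sandwich[OF UU] N'_def A_def by (simp add: matrix_mul_assoc)
      then show ?thesis unfolding K_def
        using norm_compress_le[OF UU, of "\<lambda>a c. N_hat \<phi> p y a c - population_N \<pi> Q X a c"] N
        by (metis (no_types, lifting) mult_left_mono of_nat_0_le_iff order_trans)
    qed
    have L1: "norm (L' - A *v \<pi>) \<le> K * e"
    proof -
      have "L' - A *v \<pi> = tr_mult_vec M U (\<lambda>a. L_hat \<phi> p y a - X a \<bullet> \<pi>)"
        unfolding tr_mult_vec_diff[OF UU] tr_mult_vec_inner[OF UU] L'_def A_def ..
      then show ?thesis unfolding K_def
        using norm_tr_mult_vec_le[OF UU, of "\<lambda>a. L_hat \<phi> p y a - X a \<bullet> \<pi>"] L
        by (metis (no_types, lifting) mult_left_mono of_nat_0_le_iff order_trans)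
    qed
    have T1: "norm (T x - A ** diag_mat \<pi> ** Q ** diag_mat ((transpose \<Theta> ** A) $ x) ** Q ** transpose A) \<le> K * e" for x
    proof -
      let ?w = "\<lambda>b. (U b v* \<Theta>) $ x"
      have "(\<Sum>b=1..M. ?w b *\<^sub>R X b) = (transpose \<Theta> ** A) $ x"
        by (simp add: vec_eq_iff sum_U_vector_mult[OF UU] A_def)
      then have "(\<Sum>b=1..M. ?w b *\<^sub>R compress M U (\<lambda>a c. population_M \<pi> Q X a b c))
        = (A ** diag_mat \<pi> ** Q) ** diag_mat ((transpose \<Theta> ** A) $ x) ** (Q ** transpose A)"
        unfolding population_M_def compress_sandwich[OF UU] A_def[symmetric]
        using sum_scaleR_diag_sandwich[of ?w "A ** diag_mat \<pi> ** Q" X "Q ** transpose A" "{1..M}"]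
        by (simp add: matrix_mul_assoc)
      then have "T x - A ** diag_mat \<pi> ** Q ** diag_mat ((transpose \<Theta> ** A) $ x) ** Q ** transpose A
        = (\<Sum>b=1..M. ?w b *\<^sub>R compress M U (\<lambda>a c. M_hat \<phi> p y a b c - population_M \<pi> Q X a b c))"
        unfolding compress_diff[OF UU] T_def by (simp add: scaleR_diff_right sum_subtractf matrix_mul_assoc)
      then show ?thesis unfolding K_def
        using norm_compress_sum_le[OF UU L2_set_U_vector_mult[OF UU \<Theta>], of x "\<lambda>a b c. M_hat \<phi> p y a b c - population_M \<pi> Q X a b c"] Mh
        by (metis (no_types, lifting) mult_left_mono of_nat_0_le_iff order_trans)
    qed
    have small: "K * e \<le> e' * g" using e1(1) K by (simp add: g_def field_simps)
    note alg = core[OF Alow nA \<Theta> g gap' P1 T1 N1 L1 small]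
    have inv: "invertible (compress M U (P_hat \<phi> p y))" using alg by (simp add: P'_def)
    have Ch: "C_hat \<phi> M p y U \<Theta> x = matrix_inv P' ** T x" for x
      unfolding C_hat_def B_hat_def T_def P'_def matrix_mult_sum_right ..
    have bnd: "C' * (K * e) / g \<le> C * e / t" "C' * (K * e) / g + r * e \<le> C * e / t"
    proof -
      have "C' * (K * e) / g = (C' * K / s) * (e / t)" by (simp add: g_def mult_ac)
      moreover have "e \<le> e / t" using t en by (simp add: field_simps mult_left_le)
      then have "r * e \<le> r * (e / t)" using r by (intro mult_left_mono) auto
      moreover have "0 \<le> r * e" using r en by simp
      moreover have "C * e / t = (C' * K / s) * (e / t) + r * (e / t)" by (simp add: C_def distrib_right add_divide_distrib)
      ultimately show "C' * (K * e) / g \<le> C * e / t" "C' * (K * e) / g + r * e \<le> C * e / t" by linarith+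
    qed
    have run: "let Ah = \<Theta> ** Lambda_hat \<phi> M p y U \<Theta> R; Oh = O_hat \<phi> M p y U \<Theta> R;
        \<pi>t = matrix_inv (tr_mult M U Oh) *v tr_mult_vec M U (L_hat \<phi> p y);
        Qh = closest_point {A. transition_matrix A}
               (matrix_inv (tr_mult M U Oh ** diag_mat \<pi>t) ** compress M U (N_hat \<phi> p y) **
                matrix_inv (tr_mult M Oh U))
      in Oh = (\<lambda>m. U m v* Ah) \<and> invertible (tr_mult M U Oh) \<and> invertible (tr_mult M U Oh ** diag_mat \<pi>t) \<and>
        (\<exists>\<tau>. \<tau> permutes UNIV \<and> (\<forall>x. norm (column (\<tau> x) Ah - column x A) \<le> C' * (K * e) / g) \<and>
             norm (perm_mat \<tau> ** Qh ** transpose (perm_mat \<tau>) - Q) \<le> C' * (K * e) / g)"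
      if "invertible R" "\<forall>i j. i \<noteq> j \<longrightarrow> (matrix_inv R ** C_hat \<phi> M p y U \<Theta> x1 ** R) $ i $ j = 0" for R :: "real^'k^'k"
    proof -
      have Oh: "O_hat \<phi> M p y U \<Theta> R = (\<lambda>m. U m v* (\<Theta> ** Lambda_hat \<phi> M p y U \<Theta> R))"
        by (simp add: O_hat_def)
      show ?thesis
        unfolding Let_def Oh tr_mult_self[OF UU] tr_mult_transpose[OF UU]
        using conjunct2[OF conjunct2[OF alg]] that unfolding Ch Let_def Lambda_hat_def N'_def L'_def by blast
    qed
    show "(\<exists>f' \<pi>' Q'. spectral_output \<phi> M p x1 y U \<Theta> f' \<pi>' Q') \<and>
      (\<forall>f' \<pi>' Q'. spectral_output \<phi> M p x1 y U \<Theta> f' \<pi>' Q' \<longrightarrow>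
         transition_matrix Q' \<and> stationary_distribution Q' \<pi>' \<and>
         (\<exists>\<tau>. \<tau> permutes UNIV \<and>
           (\<forall>x. \<exists>w. f' (\<tau> x) = (\<lambda>z. \<Sum>m=1..M. w m * \<phi> m z) \<and> L2_set (\<lambda>m. X m $ x - w m) {1..M} \<le> C * e / t) \<and>
           norm (perm_mat \<tau> ** Q' ** transpose (perm_mat \<tau>) - Q) \<le> C * e / t))"
    proof (intro conjI allI impI)
      obtain R :: "real^'k^'k" where R: "invertible R" "\<forall>x. norm (column x R) = 1"
        "\<forall>i j. i \<noteq> j \<longrightarrow> (matrix_inv R ** C_hat \<phi> M p y U \<Theta> x1 ** R) $ i $ j = 0"
        using conjunct1[OF conjunct2[OF alg]] unfolding Ch by blast
      define Oh where "Oh = O_hat \<phi> M p y U \<Theta> R"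
      define \<pi>t where "\<pi>t = matrix_inv (tr_mult M U Oh) *v tr_mult_vec M U (L_hat \<phi> p y)"
      define Qh where "Qh = closest_point {A. transition_matrix A}
               (matrix_inv (tr_mult M U Oh ** diag_mat \<pi>t) ** compress M U (N_hat \<phi> p y) **
                matrix_inv (tr_mult M Oh U))"
      have "transition_matrix Qh" unfolding Qh_def by (rule closest_transition_matrix(1)[OF Q(1)])
      then obtain \<pi>h where "stationary_distribution Qh \<pi>h" using stationary_distribution_exists by blast
      moreover have "invertible (tr_mult M U Oh)" "invertible (tr_mult M U Oh ** diag_mat \<pi>t)"
        using run[OF R(1,3)] unfolding Let_def Oh_def[symmetric] \<pi>t_def[symmetric] by blast+
      ultimately have "spectral_output \<phi> M p x1 y U \<Theta> (\<lambda>x z. \<Sum>m=1..M. Oh m $ x * \<phi> m z) \<pi>h Qh"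
        unfolding spectral_output_def using inv R Oh_def \<pi>t_def Qh_def by blast
      then show "\<exists>f' \<pi>' Q'. spectral_output \<phi> M p x1 y U \<Theta> f' \<pi>' Q'" by blast
    next
      fix f' \<pi>' Q'
      assume out: "spectral_output \<phi> M p x1 y U \<Theta> f' \<pi>' Q'"
      then obtain R Oh \<pi>t where R: "invertible (R :: real^'k^'k)"
         "\<forall>i j. i \<noteq> j \<longrightarrow> (matrix_inv R ** C_hat \<phi> M p y U \<Theta> x1 ** R) $ i $ j = 0"
        and Oh: "Oh = O_hat \<phi> M p y U \<Theta> R" and f': "f' = (\<lambda>x z. \<Sum>m=1..M. Oh m $ x * \<phi> m z)"
        and \<pi>t: "\<pi>t = matrix_inv (tr_mult M U Oh) *v tr_mult_vec M U (L_hat \<phi> p y)"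
        and Q': "Q' = closest_point {A. transition_matrix A}
               (matrix_inv (tr_mult M U Oh ** diag_mat \<pi>t) ** compress M U (N_hat \<phi> p y) **
                matrix_inv (tr_mult M Oh U))"
        and stat: "stationary_distribution Q' \<pi>'"
        unfolding spectral_output_def by (elim conjE exE) (rule that)
      show "transition_matrix Q'" unfolding Q' by (rule closest_transition_matrix(1)[OF Q(1)])
      show "stationary_distribution Q' \<pi>'" by fact
      define Ah where "Ah = \<Theta> ** Lambda_hat \<phi> M p y U \<Theta> R"
      obtain \<tau> where \<tau>: "\<tau> permutes UNIV" "\<And>x. norm (column (\<tau> x) Ah - column x A) \<le> C' * (K * e) / g"
        "norm (perm_mat \<tau> ** Q' ** transpose (perm_mat \<tau>) - Q) \<le> C' * (K * e) / g"
        and Oh': "Oh = (\<lambda>m. U m v* Ah)"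
        using run[OF R] unfolding Let_def Oh[symmetric] \<pi>t[symmetric] Q'[symmetric] Ah_def[symmetric] by blast
      have "\<exists>w. f' (\<tau> x) = (\<lambda>z. \<Sum>m=1..M. w m * \<phi> m z) \<and> L2_set (\<lambda>m. X m $ x - w m) {1..M} \<le> C * e / t" for x
      proof (intro exI[of _ "\<lambda>m. Oh m $ \<tau> x"] conjI)
        show "f' (\<tau> x) = (\<lambda>z. \<Sum>m=1..M. Oh m $ \<tau> x * \<phi> m z)" by (simp add: f')
        have 1: "Oh m $ \<tau> x = U m \<bullet> column (\<tau> x) Ah" for m
          by (simp add: Oh' vector_matrix_mult_def inner_vec_def column_def mult.commute)
        have 2: "A *v axis x 1 = column x A" by (simp add: matrix_vector_mult_basis)
        \<comment> \<open>Splits the error into the part of O missed by \<open>U\<close> and the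
          error within the span, where \<open>U\<close> acts as an isometry.\<close>
        have "L2_set (\<lambda>m. X m $ x - Oh m $ \<tau> x) {1..M}
          = L2_set (\<lambda>m. (X m \<bullet> axis x 1 - U m \<bullet> (A *v axis x 1)) - U m \<bullet> (column (\<tau> x) Ah - column x A)) {1..M}"
          unfolding 1 2 by (simp add: inner_axis inner_diff_right)
        also have "\<dots> \<le> r * e * norm (axis x 1 :: real^'k) + norm (column (\<tau> x) Ah - column x A)"
          by (rule order_trans[OF L2_set_diff_triangle]) (intro add_mono res, simp add: L2_set_U_inner[OF UU])
        also have "\<dots> \<le> C * e / t" using \<tau>(2)[of x] bnd(2) by simp
        finally show "L2_set (\<lambda>m. X m $ x - Oh m $ \<tau> x) {1..M} \<le> C * e / t" .
      qed
      then show "\<exists>\<tau>. \<tau> permutes UNIV \<and>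
           (\<forall>x. \<exists>w. f' (\<tau> x) = (\<lambda>z. \<Sum>m=1..M. w m * \<phi> m z) \<and> L2_set (\<lambda>m. X m $ x - w m) {1..M} \<le> C * e / t) \<and>
           norm (perm_mat \<tau> ** Q' ** transpose (perm_mat \<tau>) - Q) \<le> C * e / t"
        using \<tau>(1,3) bnd(1) by (meson order_trans)
    qed
  qed
qed

section \<open>Exponential moments of a vector-valued martingale\<close>

lemma convex_power_nonneg: "convex_on {0..} (\<lambda>x::real. x ^ n)"
  by (cases "even n") (auto intro: convex_power_odd convex_on_subset[OF convex_power_even])

text \<open>The power series of cosh(sqrt s) in \<open>s\<close> has the nonnegative coefficients 1
  / (2 k)!, so convexity for s >= 0 holds term by term.\<close>

lemma cosh_sqrt_convex:
  fixes a b \<theta> :: real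
  assumes a: "0 \<le> a" and b: "0 \<le> b" and \<theta>: "0 \<le> \<theta>" "\<theta> \<le> 1"
  shows "cosh (sqrt (\<theta> * a + (1 - \<theta>) * b)) \<le> \<theta> * cosh (sqrt a) + (1 - \<theta>) * cosh (sqrt b)"
proof -
  define c where "c s n = (if even n then sqrt s ^ n /\<^sub>R fact n else 0)" for s :: real and n :: nat
  have c: "c s sums cosh (sqrt s)" for s unfolding c_def by (rule cosh_converges)
  have m1: "(\<lambda>n. \<theta> * c a n + (1 - \<theta>) * c b n) sums (\<theta> * cosh (sqrt a) + (1 - \<theta>) * cosh (sqrt b))"
    by (intro sums_add sums_mult c)
  have m2: "c (\<theta> * a + (1 - \<theta>) * b) n \<le> \<theta> * c a n + (1 - \<theta>) * c b n" for n
  proof (cases "even n")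
    case True
    then obtain k where n: "n = 2 * k" by (rule evenE)
    have s: "sqrt s ^ n = s ^ k" if "0 \<le> s" for s using that by (simp add: n power_mult)
    have "(\<theta> * a + (1 - \<theta>) * b) ^ k \<le> \<theta> * a ^ k + (1 - \<theta>) * b ^ k"
      using convex_onD[OF convex_power_nonneg[of k], of "1 - \<theta>" a b] a b \<theta> by simp
    then have "(\<theta> * a + (1 - \<theta>) * b) ^ k / fact n \<le> (\<theta> * a ^ k + (1 - \<theta>) * b ^ k) / fact n"
      by (rule divide_right_mono) simp
    moreover have "0 \<le> \<theta> * a + (1 - \<theta>) * b" using a b \<theta> by simp
    ultimately show ?thesis
      unfolding c_def if_P[OF True] using s a b by (simp add: add_divide_distrib divide_inverse mult_ac distrib_left)
  qed (simp add: c_def)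
  show ?thesis by (rule sums_le[OF m2 c m1])
qed

lemma sinh_ge_self: "x \<le> sinh x" if "0 \<le> x" for x :: real
proof -
  have "x - sinh x \<le> 0 - sinh 0"
  proof (rule DERIV_nonpos_imp_nonincreasing[OF that])
    fix y :: real assume "0 \<le> y" "y \<le> x"
    show "\<exists>z. ((\<lambda>x. x - sinh x) has_real_derivative z) (at y) \<and> z \<le> 0"
      by (rule exI[of _ "1 - cosh y"]) (auto intro!: derivative_eq_intros simp: cosh_real_ge_1)
  qed
  then show ?thesis by simp
qed

text \<open>The left-hand side is convex in the inner product \<open>ip\<close>, hence below the chord between
  \<open>cosh (r - \<rho>)\<close> and \<open>cosh (r + \<rho>)\<close>.\<close>

lemma cosh_sqrt_add_le:
  fixes r \<rho> ip :: real
  assumes r: "0 \<le> r" and \<rho>: "0 \<le> \<rho>" and ip: "\<bar>ip\<bar> \<le> r * \<rho>"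
  shows "cosh (sqrt (r\<^sup>2 + \<rho>\<^sup>2 + 2 * ip)) \<le> cosh r * (exp \<rho> - \<rho>) + sinh r / r * ip"
proof (cases "r = 0 \<or> \<rho> = 0")
  case True
  then have "ip = 0" using ip by auto
  have "cosh \<rho> \<le> exp \<rho> - \<rho>"
    using sinh_ge_self[OF \<rho>] cosh_plus_sinh[of \<rho>] by linarith
  then show ?thesis using True r \<rho> \<open>ip = 0\<close> by auto
next
  case False
  then have pos: "0 < r" "0 < \<rho>" using r \<rho> by auto
  \<comment> \<open>The cosine of the angle between vectors of lengths \<open>r\<close> and
    \<open>\<rho>\<close>; \<open>\<theta>\<close> is then the position of r^2 + \<rho>^2 + 2 ip
    between (r - \<rho>)^2 and (r + \<rho>)^2.\<close>
  define t where "t = ip / (r * \<rho>)"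
  have ipt: "ip = t * (r * \<rho>)" using pos by (simp add: t_def)
  have t: "- 1 \<le> t" "t \<le> 1"
    using ip pos unfolding t_def by (auto simp: field_simps abs_le_iff)
  define \<theta> where "\<theta> = (1 + t) / 2"
  have \<theta>: "0 \<le> \<theta>" "\<theta> \<le> 1" using t by (auto simp: \<theta>_def)
  have "r\<^sup>2 + \<rho>\<^sup>2 + 2 * ip = \<theta> * (r + \<rho>)\<^sup>2 + (1 - \<theta>) * (r - \<rho>)\<^sup>2"
    by (simp add: ipt \<theta>_def power2_eq_square field_simps)
  then have "cosh (sqrt (r\<^sup>2 + \<rho>\<^sup>2 + 2 * ip)) \<le> \<theta> * cosh (r + \<rho>) + (1 - \<theta>) * cosh (r - \<rho>)"
    using cosh_sqrt_convex[of "(r + \<rho>)\<^sup>2" "(r - \<rho>)\<^sup>2" \<theta>] \<theta> pos by simp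
  also have "\<dots> = cosh r * cosh \<rho> + t * (sinh r * sinh \<rho>)"
    by (simp add: cosh_add cosh_diff \<theta>_def field_simps)
  \<comment> \<open>With \<rho> in place of sinh \<rho>, the coefficient of \<open>ip\<close> no
    longer depends on the increment, so this term averages to zero when the increment is centred.
    The rest, sinh \<rho> - \<rho>, is absorbed in exp \<rho> - \<rho>.\<close>
  also have "t * (sinh r * sinh \<rho>) = t * (sinh r * (sinh \<rho> - \<rho>)) + sinh r / r * ip"
    using pos by (simp add: ipt field_simps)
  also have "t * (sinh r * (sinh \<rho> - \<rho>)) \<le> cosh r * (sinh \<rho> - \<rho>)"
  proof -
    have 1: "0 \<le> sinh \<rho> - \<rho>" using sinh_ge_self[OF \<rho>] by simp
    have "0 \<le> sinh r" using r by simp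
    then have "t * (sinh r * (sinh \<rho> - \<rho>)) \<le> 1 * (sinh r * (sinh \<rho> - \<rho>))"
      using 1 t by (intro mult_right_mono) auto
    also have "\<dots> \<le> cosh r * (sinh \<rho> - \<rho>)"
      using 1 by (simp add: mult_right_mono sinh_le_cosh_real)
    finally show ?thesis .
  qed
  finally show ?thesis unfolding cosh_plus_sinh[of \<rho>, symmetric] by (simp add: algebra_simps)
qed

text \<open>The left side increases with \<rho> >= 0, and exp c - c <= exp(c^2) follows from exp c
  <= 1 + c + c^2 up to c = 1 and from c <= c^2 beyond. Cancelling the linear term of the exponential
  is what makes the bound quadratic in \<open>c\<close>.\<close>

lemma exp_minus_self_le:
  fixes c :: real assumes "0 \<le> \<rho>" "\<rho> \<le> c" shows "exp \<rho> - \<rho> \<le> exp (c\<^sup>2)"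
proof -
  have "c - \<rho> \<le> exp (c - \<rho>) - 1" using exp_ge_add_one_self[of "c - \<rho>"] by linarith
  also have "\<dots> \<le> exp \<rho> * (exp (c - \<rho>) - 1)"
    using assms mult_right_mono[of 1 "exp \<rho>" "exp (c - \<rho>) - 1"] by simp
  also have "\<dots> = exp c - exp \<rho>" by (simp add: right_diff_distrib flip: exp_add)
  finally have 1: "exp \<rho> - \<rho> \<le> exp c - c" by simp
  have "exp c - c \<le> exp (c\<^sup>2)"
  proof (cases "c \<le> 1")
    case True
    then have "exp c - c \<le> 1 + c\<^sup>2" using exp_bound[of c] assms by simp
    also have "\<dots> \<le> exp (c\<^sup>2)" by (rule exp_ge_add_one_self)
    finally show ?thesis .
  next
    case False
    then have "c \<le> c\<^sup>2" by (simp add: power2_eq_square)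
    then have "exp c \<le> exp (c\<^sup>2)" by simp
    then show ?thesis using assms by linarith
  qed
  with 1 show ?thesis by simp
qed

text \<open>The second term is linear in \<open>d\<close>, with a coefficient depending on
  \<open>v\<close> only. Where its denominator is 0 the quotient is 0 by convention, which is
  harmless because the factor it multiplies vanishes there too.\<close>

lemma cosh_L2_set_add_le:
  fixes v d :: "'i \<Rightarrow> real" and l c :: real
  assumes l: "0 \<le> l" and d: "L2_set d I \<le> c"
  shows "cosh (l * L2_set (\<lambda>i. v i + d i) I) \<le> exp (l\<^sup>2 * c\<^sup>2) * cosh (l * L2_set v I)
    + sinh (l * L2_set v I) / (l * L2_set v I) * (l\<^sup>2 * (\<Sum>i\<in>I. v i * d i))"
proof -
  define r where "r = l * L2_set v I"
  define \<rho> where "\<rho> = l * L2_set d I"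
  define ip where "ip = l\<^sup>2 * (\<Sum>i\<in>I. v i * d i)"
  have r: "0 \<le> r" and \<rho>: "0 \<le> \<rho>" using l by (auto simp: r_def \<rho>_def)
  have ip: "\<bar>ip\<bar> \<le> r * \<rho>"
    using mult_left_mono[OF sum_mult_le_L2_set[of v d I], of "l\<^sup>2"]
    by (simp add: ip_def r_def \<rho>_def abs_mult power2_eq_square mult_ac)
  have "(l * L2_set (\<lambda>i. v i + d i) I)\<^sup>2 = r\<^sup>2 + \<rho>\<^sup>2 + 2 * ip"
    unfolding r_def \<rho>_def ip_def power_mult_distrib L2_set_sq
    by (simp add: power2_sum sum.distrib sum_distrib_left algebra_simps)
  then have "l * L2_set (\<lambda>i. v i + d i) I = sqrt (r\<^sup>2 + \<rho>\<^sup>2 + 2 * ip)"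
    using l by (metis L2_set_nonneg mult_nonneg_nonneg real_sqrt_unique)
  then have "cosh (l * L2_set (\<lambda>i. v i + d i) I) \<le> cosh r * (exp \<rho> - \<rho>) + sinh r / r * ip"
    using cosh_sqrt_add_le[OF r \<rho> ip] by simp
  also have "cosh r * (exp \<rho> - \<rho>) \<le> cosh r * exp ((l * c)\<^sup>2)"
    using exp_minus_self_le[OF \<rho>, of "l * c"] d l by (intro mult_left_mono) (auto simp: \<rho>_def mult_left_mono)
  finally show ?thesis by (simp add: r_def ip_def power_mult_distrib mult.commute)
qed

lemma cosh_le_exp_sq: "cosh x \<le> exp (x\<^sup>2)" for x :: real
proof -
  have "cosh \<bar>x\<bar> \<le> exp \<bar>x\<bar> - \<bar>x\<bar>"
    using sinh_ge_self[of "\<bar>x\<bar>"] cosh_plus_sinh[of "\<bar>x\<bar>"] by linarith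
  also have "\<dots> \<le> exp (x\<^sup>2)" using exp_minus_self_le[of "\<bar>x\<bar>" "\<bar>x\<bar>"] by simp
  finally show ?thesis by simp
qed

text \<open>Given the past, the next state has law \<open>q\<close> and the observation in state
  \<open>x\<close> has law \<open>\<mu> x\<close>. The increment need be centred only for this
  mixture and not for each state. Integration removes the linear term of
  \<open>cosh_L2_set_add_le\<close>, and the size of \<open>I\<close> never enters.\<close>

lemma nn_integral_cosh_step:
  fixes q :: "'k::finite \<Rightarrow> real" and \<mu> :: "'k \<Rightarrow> 'y measure" and d :: "'k \<Rightarrow> 'y \<Rightarrow> 'i \<Rightarrow> real"
  assumes q: "\<And>x. 0 \<le> q x" "(\<Sum>x\<in>UNIV. q x) = 1" and \<mu>: "\<And>x. prob_space (\<mu> x)"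
    and int: "\<And>x i. i \<in> I \<Longrightarrow> integrable (\<mu> x) (\<lambda>y. d x y i)"
    and mean: "\<And>i. i \<in> I \<Longrightarrow> (\<Sum>x\<in>UNIV. q x * (\<integral>y. d x y i \<partial>\<mu> x)) = 0"
    and c: "\<And>x y. y \<in> space (\<mu> x) \<Longrightarrow> L2_set (d x y) I \<le> c" and l: "0 \<le> l"
  shows "(\<Sum>x\<in>UNIV. ennreal (q x) * (\<integral>\<^sup>+y. ennreal (cosh (l * L2_set (\<lambda>i. v i + d x y i) I)) \<partial>\<mu> x))
    \<le> ennreal (exp (l\<^sup>2 * c\<^sup>2) * cosh (l * L2_set v I))"
proof -
  define a where "a = exp (l\<^sup>2 * c\<^sup>2) * cosh (l * L2_set v I)"
  define s where "s = sinh (l * L2_set v I) / (l * L2_set v I) * l\<^sup>2"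
  define h where "h x y = a + s * (\<Sum>i\<in>I. v i * d x y i)" for x y
  have le: "cosh (l * L2_set (\<lambda>i. v i + d x y i) I) \<le> h x y" if "y \<in> space (\<mu> x)" for x y
    using cosh_L2_set_add_le[OF l c[OF that], of v] by (simp add: h_def a_def s_def mult.assoc)
  have h0: "0 \<le> h x y" if "y \<in> space (\<mu> x)" for x y
    using le[OF that] cosh_real_nonneg order_trans by blast
  have hint: "integrable (\<mu> x) (h x)" and hval: "(\<integral>y. h x y \<partial>\<mu> x) = a + s * (\<Sum>i\<in>I. v i * (\<integral>y. d x y i \<partial>\<mu> x))" for x
  proof -
    interpret prob_space "\<mu> x" by (rule \<mu>)
    show "integrable (\<mu> x) (h x)" unfolding h_def by (intro Bochner_Integration.integrable_add integrable_mult_right Bochner_Integration.integrable_sum int) auto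
    have "integrable (\<mu> x) (\<lambda>y. \<Sum>i\<in>I. v i * d x y i)"
      by (intro integrable_mult_right Bochner_Integration.integrable_sum int)
    moreover have "(\<integral>y. (\<Sum>i\<in>I. v i * d x y i) \<partial>\<mu> x) = (\<Sum>i\<in>I. v i * (\<integral>y. d x y i \<partial>\<mu> x))"
      by (subst Bochner_Integration.integral_sum) (auto intro!: integrable_mult_right int)
    ultimately show "(\<integral>y. h x y \<partial>\<mu> x) = a + s * (\<Sum>i\<in>I. v i * (\<integral>y. d x y i \<partial>\<mu> x))"
      unfolding h_def by (simp add: prob_space)
  qed
  have "(\<Sum>x\<in>UNIV. ennreal (q x) * (\<integral>\<^sup>+y. ennreal (cosh (l * L2_set (\<lambda>i. v i + d x y i) I)) \<partial>\<mu> x))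
    \<le> (\<Sum>x\<in>UNIV. ennreal (q x) * (\<integral>\<^sup>+y. ennreal (h x y) \<partial>\<mu> x))"
    by (intro sum_mono mult_left_mono nn_integral_mono ennreal_leI le) auto
  also have "\<dots> = (\<Sum>x\<in>UNIV. ennreal (q x * (\<integral>y. h x y \<partial>\<mu> x)))"
  proof (intro sum.cong refl)
    fix x
    have "(\<integral>\<^sup>+y. ennreal (h x y) \<partial>\<mu> x) = ennreal (\<integral>y. h x y \<partial>\<mu> x)"
      by (intro nn_integral_eq_integral hint AE_I2 h0)
    moreover have "0 \<le> (\<integral>y. h x y \<partial>\<mu> x)" by (intro integral_nonneg_AE AE_I2 h0)
    ultimately show "ennreal (q x) * (\<integral>\<^sup>+y. ennreal (h x y) \<partial>\<mu> x) = ennreal (q x * (\<integral>y. h x y \<partial>\<mu> x))"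
      using q(1)[of x] by (simp add: ennreal_mult)
  qed
  also have "\<dots> = ennreal (\<Sum>x\<in>UNIV. q x * (\<integral>y. h x y \<partial>\<mu> x))"
    using q(1) by (intro sum_ennreal) (auto intro!: mult_nonneg_nonneg integral_nonneg_AE h0)
  also have "(\<Sum>x\<in>UNIV. q x * (\<integral>y. h x y \<partial>\<mu> x)) = a"
  proof -
    have "(\<Sum>x\<in>UNIV. q x * (\<integral>y. h x y \<partial>\<mu> x)) = (\<Sum>x\<in>UNIV. q x) * a + s * (\<Sum>x\<in>UNIV. \<Sum>i\<in>I. v i * (q x * (\<integral>y. d x y i \<partial>\<mu> x)))"
      by (simp add: hval distrib_left sum.distrib sum_distrib_left sum_distrib_right mult_ac)
    also have "(\<Sum>x\<in>UNIV. \<Sum>i\<in>I. v i * (q x * (\<integral>y. d x y i \<partial>\<mu> x))) = (\<Sum>i\<in>I. v i * (\<Sum>x\<in>UNIV. q x * (\<integral>y. d x y i \<partial>\<mu> x)))"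
      by (subst sum.swap) (simp add: sum_distrib_left)
    also have "\<dots> = 0" by (simp add: mean)
    finally show ?thesis using q by simp
  qed
  finally show ?thesis unfolding a_def .
qed

subsection \<open>The Poisson equation\<close>

lemma mat_pow_Suc: "mat_pow Q (Suc n) = Q ** mat_pow Q n"
  by (simp add: mat_pow_def)

lemma mat_pow_fixed_right:
  assumes "Q *v v = v" shows "mat_pow Q n *v v = v"
proof (induction n)
  case (Suc n)
  have "mat_pow Q (Suc n) *v v = Q *v (mat_pow Q n *v v)"
    by (simp only: mat_pow_Suc matrix_vector_mul_assoc)
  then show ?case using Suc assms by simp
qed (simp add: mat_pow_def)

lemma mat_pow_fixed_left:
  assumes "\<pi> v* Q = \<pi>" shows "\<pi> v* mat_pow Q n = \<pi>"
proof (induction n)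
  case (Suc n)
  have "\<pi> v* mat_pow Q (Suc n) = (\<pi> v* Q) v* mat_pow Q n"
    by (simp only: mat_pow_Suc vector_matrix_mul_assoc)
  then show ?case using Suc assms by simp
qed (simp add: mat_pow_def)

lemma mat_pow_nonneg:
  assumes "transition_matrix Q" shows "0 \<le> mat_pow Q n $ x $ y"
proof (induction n arbitrary: x y)
  case (Suc n)
  then show ?case using assms
    by (auto simp: mat_pow_Suc matrix_matrix_mult_def transition_matrix_def intro!: sum_nonneg)
qed (simp add: mat_pow_def mat_def)

lemma transition_matrix_mult_1: "transition_matrix Q \<Longrightarrow> Q *v (\<chi> x. c) = (\<chi> x. c)"
  by (simp add: vec_eq_iff matrix_vector_mult_def transition_matrix_def flip: sum_distrib_right)

text \<open>Maximum principle: the distance of \<open>v\<close> to its maximum is nonnegative, fixed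
  by all powers of \<open>Q\<close> and zero at a maximizer \<open>z\<close>, hence zero at every
  state reachable from \<open>z\<close>.\<close>

lemma harmonic_constant:
  assumes Q: "transition_matrix Q" "irreducible_chain Q" and v: "Q *v v = v"
  shows "v $ x = v $ y"
proof -
  have "finite (range (($) v))" by simp
  then obtain z where z: "\<And>x. v $ x \<le> v $ z"
    using Max_in[of "range (($) v)"] Max_ge[of "range (($) v)"] by (metis UNIV_not_empty image_is_empty imageE rangeI)
  have "v $ y = v $ z" for y
  proof -
    obtain n where n: "0 < mat_pow Q n $ z $ y" using Q(2) unfolding irreducible_chain_def by blast
    let ?w = "(\<chi> x. v $ z) - v"
    have "mat_pow Q n *v ?w = ?w"
      by (rule mat_pow_fixed_right) (simp add: matrix_vector_mult_diff_distrib transition_matrix_mult_1[OF Q(1)] v)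
    then have "(\<Sum>x\<in>UNIV. mat_pow Q n $ z $ x * (v $ z - v $ x)) = 0"
      by (simp add: vec_eq_iff matrix_vector_mult_def)
    then have "mat_pow Q n $ z $ y * (v $ z - v $ y) = 0"
      using z mat_pow_nonneg[OF Q(1)] by (subst (asm) sum_nonneg_eq_0_iff) auto
    then show ?thesis using n by simp
  qed
  then show ?thesis by metis
qed

lemma stationary_distribution_pos:
  assumes Q: "transition_matrix Q" "irreducible_chain Q" and \<pi>: "stationary_distribution Q \<pi>"
  shows "0 < \<pi> $ x"
proof -
  have "\<exists>z. 0 < \<pi> $ z"
  proof (rule ccontr)
    assume "\<not> ?thesis"
    then have "(\<Sum>z\<in>UNIV. \<pi> $ z) \<le> 0" by (intro sum_nonpos) (simp add: not_less)
    then show False using \<pi> by (simp add: stationary_distribution_def)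
  qed
  then obtain z where z: "0 < \<pi> $ z" by blast
  obtain n where n: "0 < mat_pow Q n $ z $ x" using Q(2) unfolding irreducible_chain_def by blast
  have "\<pi> $ x = (\<Sum>y\<in>UNIV. mat_pow Q n $ y $ x * \<pi> $ y)"
    using mat_pow_fixed_left[of \<pi> Q n] \<pi> unfolding stationary_distribution_def
    by (metis (no_types, lifting) mult.commute sum.cong vec_lambda_beta vector_matrix_mult_def)
  moreover have "mat_pow Q n $ z $ x * \<pi> $ z \<le> (\<Sum>y\<in>UNIV. mat_pow Q n $ y $ x * \<pi> $ y)"
    using \<pi> mat_pow_nonneg[OF Q(1)] by (intro member_le_sum) (auto simp: stationary_distribution_def)
  ultimately show ?thesis using n z by (metis less_le_trans mult_pos_pos)
qed

text \<open>\<open>H\<close> is the fundamental matrix of Kemeny and Snell, the inverse of 1 - Q +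
  J, where all rows of J are \<pi>. A vector in the kernel has \<pi>-mean zero and is harmonic,
  hence 0 by irreducibility. The same inverse solves the Poisson equation and measures the
  sensitivity of \<pi> to a change of \<open>Q\<close>; in the second property \<open>\<pi>'\<close>
  may be any stationary distribution of \<open>Q'\<close>, which suits an estimate that may be
  reducible.\<close>

lemma fundamental_matrix:
  fixes Q :: "real^'k^'k"
  assumes Q: "transition_matrix Q" "irreducible_chain Q" and \<pi>: "stationary_distribution Q \<pi>"
  obtains H where "\<And>g. \<pi> \<bullet> g = 0 \<Longrightarrow> H *v g - Q *v (H *v g) = g"
    "\<And>\<pi>' (Q' :: real^'k^'k). stationary_distribution Q' \<pi>' \<Longrightarrow> \<pi>' - \<pi> = (\<pi>' v* (Q' - Q)) v* H"
proof -
  define J :: "real^'k^'k" where "J = (\<chi> x y. \<pi> $ y)"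
  define Z where "Z = mat 1 - Q + J"
  have \<pi>1: "(\<Sum>x\<in>UNIV. \<pi> $ x) = 1" and \<pi>Q: "\<pi> v* Q = \<pi>"
    using \<pi> by (auto simp: stationary_distribution_def)
  have Zv: "Z *v v = v - Q *v v + (\<chi> x. \<pi> \<bullet> v)" for v
    unfolding Z_def by (simp add: matrix_vector_mult_diff_rdistrib matrix_vector_mult_add_rdistrib)
      (simp add: J_def matrix_vector_mult_def inner_vec_def)
  have \<pi>Qv: "\<pi> \<bullet> (Q *v v) = \<pi> \<bullet> v" for v
    by (simp only: dot_lmul_matrix[symmetric] \<pi>Q)
  have \<pi>c: "\<pi> \<bullet> (\<chi> x. c) = c" for c by (simp add: inner_vec_def \<pi>1 flip: sum_distrib_right)
  have \<pi>Z: "\<pi> \<bullet> (Z *v v) = \<pi> \<bullet> v" for v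
    by (simp add: Zv inner_add_right inner_diff_right \<pi>Qv \<pi>c)
  have ker: "v = 0" if "Z *v v = 0" for v
  proof -
    have 0: "\<pi> \<bullet> v = 0" using \<pi>Z[of v] that by simp
    then have "Q *v v = v" using that by (simp add: Zv vec_eq_iff)
    then have "v $ x = v $ y" for x y by (rule harmonic_constant[OF Q])
    then obtain c where "v = (\<chi> x. c)" by (metis vec_lambda_unique)
    moreover from this have "c = 0" using \<pi>c[of c] 0 by simp
    ultimately show ?thesis by (simp add: vec_eq_iff)
  qed
  then have Z: "invertible Z" using matrix_left_invertible_ker invertible_left_inverse by metis
  show ?thesis
  proof (rule that[of "matrix_inv Z"])
    fix g assume g: "\<pi> \<bullet> g = 0"
    have 1: "Z *v (matrix_inv Z *v g) = g" by (simp add: matrix_vector_mul_assoc matrix_inv_mult Z)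
    then have "\<pi> \<bullet> (matrix_inv Z *v g) = 0" using \<pi>Z[of "matrix_inv Z *v g"] g by simp
    then show "matrix_inv Z *v g - Q *v (matrix_inv Z *v g) = g"
      using 1 unfolding Zv by (simp add: vec_eq_iff)
  next
    fix \<pi>' :: "real^'k" and Q' :: "real^'k^'k" assume s: "stationary_distribution Q' \<pi>'"
    have "(\<Sum>x\<in>UNIV. \<pi>' $ x) = 1" and "\<pi>' v* Q' = \<pi>'"
      using s by (auto simp: stationary_distribution_def)
    have r: "w v* (\<chi> x y. \<pi> $ y) = (\<Sum>x\<in>UNIV. w $ x) *\<^sub>R \<pi>" for w :: "real^'k"
      by (simp add: vec_eq_iff vector_matrix_mult_def sum_distrib_left mult.commute)
    have 1: "\<pi>' v* J = \<pi> v* J"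
      unfolding J_def r using \<open>(\<Sum>x\<in>UNIV. \<pi>' $ x) = 1\<close> \<pi>1 by (simp add: sum_subtractf)
    have "(\<pi>' - \<pi>) v* Z = (\<pi>' - \<pi>) - (\<pi>' v* Q - \<pi> v* Q)"
      unfolding Z_def by (simp add: vector_matrix_mult_add_rdistrib vector_matrix_mult_diff_rdistrib 1 vector_matrix_mult_diff_distrib)
    also have "\<dots> = \<pi>' v* (Q' - Q)"
      using \<pi>Q \<open>\<pi>' v* Q' = \<pi>'\<close> by (simp add: vector_matrix_mult_diff_rdistrib)
    finally have "((\<pi>' - \<pi>) v* Z) v* matrix_inv Z = (\<pi>' v* (Q' - Q)) v* matrix_inv Z" by simp
    then show "\<pi>' - \<pi> = (\<pi>' v* (Q' - Q)) v* matrix_inv Z"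
      by (simp add: vector_matrix_mul_assoc matrix_inv_mult Z)
  qed
qed

subsection \<open>Law and concentration of a hidden Markov model\<close>

locale hmm = prob_space \<Omega>
  for \<Omega> :: "'w measure" and \<pi> :: "real^'k" and Q :: "real^'k^'k" and \<Y> :: "(real^'d) set"
    and f :: "'k \<Rightarrow> real^'d \<Rightarrow> real" and X :: "nat \<Rightarrow> 'w \<Rightarrow> 'k" and Y :: "nat \<Rightarrow> 'w \<Rightarrow> real^'d" +
  assumes model: "hidden_markov_model \<Omega> \<pi> Q \<Y> f X Y"
    and borel_Y: "\<Y> \<in> sets borel" and densities: "\<And>x. prob_density \<Y> (f x)"
    and transition: "transition_matrix Q" and stationary: "stationary_distribution Q \<pi>"
begin

definition em :: "'k \<Rightarrow> (real^'d) measure" where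
  "em x = density (leb \<Y>) (\<lambda>y. ennreal (f x y))"

lemma space_leb: "space (leb \<Y>) = \<Y>"
  by (simp add: leb_def space_restrict_space)

lemma f_measurable [measurable]: "f x \<in> borel_measurable (leb \<Y>)"
  using densities[of x] by (auto simp: prob_density_def)

lemma f_nonneg: "y \<in> space (leb \<Y>) \<Longrightarrow> 0 \<le> f x y"
  using densities[of x] by (auto simp: prob_density_def space_leb)

lemma sets_em [simp, measurable_cong]: "sets (em x) = sets (leb \<Y>)"
  and space_em [simp]: "space (em x) = \<Y>"
  by (auto simp: em_def space_leb)

lemma emeasure_em:
  assumes A: "A \<in> sets (leb \<Y>)" shows "emeasure (em x) A = ennreal (LINT y:A|leb \<Y>. f x y)"
proof -
  have int: "integrable (leb \<Y>) (f x)" using densities[of x] by (auto simp: prob_density_def)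
  have "emeasure (em x) A = (\<integral>\<^sup>+y. ennreal (indicator A y *\<^sub>R f x y) \<partial>leb \<Y>)"
    unfolding em_def using A by (subst emeasure_density) (auto intro!: nn_integral_cong split: split_indicator)
  also have "\<dots> = ennreal (LINT y:A|leb \<Y>. f x y)"
    unfolding set_lebesgue_integral_def using A
    by (intro nn_integral_eq_integral integrable_mult_indicator int AE_I2) (auto simp: f_nonneg split: split_indicator)
  finally show ?thesis .
qed

lemma prob_space_em: "prob_space (em x)"
proof
  have "(LINT y:\<Y>|leb \<Y>. f x y) = (LINT y|leb \<Y>. f x y)"
    unfolding set_lebesgue_integral_def by (intro Bochner_Integration.integral_cong) (auto simp: space_leb)
  then show "emeasure (em x) (space (em x)) = 1"
    using emeasure_em[of \<Y> x] densities[of x] sets.top[of "leb \<Y>"] by (simp add: space_leb prob_density_def)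
qed

lemma integral_em: "g \<in> borel_measurable (leb \<Y>) \<Longrightarrow> (\<integral>y. g y \<partial>em x) = (\<integral>y. f x y * g y \<partial>leb \<Y>)"
  unfolding em_def by (subst integral_density) (auto simp: f_nonneg)

lemma integrable_em: "g \<in> borel_measurable (leb \<Y>) \<Longrightarrow> integrable (em x) g \<longleftrightarrow> integrable (leb \<Y>) (\<lambda>y. f x y * g y)"
  unfolding em_def by (subst integrable_density) (auto simp: f_nonneg)

lemma X_measurable [measurable]: "1 \<le> j \<Longrightarrow> X j \<in> measurable \<Omega> (count_space UNIV)"
  and Y_measurable [measurable]: "1 \<le> j \<Longrightarrow> Y j \<in> measurable \<Omega> (leb \<Y>)"
  using model by (auto simp: hidden_markov_model_def markov_chain_def)

lemma Y_in: "1 \<le> j \<Longrightarrow> \<omega> \<in> space \<Omega> \<Longrightarrow> Y j \<omega> \<in> \<Y>"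
  using measurable_space[OF Y_measurable] by (simp add: space_leb)

lemma Y_nonempty: "\<Y> \<noteq> {}"
  using not_empty Y_in[of 1] by fastforce

definition weight :: "nat \<Rightarrow> (nat \<Rightarrow> 'k) \<Rightarrow> real" where
  "weight n x = \<pi> $ x 1 * (\<Prod>i\<in>{1..<n}. Q $ x i $ x (Suc i))"

lemma weight_nonneg: "0 \<le> weight n x"
  unfolding weight_def using stationary transition
  by (auto simp: stationary_distribution_def transition_matrix_def intro!: mult_nonneg_nonneg prod_nonneg)

lemma weight_Suc: "1 \<le> n \<Longrightarrow> weight (Suc n) x = weight n x * Q $ x n $ x (Suc n)"
  by (simp add: weight_def atLeastLessThanSuc)

lemma weight_cong: "1 \<le> n \<Longrightarrow> (\<And>i. i \<in> {1..n} \<Longrightarrow> x i = x' i) \<Longrightarrow> weight n x = weight n x'"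
  unfolding weight_def by (auto intro!: arg_cong2[where f="(*)"] prod.cong)

definition path_event :: "nat \<Rightarrow> (nat \<Rightarrow> 'k) \<Rightarrow> 'w set" where
  "path_event n x = {\<omega> \<in> space \<Omega>. \<forall>i\<in>{1..n}. X i \<omega> = x i}"

lemma X_event [measurable]: "1 \<le> j \<Longrightarrow> {\<omega> \<in> space \<Omega>. X j \<omega> = a} \<in> events"
  by measurable

lemma path_event_sets [measurable]: "path_event n x \<in> events"
  unfolding path_event_def by (intro sets.sets_Collect_finite_All) auto

lemma prob_path_event: "1 \<le> n \<Longrightarrow> prob (path_event n x) = weight n x"
proof (induction n rule: nat_induct_at_least)
  case base
  then show ?case using model
    by (simp add: path_event_def weight_def hidden_markov_model_def markov_chain_def)
next
  case (Suc n)
  have eq: "path_event (Suc n) x = {\<omega> \<in> space \<Omega>. X (Suc n) \<omega> = x (Suc n) \<and> (\<forall>i\<in>{1..n}. X i \<omega> = x i)}"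
    unfolding path_event_def using Suc(1) by (auto simp: atLeastAtMostSuc_conv)
  show ?case
  proof (cases "prob (path_event n x) = 0")
    case True
    have "prob (path_event (Suc n) x) \<le> prob (path_event n x)"
      by (intro finite_measure_mono) (auto simp: path_event_def)
    then have "prob (path_event (Suc n) x) = 0" using True measure_nonneg[of \<Omega> "path_event (Suc n) x"] by linarith
    then show ?thesis using True Suc by (simp add: weight_Suc)
  next
    case False
    then have pos: "0 < prob (path_event n x)" by (simp add: zero_less_measure_iff)
    then have "\<P>(\<omega> in \<Omega>. X (Suc n) \<omega> = x (Suc n) \<bar> \<forall>i\<in>{1..n}. X i \<omega> = x i) = Q $ x n $ x (Suc n)"
      using model Suc(1) unfolding hidden_markov_model_def markov_chain_def path_event_def by blast
    moreover have "\<P>(\<omega> in \<Omega>. X (Suc n) \<omega> = x (Suc n) \<bar> \<forall>i\<in>{1..n}. X i \<omega> = x i) = prob (path_event (Suc n) x) / prob (path_event n x)"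
      by (simp only: eq cond_prob_def) (simp only: path_event_def)
    ultimately have "prob (path_event (Suc n) x) = Q $ x n $ x (Suc n) * prob (path_event n x)"
      using pos by (simp add: field_simps)
    then show ?thesis using Suc by (simp add: weight_Suc mult.commute)
  qed
qed

lemma emeasure_path_and_observations:
  assumes n: "1 \<le> n" and A: "\<And>i. i \<in> {1..n} \<Longrightarrow> A i \<in> sets (leb \<Y>)"
  shows "emeasure \<Omega> {\<omega> \<in> space \<Omega>. (\<forall>i\<in>{1..n}. Y i \<omega> \<in> A i) \<and> (\<forall>i\<in>{1..n}. X i \<omega> = x i)}
    = ennreal (weight n x) * (\<Prod>i\<in>{1..n}. emeasure (em (x i)) (A i))" (is "emeasure \<Omega> ?E = _")
proof (cases "weight n x = 0")
  case True
  have "measure \<Omega> ?E \<le> prob (path_event n x)" by (intro finite_measure_mono) (auto simp: path_event_def)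
  then have "measure \<Omega> ?E \<le> 0" using True prob_path_event[OF n, of x] by linarith
  then have "measure \<Omega> ?E = 0" using measure_nonneg[of \<Omega> ?E] by linarith
  then show ?thesis using True by (simp add: emeasure_eq_measure)
next
  case False
  then have pos: "0 < prob (path_event n x)" using weight_nonneg[of n x] by (simp add: prob_path_event[OF n])
  have "\<P>(\<omega> in \<Omega>. (\<forall>i\<in>{1..n}. Y i \<omega> \<in> A i) \<bar> \<forall>i\<in>{1..n}. X i \<omega> = x i)
          = (\<Prod>i=1..n. LINT y:A i|leb \<Y>. f (x i) y)"
    using model A pos unfolding hidden_markov_model_def path_event_def by blast
  then have "measure \<Omega> ?E = weight n x * (\<Prod>i=1..n. LINT y:A i|leb \<Y>. f (x i) y)"
    using pos unfolding cond_prob_def prob_path_event[OF n, symmetric] path_event_def by (simp add: field_simps)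
  moreover have "0 \<le> (LINT y:A i|leb \<Y>. f (x i) y)" for i
    unfolding set_lebesgue_integral_def
    by (intro integral_nonneg_AE AE_I2) (auto simp: f_nonneg split: split_indicator)
  ultimately show ?thesis using A weight_nonneg[of n x]
    by (simp add: emeasure_eq_measure ennreal_mult prod_nonneg emeasure_em prod_ennreal)
qed

definition obs :: "nat \<Rightarrow> 'w \<Rightarrow> nat \<Rightarrow> real^'d" where
  "obs n \<omega> = (\<lambda>i\<in>{1..n}. Y i \<omega>)"

lemma obs_measurable [measurable]: "obs n \<in> measurable \<Omega> (PiM {1..n} (\<lambda>_. leb \<Y>))"
  unfolding obs_def by (rule measurable_restrict) auto

lemma sets_PiM_em: "sets (PiM I (\<lambda>i. em (x i))) = sets (PiM I (\<lambda>_. leb \<Y>))"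
  by (rule sets_PiM_cong) auto

text \<open>Given the path, the observations have a product law: both measures agree on rectangles,
  and these determine a finite product of probability measures. Paths of probability zero, about
  which the conditional formulation says nothing, contribute zero to both sides.\<close>

lemma nn_integral_path:
  assumes n: "1 \<le> n" and g: "g \<in> borel_measurable (PiM {1..n} (\<lambda>_. leb \<Y>))"
  shows "(\<integral>\<^sup>+\<omega>. indicator (path_event n x) \<omega> * g (obs n \<omega>) \<partial>\<Omega>)
    = ennreal (weight n x) * (\<integral>\<^sup>+y. g y \<partial>PiM {1..n} (\<lambda>i. em (x i)))"
proof (cases "weight n x = 0")
  case True
  then have "emeasure \<Omega> (path_event n x) = 0" using prob_path_event[OF n, of x] by (simp add: emeasure_eq_measure)
  then have "AE \<omega> in \<Omega>. \<omega> \<notin> path_event n x" by (intro AE_not_in) (auto simp: null_sets_def)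
  then have "(\<integral>\<^sup>+\<omega>. indicator (path_event n x) \<omega> * g (obs n \<omega>) \<partial>\<Omega>) = (\<integral>\<^sup>+\<omega>. 0 \<partial>\<Omega>)"
    by (intro nn_integral_cong_AE) auto
  then show ?thesis using True by simp
next
  case False
  define w where "w = weight n x"
  have w: "0 < w" using False weight_nonneg[of n x] by (simp add: w_def)
  define \<nu> where "\<nu> = distr (density \<Omega> (\<lambda>\<omega>. ennreal (1 / w) * indicator (path_event n x) \<omega>)) (PiM {1..n} (\<lambda>_. leb \<Y>)) (obs n)"
  interpret P: product_sigma_finite "\<lambda>i. em (x i)"
    unfolding product_sigma_finite_def using prob_space_em prob_space_imp_sigma_finite by blast
  have "\<nu> = PiM {1..n} (\<lambda>i. em (x i))"
  proof (rule P.PiM_eqI)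
    show "sets \<nu> = sets (PiM {1..n} (\<lambda>i. em (x i)))" unfolding sets_PiM_em by (simp add: \<nu>_def)
    fix A assume "\<And>i. i \<in> {1..n} \<Longrightarrow> A i \<in> sets (em (x i))"
    then have A: "\<And>i. i \<in> {1..n} \<Longrightarrow> A i \<in> sets (leb \<Y>)" by simp
    have AS: "Pi\<^sub>E {1..n} A \<in> sets (PiM {1..n} (\<lambda>_. leb \<Y>))" using A by (intro sets_PiM_I_finite) auto
    let ?E = "{\<omega> \<in> space \<Omega>. (\<forall>i\<in>{1..n}. Y i \<omega> \<in> A i) \<and> (\<forall>i\<in>{1..n}. X i \<omega> = x i)}"
    have E: "?E = path_event n x \<inter> (obs n -` Pi\<^sub>E {1..n} A \<inter> space \<Omega>)"
      by (auto simp: path_event_def obs_def PiE_iff)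
    have Em: "?E \<in> events" unfolding E using measurable_sets[OF obs_measurable AS] by auto
    have "emeasure \<nu> (Pi\<^sub>E {1..n} A) = (\<integral>\<^sup>+\<omega>. ennreal (1 / w) * indicator (path_event n x) \<omega> * indicator (obs n -` Pi\<^sub>E {1..n} A \<inter> space \<Omega>) \<omega> \<partial>\<Omega>)"
      unfolding \<nu>_def using AS by (subst emeasure_distr) (auto intro!: emeasure_density)
    also have "\<dots> = (\<integral>\<^sup>+\<omega>. ennreal (1 / w) * indicator ?E \<omega> \<partial>\<Omega>)"
      unfolding E by (intro nn_integral_cong) (auto split: split_indicator)
    also have "\<dots> = ennreal (1 / w) * emeasure \<Omega> ?E" using Em by (simp add: nn_integral_cmult)
    also have "\<dots> = (ennreal (1 / w) * ennreal w) * (\<Prod>i\<in>{1..n}. emeasure (em (x i)) (A i))"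
      by (simp only: emeasure_path_and_observations[OF n A] w_def mult.assoc)
    also have "ennreal (1 / w) * ennreal w = 1" using w by (simp flip: ennreal_mult')
    finally show "emeasure \<nu> (Pi\<^sub>E {1..n} A) = (\<Prod>i\<in>{1..n}. emeasure (em (x i)) (A i))" by simp
  qed simp
  then have "(\<integral>\<^sup>+y. g y \<partial>PiM {1..n} (\<lambda>i. em (x i))) = (\<integral>\<^sup>+y. g y \<partial>\<nu>)" by simp
  also have "\<dots> = (\<integral>\<^sup>+\<omega>. ennreal (1 / w) * indicator (path_event n x) \<omega> * g (obs n \<omega>) \<partial>\<Omega>)"
    unfolding \<nu>_def using g by (simp add: nn_integral_distr nn_integral_density)
  also have "\<dots> = ennreal (1 / w) * (\<integral>\<^sup>+\<omega>. indicator (path_event n x) \<omega> * g (obs n \<omega>) \<partial>\<Omega>)"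
    using g by (subst nn_integral_cmult[symmetric]) (auto simp: mult.assoc)
  finally have "ennreal w * (\<integral>\<^sup>+y. g y \<partial>PiM {1..n} (\<lambda>i. em (x i)))
    = (ennreal w * ennreal (1 / w)) * (\<integral>\<^sup>+\<omega>. indicator (path_event n x) \<omega> * g (obs n \<omega>) \<partial>\<Omega>)" by (simp only: mult.assoc)
  also have "ennreal w * ennreal (1 / w) = 1" using w by (simp flip: ennreal_mult')
  finally show ?thesis by (simp add: w_def)
qed

text \<open>The expectation of a function of the first \<open>n\<close> states and observations, as
  a finite sum over paths of product integrals. In this form conditioning on the past amounts to
  integrating the last coordinate first, and no abstract conditional expectation is
  involved.\<close>

definition expect :: "nat \<Rightarrow> ((nat \<Rightarrow> 'k) \<Rightarrow> (nat \<Rightarrow> real^'d) \<Rightarrow> ennreal) \<Rightarrow> ennreal" where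
  "expect n g = (\<Sum>x\<in>{1..n} \<rightarrow>\<^sub>E UNIV. ennreal (weight n x) * (\<integral>\<^sup>+y. g x y \<partial>PiM {1..n} (\<lambda>i. em (x i))))"

definition states :: "nat \<Rightarrow> 'w \<Rightarrow> nat \<Rightarrow> 'k" where
  "states n \<omega> = (\<lambda>i\<in>{1..n}. X i \<omega>)"

lemma states_eq_sum:
  assumes "\<omega> \<in> space \<Omega>"
  shows "g (states n \<omega>) = (\<Sum>x\<in>{1..n} \<rightarrow>\<^sub>E UNIV. indicator (path_event n x) \<omega> * (g x :: ennreal))"
proof -
  have "indicator (path_event n x) \<omega> * g x = (if x = states n \<omega> then g x else 0)"
    if "x \<in> {1..n} \<rightarrow>\<^sub>E UNIV" for x
  proof -
    have "\<omega> \<in> path_event n x \<longleftrightarrow> x = states n \<omega>"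
      using that assms by (auto simp: path_event_def states_def fun_eq_iff PiE_iff extensional_def)
    then show ?thesis by (simp add: indicator_def)
  qed
  moreover have "states n \<omega> \<in> {1..n} \<rightarrow>\<^sub>E UNIV" by (simp add: states_def)
  ultimately show ?thesis by (simp add: sum.delta' finite_PiE cong: sum.cong)
qed

lemma nn_integral_eq_expect:
  assumes n: "1 \<le> n" and g: "\<And>x. x \<in> {1..n} \<rightarrow>\<^sub>E UNIV \<Longrightarrow> g x \<in> borel_measurable (PiM {1..n} (\<lambda>_. leb \<Y>))"
  shows "(\<integral>\<^sup>+\<omega>. g (states n \<omega>) (obs n \<omega>) \<partial>\<Omega>) = expect n g"
proof -
  have "(\<integral>\<^sup>+\<omega>. g (states n \<omega>) (obs n \<omega>) \<partial>\<Omega>)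
    = (\<integral>\<^sup>+\<omega>. (\<Sum>x\<in>{1..n} \<rightarrow>\<^sub>E UNIV. indicator (path_event n x) \<omega> * g x (obs n \<omega>)) \<partial>\<Omega>)"
    by (intro nn_integral_cong) (rule states_eq_sum[of _ "\<lambda>x. g x (obs n _)"])
  also have "\<dots> = (\<Sum>x\<in>{1..n} \<rightarrow>\<^sub>E UNIV. (\<integral>\<^sup>+\<omega>. indicator (path_event n x) \<omega> * g x (obs n \<omega>) \<partial>\<Omega>))"
    using g by (intro nn_integral_sum borel_measurable_times measurable_compose[OF obs_measurable]) auto
  also have "\<dots> = expect n g"
    unfolding expect_def by (intro sum.cong refl nn_integral_path n g)
  finally show ?thesis .
qed

lemma sum_PiE_Suc:
  "(\<Sum>x\<in>{1..Suc n} \<rightarrow>\<^sub>E (UNIV :: 'k set). h x) = (\<Sum>x\<in>{1..n} \<rightarrow>\<^sub>E UNIV. \<Sum>x'\<in>UNIV. h (x(Suc n := x')) :: ennreal)"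
proof -
  have *: "{1..Suc n} = insert (Suc n) {1..n}" by auto
  have inj: "inj_on (\<lambda>(y, g). g(Suc n := y)) (UNIV \<times> ({1..n} \<rightarrow>\<^sub>E (UNIV :: 'k set)))"
    by (rule inj_combinator) simp
  have "(\<Sum>x\<in>{1..Suc n} \<rightarrow>\<^sub>E (UNIV :: 'k set). h x) = (\<Sum>(x', x)\<in>UNIV \<times> ({1..n} \<rightarrow>\<^sub>E UNIV). h (x(Suc n := x')))"
    unfolding * PiE_insert_eq by (subst sum.reindex[OF inj]) (simp add: split_def)
  also have "\<dots> = (\<Sum>x\<in>{1..n} \<rightarrow>\<^sub>E UNIV. \<Sum>x'\<in>UNIV. h (x(Suc n := x')))"
    by (subst sum.cartesian_product[symmetric], rule sum.swap)
  finally show ?thesis .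
qed

text \<open>The tower property in one-sided form: Fubini for the last observation, together with the
  last factor \<open>Q $ x n $ x'\<close> of the path weight, reduces the claim to a bound on the
  one-step conditional expectation.\<close>

lemma expect_Suc_le:
  assumes n: "1 \<le> n" and g: "\<And>x. x \<in> {1..Suc n} \<rightarrow>\<^sub>E UNIV \<Longrightarrow> g x \<in> borel_measurable (PiM {1..Suc n} (\<lambda>_. leb \<Y>))"
    and h: "\<And>x. x \<in> {1..n} \<rightarrow>\<^sub>E UNIV \<Longrightarrow> h x \<in> borel_measurable (PiM {1..n} (\<lambda>_. leb \<Y>))"
    and le: "\<And>x y. x \<in> {1..n} \<rightarrow>\<^sub>E UNIV \<Longrightarrow> y \<in> space (PiM {1..n} (\<lambda>_. leb \<Y>)) \<Longrightarrow>
      (\<Sum>x'\<in>UNIV. ennreal (Q $ x n $ x') * (\<integral>\<^sup>+y'. g (x(Suc n := x')) (y(Suc n := y')) \<partial>em x')) \<le> c * h x y"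
  shows "expect (Suc n) g \<le> c * expect n h"
proof -
  have "ennreal (weight (Suc n) (x(Suc n := x'))) * (\<integral>\<^sup>+y. g (x(Suc n := x')) y \<partial>PiM {1..Suc n} (\<lambda>i. em ((x(Suc n := x')) i)))
    = ennreal (weight n x) * (\<integral>\<^sup>+y. ennreal (Q $ x n $ x') * (\<integral>\<^sup>+y'. g (x(Suc n := x')) (y(Suc n := y')) \<partial>em x') \<partial>PiM {1..n} (\<lambda>i. em (x i)))"
    if x: "x \<in> {1..n} \<rightarrow>\<^sub>E UNIV" for x x'
  proof -
    let ?x = "x(Suc n := x')"
    have x': "?x \<in> {1..Suc n} \<rightarrow>\<^sub>E UNIV" using x by (auto simp: PiE_iff extensional_def)
    interpret P: product_sigma_finite "\<lambda>i. em (?x i)"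
      unfolding product_sigma_finite_def using prob_space_em prob_space_imp_sigma_finite by blast
    interpret E: sigma_finite_measure "em x'" using prob_space_em prob_space_imp_sigma_finite by blast
    have *: "{1..Suc n} = insert (Suc n) {1..n}" by auto
    have m: "g ?x \<in> borel_measurable (PiM (insert (Suc n) {1..n}) (\<lambda>i. em (?x i)))"
      using g[OF x'] unfolding *[symmetric] by (simp cong: measurable_cong_sets add: sets_PiM_em)
    have "(\<integral>\<^sup>+y. g ?x y \<partial>PiM {1..Suc n} (\<lambda>i. em (?x i)))
      = (\<integral>\<^sup>+y. (\<integral>\<^sup>+y'. g ?x (y(Suc n := y')) \<partial>em (?x (Suc n))) \<partial>PiM {1..n} (\<lambda>i. em (?x i)))"
      unfolding * by (rule P.product_nn_integral_insert[OF _ _ m]) auto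
    also have "PiM {1..n} (\<lambda>i. em (?x i)) = PiM {1..n} (\<lambda>i. em (x i))" by (intro PiM_cong) auto
    finally have eq: "(\<integral>\<^sup>+y. g ?x y \<partial>PiM {1..Suc n} (\<lambda>i. em (?x i)))
      = (\<integral>\<^sup>+y. (\<integral>\<^sup>+y'. g ?x (y(Suc n := y')) \<partial>em x') \<partial>PiM {1..n} (\<lambda>i. em (x i)))" by (simp only: fun_upd_same)
    have m2: "(\<lambda>(y, y'). g ?x (y(Suc n := y'))) \<in> borel_measurable (PiM {1..n} (\<lambda>i. em (x i)) \<Otimes>\<^sub>M em x')"
    proof -
      have "(\<lambda>(y, y'). y(Suc n := y')) \<in> measurable (PiM {1..n} (\<lambda>i. em (?x i)) \<Otimes>\<^sub>M em (?x (Suc n))) (PiM (insert (Suc n) {1..n}) (\<lambda>i. em (?x i)))"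
        by (rule measurable_add_dim)
      then have "(\<lambda>p. g ?x ((\<lambda>(y, y'). y(Suc n := y')) p)) \<in> borel_measurable (PiM {1..n} (\<lambda>i. em (?x i)) \<Otimes>\<^sub>M em (?x (Suc n)))"
        using m by (rule measurable_compose)
      moreover have "PiM {1..n} (\<lambda>i. em (?x i)) = PiM {1..n} (\<lambda>i. em (x i))" by (intro PiM_cong) auto
      ultimately show ?thesis by (simp add: split_def)
    qed
    have "ennreal (weight (Suc n) ?x) = ennreal (weight n x) * ennreal (Q $ x n $ x')"
    proof -
      have "weight n ?x = weight n x" by (intro weight_cong n) auto
      then show ?thesis using n weight_nonneg[of n x] transition
        by (simp add: weight_Suc transition_matrix_def ennreal_mult)
    qed
    moreover have "ennreal (Q $ x n $ x') * (\<integral>\<^sup>+y. (\<integral>\<^sup>+y'. g ?x (y(Suc n := y')) \<partial>em x') \<partial>PiM {1..n} (\<lambda>i. em (x i)))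
      = (\<integral>\<^sup>+y. ennreal (Q $ x n $ x') * (\<integral>\<^sup>+y'. g ?x (y(Suc n := y')) \<partial>em x') \<partial>PiM {1..n} (\<lambda>i. em (x i)))"
      by (rule nn_integral_cmult[symmetric]) (rule E.borel_measurable_nn_integral[OF m2])
    ultimately show ?thesis unfolding eq by (simp only: mult.assoc)
  qed
  note step_eq = this
  have mi: "(\<lambda>y. ennreal (Q $ x n $ x') * (\<integral>\<^sup>+y'. g (x(Suc n := x')) (y(Suc n := y')) \<partial>em x')) \<in> borel_measurable (PiM {1..n} (\<lambda>i. em (x i)))"
    if x: "x \<in> {1..n} \<rightarrow>\<^sub>E UNIV" for x x'
  proof -
    let ?x = "x(Suc n := x')"
    have x': "?x \<in> {1..Suc n} \<rightarrow>\<^sub>E UNIV" using x by (auto simp: PiE_iff extensional_def)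
    interpret E: sigma_finite_measure "em x'" using prob_space_em prob_space_imp_sigma_finite by blast
    have *: "{1..Suc n} = insert (Suc n) {1..n}" by auto
    have m: "g ?x \<in> borel_measurable (PiM (insert (Suc n) {1..n}) (\<lambda>i. em (?x i)))"
      using g[OF x'] unfolding *[symmetric] by (simp cong: measurable_cong_sets add: sets_PiM_em)
    have "(\<lambda>(y, y'). y(Suc n := y')) \<in> measurable (PiM {1..n} (\<lambda>i. em (?x i)) \<Otimes>\<^sub>M em (?x (Suc n))) (PiM (insert (Suc n) {1..n}) (\<lambda>i. em (?x i)))"
      by (rule measurable_add_dim)
    then have "(\<lambda>p. g ?x ((\<lambda>(y, y'). y(Suc n := y')) p)) \<in> borel_measurable (PiM {1..n} (\<lambda>i. em (?x i)) \<Otimes>\<^sub>M em (?x (Suc n)))"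
      using m by (rule measurable_compose)
    moreover have "PiM {1..n} (\<lambda>i. em (?x i)) = PiM {1..n} (\<lambda>i. em (x i))" by (intro PiM_cong) auto
    ultimately have "(\<lambda>(y, y'). g ?x (y(Suc n := y'))) \<in> borel_measurable (PiM {1..n} (\<lambda>i. em (x i)) \<Otimes>\<^sub>M em x')" by (simp add: split_def)
    from E.borel_measurable_nn_integral[OF this] show ?thesis by simp
  qed
  have sp: "space (PiM {1..n} (\<lambda>i. em (x i))) = space (PiM {1..n} (\<lambda>_. leb \<Y>))" for x
    by (rule sets_eq_imp_space_eq[OF sets_PiM_em])
  have "expect (Suc n) g = (\<Sum>x\<in>{1..n} \<rightarrow>\<^sub>E UNIV. \<Sum>x'\<in>UNIV. ennreal (weight n x) *
     (\<integral>\<^sup>+y. ennreal (Q $ x n $ x') * (\<integral>\<^sup>+y'. g (x(Suc n := x')) (y(Suc n := y')) \<partial>em x') \<partial>PiM {1..n} (\<lambda>i. em (x i))))"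
    unfolding expect_def sum_PiE_Suc by (intro sum.cong refl step_eq)
  also have "\<dots> = (\<Sum>x\<in>{1..n} \<rightarrow>\<^sub>E UNIV. ennreal (weight n x) *
     (\<integral>\<^sup>+y. (\<Sum>x'\<in>UNIV. ennreal (Q $ x n $ x') * (\<integral>\<^sup>+y'. g (x(Suc n := x')) (y(Suc n := y')) \<partial>em x')) \<partial>PiM {1..n} (\<lambda>i. em (x i))))"
    unfolding sum_distrib_left[symmetric] by (intro sum.cong refl arg_cong2[where f="(*)"] nn_integral_sum[symmetric] mi) auto
  also have "\<dots> \<le> (\<Sum>x\<in>{1..n} \<rightarrow>\<^sub>E UNIV. ennreal (weight n x) * (\<integral>\<^sup>+y. c * h x y \<partial>PiM {1..n} (\<lambda>i. em (x i))))"
    by (intro sum_mono mult_left_mono nn_integral_mono le) (auto simp: sp)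
  also have "\<dots> = (\<Sum>x\<in>{1..n} \<rightarrow>\<^sub>E UNIV. c * (ennreal (weight n x) * (\<integral>\<^sup>+y. h x y \<partial>PiM {1..n} (\<lambda>i. em (x i)))))"
  proof (intro sum.cong refl)
    fix x assume x: "x \<in> {1..n} \<rightarrow>\<^sub>E (UNIV :: 'k set)"
    have "h x \<in> borel_measurable (PiM {1..n} (\<lambda>i. em (x i)))"
      using h[OF x] by (simp cong: measurable_cong_sets add: sets_PiM_em)
    then show "ennreal (weight n x) * (\<integral>\<^sup>+y. c * h x y \<partial>PiM {1..n} (\<lambda>i. em (x i)))
      = c * (ennreal (weight n x) * (\<integral>\<^sup>+y. h x y \<partial>PiM {1..n} (\<lambda>i. em (x i))))"
      by (simp add: nn_integral_cmult mult_ac)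
  qed
  also have "\<dots> = c * expect n h" by (simp add: expect_def sum_distrib_left)
  finally show ?thesis .
qed

end

section \<open>Tensors of three consecutive observations and their Poisson martingale\<close>

lemma L2_set_sum_scale_le:
  assumes "finite J"
  shows "L2_set (\<lambda>i. \<Sum>x\<in>J. c x * v x i) I \<le> (\<Sum>x\<in>J. \<bar>c x\<bar> * L2_set (v x) I)"
  using assms
proof (induction J rule: finite_induct)
  case (insert a J)
  have "L2_set (\<lambda>i. c a * v a i) I = \<bar>c a\<bar> * L2_set (v a) I"
    by (simp add: L2_set_def power_mult_distrib real_sqrt_mult flip: sum_distrib_left)
  then show ?case using insert L2_set_triangle_ineq[of "\<lambda>i. c a * v a i" "\<lambda>i. \<Sum>x\<in>J. c x * v x i" I] by simp
qed (simp add: L2_set_def)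

text \<open>Jensen's inequality for the norm, by pairing the mean vector w with the integrand: |w|^2
  = E <w, F> <= |w| \<eta>.\<close>

lemma L2_set_integral_le:
  assumes "prob_space \<mu>" and fin: "finite I" and int: "\<And>i. i \<in> I \<Longrightarrow> integrable \<mu> (\<lambda>y. F y i)"
    and b: "\<And>y. y \<in> space \<mu> \<Longrightarrow> L2_set (F y) I \<le> \<eta>"
  shows "L2_set (\<lambda>i. \<integral>y. F y i \<partial>\<mu>) I \<le> \<eta>"
proof -
  interpret prob_space \<mu> by fact
  define w where "w i = (\<integral>y. F y i \<partial>\<mu>)" for i
  have \<eta>: "0 \<le> \<eta>" using not_empty b L2_set_nonneg order_trans by blast
  have intw: "integrable \<mu> (\<lambda>y. \<Sum>i\<in>I. w i * F y i)"
    by (intro Bochner_Integration.integrable_sum integrable_mult_right int)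
  have "(L2_set w I)\<^sup>2 = (\<Sum>i\<in>I. \<integral>y. w i * F y i \<partial>\<mu>)"
    unfolding L2_set_sq by (simp add: w_def power2_eq_square)
  also have "\<dots> = (\<integral>y. (\<Sum>i\<in>I. w i * F y i) \<partial>\<mu>)"
    by (intro Bochner_Integration.integral_sum[symmetric] integrable_mult_right int)
  also have "\<dots> \<le> (\<integral>y. L2_set w I * \<eta> \<partial>\<mu>)"
  proof (rule integral_mono[OF intw])
    fix y assume "y \<in> space \<mu>"
    then have "(\<Sum>i\<in>I. w i * F y i) \<le> L2_set w I * L2_set (F y) I"
      using sum_mult_le_L2_set[of w "F y" I] by linarith
    also have "\<dots> \<le> L2_set w I * \<eta>" using b[OF \<open>y \<in> space \<mu>\<close>] by (intro mult_left_mono) auto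
    finally show "(\<Sum>i\<in>I. w i * F y i) \<le> L2_set w I * \<eta>" .
  qed simp
  also have "\<dots> = L2_set w I * \<eta>" by (simp add: prob_space)
  finally have "L2_set w I * L2_set w I \<le> L2_set w I * \<eta>" by (simp add: power2_eq_square)
  then have "L2_set w I \<le> \<eta>" using \<eta>
    by (cases "L2_set w I = 0") (auto simp: L2_set_nonneg less_le)
  then show ?thesis by (simp only: w_def[abs_def])
qed

lemma (in hmm) prob_em [simp]: "measure (em x) \<Y> = 1"
  using prob_space.prob_space[OF prob_space_em[of x]] by simp

text \<open>The indices start at 0 to leave room for a constant feature. Apart from integrability,
  the features are constrained only by the oscillation \<open>\<eta>\<close> of their
  tensor.\<close>

locale hmm_features = hmm \<Omega> \<pi> Q \<Y> f X Y
  for \<Omega> :: "'w measure" and \<pi> :: "real^'k" and Q :: "real^'k^'k" and \<Y> :: "(real^'d) set"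
    and f :: "'k \<Rightarrow> real^'d \<Rightarrow> real" and X :: "nat \<Rightarrow> 'w \<Rightarrow> 'k" and Y :: "nat \<Rightarrow> 'w \<Rightarrow> real^'d" +
  fixes \<phi> :: "nat \<Rightarrow> real^'d \<Rightarrow> real" and M :: nat and \<eta> :: real and H :: "real^'k^'k"
  assumes \<phi>_measurable: "\<And>a. a \<le> M \<Longrightarrow> \<phi> a \<in> borel_measurable (leb \<Y>)"
    and \<phi>_integrable: "\<And>a x. a \<le> M \<Longrightarrow> integrable (em x) (\<phi> a)"
    and diameter: "\<And>y1 y2 y3 z1 z2 z3. y1 \<in> \<Y> \<Longrightarrow> y2 \<in> \<Y> \<Longrightarrow> y3 \<in> \<Y> \<Longrightarrow> z1 \<in> \<Y> \<Longrightarrow> z2 \<in> \<Y> \<Longrightarrow> z3 \<in> \<Y> \<Longrightarrow>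
      L2_set (\<lambda>(a, b, c). \<phi> a y1 * \<phi> b y2 * \<phi> c y3 - \<phi> a z1 * \<phi> b z2 * \<phi> c z3) ({..M} \<times> {..M} \<times> {..M}) \<le> \<eta>"
    and poisson: "\<And>g. \<pi> \<bullet> g = 0 \<Longrightarrow> H *v g - Q *v (H *v g) = g"
begin

abbreviation "II \<equiv> {..M} \<times> {..M} \<times> {..M}"

definition mean :: "nat \<Rightarrow> 'k \<Rightarrow> real" where "mean a x = (\<integral>y. \<phi> a y \<partial>em x)"
definition mean1 :: "nat \<Rightarrow> 'k \<Rightarrow> real" where "mean1 c x = (\<Sum>x'\<in>UNIV. Q $ x $ x' * mean c x')"
definition mean2 :: "nat \<Rightarrow> nat \<Rightarrow> 'k \<Rightarrow> real" where
  "mean2 b c x = (\<Sum>x'\<in>UNIV. Q $ x $ x' * (mean b x' * mean1 c x'))"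

text \<open>\<open>t1\<close>, \<open>t2\<close>, \<open>t3\<close> and \<open>tm\<close> are the conditional expectations of the feature tensor \<open>t0\<close> of three
  consecutive observations given, respectively, the first two observations and the second state,
  the first observation and state, the first state, and nothing.\<close>

definition t0 :: "real^'d \<Rightarrow> real^'d \<Rightarrow> real^'d \<Rightarrow> nat \<times> nat \<times> nat \<Rightarrow> real" where
  "t0 y1 y2 y3 = (\<lambda>(a, b, c). \<phi> a y1 * \<phi> b y2 * \<phi> c y3)"
definition t1 :: "real^'d \<Rightarrow> real^'d \<Rightarrow> 'k \<Rightarrow> nat \<times> nat \<times> nat \<Rightarrow> real" where
  "t1 y1 y2 x = (\<lambda>(a, b, c). \<phi> a y1 * \<phi> b y2 * mean1 c x)"
definition t2 :: "real^'d \<Rightarrow> 'k \<Rightarrow> nat \<times> nat \<times> nat \<Rightarrow> real" where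
  "t2 y x = (\<lambda>(a, b, c). \<phi> a y * mean2 b c x)"
definition t3 :: "'k \<Rightarrow> nat \<times> nat \<times> nat \<Rightarrow> real" where
  "t3 x = (\<lambda>(a, b, c). mean a x * mean2 b c x)"
definition tm :: "nat \<times> nat \<times> nat \<Rightarrow> real" where
  "tm i = (\<Sum>x\<in>UNIV. \<pi> $ x * t3 x i)"

text \<open>Closeness to all values of the tensor at once. It is a convex condition, hence inherited
  by averages and integrals and so by all conditional expectations, and two tensors satisfying it
  are within 2 \<eta> of each other by way of any common value.\<close>

definition near :: "(nat \<times> nat \<times> nat \<Rightarrow> real) \<Rightarrow> bool" where
  "near t \<longleftrightarrow> (\<forall>y1\<in>\<Y>. \<forall>y2\<in>\<Y>. \<forall>y3\<in>\<Y>. L2_set (\<lambda>i. t i - t0 y1 y2 y3 i) II \<le> \<eta>)"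

lemma finite_II: "finite II" by simp

lemma eta_nonneg: "0 \<le> \<eta>"
proof -
  obtain y where "y \<in> \<Y>" using Y_nonempty by blast
  from diameter[OF this this this this this this] show ?thesis using L2_set_nonneg order_trans by blast
qed

lemma near_t0: "y1 \<in> \<Y> \<Longrightarrow> y2 \<in> \<Y> \<Longrightarrow> y3 \<in> \<Y> \<Longrightarrow> near (t0 y1 y2 y3)"
  using diameter by (auto simp: near_def t0_def split_def)

lemma near_average:
  assumes "\<And>x. 0 \<le> q x" "(\<Sum>x\<in>UNIV. q x) = 1" "\<And>x::'k. near (t x)"
  shows "near (\<lambda>i. \<Sum>x\<in>UNIV. q x * t x i)"
  unfolding near_def
proof (intro ballI)
  fix y1 y2 y3 assume y: "y1 \<in> \<Y>" "y2 \<in> \<Y>" "y3 \<in> \<Y>"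
  have "(\<Sum>x\<in>UNIV. q x * t x i) - t0 y1 y2 y3 i = (\<Sum>x\<in>UNIV. q x * (t x i - t0 y1 y2 y3 i))" for i
    using assms(2) by (simp add: right_diff_distrib sum_subtractf flip: sum_distrib_right)
  then have "L2_set (\<lambda>i. (\<Sum>x\<in>UNIV. q x * t x i) - t0 y1 y2 y3 i) II
    \<le> (\<Sum>x\<in>UNIV. \<bar>q x\<bar> * L2_set (\<lambda>i. t x i - t0 y1 y2 y3 i) II)"
    using L2_set_sum_scale_le[of UNIV q "\<lambda>x i. t x i - t0 y1 y2 y3 i" II] by simp
  also have "\<dots> \<le> (\<Sum>x\<in>UNIV. q x * \<eta>)"
    using assms y by (intro sum_mono mult_mono) (auto simp: near_def)
  also have "\<dots> = \<eta>" using assms(2) by (simp flip: sum_distrib_right)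
  finally show "L2_set (\<lambda>i. (\<Sum>x\<in>UNIV. q x * t x i) - t0 y1 y2 y3 i) II \<le> \<eta>" .
qed

lemma near_integral:
  assumes int: "\<And>i. i \<in> II \<Longrightarrow> integrable (em x) (\<lambda>y. t y i)" and near: "\<And>y. y \<in> \<Y> \<Longrightarrow> near (t y)"
    and eq: "\<And>i. i \<in> II \<Longrightarrow> t' i = (\<integral>y. t y i \<partial>em x)"
  shows "near t'"
  unfolding near_def
proof (intro ballI)
  fix y1 y2 y3 assume y: "y1 \<in> \<Y>" "y2 \<in> \<Y>" "y3 \<in> \<Y>"
  interpret E: prob_space "em x" by (rule prob_space_em)
  have "t' i - t0 y1 y2 y3 i = (\<integral>y. t y i - t0 y1 y2 y3 i \<partial>em x)" if "i \<in> II" for i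
    using int[OF that] eq[OF that] by simp
  then have "L2_set (\<lambda>i. t' i - t0 y1 y2 y3 i) II = L2_set (\<lambda>i. \<integral>y. t y i - t0 y1 y2 y3 i \<partial>em x) II"
    by (intro L2_set_cong) auto
  also have "\<dots> \<le> \<eta>"
    using near y int by (intro L2_set_integral_le[OF prob_space_em finite_II]) (auto simp: near_def)
  finally show "L2_set (\<lambda>i. t' i - t0 y1 y2 y3 i) II \<le> \<eta>" .
qed

lemma Q_row: "0 \<le> Q $ x $ x'" "(\<Sum>x'\<in>UNIV. Q $ x $ x') = 1"
  using transition by (auto simp: transition_matrix_def)

lemma integral_t0: "i \<in> II \<Longrightarrow> integrable (em x) (\<lambda>y. t0 y1 y2 y i)"
    "(\<integral>y. t0 y1 y2 y (a, b, c) \<partial>em x) = \<phi> a y1 * \<phi> b y2 * mean c x"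
  by (auto simp: t0_def mean_def \<phi>_integrable)

lemma integral_t1: "i \<in> II \<Longrightarrow> integrable (em x) (\<lambda>y. t1 y1 y x' i)"
    "(\<integral>y. t1 y1 y x' (a, b, c) \<partial>em x) = \<phi> a y1 * mean b x * mean1 c x'"
  by (auto simp: t1_def mean_def \<phi>_integrable)

lemma integral_t2: "i \<in> II \<Longrightarrow> integrable (em x) (\<lambda>y. t2 y x' i)"
    "(\<integral>y. t2 y x' (a, b, c) \<partial>em x) = mean a x * mean2 b c x'"
  by (auto simp: t2_def mean_def \<phi>_integrable)

lemma near_t1: assumes "y1 \<in> \<Y>" "y2 \<in> \<Y>" shows "near (t1 y1 y2 x)"
proof -
  have "near (\<lambda>i. \<Sum>x'\<in>UNIV. Q $ x $ x' * (\<lambda>(a, b, c). \<phi> a y1 * \<phi> b y2 * mean c x') i)"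
  proof (intro near_average Q_row)
    fix x' show "near (\<lambda>(a, b, c). \<phi> a y1 * \<phi> b y2 * mean c x')"
      by (rule near_integral[where t = "t0 y1 y2" and x = x'])
        (auto simp: integral_t0 near_t0 assms)
  qed
  also have "(\<lambda>i. \<Sum>x'\<in>UNIV. Q $ x $ x' * (\<lambda>(a, b, c). \<phi> a y1 * \<phi> b y2 * mean c x') i) = t1 y1 y2 x"
    by (auto simp: t1_def mean1_def fun_eq_iff sum_distrib_left mult_ac)
  finally show ?thesis .
qed

lemma near_t2: assumes "y \<in> \<Y>" shows "near (t2 y x)"
proof -
  have "near (\<lambda>i. \<Sum>x'\<in>UNIV. Q $ x $ x' * (\<lambda>(a, b, c). \<phi> a y * mean b x' * mean1 c x') i)"
  proof (intro near_average Q_row)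
    fix x' show "near (\<lambda>(a, b, c). \<phi> a y * mean b x' * mean1 c x')"
      by (rule near_integral[where t = "\<lambda>y'. t1 y y' x'" and x = x'])
        (auto simp: integral_t1 near_t1 assms)
  qed
  also have "(\<lambda>i. \<Sum>x'\<in>UNIV. Q $ x $ x' * (\<lambda>(a, b, c). \<phi> a y * mean b x' * mean1 c x') i) = t2 y x"
    by (auto simp: t2_def mean2_def fun_eq_iff sum_distrib_left mult_ac)
  finally show ?thesis .
qed

lemma near_t3: "near (t3 x)"
  by (rule near_integral[where t = "\<lambda>y. t2 y x" and x = x]) (auto simp: integral_t2 near_t2 t3_def)

lemma near_tm: "near tm"
  unfolding tm_def using stationary by (intro near_average near_t3) (auto simp: stationary_distribution_def)

lemma near_diff: assumes "near t" "near t'" shows "L2_set (\<lambda>i. t i - t' i) II \<le> 2 * \<eta>"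
proof -
  obtain y where y: "y \<in> \<Y>" using Y_nonempty by blast
  show ?thesis
    using L2_set_diff_triangle[of "\<lambda>i. t i - t0 y y y i" "\<lambda>i. t' i - t0 y y y i" II] assms y
    unfolding near_def by fastforce
qed

definition G :: "nat \<times> nat \<times> nat \<Rightarrow> real^'k" where "G i = (\<chi> x. t3 x i - tm i)"
text \<open>\<open>H *v G i\<close> solves the Poisson equation for the centred \<open>G i\<close>.
  Applying \<open>Q\<close> once more gives what plays the part of the sum of Q^j G over j >= 1, the
  expected contribution of all windows starting after the current time.\<close>

definition h :: "nat \<times> nat \<times> nat \<Rightarrow> 'k \<Rightarrow> real" where "h i x = (Q *v (H *v G i)) $ x"
definition cH :: real where "cH = real CARD('k) * norm (Q ** H)"

lemma poisson_h: "(\<Sum>x'\<in>UNIV. Q $ x $ x' * (t3 x' i - tm i + h i x')) = h i x"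
proof -
  have "\<pi> \<bullet> G i = 0"
    using stationary by (simp add: G_def inner_vec_def right_diff_distrib sum_subtractf tm_def stationary_distribution_def flip: sum_distrib_right)
  then have "H *v G i = G i + Q *v (H *v G i)" using poisson by (metis diff_add_cancel)
  then have "Q *v (H *v G i) = Q *v (G i + Q *v (H *v G i))" by simp
  then have "h i x = (Q *v (G i + Q *v (H *v G i))) $ x" by (simp add: h_def)
  moreover have "(G i + Q *v (H *v G i)) $ x' = t3 x' i - tm i + h i x'" for x'
    by (simp add: h_def) (simp add: G_def)
  moreover have "(Q *v w) $ x = (\<Sum>x'\<in>UNIV. Q $ x $ x' * w $ x')" for w
    by (simp add: matrix_vector_mult_def)
  ultimately show ?thesis by (simp only:)
qed

lemma L2_set_h: "L2_set (\<lambda>i. h i x) II \<le> 2 * cH * \<eta>"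
proof -
  have "h i x = (\<Sum>x'\<in>UNIV. (Q ** H) $ x $ x' * (t3 x' i - tm i))" for i
    by (simp add: h_def matrix_vector_mul_assoc) (simp add: matrix_vector_mult_def[of "Q ** H"] G_def)
  then have "L2_set (\<lambda>i. h i x) II \<le> (\<Sum>x'\<in>UNIV. \<bar>(Q ** H) $ x $ x'\<bar> * L2_set (\<lambda>i. t3 x' i - tm i) II)"
    using L2_set_sum_scale_le[of UNIV "\<lambda>x'. (Q ** H) $ x $ x'" "\<lambda>x' i. t3 x' i - tm i" II] by simp
  also have "\<dots> \<le> (\<Sum>x'\<in>(UNIV :: 'k set). norm (Q ** H) * (2 * \<eta>))"
    by (intro sum_mono mult_mono matrix_entry_le_norm near_diff near_t3 near_tm) auto
  also have "\<dots> = 2 * cH * \<eta>" by (simp add: cH_def)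
  finally show ?thesis .
qed

text \<open>What is predicted of the centred sum from the first k + 2 states and observations:
  windows 1 to k are complete, window k + 1 lacks its third observation, window k + 2 its last two,
  and \<open>h\<close> stands for all later windows.\<close>

definition V :: "nat \<Rightarrow> (nat \<Rightarrow> 'k) \<Rightarrow> (nat \<Rightarrow> real^'d) \<Rightarrow> nat \<times> nat \<times> nat \<Rightarrow> real" where
  "V k x y i = (\<Sum>s=1..k. t0 (y s) (y (s + 1)) (y (s + 2)) i - tm i)
    + (t1 (y (k + 1)) (y (k + 2)) (x (k + 2)) i - tm i) + (t2 (y (k + 2)) (x (k + 2)) i - tm i) + h i (x (k + 2))"

text \<open>A new observation completes one window, advances the next and opens a third one, which
  \<open>h\<close> covered so far; hence the four brackets.\<close>

definition inc :: "real^'d \<Rightarrow> real^'d \<Rightarrow> 'k \<Rightarrow> 'k \<Rightarrow> real^'d \<Rightarrow> nat \<times> nat \<times> nat \<Rightarrow> real" where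
  "inc y1 y2 x x' y' i = (t0 y1 y2 y' i - t1 y1 y2 x i) + (t1 y2 y' x' i - t2 y2 x i) + (t2 y' x' i - tm i) + (h i x' - h i x)"

lemma V_0: "V 0 x y = (\<lambda>i. (t1 (y 1) (y 2) (x 2) i - tm i) + (t2 (y 2) (x 2) i - tm i) + h i (x 2))"
  by (simp add: V_def fun_eq_iff numeral_2_eq_2 One_nat_def)

lemma V_Suc: "V (Suc k) (x(k + 3 := x')) (y(k + 3 := y')) i = V k x y i + inc (y (k + 1)) (y (k + 2)) (x (k + 2)) x' y' i"
proof -
  have "(\<Sum>s=1..k. t0 ((y(k + 3 := y')) s) ((y(k + 3 := y')) (s + 1)) ((y(k + 3 := y')) (s + 2)) i - tm i)
    = (\<Sum>s=1..k. t0 (y s) (y (s + 1)) (y (s + 2)) i - tm i)"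
    by (intro sum.cong) auto
  moreover have "Suc k + 2 = k + 3" "Suc k + 1 = k + 2" by auto
  ultimately show ?thesis unfolding V_def inc_def by (simp add: numeral_3_eq_3 numeral_2_eq_2 One_nat_def)
qed

lemma L2_set_inc:
  assumes "y1 \<in> \<Y>" "y2 \<in> \<Y>" "y' \<in> \<Y>"
  shows "L2_set (inc y1 y2 x x' y') II \<le> (6 + 4 * cH) * \<eta>"
proof -
  have "L2_set (\<lambda>i. h i x' - h i x) II \<le> 4 * cH * \<eta>"
    using L2_set_diff_triangle[of "\<lambda>i. h i x'" "\<lambda>i. h i x" II] L2_set_h[of x] L2_set_h[of x'] by simp
  moreover have "L2_set (\<lambda>i. t0 y1 y2 y' i - t1 y1 y2 x i) II \<le> 2 * \<eta>" "L2_set (\<lambda>i. t1 y2 y' x' i - t2 y2 x i) II \<le> 2 * \<eta>"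
    "L2_set (\<lambda>i. t2 y' x' i - tm i) II \<le> 2 * \<eta>"
    by (intro near_diff near_t0 near_t1 near_t2 near_tm assms)+
  ultimately show ?thesis
    using L2_set_triangle_ineq[of "\<lambda>i. (t0 y1 y2 y' i - t1 y1 y2 x i) + (t1 y2 y' x' i - t2 y2 x i) + (t2 y' x' i - tm i)" "\<lambda>i. h i x' - h i x" II]
      L2_set_triangle_ineq[of "\<lambda>i. (t0 y1 y2 y' i - t1 y1 y2 x i) + (t1 y2 y' x' i - t2 y2 x i)" "\<lambda>i. t2 y' x' i - tm i" II]
      L2_set_triangle_ineq[of "\<lambda>i. (t0 y1 y2 y' i - t1 y1 y2 x i)" "\<lambda>i. t1 y2 y' x' i - t2 y2 x i" II]
    unfolding inc_def by (simp add: algebra_simps)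
qed

lemma L2_set_remainder:
  assumes "y1 \<in> \<Y>" "y2 \<in> \<Y>"
  shows "L2_set (\<lambda>i. (t1 y1 y2 x i - tm i) + (t2 y2 x i - tm i) + h i x) II \<le> (4 + 2 * cH) * \<eta>"
proof -
  have "L2_set (\<lambda>i. t1 y1 y2 x i - tm i) II \<le> 2 * \<eta>" "L2_set (\<lambda>i. t2 y2 x i - tm i) II \<le> 2 * \<eta>"
    by (intro near_diff near_t1 near_t2 near_tm assms)+
  then show ?thesis
    using L2_set_triangle_ineq[of "\<lambda>i. (t1 y1 y2 x i - tm i) + (t2 y2 x i - tm i)" "\<lambda>i. h i x" II]
      L2_set_triangle_ineq[of "\<lambda>i. t1 y1 y2 x i - tm i" "\<lambda>i. t2 y2 x i - tm i" II] L2_set_h[of x]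
    by (simp add: algebra_simps)
qed

lemma inc_integrable:
  assumes "i \<in> II" shows "integrable (em x') (\<lambda>y'. inc y1 y2 x x' y' i)"
proof -
  interpret E: prob_space "em x'" by (rule prob_space_em)
  show ?thesis unfolding inc_def
    using integral_t0(1)[OF assms] integral_t1(1)[OF assms] integral_t2(1)[OF assms] by simp
qed

text \<open>The martingale property. The first two brackets are centred by the definitions of
  \<open>mean1\<close> and \<open>mean2\<close>. In state \<open>x'\<close> the third has mean
  \<open>t3 x' i - tm i\<close>, and together with the change of \<open>h\<close> this averages to
  zero by the Poisson equation.\<close>

lemma inc_mean:
  assumes "i \<in> II" shows "(\<Sum>x'\<in>UNIV. Q $ x $ x' * (\<integral>y'. inc y1 y2 x x' y' i \<partial>em x')) = 0"
proof -
  obtain a b c where i: "i = (a, b, c)" by (cases i)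
  have "(\<integral>y'. inc y1 y2 x x' y' i \<partial>em x') = (\<phi> a y1 * \<phi> b y2 * mean c x' - t1 y1 y2 x i) + (\<phi> a y2 * mean b x' * mean1 c x' - t2 y2 x i)
     + (t3 x' i - tm i + h i x' - h i x)" for x'
  proof -
    interpret E: prob_space "em x'" by (rule prob_space_em)
    show ?thesis unfolding inc_def
      using integral_t0(1)[OF assms] integral_t1(1)[OF assms] integral_t2(1)[OF assms]
      by simp (simp add: i integral_t0 integral_t1 integral_t2 t3_def)
  qed
  then have "(\<Sum>x'\<in>UNIV. Q $ x $ x' * (\<integral>y'. inc y1 y2 x x' y' i \<partial>em x'))
    = (\<phi> a y1 * \<phi> b y2 * mean1 c x - t1 y1 y2 x i) + (\<phi> a y2 * mean2 b c x - t2 y2 x i)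
      + ((\<Sum>x'\<in>UNIV. Q $ x $ x' * (t3 x' i - tm i + h i x')) - h i x)"
    using Q_row(2)[of x] by (simp add: right_diff_distrib distrib_left sum.distrib sum_subtractf mean1_def mean2_def sum_distrib_left mult_ac
        flip: sum_distrib_right sum_distrib_left)
  also have "\<dots> = 0" unfolding poisson_h by (simp add: i t1_def t2_def)
  finally show ?thesis .
qed

lemma feature_obs_measurable:
  assumes "a \<le> M" "s \<in> {1..n}" shows "(\<lambda>y. \<phi> a (y s)) \<in> borel_measurable (PiM {1..n} (\<lambda>_. leb \<Y>))"
  by (rule measurable_compose[OF measurable_component_singleton[OF assms(2)] \<phi>_measurable[OF assms(1)]])

lemma V_measurable:
  assumes i: "i \<in> II" shows "(\<lambda>y. V k x y i) \<in> borel_measurable (PiM {1..k + 2} (\<lambda>_. leb \<Y>))"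
proof -
  obtain a b c where i': "i = (a, b, c)" by (cases i)
  have abc: "a \<le> M" "b \<le> M" "c \<le> M" using i i' by auto
  note m = abc[THEN feature_obs_measurable]
  have "(\<lambda>y. \<phi> a (y s)) \<in> borel_measurable (PiM {1..k + 2} (\<lambda>_. leb \<Y>))"
    "(\<lambda>y. \<phi> b (y s)) \<in> borel_measurable (PiM {1..k + 2} (\<lambda>_. leb \<Y>))"
    "(\<lambda>y. \<phi> c (y s)) \<in> borel_measurable (PiM {1..k + 2} (\<lambda>_. leb \<Y>))" if "s \<in> {1..k + 2}" for s
    using m that by blast+
  then show ?thesis unfolding V_def i' t0_def t1_def t2_def prod.case
    by (intro borel_measurable_add borel_measurable_diff borel_measurable_sum borel_measurable_times borel_measurable_const) auto
qed

lemma L2_set_V_measurable: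
  "(\<lambda>y. ennreal (cosh (l * L2_set (V k x y) II))) \<in> borel_measurable (PiM {1..k + 2} (\<lambda>_. leb \<Y>))"
proof -
  have [measurable]: "(\<lambda>y. \<Sum>i\<in>II. (V k x y i)\<^sup>2) \<in> borel_measurable (PiM {1..k + 2} (\<lambda>_. leb \<Y>))"
    by (intro borel_measurable_sum borel_measurable_power V_measurable)
  show ?thesis
    unfolding cosh_field_def L2_set_def by measurable
qed

lemma expect_cosh_V:
  assumes l: "0 \<le> l"
  defines "c \<equiv> (6 + 4 * cH) * \<eta>"
  shows "expect (k + 2) (\<lambda>x y. ennreal (cosh (l * L2_set (V k x y) II))) \<le> ennreal (exp (l\<^sup>2 * c\<^sup>2)) ^ k * ennreal (cosh (l * c))"
proof (induction k)
  case 0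
  have cH: "0 \<le> cH" by (simp add: cH_def)
  \<comment> \<open>At \<open>k = 0\<close> the sum is empty and only the remainder is left, bounded
    by \<open>c\<close>; this is the origin of the factor cosh(l c).\<close>
  have "expect 2 (\<lambda>x y. ennreal (cosh (l * L2_set (V 0 x y) II)))
    = (\<integral>\<^sup>+\<omega>. ennreal (cosh (l * L2_set (V 0 (states 2 \<omega>) (obs 2 \<omega>)) II)) \<partial>\<Omega>)"
    by (intro nn_integral_eq_expect[symmetric] L2_set_V_measurable[of l 0, unfolded add_0]) simp
  also have "\<dots> \<le> (\<integral>\<^sup>+\<omega>. ennreal (cosh (l * c)) \<partial>\<Omega>)"
  proof (intro nn_integral_mono ennreal_leI)
    fix \<omega> assume w: "\<omega> \<in> space \<Omega>"
    have "obs 2 \<omega> 1 \<in> \<Y>" "obs 2 \<omega> 2 \<in> \<Y>" using Y_in[OF _ w] by (auto simp: obs_def)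
    then have "L2_set (V 0 (states 2 \<omega>) (obs 2 \<omega>)) II \<le> (4 + 2 * cH) * \<eta>"
      unfolding V_0 by (rule L2_set_remainder)
    also have "\<dots> \<le> c" unfolding c_def using cH eta_nonneg by (intro mult_right_mono) auto
    finally have le: "L2_set (V 0 (states 2 \<omega>) (obs 2 \<omega>)) II \<le> c" .
    then have "0 \<le> c" using L2_set_nonneg order_trans by blast
    then show "cosh (l * L2_set (V 0 (states 2 \<omega>) (obs 2 \<omega>)) II) \<le> cosh (l * c)"
      using l le by (subst cosh_real_nonneg_le_iff) (auto intro!: mult_left_mono)
  qed
  also have "\<dots> = ennreal (cosh (l * c))" by (simp add: emeasure_space_1)
  finally show ?case by (simp add: numeral_2_eq_2)
next
  case (Suc k)
  have k3: "Suc (k + 2) = k + 3" by simp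
  have "expect (Suc (k + 2)) (\<lambda>x y. ennreal (cosh (l * L2_set (V (Suc k) x y) II)))
    \<le> ennreal (exp (l\<^sup>2 * c\<^sup>2)) * expect (k + 2) (\<lambda>x y. ennreal (cosh (l * L2_set (V k x y) II)))"
  proof (rule expect_Suc_le)
    show "(\<lambda>y. ennreal (cosh (l * L2_set (V (Suc k) x y) II))) \<in> borel_measurable (PiM {1..Suc (k + 2)} (\<lambda>_. leb \<Y>))" for x
      using L2_set_V_measurable[of l "Suc k" x] by simp
    show "(\<lambda>y. ennreal (cosh (l * L2_set (V k x y) II))) \<in> borel_measurable (PiM {1..k + 2} (\<lambda>_. leb \<Y>))" for x
      by (rule L2_set_V_measurable)
    fix x y assume "y \<in> space (PiM {1..k + 2} (\<lambda>_. leb \<Y>))"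
    then have y: "y (k + 1) \<in> \<Y>" "y (k + 2) \<in> \<Y>" by (auto simp: space_PiM space_leb)
    have "(\<Sum>x'\<in>UNIV. ennreal (Q $ x (k + 2) $ x') * (\<integral>\<^sup>+y'. ennreal (cosh (l * L2_set (\<lambda>i. V k x y i + inc (y (k + 1)) (y (k + 2)) (x (k + 2)) x' y' i) II)) \<partial>em x'))
      \<le> ennreal (exp (l\<^sup>2 * c\<^sup>2) * cosh (l * L2_set (V k x y) II))"
      by (intro nn_integral_cosh_step Q_row prob_space_em inc_integrable inc_mean l)
        (simp_all add: c_def L2_set_inc y del: add_2_eq_Suc')
    then show "(\<Sum>x'\<in>UNIV. ennreal (Q $ x (k + 2) $ x') * (\<integral>\<^sup>+y'. ennreal (cosh (l * L2_set (V (Suc k) (x(Suc (k + 2) := x')) (y(Suc (k + 2) := y'))) II)) \<partial>em x'))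
      \<le> ennreal (exp (l\<^sup>2 * c\<^sup>2)) * ennreal (cosh (l * L2_set (V k x y) II))"
      unfolding k3 V_Suc[abs_def] by (simp add: ennreal_mult cosh_real_nonneg)
  qed simp
  also have "\<dots> \<le> ennreal (exp (l\<^sup>2 * c\<^sup>2)) * (ennreal (exp (l\<^sup>2 * c\<^sup>2)) ^ k * ennreal (cosh (l * c)))"
    by (rule mult_left_mono[OF Suc]) simp
  finally show ?case by (simp add: mult.assoc)
qed

lemma obs_apply: "s \<in> {1..n} \<Longrightarrow> obs n \<omega> s = Y s \<omega>"
  by (simp add: obs_def)

text \<open>Markov's inequality for cosh(l |V|). Of the constant 5, four parts are the deviation of
  the martingale; the fifth covers the difference between the martingale and the sum, at most c <= c
  sqrt(p u).\<close>

lemma deviation_probability: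
  assumes p: "1 \<le> p" and u: "1 \<le> u"
  defines "c \<equiv> (6 + 4 * cH) * \<eta>"
  defines "E \<equiv> {\<omega> \<in> space \<Omega>. L2_set (\<lambda>i. \<Sum>s=1..p. t0 (Y s \<omega>) (Y (s + 1) \<omega>) (Y (s + 2) \<omega>) i - tm i) II
      \<le> 5 * c * sqrt (p * u)}"
  shows "E \<in> events" "prob (space \<Omega> - E) \<le> exp (- u)"
proof -
  have cH: "0 \<le> cH" by (simp add: cH_def)
  have c0: "0 \<le> c" unfolding c_def using cH eta_nonneg by simp
  define S where "S \<omega> i = (\<Sum>s=1..p. t0 (Y s \<omega>) (Y (s + 1) \<omega>) (Y (s + 2) \<omega>) i - tm i)" for \<omega> i
  have \<phi>m: "(\<lambda>\<omega>. \<phi> a (Y s \<omega>)) \<in> borel_measurable \<Omega>" if "a \<le> M" "1 \<le> s" for a s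
    by (rule measurable_compose[OF Y_measurable[OF that(2)] \<phi>_measurable[OF that(1)]])
  have "(\<lambda>\<omega>. S \<omega> i) \<in> borel_measurable \<Omega>" if "i \<in> II" for i
  proof -
    obtain a b c where i: "i = (a, b, c)" by (cases i)
    then show ?thesis using that unfolding S_def t0_def i prod.case
      by (intro borel_measurable_sum borel_measurable_diff borel_measurable_times borel_measurable_const \<phi>m) auto
  qed
  then have [measurable]: "(\<lambda>\<omega>. \<Sum>i\<in>II. (S \<omega> i)\<^sup>2) \<in> borel_measurable \<Omega>"
    by (intro borel_measurable_sum borel_measurable_power)
  have [measurable]: "(\<lambda>\<omega>. L2_set (S \<omega>) II) \<in> borel_measurable \<Omega>"
    unfolding L2_set_def by measurable
  have E: "E = {\<omega> \<in> space \<Omega>. L2_set (S \<omega>) II \<le> 5 * c * sqrt (p * u)}"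
    unfolding E_def S_def ..
  show "E \<in> events" unfolding E by measurable
  show "prob (space \<Omega> - E) \<le> exp (- u)"
  \<comment> \<open>The parameter \<open>l\<close> below divides by \<open>c\<close>. For \<eta> = 0
    all the tensors coincide on the index set and the sum vanishes.\<close>
  proof (cases "\<eta> = 0")
    case True
    have "L2_set (S \<omega>) II \<le> 0" if w: "\<omega> \<in> space \<Omega>" for \<omega>
    proof -
      have "L2_set (\<lambda>i. t0 (Y s \<omega>) (Y (s + 1) \<omega>) (Y (s + 2) \<omega>) i - tm i) II \<le> 0" if "1 \<le> s" for s
        using near_diff[OF near_t0 near_tm, of "Y s \<omega>" "Y (s + 1) \<omega>" "Y (s + 2) \<omega>"] Y_in[OF _ w] that True by simp
      moreover have "L2_set (S \<omega>) II \<le> (\<Sum>s\<in>{1..p}. L2_set (\<lambda>i. t0 (Y s \<omega>) (Y (s + 1) \<omega>) (Y (s + 2) \<omega>) i - tm i) II)"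
        unfolding S_def using L2_set_sum_scale_le[of "{1..p}" "\<lambda>_. 1" "\<lambda>s i. t0 (Y s \<omega>) (Y (s + 1) \<omega>) (Y (s + 2) \<omega>) i - tm i" II] by simp
      ultimately show ?thesis by (meson atLeastAtMost_iff order_trans sum_nonpos)
    qed
    then have "space \<Omega> - E = {}" unfolding E by (auto simp: c_def True)
    then show ?thesis by (simp only: measure_empty exp_ge_zero)
  next
    case False
    then have c: "0 < c" unfolding c_def using cH eta_nonneg by (intro mult_pos_pos) auto
    define r where "r = sqrt (p * u)"
    have pu: "1 \<le> real p * u" using p u mult_mono[of 1 "real p" 1 u] by simp
    have r: "1 \<le> r" "r\<^sup>2 = p * u" using pu u by (auto simp: r_def)
    \<comment> \<open>Gives l^2 c^2 = u / p, and l t = 4 u for t = 4 c r, so that (p + 1) l^2 c^2 -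
      l t is at most 2 u - 4 u. The factor 2 arising from 1 / cosh is then absorbed, since 2 exp(-u)
      <= 1 for u >= 1.\<close>
    define l where "l = r / (c * p)"
    have l: "0 \<le> l" using r c by (simp add: l_def)
    define t where "t = 4 * c * r"
    have t: "0 \<le> t" using c r by (simp add: t_def)
    let ?V = "\<lambda>\<omega>. L2_set (V p (states (p + 2) \<omega>) (obs (p + 2) \<omega>)) II"
    define g where "g \<omega> = ennreal (cosh (l * ?V \<omega>))" for \<omega>
    have SV: "L2_set (S \<omega>) II \<le> ?V \<omega> + c" if w: "\<omega> \<in> space \<Omega>" for \<omega>
    proof -
      let ?o = "obs (p + 2) \<omega>"
      let ?R = "\<lambda>i. (t1 (?o (p + 1)) (?o (p + 2)) (states (p + 2) \<omega> (p + 2)) i - tm i) + (t2 (?o (p + 2)) (states (p + 2) \<omega> (p + 2)) i - tm i) + h i (states (p + 2) \<omega> (p + 2))"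
      have "S \<omega> i = (\<Sum>s=1..p. t0 (?o s) (?o (s + 1)) (?o (s + 2)) i - tm i)" for i
        unfolding S_def by (intro sum.cong) (auto simp: obs_apply)
      then have S_eq: "S \<omega> = (\<lambda>i. V p (states (p + 2) \<omega>) ?o i - ?R i)"
        by (auto simp: V_def fun_eq_iff)
      have "L2_set (S \<omega>) II \<le> ?V \<omega> + L2_set ?R II" unfolding S_eq by (rule L2_set_diff_triangle)
      moreover have "L2_set ?R II \<le> (4 + 2 * cH) * \<eta>"
        by (rule L2_set_remainder) (auto simp: obs_apply Y_in[OF _ w])
      moreover have "(4 + 2 * cH) * \<eta> \<le> c" unfolding c_def using cH eta_nonneg by (intro mult_right_mono) auto
      ultimately show ?thesis by linarith
    qed
    have sub: "space \<Omega> - E \<subseteq> {\<omega> \<in> space \<Omega>. 1 \<le> ennreal (1 / cosh (l * t)) * g \<omega>}"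
    proof
      fix \<omega> assume w: "\<omega> \<in> space \<Omega> - E"
      then have "5 * c * r < L2_set (S \<omega>) II" unfolding E r_def by auto
      also have "\<dots> \<le> ?V \<omega> + c" using w by (intro SV) auto
      also have "c \<le> c * r" using r c by simp
      finally have "t \<le> ?V \<omega>" unfolding t_def by simp
      then have "cosh (l * t) \<le> cosh (l * ?V \<omega>)"
        using l t by (subst cosh_real_nonneg_le_iff) (auto intro!: mult_left_mono)
      then have "1 \<le> 1 / cosh (l * t) * cosh (l * ?V \<omega>)"
        using cosh_real_pos[of "l * t"] by (simp add: field_simps)
      then have "ennreal 1 \<le> ennreal (1 / cosh (l * t) * cosh (l * ?V \<omega>))" by (rule ennreal_leI)
      then show "\<omega> \<in> {\<omega> \<in> space \<Omega>. 1 \<le> ennreal (1 / cosh (l * t)) * g \<omega>}"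
        using w by (subst (asm) ennreal_mult') (auto simp only: g_def ennreal_1 Diff_iff mem_Collect_eq zero_le_divide_1_iff cosh_real_nonneg)
    qed
    have gm: "g \<in> borel_measurable \<Omega>"
    proof -
      have "g \<omega> = (\<Sum>x\<in>{1..p + 2} \<rightarrow>\<^sub>E UNIV. indicator (path_event (p + 2) x) \<omega> * ennreal (cosh (l * L2_set (V p x (obs (p + 2) \<omega>)) II)))"
        if "\<omega> \<in> space \<Omega>" for \<omega>
        unfolding g_def by (rule states_eq_sum[OF that, of "\<lambda>x. ennreal (cosh (l * L2_set (V p x (obs (p + 2) \<omega>)) II))"])
      moreover have "(\<lambda>\<omega>. \<Sum>x\<in>{1..p + 2} \<rightarrow>\<^sub>E UNIV. indicator (path_event (p + 2) x) \<omega> * ennreal (cosh (l * L2_set (V p x (obs (p + 2) \<omega>)) II))) \<in> borel_measurable \<Omega>"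
        by (intro borel_measurable_sum borel_measurable_times_ennreal borel_measurable_indicator path_event_sets
            measurable_compose[OF obs_measurable L2_set_V_measurable])
      ultimately show ?thesis by (simp cong: measurable_cong)
    qed
    have "emeasure \<Omega> (space \<Omega> - E) \<le> emeasure \<Omega> {\<omega> \<in> space \<Omega>. 1 \<le> ennreal (1 / cosh (l * t)) * g \<omega>}"
      using sub gm by (intro emeasure_mono) measurable
    also have "\<dots> \<le> ennreal (1 / cosh (l * t)) * (\<integral>\<^sup>+\<omega>. g \<omega> * indicator (space \<Omega>) \<omega> \<partial>\<Omega>)"
      by (rule nn_integral_Markov_inequality) (use gm in auto)
    also have "(\<integral>\<^sup>+\<omega>. g \<omega> * indicator (space \<Omega>) \<omega> \<partial>\<Omega>) = (\<integral>\<^sup>+\<omega>. g \<omega> \<partial>\<Omega>)"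
      by (intro nn_integral_cong) auto
    also have "\<dots> = expect (p + 2) (\<lambda>x y. ennreal (cosh (l * L2_set (V p x y) II)))"
      unfolding g_def by (rule nn_integral_eq_expect, simp) (rule L2_set_V_measurable)
    also have "\<dots> \<le> ennreal (exp (l\<^sup>2 * c\<^sup>2)) ^ p * ennreal (cosh (l * c))"
      unfolding c_def by (rule expect_cosh_V[OF l])
    finally have "emeasure \<Omega> (space \<Omega> - E) \<le> ennreal (1 / cosh (l * t)) * (ennreal (exp (l\<^sup>2 * c\<^sup>2)) ^ p * ennreal (cosh (l * c)))"
      by (simp add: mult_left_mono)
    also have "\<dots> = ennreal (1 / cosh (l * t) * (exp (l\<^sup>2 * c\<^sup>2) ^ p * cosh (l * c)))"
      by (subst ennreal_mult', simp add: cosh_real_nonneg, subst ennreal_mult', simp, subst ennreal_power, simp, rule refl)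
    finally have 1: "prob (space \<Omega> - E) \<le> 1 / cosh (l * t) * (exp (l\<^sup>2 * c\<^sup>2) ^ p * cosh (l * c))"
      unfolding emeasure_eq_measure by (subst (asm) ennreal_le_iff) (auto simp: cosh_real_nonneg)
    have m1: "1 / cosh (l * t) \<le> 2 * exp (- (l * t))"
    proof -
      have "exp (l * t) / 2 \<le> cosh (l * t)" by (simp add: cosh_field_def)
      then have "1 / cosh (l * t) \<le> 1 / (exp (l * t) / 2)" by (intro divide_left_mono) (auto intro!: mult_pos_pos)
      then show ?thesis by (simp add: exp_minus field_simps)
    qed
    have m2: "exp (l\<^sup>2 * c\<^sup>2) ^ p * cosh (l * c) \<le> exp (p * (l\<^sup>2 * c\<^sup>2)) * exp (l\<^sup>2 * c\<^sup>2)"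
      using cosh_le_exp_sq[of "l * c"] by (simp add: exp_of_nat_mult power_mult_distrib)
    have "1 / cosh (l * t) * (exp (l\<^sup>2 * c\<^sup>2) ^ p * cosh (l * c)) \<le> 2 * exp (- (l * t)) * (exp (p * (l\<^sup>2 * c\<^sup>2)) * exp (l\<^sup>2 * c\<^sup>2))"
      by (rule mult_mono[OF m1 m2]) (simp_all add: cosh_real_nonneg)
    also have "\<dots> = 2 * exp ((p + 1) * (l\<^sup>2 * c\<^sup>2) - l * t)"
      by (simp add: exp_diff exp_minus exp_add[symmetric] distrib_right field_simps)
    also have "(p + 1) * (l\<^sup>2 * c\<^sup>2) - l * t \<le> - 2 * u"
    proof -
      have "l\<^sup>2 * c\<^sup>2 = r\<^sup>2 / (real p)\<^sup>2" using c by (simp add: l_def power_divide power_mult_distrib)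
      then have lc: "l\<^sup>2 * c\<^sup>2 = u / p" unfolding r(2) using p by (simp add: power2_eq_square)
      have "l * t = 4 * (r\<^sup>2 / p)" using c p by (simp add: l_def t_def field_simps power2_eq_square)
      then have lt: "l * t = 4 * u" using p by (simp add: r(2))
      have "(p + 1) * (u / p) \<le> 2 * u" using p u by (simp add: field_simps)
      then show ?thesis unfolding lc lt by linarith
    qed
    finally have "prob (space \<Omega> - E) \<le> 2 * exp (- 2 * u)" using 1 by simp
    also have "\<dots> = (2 * exp (- u)) * exp (- u)" by (simp flip: exp_add)
    also have "\<dots> \<le> 1 * exp (- u)"
    proof (intro mult_right_mono)
      have "2 \<le> exp u" using exp_ge_add_one_self[of u] u by linarith
      then show "2 * exp (- u) \<le> 1" by (simp add: exp_minus field_simps)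
    qed simp
    finally show ?thesis by simp
  qed
qed

end

subsection \<open>Small ball probability of a uniform orthogonal matrix\<close>

lemma card_le_of_diameter:
  fixes S :: "nat set"
  assumes "finite S" and "0 \<le> L" and d: "\<And>s s'. s \<in> S \<Longrightarrow> s' \<in> S \<Longrightarrow> real s - real s' \<le> L"
  shows "real (card S) \<le> L + 1"
proof (cases "S = {}")
  case False
  have "S \<subseteq> {Min S..Max S}" using assms(1) by auto
  then have "card S \<le> card {Min S..Max S}" by (intro card_mono) auto
  then have "real (card S) \<le> real (Max S) - real (Min S) + 1"
    using Max_ge[OF assms(1) Min_in[OF assms(1) False]] by (simp add: of_nat_diff Suc_diff_le)
  also have "\<dots> \<le> L + 1" using d[of "Max S" "Min S"] False assms(1) by simp
  finally show ?thesis .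
qed (use assms in simp)

lemma exists_large_coordinate:
  fixes \<theta> :: "real^'k" assumes "norm \<theta> = 1"
  obtains i where "1 \<le> sqrt (real CARD('k)) * \<bar>\<theta> $ i\<bar>"
proof -
  have "\<exists>i. 1 / real CARD('k) \<le> (\<theta> $ i)\<^sup>2"
  proof (rule ccontr)
    assume "\<not> ?thesis"
    then have "(\<Sum>i\<in>UNIV. (\<theta> $ i)\<^sup>2) < (\<Sum>i\<in>(UNIV :: 'k set). 1 / real CARD('k))"
      by (intro sum_strict_mono) (auto simp: not_le)
    then show False using assms norm_vec_sq[of \<theta>] by simp
  qed
  then obtain i where "1 / real CARD('k) \<le> (\<theta> $ i)\<^sup>2" by blast
  then have "1 \<le> real CARD('k) * (\<theta> $ i)\<^sup>2" by (simp add: field_simps)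
  then have "sqrt 1 \<le> sqrt (real CARD('k) * (\<theta> $ i)\<^sup>2)" by (rule real_sqrt_le_mono)
  then show ?thesis using that[of i] by (simp add: real_sqrt_mult)
qed

definition grid :: "nat \<Rightarrow> ('k \<Rightarrow> nat) set" where "grid n = UNIV \<rightarrow>\<^sub>E {1..n}"

text \<open>A unit vector \<theta> has a coordinate \<open>i\<close> of size at least 1 / sqrt K,
  and grid points have norm at most n sqrt K. So each of the n^(K - 1) grid lines in direction
  \<open>i\<close> meets the slab in points whose coordinates differ by at most 2 t n K.\<close>

lemma grid_slab_count:
  fixes \<theta> :: "real^'k"
  assumes \<theta>: "norm \<theta> = 1" and t: "0 \<le> t"
  shows "real (card {g \<in> grid n. \<bar>\<theta> \<bullet> (\<chi> i. real (g i))\<bar> < t * norm (\<chi> i. real (g i) :: real^'k)})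
    \<le> real n ^ (CARD('k) - 1) * (2 * t * n * CARD('k) + 1)"
proof -
  obtain i where i: "1 \<le> sqrt (real CARD('k)) * \<bar>\<theta> $ i\<bar>" using exists_large_coordinate[OF \<theta>] .
  let ?r = "sqrt (real CARD('k))"
  define T where "T = t * (n * ?r)"
  define B where "B = {g \<in> grid n. \<bar>\<theta> \<bullet> (\<chi> i. real (g i))\<bar> < t * norm (\<chi> i. real (g i) :: real^'k)}"
  have T: "0 \<le> T" using t by (simp add: T_def)
  have nrm: "norm (\<chi> i. real (g i) :: real^'k) \<le> n * ?r" if "g \<in> grid n" for g
  proof (rule power2_le_imp_le)
    have "(norm (\<chi> i. real (g i) :: real^'k))\<^sup>2 = (\<Sum>i\<in>UNIV. (real (g i))\<^sup>2)" by (simp add: norm_vec_sq)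
    also have "\<dots> \<le> (\<Sum>i\<in>(UNIV :: 'k set). (real n)\<^sup>2)"
      using that by (intro sum_mono power_mono) (auto simp: grid_def PiE_iff)
    finally show "(norm (\<chi> i. real (g i) :: real^'k))\<^sup>2 \<le> (n * ?r)\<^sup>2" by (simp add: power_mult_distrib mult.commute)
  qed simp
  have ins: "(UNIV :: 'k set) = insert i (UNIV - {i})" by auto
  let ?H = "(UNIV - {i}) \<rightarrow>\<^sub>E {1..n}"
  have inj: "inj_on (\<lambda>(y, g). g(i := y)) ({1..n} \<times> ?H)" by (rule inj_combinator) simp
  have grid: "grid n = (\<lambda>(y, g). g(i := y)) ` ({1..n} \<times> ?H)"
    unfolding grid_def by (subst ins, subst PiE_insert_eq) simp
  have finH: "finite ?H" by (intro finite_PiE) auto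
  have fin: "finite (grid n :: ('k \<Rightarrow> nat) set)" unfolding grid_def by (intro finite_PiE) auto
  have "real (card B) = (\<Sum>g\<in>grid n. if g \<in> B then 1 else 0)"
    using fin by (simp add: B_def sum.If_cases Int_def)
  also have "\<dots> = (\<Sum>(y, g)\<in>{1..n} \<times> ?H. if g(i := y) \<in> B then 1 else 0)"
    unfolding grid by (subst sum.reindex[OF inj]) (simp add: split_def)
  also have "\<dots> = (\<Sum>g\<in>?H. \<Sum>y\<in>{1..n}. if g(i := y) \<in> B then 1 else 0)"
    by (subst sum.cartesian_product[symmetric], rule sum.swap)
  also have "\<dots> = (\<Sum>g\<in>?H. real (card {y \<in> {1..n}. g(i := y) \<in> B}))"
    by (simp add: sum.If_cases Int_def)
  also have "\<dots> \<le> (\<Sum>g\<in>?H. 2 * t * n * CARD('k) + 1)"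
  proof (rule sum_mono)
    fix g assume g: "g \<in> ?H"
    show "real (card {y \<in> {1..n}. g(i := y) \<in> B}) \<le> 2 * t * n * CARD('k) + 1"
    proof (rule card_le_of_diameter)
      fix s s' assume s: "s \<in> {y \<in> {1..n}. g(i := y) \<in> B}" and s': "s' \<in> {y \<in> {1..n}. g(i := y) \<in> B}"
      have lt: "\<bar>\<theta> \<bullet> (\<chi> j. real ((g(i := y)) j))\<bar> \<le> T" if "g(i := y) \<in> B" for y
      proof -
        have "\<bar>\<theta> \<bullet> (\<chi> j. real ((g(i := y)) j))\<bar> \<le> t * norm (\<chi> j. real ((g(i := y)) j) :: real^'k)"
          using that unfolding B_def by auto
        also have "\<dots> \<le> T" unfolding T_def using that t by (intro mult_left_mono nrm) (auto simp: B_def simp del: fun_upd_apply)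
        finally show ?thesis .
      qed
      have "\<theta> \<bullet> (\<chi> j. real ((g(i := y)) j)) = \<theta> $ i * y + (\<Sum>j\<in>UNIV - {i}. \<theta> $ j * g j)" for y
      proof -
        have "\<theta> \<bullet> (\<chi> j. real ((g(i := y)) j)) = (\<Sum>j\<in>UNIV. \<theta> $ j * real ((g(i := y)) j))" by (simp add: inner_vec_def)
        also have "\<dots> = \<theta> $ i * y + (\<Sum>j\<in>UNIV - {i}. \<theta> $ j * real ((g(i := y)) j))"
          by (subst sum.remove[of _ i]) auto
        also have "(\<Sum>j\<in>UNIV - {i}. \<theta> $ j * real ((g(i := y)) j)) = (\<Sum>j\<in>UNIV - {i}. \<theta> $ j * g j)"
          by (intro sum.cong) auto
        finally show ?thesis .
      qed
      then have "\<theta> $ i * (real s - real s') = \<theta> \<bullet> (\<chi> j. real ((g(i := s)) j)) - \<theta> \<bullet> (\<chi> j. real ((g(i := s')) j))"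
        by (simp add: right_diff_distrib)
      then have "\<bar>\<theta> $ i\<bar> * \<bar>real s - real s'\<bar> \<le> 2 * T"
        using lt[of s] lt[of s'] s s' by (simp add: abs_mult[symmetric])
      then have "?r * (\<bar>\<theta> $ i\<bar> * \<bar>real s - real s'\<bar>) \<le> ?r * (2 * T)" by (intro mult_left_mono) auto
      moreover have "1 * \<bar>real s - real s'\<bar> \<le> (?r * \<bar>\<theta> $ i\<bar>) * \<bar>real s - real s'\<bar>" using i by (intro mult_right_mono) auto
      ultimately have "\<bar>real s - real s'\<bar> \<le> ?r * (2 * T)" unfolding mult.assoc mult_1 by (rule order_trans[rotated])
      also have "\<dots> = 2 * t * n * CARD('k)" by (simp add: T_def mult_ac)
      finally show "real s - real s' \<le> 2 * t * n * CARD('k)" by linarith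
    qed (use t in auto)
  qed
  also have "\<dots> = real n ^ (CARD('k) - 1) * (2 * t * n * CARD('k) + 1)"
    by (simp add: card_PiE card_Diff_singleton)
  finally show ?thesis unfolding B_def .
qed

lemma column_measurable:
  assumes "\<Theta> \<in> borel_measurable M" "w \<in> borel_measurable M"
  shows "(\<lambda>\<omega>. column x (\<Theta> \<omega> :: real^'k^'k) \<bullet> (w \<omega> :: real^'k)) \<in> borel_measurable M"
proof -
  have "continuous_on UNIV (\<lambda>A :: real^'k^'k. column x A)"
    unfolding column_def by (intro continuous_intros)
  then have "(\<lambda>A :: real^'k^'k. column x A) \<in> borel_measurable borel" by (rule borel_measurable_continuous_onI)
  from measurable_compose[OF assms(1) this] assms(2) show ?thesis by (rule borel_measurable_inner)
qed

text \<open>The probability is the same for all \<open>v\<close>; average it over a grid of integer vectors \<open>v\<close>.\<close>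

lemma uniform_orthogonal_small_ball:
  fixes \<Theta> :: "'w \<Rightarrow> real^'k^'k" and v :: "real^'k"
  assumes ps: "prob_space \<Omega>" and u: "uniform_orthogonal \<Omega> \<Theta>" and t: "0 \<le> t"
  shows "measure \<Omega> {\<omega> \<in> space \<Omega>. \<bar>column x (\<Theta> \<omega>) \<bullet> v\<bar> < t * norm v} \<le> 2 * t * CARD('k)"
proof (cases "v = 0")
  case True
  then show ?thesis using t by simp
next
  case False
  interpret prob_space \<Omega> by fact
  define P where "P v = measure \<Omega> {\<omega> \<in> space \<Omega>. \<bar>column x (\<Theta> \<omega>) \<bullet> v\<bar> < t * norm v}" for v :: "real^'k"
  have \<Theta>: "\<Theta> \<in> borel_measurable \<Omega>" and orth: "\<And>\<omega>. \<omega> \<in> space \<Omega> \<Longrightarrow> orthogonal_matrix (\<Theta> \<omega>)"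
    and inv: "\<And>W. orthogonal_matrix W \<Longrightarrow> distr \<Omega> borel (\<lambda>\<omega>. W ** \<Theta> \<omega>) = distr \<Omega> borel \<Theta>"
    using u by (auto simp: uniform_orthogonal_def)
  have m: "{\<omega> \<in> space \<Omega>. \<bar>column x (\<Theta> \<omega>) \<bullet> w\<bar> < t * norm w} \<in> events" for w
  proof -
    have [measurable]: "(\<lambda>\<omega>. column x (\<Theta> \<omega>) \<bullet> w) \<in> borel_measurable \<Omega>" by (rule column_measurable[OF \<Theta>]) simp
    show ?thesis by measurable
  qed
  \<comment> \<open>An orthogonal matrix taking \<open>w'\<close> to \<open>w\<close> leaves the law
    of \<Theta> unchanged when applied from the left. It acts on each column separately, so it turns
    inner products with \<open>w\<close> into inner products with \<open>w'\<close>.\<close>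
  have eq_norm: "P w = P w'" if nw: "norm w = norm w'" for w w'
  proof -
    obtain h where h: "orthogonal_transformation h" "h w' = w"
      by (rule orthogonal_transformation_exists[OF nw[symmetric]])
    let ?W = "matrix h"
    have W: "orthogonal_matrix ?W" and Ww: "?W *v w' = w"
      using h by (auto simp: orthogonal_transformation_matrix matrix_works)
    let ?S = "{A :: real^'k^'k. \<bar>column x A \<bullet> w\<bar> < t * norm w}"
    have S: "?S \<in> sets borel"
    proof -
      have [measurable]: "(\<lambda>A :: real^'k^'k. column x A \<bullet> w) \<in> borel_measurable borel" by (rule column_measurable) auto
      show ?thesis by measurable
    qed
    have tm: "(\<lambda>\<omega>. ?W ** \<Theta> \<omega>) \<in> borel_measurable \<Omega>"
    proof -
      have "continuous_on UNIV (\<lambda>A. ?W ** A)"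
        unfolding matrix_matrix_mult_def by (intro continuous_intros)
      from measurable_compose[OF \<Theta> borel_measurable_continuous_onI[OF this]] show ?thesis .
    qed
    have "column x (?W ** A) \<bullet> w = column x A \<bullet> w'" for A :: "real^'k^'k"
    proof -
      have "column x (?W ** A) = ?W *v column x A"
        by (simp add: vec_eq_iff column_def matrix_matrix_mult_def matrix_vector_mult_def)
      then have "column x (?W ** A) \<bullet> w = (?W *v column x A) \<bullet> (?W *v w')" by (simp add: Ww)
      also have "\<dots> = column x A \<bullet> w'"
        using h(1) by (simp add: orthogonal_transformation_def matrix_works[of h] orthogonal_transformation_linear)
      finally show ?thesis .
    qed
    then have "P w' = measure (distr \<Omega> borel (\<lambda>\<omega>. ?W ** \<Theta> \<omega>)) ?S"
      using S tm nw by (simp add: P_def measure_distr vimage_def Int_def conj_commute)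
    also have "\<dots> = P w" unfolding inv[OF W]
      using S \<Theta> by (simp add: P_def measure_distr vimage_def Int_def conj_commute)
    finally show ?thesis by simp
  qed
  have eq: "P v = P w" if "w \<noteq> 0" for w
  proof -
    let ?s = "norm v / norm w"
    have s: "0 < ?s" using that False by simp
    have "P v = P (?s *\<^sub>R w)" using that by (intro eq_norm) simp
    also have "\<dots> = P w"
    proof -
      have "\<bar>a \<bullet> (?s *\<^sub>R w)\<bar> < t * norm (?s *\<^sub>R w) \<longleftrightarrow> \<bar>a \<bullet> w\<bar> < t * norm w" for a :: "real^'k"
      proof -
        have "\<bar>a \<bullet> (?s *\<^sub>R w)\<bar> = ?s * \<bar>a \<bullet> w\<bar>" "t * norm (?s *\<^sub>R w) = ?s * (t * norm w)"
          using s by (simp_all add: abs_mult)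
        then show ?thesis using s by (metis mult_less_cancel_left_pos)
      qed
      then show ?thesis by (simp only: P_def)
    qed
    finally show ?thesis .
  qed
  \<comment> \<open>All n^K grid points are non-zero, as their coordinates start at 1, so they share
    the value of \<open>P\<close>. For every outcome at most n^(K - 1) (2 t n K + 1) of them lie in
    the slab; dividing by n^K leaves 2 t K + 1 / n.\<close>
  have bound: "P v \<le> 2 * t * CARD('k) + 1 / n" if n: "1 \<le> n" for n :: nat
  proof -
    let ?G = "grid n :: ('k \<Rightarrow> nat) set"
    let ?v = "\<lambda>g :: 'k \<Rightarrow> nat. \<chi> i. real (g i) :: real^'k"
    let ?A = "\<lambda>g. {\<omega> \<in> space \<Omega>. \<bar>column x (\<Theta> \<omega>) \<bullet> ?v g\<bar> < t * norm (?v g)}"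
    have fin: "finite ?G" unfolding grid_def by (intro finite_PiE) auto
    have card: "card ?G = n ^ CARD('k)" by (simp add: grid_def card_PiE)
    have ii: "integrable \<Omega> (indicator (?A g) :: 'w \<Rightarrow> real)" for g
      by (rule integrable_real_indicator) (use m in \<open>auto simp: less_top[symmetric]\<close>)
    have nz: "?v g \<noteq> 0" if "g \<in> ?G" for g
      using that by (fastforce simp: grid_def PiE_iff vec_eq_iff)
    have "real (card ?G) * P v = (\<Sum>g\<in>?G. P v)" by simp
    also have "\<dots> = (\<Sum>g\<in>?G. P (?v g))" by (intro sum.cong refl eq nz)
    also have "\<dots> = (\<Sum>g\<in>?G. expectation (indicator (?A g)))" using m by (simp add: P_def)
    also have "\<dots> = expectation (\<lambda>\<omega>. \<Sum>g\<in>?G. indicator (?A g) \<omega>)"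
      by (intro Bochner_Integration.integral_sum[symmetric] ii)
    also have "\<dots> \<le> expectation (\<lambda>_. real n ^ (CARD('k) - 1) * (2 * t * n * CARD('k) + 1))"
    proof (rule integral_mono[OF Bochner_Integration.integrable_sum[OF ii] integrable_const])
      fix \<omega> assume w: "\<omega> \<in> space \<Omega>"
      have "norm (column x (\<Theta> \<omega>)) = 1" using orth[OF w] by (simp add: orthogonal_matrix_orthonormal_columns)
      moreover have "(\<Sum>g\<in>?G. indicator (?A g) \<omega>) = real (card {g \<in> ?G. \<bar>column x (\<Theta> \<omega>) \<bullet> ?v g\<bar> < t * norm (?v g)})"
        using w fin by (simp add: indicator_def sum.If_cases Int_def)
      ultimately show "(\<Sum>g\<in>?G. indicator (?A g) \<omega>) \<le> real n ^ (CARD('k) - 1) * (2 * t * n * CARD('k) + 1)"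
        using grid_slab_count[OF _ t, of "column x (\<Theta> \<omega>)" n] by simp
    qed
    also have "\<dots> = real n ^ (CARD('k) - 1) * (2 * t * n * CARD('k) + 1)" by (simp add: prob_space)
    finally have "real n ^ CARD('k) * P v \<le> real n ^ (CARD('k) - 1) * (2 * t * n * CARD('k) + 1)" by (simp add: card)
    moreover have "real n ^ CARD('k) = real n ^ (CARD('k) - 1) * n"
      by (metis power_minus_mult zero_less_card_finite)
    ultimately have "n * P v \<le> 2 * t * n * CARD('k) + 1" using n by (simp add: mult.assoc)
    then show ?thesis using n by (simp add: field_simps)
  qed
  have "P v \<le> 2 * t * CARD('k)"
  proof (rule field_le_epsilon)
    fix e :: real assume "0 < e"
    then obtain n where "inverse (real (Suc n)) < e" using reals_Archimedean by blast
    then show "P v \<le> 2 * t * CARD('k) + e" using bound[of "Suc n"] by (simp add: One_nat_def inverse_eq_divide)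
  qed
  then show ?thesis by (simp add: P_def)
qed

text \<open>By independence the joint law of \<open>Z\<close> and \<Theta> is a product, and Fubini
  freezes the direction \<open>w (Z \<omega>)\<close> while \<Theta> is integrated. This is how a
  direction depending on the observations is dealt with.\<close>

lemma independent_small_ball:
  fixes \<Theta> :: "'w \<Rightarrow> real^'k^'k" and w :: "'z \<Rightarrow> real^'k"
  assumes ps: "prob_space \<Omega>" and u: "uniform_orthogonal \<Omega> \<Theta>" and t: "0 \<le> t"
    and Z: "Z \<in> measurable \<Omega> S"
    and ind: "\<And>A B. A \<in> sets S \<Longrightarrow> B \<in> sets borel \<Longrightarrow>
      measure \<Omega> ((Z -` A \<inter> space \<Omega>) \<inter> (\<Theta> -` B \<inter> space \<Omega>)) = measure \<Omega> (Z -` A \<inter> space \<Omega>) * measure \<Omega> (\<Theta> -` B \<inter> space \<Omega>)"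
    and w: "w \<in> borel_measurable S"
  shows "{\<omega> \<in> space \<Omega>. \<bar>column x (\<Theta> \<omega>) \<bullet> w (Z \<omega>)\<bar> < t * norm (w (Z \<omega>))} \<in> sets \<Omega>"
    and "measure \<Omega> {\<omega> \<in> space \<Omega>. \<bar>column x (\<Theta> \<omega>) \<bullet> w (Z \<omega>)\<bar> < t * norm (w (Z \<omega>))} \<le> 2 * t * CARD('k)"
proof -
  interpret prob_space \<Omega> by fact
  have \<Theta>: "\<Theta> \<in> borel_measurable \<Omega>" using u by (simp add: uniform_orthogonal_def)
  interpret T: prob_space "distr \<Omega> borel \<Theta>" by (rule prob_space_distr[OF \<Theta>])
  interpret D: prob_space "distr \<Omega> S Z" by (rule prob_space_distr[OF Z])
  have joint: "distr \<Omega> S Z \<Otimes>\<^sub>M distr \<Omega> borel \<Theta> = distr \<Omega> (S \<Otimes>\<^sub>M borel) (\<lambda>\<omega>. (Z \<omega>, \<Theta> \<omega>))"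
  proof (rule pair_measure_eqI)
    show "sigma_finite_measure (distr \<Omega> S Z)" "sigma_finite_measure (distr \<Omega> borel \<Theta>)" by unfold_locales
    show "sets (distr \<Omega> S Z \<Otimes>\<^sub>M distr \<Omega> borel \<Theta>) = sets (distr \<Omega> (S \<Otimes>\<^sub>M borel) (\<lambda>\<omega>. (Z \<omega>, \<Theta> \<omega>)))"
      unfolding sets_distr by (rule sets_pair_measure_cong) auto
    fix A B assume "A \<in> sets (distr \<Omega> S Z)" "B \<in> sets (distr \<Omega> borel \<Theta>)"
    then have A: "A \<in> sets S" and B: "B \<in> sets borel" by auto
    have "emeasure (distr \<Omega> (S \<Otimes>\<^sub>M borel) (\<lambda>\<omega>. (Z \<omega>, \<Theta> \<omega>))) (A \<times> B) = emeasure \<Omega> ((\<lambda>\<omega>. (Z \<omega>, \<Theta> \<omega>)) -` (A \<times> B) \<inter> space \<Omega>)"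
      using Z \<Theta> A B by (intro emeasure_distr) auto
    also have "(\<lambda>\<omega>. (Z \<omega>, \<Theta> \<omega>)) -` (A \<times> B) \<inter> space \<Omega> = (Z -` A \<inter> space \<Omega>) \<inter> (\<Theta> -` B \<inter> space \<Omega>)" by auto
    finally show "emeasure (distr \<Omega> S Z) A * emeasure (distr \<Omega> borel \<Theta>) B
        = emeasure (distr \<Omega> (S \<Otimes>\<^sub>M borel) (\<lambda>\<omega>. (Z \<omega>, \<Theta> \<omega>))) (A \<times> B)"
      using Z \<Theta> A B by (simp add: emeasure_distr emeasure_eq_measure ind ennreal_mult)
  qed
  let ?B = "{p \<in> space (S \<Otimes>\<^sub>M (borel :: (real^'k^'k) measure)). \<bar>column x (snd p) \<bullet> w (fst p)\<bar> < t * norm (w (fst p))}"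
  have [measurable]: "(\<lambda>p. column x (snd p) \<bullet> w (fst p)) \<in> borel_measurable (S \<Otimes>\<^sub>M (borel :: (real^'k^'k) measure))"
    by (rule column_measurable) (use w in measurable)
  have [measurable]: "(\<lambda>p. w (fst p)) \<in> borel_measurable (S \<Otimes>\<^sub>M (borel :: (real^'k^'k) measure))" using w by measurable
  have B: "?B \<in> sets (S \<Otimes>\<^sub>M borel)" by measurable
  have pm: "(\<lambda>\<omega>. (Z \<omega>, \<Theta> \<omega>)) \<in> measurable \<Omega> (S \<Otimes>\<^sub>M borel)" using Z \<Theta> by measurable
  let ?E = "{\<omega> \<in> space \<Omega>. \<bar>column x (\<Theta> \<omega>) \<bullet> w (Z \<omega>)\<bar> < t * norm (w (Z \<omega>))}"
  have E: "?E = (\<lambda>\<omega>. (Z \<omega>, \<Theta> \<omega>)) -` ?B \<inter> space \<Omega>"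
    using measurable_space[OF Z] by (auto simp: space_pair_measure)
  show "?E \<in> events" unfolding E using pm B by (rule measurable_sets)
  have "emeasure \<Omega> ?E = emeasure (distr \<Omega> (S \<Otimes>\<^sub>M borel) (\<lambda>\<omega>. (Z \<omega>, \<Theta> \<omega>))) ?B"
    unfolding E by (rule emeasure_distr[OF pm B, symmetric])
  also have "\<dots> = emeasure (distr \<Omega> S Z \<Otimes>\<^sub>M distr \<Omega> borel \<Theta>) ?B" unfolding joint ..
  also have "\<dots> = (\<integral>\<^sup>+z. emeasure (distr \<Omega> borel \<Theta>) (Pair z -` ?B) \<partial>distr \<Omega> S Z)"
  proof (rule T.emeasure_pair_measure_alt)
    show "?B \<in> sets (distr \<Omega> S Z \<Otimes>\<^sub>M distr \<Omega> borel \<Theta>)" unfolding joint using B by simp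
  qed
  also have "\<dots> \<le> (\<integral>\<^sup>+z. ennreal (2 * t * CARD('k)) \<partial>distr \<Omega> S Z)"
  proof (rule nn_integral_mono)
    fix z assume "z \<in> space (distr \<Omega> S Z)"
    then have z: "z \<in> space S" by simp
    have "Pair z -` ?B \<in> sets borel" using B by (rule sets_Pair1)
    then have "emeasure (distr \<Omega> borel \<Theta>) (Pair z -` ?B) = emeasure \<Omega> {\<omega> \<in> space \<Omega>. \<bar>column x (\<Theta> \<omega>) \<bullet> w z\<bar> < t * norm (w z)}"
      using z \<Theta> by (subst emeasure_distr) (auto simp: space_pair_measure intro!: arg_cong2[where f = emeasure])
    also have "\<dots> \<le> ennreal (2 * t * CARD('k))"
      unfolding emeasure_eq_measure by (intro ennreal_leI uniform_orthogonal_small_ball ps u t)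
    finally show "emeasure (distr \<Omega> borel \<Theta>) (Pair z -` ?B) \<le> ennreal (2 * t * CARD('k))" .
  qed
  also have "\<dots> = ennreal (2 * t * CARD('k))" using D.emeasure_space_1 by simp
  finally show "measure \<Omega> ?E \<le> 2 * t * CARD('k)"
    unfolding emeasure_eq_measure using t by (simp add: ennreal_le_iff)
qed

text \<open>Independence is formulated for the whole sequence; the first \<open>n\<close>
  observations are obtained from it by the measurable restriction map.\<close>

lemma indep_of_observationsD:
  assumes ps: "prob_space \<Omega>" and Y: "\<And>j. 1 \<le> j \<Longrightarrow> Y j \<in> measurable \<Omega> (leb \<Y>)"
    and ind: "indep_of_observations \<Omega> \<Y> Y \<Theta>"
    and A: "A \<in> sets (PiM {1..n} (\<lambda>_. leb \<Y>))" and B: "B \<in> sets borel"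
  shows "measure \<Omega> (((\<lambda>\<omega>. \<lambda>j\<in>{1..n}. Y j \<omega>) -` A \<inter> space \<Omega>) \<inter> (\<Theta> -` B \<inter> space \<Omega>))
    = measure \<Omega> ((\<lambda>\<omega>. \<lambda>j\<in>{1..n}. Y j \<omega>) -` A \<inter> space \<Omega>) * measure \<Omega> (\<Theta> -` B \<inter> space \<Omega>)"
proof -
  interpret prob_space \<Omega> by fact
  let ?S = "PiM {1..n} (\<lambda>_. leb \<Y>)" and ?Z = "\<lambda>\<omega>. \<lambda>j\<in>{1..n}. Y j \<omega>"
  let ?F = "\<lambda>\<omega>. \<lambda>j\<in>{1..}. Y j \<omega>" and ?P = "PiM {1..} (\<lambda>_. leb \<Y>)"
  have F: "?F \<in> measurable \<Omega> ?P" using Y by (intro measurable_restrict) auto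
  have r: "(\<lambda>f. restrict f {1..n}) \<in> measurable ?P ?S" by (rule measurable_restrict_subset) auto
  have "?Z -` A \<inter> space \<Omega> = ?F -` ((\<lambda>f. restrict f {1..n}) -` A \<inter> space ?P) \<inter> space \<Omega>"
  proof -
    have "restrict (?F \<omega>) {1..n} = ?Z \<omega>" for \<omega> by (auto simp: fun_eq_iff)
    then show ?thesis using measurable_space[OF F] by auto
  qed
  then have 1: "?Z -` A \<inter> space \<Omega> \<in> sets (vimage_algebra (space \<Omega>) ?F ?P)"
    using in_vimage_algebra[OF measurable_sets[OF r A]] by simp
  have 2: "\<Theta> -` B \<inter> space \<Omega> \<in> sets (vimage_algebra (space \<Omega>) \<Theta> borel)"
    by (rule in_vimage_algebra[OF B])
  show ?thesis
    using ind 1 2 unfolding indep_of_observations_def by (rule indep_setD)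
qed

subsection \<open>Gram matrices and oscillation of the features\<close>

text \<open>\<open>smallest_eigenvalue\<close> is a \<open>Min\<close>, meaningful for finite sets
  only. Eigenvectors to different eigenvalues are orthogonal, hence independent, and so there are
  finitely many.\<close>

lemma finite_eigenvalues_symmetric:
  fixes A :: "real^'k^'k"
  assumes sym: "transpose A = A" shows "finite {l. \<exists>v. v \<noteq> 0 \<and> A *v v = l *\<^sub>R v}"
proof -
  let ?L = "{l. \<exists>v. v \<noteq> 0 \<and> A *v v = l *\<^sub>R v}"
  obtain e where e: "\<And>l. l \<in> ?L \<Longrightarrow> e l \<noteq> 0 \<and> A *v e l = l *\<^sub>R e l"
    using bchoice[of ?L "\<lambda>l v. v \<noteq> 0 \<and> A *v v = l *\<^sub>R v"] by auto
  have orth: "e l \<bullet> e m = 0" if "l \<in> ?L" "m \<in> ?L" "l \<noteq> m" for l m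
  proof -
    have "l * (e l \<bullet> e m) = (A *v e l) \<bullet> e m" using e[OF that(1)] by simp
    also have "\<dots> = (e l v* A) \<bullet> e m" using sym transpose_matrix_vector[of A "e l"] by simp
    also have "\<dots> = m * (e l \<bullet> e m)" unfolding dot_lmul_matrix using e[OF that(2)] by simp
    finally show ?thesis using that(3) by simp
  qed
  have inj: "inj_on e ?L"
  proof (rule inj_onI)
    fix l m assume lm: "l \<in> ?L" "m \<in> ?L" "e l = e m"
    then have "e l \<bullet> e m \<noteq> 0" using e by simp
    then show "l = m" using orth lm by blast
  qed
  have "independent (e ` ?L)"
  proof (rule pairwise_orthogonal_independent)
    show "pairwise orthogonal (e ` ?L)"
      unfolding pairwise_def orthogonal_def
      by (intro ballI impI, elim imageE, hypsubst, rule orth, assumption, assumption, blast)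
    show "0 \<notin> e ` ?L"
    proof
      assume "0 \<in> e ` ?L"
      then obtain l where "0 = e l" "l \<in> ?L" by (rule imageE)
      then show False using e[of l] by simp
    qed
  qed
  then have "finite (e ` ?L)" by (rule independent_imp_finite)
  then show ?thesis using inj finite_image_iff by blast
qed

text \<open>The first-order condition at a minimum: for small \<open>s\<close> of the sign opposite
  to \<open>a\<close>, the linear term prevails over the quadratic one.\<close>

lemma linear_nonneg_quadratic_zero:
  fixes a b :: real
  assumes "\<And>s. 0 \<le> 2 * s * a + s\<^sup>2 * b" shows "a = 0"
proof (rule ccontr)
  assume a: "a \<noteq> 0"
  define s where "s = - a / (\<bar>b\<bar> + 1)"
  have pos: "0 < \<bar>b\<bar> + 1" by simp
  have s1: "s * (\<bar>b\<bar> + 1) = - a" using pos by (simp add: s_def)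
  have "s \<noteq> 0" using a pos by (auto simp: s_def)
  then have s2: "0 < s\<^sup>2" by simp
  have "s\<^sup>2 * (b - 2 * (\<bar>b\<bar> + 1)) = s\<^sup>2 * b - 2 * s * (s * (\<bar>b\<bar> + 1))"
    by (simp add: power2_eq_square algebra_simps)
  then have "2 * s * a + s\<^sup>2 * b = s\<^sup>2 * (b - 2 * (\<bar>b\<bar> + 1))" unfolding s1 by simp
  also have "\<dots> < 0" using s2 by (intro mult_pos_neg) auto
  finally show False using assms[of s] by simp
qed

text \<open>A minimizer of the quadratic form on the unit sphere is an eigenvector, so the minimum
  \<rho> is an eigenvalue and \<open>smallest_eigenvalue\<close> is at most \<rho>. In this
  direction the inequality allows the Gram threshold to be weakened to 3 \<rho> / 4.\<close>

lemma smallest_eigenvalue_le_rayleigh_min: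
  fixes A :: "real^'k^'k"
  assumes sym: "transpose A = A" and pos: "\<And>v. v \<noteq> 0 \<Longrightarrow> 0 < v \<bullet> (A *v v)"
  obtains \<rho> where "0 < \<rho>" "\<And>v. \<rho> * (norm v)\<^sup>2 \<le> v \<bullet> (A *v v)" "smallest_eigenvalue A \<le> \<rho>"
proof -
  let ?q = "\<lambda>v. v \<bullet> (A *v v)"
  have cont: "continuous_on (sphere 0 1) ?q"
    by (intro continuous_intros linear_continuous_on matrix_vector_mul_bounded_linear)
  have "axis undefined 1 \<in> sphere (0 :: real^'k) 1" by simp
  then have ne: "sphere (0 :: real^'k) 1 \<noteq> {}" by blast
  obtain v where v: "v \<in> sphere 0 1" and min: "\<And>w. w \<in> sphere 0 1 \<Longrightarrow> ?q v \<le> ?q w"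
    using continuous_attains_inf[OF compact_sphere ne cont] by blast
  define \<rho> where "\<rho> = ?q v"
  have v1: "norm v = 1" using v by simp
  then have v0: "v \<noteq> 0" by auto
  have low: "\<rho> * (norm w)\<^sup>2 \<le> ?q w" for w
  proof (cases "w = 0")
    case False
    have "\<rho> \<le> ?q ((1 / norm w) *\<^sub>R w)" unfolding \<rho>_def using False by (intro min) simp
    also have "\<dots> = ?q w / (norm w)\<^sup>2" by (simp add: matrix_vector_mult_scaleR power2_eq_square)
    finally show ?thesis using False by (simp add: field_simps)
  qed simp
  have symm: "x \<bullet> (A *v y) = y \<bullet> (A *v x)" for x y
  proof -
    have "x \<bullet> (A *v y) = (x v* A) \<bullet> y" by (simp add: dot_lmul_matrix)
    also have "x v* A = A *v x" using sym transpose_matrix_vector[of A x] by simp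
    finally show ?thesis by (simp add: inner_commute)
  qed
  \<comment> \<open>The defect of the eigenvalue equation. Along v + s z the form minus \<rho> times
    the squared norm is 2 s |z|^2 to first order, and it is nonnegative, which forces z = 0.\<close>
  define z where "z = A *v v - \<rho> *\<^sub>R v"
  have "z \<bullet> z = 0"
  proof (rule linear_nonneg_quadratic_zero)
    fix s :: real
    have "0 \<le> ?q (v + s *\<^sub>R z) - \<rho> * (norm (v + s *\<^sub>R z))\<^sup>2" using low[of "v + s *\<^sub>R z"] by simp
    also have "?q (v + s *\<^sub>R z) = ?q v + 2 * s * (z \<bullet> (A *v v)) + s\<^sup>2 * ?q z"
      by (simp add: matrix_vector_right_distrib matrix_vector_mult_scaleR inner_add_left inner_add_right power2_eq_square symm[of v z] algebra_simps)
    also have "(norm (v + s *\<^sub>R z))\<^sup>2 = 1 + 2 * s * (z \<bullet> v) + s\<^sup>2 * (z \<bullet> z)"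
      unfolding power2_norm_eq_inner using v1
      by (simp add: inner_add_left inner_add_right inner_commute[of v z] power2_eq_square norm_eq_1 algebra_simps)
    also have "?q v + 2 * s * (z \<bullet> (A *v v)) + s\<^sup>2 * ?q z - \<rho> * (1 + 2 * s * (z \<bullet> v) + s\<^sup>2 * (z \<bullet> z))
      = 2 * s * (z \<bullet> z) + s\<^sup>2 * (?q z - \<rho> * (z \<bullet> z))"
    proof -
      have "z \<bullet> z = z \<bullet> (A *v v) - \<rho> * (z \<bullet> v)" by (subst (2) z_def) (simp add: inner_diff_right)
      then have "z \<bullet> (A *v v) = z \<bullet> z + \<rho> * (z \<bullet> v)" by simp
      then show ?thesis by (simp only: \<rho>_def[symmetric]) (simp add: algebra_simps)
    qed
    finally show "0 \<le> 2 * s * (z \<bullet> z) + s\<^sup>2 * (?q z - \<rho> * (z \<bullet> z))" .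
  qed
  then have "A *v v = \<rho> *\<^sub>R v" by (simp add: z_def)
  then have "\<rho> \<in> {l. \<exists>v. v \<noteq> 0 \<and> A *v v = l *\<^sub>R v}" using v0 by blast
  then have "smallest_eigenvalue A \<le> \<rho>"
    unfolding smallest_eigenvalue_def by (intro Min_le finite_eigenvalues_symmetric sym)
  with that[of \<rho>] low pos[OF v0] show ?thesis by (simp add: \<rho>_def)
qed

lemma L2_fun_mult_integrable:
  assumes "L2_fun \<Y> g" "L2_fun \<Y> h" shows "integrable (leb \<Y>) (\<lambda>y. g y * h y)"
proof (rule Bochner_Integration.integrable_bound)
  show "integrable (leb \<Y>) (\<lambda>y. (g y)\<^sup>2 + (h y)\<^sup>2)" using assms by (auto simp: L2_fun_def)
  show "(\<lambda>y. g y * h y) \<in> borel_measurable (leb \<Y>)" using assms by (auto simp: L2_fun_def)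
  have "\<bar>a * b\<bar> \<le> a\<^sup>2 + b\<^sup>2" for a b :: real
    using sum_squares_bound[of "\<bar>a\<bar>" "\<bar>b\<bar>"] by (simp add: abs_mult) (use zero_le_power2[of a] zero_le_power2[of b] in linarith)
  then show "AE y in leb \<Y>. norm (g y * h y) \<le> norm ((g y)\<^sup>2 + (h y)\<^sup>2)" by simp
qed

lemma L2_inner_sums:
  assumes "\<And>i. i \<in> I \<Longrightarrow> L2_fun \<Y> (g i)" "\<And>j. j \<in> J \<Longrightarrow> L2_fun \<Y> (h j)"
  shows "L2_inner \<Y> (\<lambda>y. \<Sum>i\<in>I. c i * g i y) (\<lambda>y. \<Sum>j\<in>J. d j * h j y) = (\<Sum>i\<in>I. \<Sum>j\<in>J. c i * d j * L2_inner \<Y> (g i) (h j))"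
proof -
  have int: "integrable (leb \<Y>) (\<lambda>y. (c i * d j) * (g i y * h j y))" if "i \<in> I" "j \<in> J" for i j
    using L2_fun_mult_integrable[OF assms(1)[OF that(1)] assms(2)[OF that(2)]] by (rule integrable_mult_right)
  have "L2_inner \<Y> (\<lambda>y. \<Sum>i\<in>I. c i * g i y) (\<lambda>y. \<Sum>j\<in>J. d j * h j y) = (LINT y|leb \<Y>. (\<Sum>i\<in>I. \<Sum>j\<in>J. (c i * d j) * (g i y * h j y)))"
    unfolding L2_inner_def by (simp add: sum_product mult_ac)
  also have "\<dots> = (\<Sum>i\<in>I. \<Sum>j\<in>J. LINT y|leb \<Y>. (c i * d j) * (g i y * h j y))"
    by (subst Bochner_Integration.integral_sum, intro Bochner_Integration.integrable_sum int, assumption, assumption)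
      (intro sum.cong refl Bochner_Integration.integral_sum int)
  finally show ?thesis by (simp add: L2_inner_def)
qed

lemma gram_quadratic_form:
  fixes f :: "'k::finite \<Rightarrow> real^'d \<Rightarrow> real"
  assumes "\<And>x. L2_fun \<Y> (f x)"
  shows "v \<bullet> (gram_matrix \<Y> f *v v) = L2_inner \<Y> (\<lambda>y. \<Sum>x\<in>UNIV. v $ x * f x y) (\<lambda>y. \<Sum>x\<in>UNIV. v $ x * f x y)"
  unfolding L2_inner_sums[OF assms assms]
  by (simp add: gram_matrix_def matrix_vector_mult_def inner_vec_def sum_distrib_left mult_ac)

lemma gram_matrix_positive:
  fixes f :: "'k::finite \<Rightarrow> real^'d \<Rightarrow> real"
  assumes L2: "\<And>x. L2_fun \<Y> (f x)" and ind: "lin_indep_family \<Y> f" and v: "v \<noteq> 0"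
  shows "0 < v \<bullet> (gram_matrix \<Y> f *v v)"
proof -
  let ?g = "\<lambda>y. \<Sum>x\<in>UNIV. v $ x * f x y"
  have int: "integrable (leb \<Y>) (\<lambda>y. ?g y * ?g y)"
    using L2_fun_mult_integrable[OF L2 L2]
    by (simp add: sum_product mult.assoc mult.left_commute[of "f _ _"])
  have "L2_inner \<Y> ?g ?g \<noteq> 0"
  proof
    assume "L2_inner \<Y> ?g ?g = 0"
    then have "AE y in leb \<Y>. ?g y * ?g y = 0"
      unfolding L2_inner_def using int by (subst (asm) integral_nonneg_eq_0_iff_AE) auto
    then have "AE y in leb \<Y>. ?g y = 0" by simp
    then have "\<forall>x. v $ x = 0" using ind unfolding lin_indep_family_def by (elim allE[of _ "($) v"]) blast
    then show False using v by (simp add: vec_eq_iff)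
  qed
  moreover have "0 \<le> L2_inner \<Y> ?g ?g" unfolding L2_inner_def by (rule integral_nonneg_AE) auto
  ultimately show ?thesis unfolding gram_quadratic_form[OF L2] by simp
qed

lemma transpose_gram_matrix: "transpose (gram_matrix \<Y> f) = gram_matrix \<Y> f"
  by (simp add: gram_matrix_def transpose_def L2_inner_def mult.commute)

lemma L2_inner_orthonormal:
  fixes M :: nat
  assumes "\<And>m. m \<in> {1..M} \<Longrightarrow> L2_fun \<Y> (\<phi> m)"
    and "\<And>m n. m \<in> {1..M} \<Longrightarrow> n \<in> {1..M} \<Longrightarrow> L2_inner \<Y> (\<phi> m) (\<phi> n) = (if m = n then 1 else 0)"
  shows "L2_inner \<Y> (\<lambda>y. \<Sum>m=1..M. c m * \<phi> m y) (\<lambda>y. \<Sum>m=1..M. d m * \<phi> m y) = (\<Sum>m=1..M. c m * d m)"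
proof -
  have "L2_inner \<Y> (\<lambda>y. \<Sum>m=1..M. c m * \<phi> m y) (\<lambda>y. \<Sum>m=1..M. d m * \<phi> m y) = (\<Sum>m=1..M. \<Sum>n=1..M. c m * d n * L2_inner \<Y> (\<phi> m) (\<phi> n))"
    by (rule L2_inner_sums) (rule assms(1), assumption)+
  also have "\<dots> = (\<Sum>m=1..M. \<Sum>n=1..M. if m = n then c m * d n else 0)"
    by (intro sum.cong refl) (simp add: assms(2))
  also have "\<dots> = (\<Sum>m=1..M. c m * d m)"
    by (intro sum.cong refl, subst sum.delta') auto
  finally show ?thesis .
qed

lemma approximation_spacesD:
  assumes "approximation_spaces \<Y> Ms \<phi>"
  shows "m \<in> {1..Ms r} \<Longrightarrow> L2_fun \<Y> (\<phi> r m)"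
    and "m \<in> {1..Ms r} \<Longrightarrow> n \<in> {1..Ms r} \<Longrightarrow> L2_inner \<Y> (\<phi> r m) (\<phi> r n) = (if m = n then 1 else 0)"
proof -
  have a: "\<forall>r. \<forall>m\<in>{1..Ms r}. L2_fun \<Y> (\<phi> r m)"
    using assms unfolding approximation_spaces_def by (elim conjE)
  have b: "\<forall>r. \<forall>m\<in>{1..Ms r}. \<forall>n\<in>{1..Ms r}. L2_inner \<Y> (\<phi> r m) (\<phi> r n) = (if m = n then 1 else 0)"
    using assms unfolding approximation_spaces_def by (elim conjE)
  show "m \<in> {1..Ms r} \<Longrightarrow> L2_fun \<Y> (\<phi> r m)" using a by simp
  show "m \<in> {1..Ms r} \<Longrightarrow> n \<in> {1..Ms r} \<Longrightarrow> L2_inner \<Y> (\<phi> r m) (\<phi> r n) = (if m = n then 1 else 0)"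
    using b by simp
qed

lemma norm_matrix_quadratic_form: "\<bar>v \<bullet> (A *v v)\<bar> \<le> op_norm A * (norm (v :: real^'k))\<^sup>2"
proof -
  have "\<bar>v \<bullet> (A *v v)\<bar> \<le> norm v * norm (A *v v)" by (rule Cauchy_Schwarz_ineq2)
  also have "\<dots> \<le> norm v * (op_norm A * norm v)"
    unfolding op_norm_def by (intro mult_left_mono onorm matrix_vector_mul_bounded_linear) auto
  finally show ?thesis by (simp add: power2_eq_square mult_ac)
qed

text \<open>By orthonormality v . (G_M v) = |O v|^2, with O the matrix of coefficients. The
  threshold leaves at least \<rho> - 3 \<rho> / 4 of the lower bound \<rho> of G, whence c0 = sqrt
  \<rho> / 2. Both constants are fixed before the basis and M.\<close>

lemma projected_features_conditioning:
  fixes f :: "'k::finite \<Rightarrow> real^'d \<Rightarrow> real"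
  assumes L2: "\<And>x. L2_fun \<Y> (f x)" and ind: "lin_indep_family \<Y> f"
  obtains c0 C0 where "0 < c0" "0 < C0"
    "\<And>Ms \<phi> M0 r v. approximation_spaces \<Y> Ms \<phi> \<Longrightarrow> gram_threshold \<Y> f Ms \<phi> M0 \<Longrightarrow> M0 \<le> Ms r \<Longrightarrow>
      c0 * norm (v :: real^'k) \<le> L2_set (\<lambda>m. (\<chi> x. L2_inner \<Y> (f x) (\<phi> r m)) \<bullet> v) {1..Ms r} \<and>
      L2_set (\<lambda>m. (\<chi> x. L2_inner \<Y> (f x) (\<phi> r m)) \<bullet> v) {1..Ms r} \<le> C0 * norm v"
proof -
  let ?G = "gram_matrix \<Y> f"
  obtain \<rho> where \<rho>: "0 < \<rho>" "\<And>v. \<rho> * (norm v)\<^sup>2 \<le> v \<bullet> (?G *v v)" "smallest_eigenvalue ?G \<le> \<rho>"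
    by (rule smallest_eigenvalue_le_rayleigh_min[OF transpose_gram_matrix gram_matrix_positive[OF L2 ind]]) (assumption, rule that)
  define B where "B = op_norm ?G + \<rho>"
  have B: "0 < B" using \<rho>(1) onorm_pos_le[OF matrix_vector_mul_bounded_linear[of ?G]] by (simp add: B_def op_norm_def)
  show ?thesis
  proof (rule that[of "sqrt \<rho> / 2" "sqrt B"])
    fix Ms \<phi> M0 r and v :: "real^'k"
    assume ap: "approximation_spaces \<Y> Ms \<phi>" and gt: "gram_threshold \<Y> f Ms \<phi> M0" and M0: "M0 \<le> Ms r"
    define O' where "O' m = (\<chi> x. L2_inner \<Y> (f x) (\<phi> r m))" for m
    let ?GM = "gram_matrix \<Y> (\<lambda>x. L2_proj \<Y> (Ms r) (\<phi> r) (f x))"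
    have on: "\<And>m. m \<in> {1..Ms r} \<Longrightarrow> L2_fun \<Y> (\<phi> r m)"
      "\<And>m n. m \<in> {1..Ms r} \<Longrightarrow> n \<in> {1..Ms r} \<Longrightarrow> L2_inner \<Y> (\<phi> r m) (\<phi> r n) = (if m = n then 1 else 0)"
      by (rule approximation_spacesD[OF ap], assumption+)+
    have GM: "v \<bullet> (?GM *v v) = (L2_set (\<lambda>m. O' m \<bullet> v) {1..Ms r})\<^sup>2"
    proof -
      have "?GM $ x $ x' = (\<Sum>m=1..Ms r. O' m $ x * O' m $ x')" for x x'
        unfolding gram_matrix_def L2_proj_def by (simp, subst L2_inner_orthonormal) (use on in \<open>auto simp: O'_def\<close>)
      then have "v \<bullet> (?GM *v v) = (\<Sum>x\<in>UNIV. \<Sum>x'\<in>UNIV. \<Sum>m=1..Ms r. (O' m $ x * v $ x) * (O' m $ x' * v $ x'))"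
        by (simp add: matrix_vector_mult_def inner_vec_def sum_distrib_left sum_distrib_right mult_ac)
      also have "\<dots> = (\<Sum>m=1..Ms r. \<Sum>x\<in>UNIV. \<Sum>x'\<in>UNIV. (O' m $ x * v $ x) * (O' m $ x' * v $ x'))"
        by (subst (2) sum.swap, subst sum.swap) simp
      also have "\<dots> = (\<Sum>m=1..Ms r. (O' m \<bullet> v)\<^sup>2)"
        by (simp add: inner_vec_def power2_eq_square sum_product)
      finally show ?thesis by (simp only: L2_set_sq)
    qed
    have "op_norm (?GM - ?G) \<le> 3 * smallest_eigenvalue ?G / 4" using gt M0 unfolding gram_threshold_def by blast
    then have "op_norm (?GM - ?G) \<le> 3 * \<rho> / 4" using \<rho>(3) by simp
    then have "op_norm (?GM - ?G) * (norm v)\<^sup>2 \<le> 3 * \<rho> / 4 * (norm v)\<^sup>2" by (rule mult_right_mono) simp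
    then have "\<bar>v \<bullet> ((?GM - ?G) *v v)\<bar> \<le> 3 * \<rho> / 4 * (norm v)\<^sup>2"
      using norm_matrix_quadratic_form[of v "?GM - ?G"] by linarith
    moreover have "v \<bullet> ((?GM - ?G) *v v) = v \<bullet> (?GM *v v) - v \<bullet> (?G *v v)"
      by (simp add: matrix_vector_mult_diff_rdistrib inner_diff_right)
    ultimately have d: "\<bar>v \<bullet> (?GM *v v) - v \<bullet> (?G *v v)\<bar> \<le> 3 * \<rho> / 4 * (norm v)\<^sup>2" by simp
    have "(sqrt \<rho> / 2 * norm v)\<^sup>2 = \<rho> / 4 * (norm v)\<^sup>2" using \<rho>(1) by (simp add: power_mult_distrib power_divide)
    also have "\<dots> \<le> v \<bullet> (?GM *v v)" using d \<rho>(2)[of v] by (simp, linarith)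
    finally have 1: "(sqrt \<rho> / 2 * norm v)\<^sup>2 \<le> (L2_set (\<lambda>m. O' m \<bullet> v) {1..Ms r})\<^sup>2" unfolding GM .
    have "v \<bullet> (?GM *v v) \<le> op_norm ?G * (norm v)\<^sup>2 + 3 * \<rho> / 4 * (norm v)\<^sup>2"
      using d norm_matrix_quadratic_form[of v ?G] by linarith
    also have "\<dots> \<le> B * (norm v)\<^sup>2" unfolding B_def distrib_right using \<rho>(1) by (intro add_left_mono mult_right_mono) auto
    also have "\<dots> = (sqrt B * norm v)\<^sup>2" using B by (simp add: power_mult_distrib)
    finally have 2: "(L2_set (\<lambda>m. O' m \<bullet> v) {1..Ms r})\<^sup>2 \<le> (sqrt B * norm v)\<^sup>2" unfolding GM .
    show "sqrt \<rho> / 2 * norm v \<le> L2_set (\<lambda>m. (\<chi> x. L2_inner \<Y> (f x) (\<phi> r m)) \<bullet> v) {1..Ms r} \<and>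
      L2_set (\<lambda>m. (\<chi> x. L2_inner \<Y> (f x) (\<phi> r m)) \<bullet> v) {1..Ms r} \<le> sqrt B * norm v"
      using power2_le_imp_le[OF 1 L2_set_nonneg] power2_le_imp_le[OF 2] B by (simp add: O'_def)
  qed (use \<rho> B in auto)
qed

text \<open>Adjoining the constant function to the basis makes all the empirical moments of the algorithm
  entries of one tensor. Its oscillation is still controlled by \<open>\<eta>\<close>: replacing one factor
  in the tensor gives a variation of the basis functions times their squared norm.\<close>

lemma extended_feature_diameter:
  fixes \<phi> :: "nat \<Rightarrow> 'y \<Rightarrow> real"
  defines "\<phi>' \<equiv> \<lambda>a. if a = 0 then \<lambda>_. 1 else \<phi> a"
  assumes \<eta>: "\<And>y1 y2 y3 z1 z2 z3. y1 \<in> \<Y> \<Longrightarrow> y2 \<in> \<Y> \<Longrightarrow> y3 \<in> \<Y> \<Longrightarrow> z1 \<in> \<Y> \<Longrightarrow> z2 \<in> \<Y> \<Longrightarrow> z3 \<in> \<Y> \<Longrightarrow>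
      L2_set (\<lambda>(a, b, c). \<phi> a y1 * \<phi> b y2 * \<phi> c y3 - \<phi> a z1 * \<phi> b z2 * \<phi> c z3) ({1..M} \<times> {1..M} \<times> {1..M}) \<le> \<eta>"
    and w0: "w0 \<in> \<Y>" "s \<le> L2_set (\<lambda>a. \<phi> a w0) {1..M}" and s: "0 < s"
    and y: "y1 \<in> \<Y>" "y2 \<in> \<Y>" "y3 \<in> \<Y>" "z1 \<in> \<Y>" "z2 \<in> \<Y>" "z3 \<in> \<Y>"
  shows "L2_set (\<lambda>(a, b, c). \<phi>' a y1 * \<phi>' b y2 * \<phi>' c y3 - \<phi>' a z1 * \<phi>' b z2 * \<phi>' c z3) ({..M} \<times> {..M} \<times> {..M})
    \<le> 3 * (1 + 1 / s\<^sup>2) * \<eta>"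
proof -
  let ?I = "{1..M}" and ?J = "{..M}"
  define D where "D y z = L2_set (\<lambda>a. \<phi>' a y - \<phi>' a z) ?J" for y z
  define N where "N w = L2_set (\<lambda>a. \<phi>' a w) ?J" for w
  define S where "S w = L2_set (\<lambda>a. \<phi> a w) ?I" for w
  have J: "?J = insert 0 ?I" by auto
  have Ds: "D y z = L2_set (\<lambda>a. \<phi> a y - \<phi> a z) ?I" for y z
    unfolding D_def J L2_set_def by (simp add: \<phi>'_def cong: sum.cong_simp)
  have Ns: "(N w)\<^sup>2 = 1 + (S w)\<^sup>2" for w
    unfolding N_def S_def L2_set_sq J by (simp add: \<phi>'_def cong: sum.cong_simp)
  have 3: "L2_set (\<lambda>(a, b, c). f a * (g b * h c)) (A \<times> A \<times> A) = L2_set f A * (L2_set g A * L2_set h A)"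
    if "finite A" for f g h :: "nat \<Rightarrow> real" and A
  proof -
    have "(\<lambda>(a, b, c). f a * (g b * h c)) = (\<lambda>(a, q). f a * (\<lambda>(b, c). g b * h c) q)" by auto
    then show ?thesis using that by (simp only: L2_set_prod)
  qed
  \<comment> \<open>The hypothesis with only the first factor varying; the other two, both taken at
    \<open>w\<close>, contribute the squared norm of the features there.\<close>
  have DS: "D y z * (S w)\<^sup>2 \<le> \<eta>" if "y \<in> \<Y>" "z \<in> \<Y>" "w \<in> \<Y>" for y z w
  proof -
    have "(\<lambda>(a, b, c). \<phi> a y * \<phi> b w * \<phi> c w - \<phi> a z * \<phi> b w * \<phi> c w) = (\<lambda>(a, b, c). (\<phi> a y - \<phi> a z) * (\<phi> b w * \<phi> c w))"
      by (auto simp: fun_eq_iff algebra_simps)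
    then have "D y z * (S w * S w) \<le> \<eta>"
      using \<eta>[of y w w z w w] that by (simp only: 3 finite_atLeastAtMost Ds S_def)
    then show ?thesis by (simp add: power2_eq_square)
  qed
  have D0: "0 \<le> D y z" for y z by (simp add: D_def)
  have N0: "0 \<le> N w" for w by (simp add: N_def)
  \<comment> \<open>The constant feature adds 1 to the squared norm, so a bound on
    \<open>D y z\<close> alone is also required. It comes from \<open>DS\<close> at the point
    \<open>w0\<close>, where the features have norm at least \<open>s\<close>.\<close>
  have DN: "D y z * (N w)\<^sup>2 \<le> (1 + 1 / s\<^sup>2) * \<eta>" if "y \<in> \<Y>" "z \<in> \<Y>" "w \<in> \<Y>" for y z w
  proof -
    have "D y z * s\<^sup>2 \<le> D y z * (S w0)\<^sup>2" using w0(2) s D0 unfolding S_def by (intro mult_left_mono power_mono) auto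
    then have "D y z * s\<^sup>2 \<le> \<eta>" using DS[OF that(1,2) w0(1)] by simp
    then have "D y z \<le> 1 / s\<^sup>2 * \<eta>" using s by (simp add: field_simps)
    then show ?thesis using DS[OF that] by (simp add: Ns distrib_left distrib_right)
  qed
  have DNN: "D y z * (N w * N w') \<le> (1 + 1 / s\<^sup>2) * \<eta>" if "y \<in> \<Y>" "z \<in> \<Y>" "w \<in> \<Y>" "w' \<in> \<Y>" for y z w w'
  proof (cases "N w \<le> N w'")
    case True
    then have "D y z * (N w * N w') \<le> D y z * (N w')\<^sup>2"
      using D0 N0 by (auto intro!: mult_left_mono mult_right_mono simp: power2_eq_square)
    then show ?thesis using DN[OF that(1,2,4)] by simp
  next
    case False
    then have "D y z * (N w * N w') \<le> D y z * (N w)\<^sup>2"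
      using D0 N0 by (auto intro!: mult_left_mono simp: power2_eq_square)
    then show ?thesis using DN[OF that(1,2,3)] by simp
  qed
  \<comment> \<open>Telescoping in the three factors; each term costs (1 + 1 / s^2) \<eta>.\<close>
  define T1 T2 T3 where "T1 = (\<lambda>(a, b, c). (\<phi>' a y1 - \<phi>' a z1) * (\<phi>' b y2 * \<phi>' c y3))"
    and "T2 = (\<lambda>(a, b, c). \<phi>' a z1 * ((\<phi>' b y2 - \<phi>' b z2) * \<phi>' c y3))"
    and "T3 = (\<lambda>(a, b, c). \<phi>' a z1 * (\<phi>' b z2 * (\<phi>' c y3 - \<phi>' c z3)))"
  have eq: "(\<lambda>(a, b, c). \<phi>' a y1 * \<phi>' b y2 * \<phi>' c y3 - \<phi>' a z1 * \<phi>' b z2 * \<phi>' c z3) = (\<lambda>i. (T1 i + T2 i) + T3 i)"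
    by (auto simp: T1_def T2_def T3_def fun_eq_iff algebra_simps)
  have T: "L2_set T1 (?J \<times> ?J \<times> ?J) \<le> (1 + 1 / s\<^sup>2) * \<eta>" "L2_set T2 (?J \<times> ?J \<times> ?J) \<le> (1 + 1 / s\<^sup>2) * \<eta>"
    "L2_set T3 (?J \<times> ?J \<times> ?J) \<le> (1 + 1 / s\<^sup>2) * \<eta>"
    unfolding T1_def T2_def T3_def 3[OF finite_atMost] D_def[symmetric] N_def[symmetric]
    using DNN[of y1 z1 y2 y3] DNN[of y2 z2 z1 y3] DNN[of y3 z3 z1 z2] y by (simp_all add: mult_ac)
  show ?thesis unfolding eq
    using L2_set_triangle_ineq[of "\<lambda>i. T1 i + T2 i" T3 "?J \<times> ?J \<times> ?J"] L2_set_triangle_ineq[of T1 T2 "?J \<times> ?J \<times> ?J"] T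
    unfolding mult.assoc by linarith
qed

lemma eta3_bound:
  assumes fin: "eta3_sq \<Y> M \<phi> < \<infinity>" and y: "y1 \<in> \<Y>" "y2 \<in> \<Y>" "y3 \<in> \<Y>" "z1 \<in> \<Y>" "z2 \<in> \<Y>" "z3 \<in> \<Y>"
  shows "L2_set (\<lambda>(a, b, c). \<phi> a y1 * \<phi> b y2 * \<phi> c y3 - \<phi> a z1 * \<phi> b z2 * \<phi> c z3) ({1..M} \<times> {1..M} \<times> {1..M}) \<le> eta3 \<Y> M \<phi>"
proof -
  let ?s = "\<Sum>a=1..M. \<Sum>b=1..M. \<Sum>c=1..M. (\<phi> a y1 * \<phi> b y2 * \<phi> c y3 - \<phi> a z1 * \<phi> b z2 * \<phi> c z3)\<^sup>2"
  have "ennreal ?s \<le> eta3_sq \<Y> M \<phi>"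
    unfolding eta3_sq_def using y by (intro SUP_upper2[of "(y1, y2, y3, z1, z2, z3)"]) auto
  then have "enn2real (ennreal ?s) \<le> enn2real (eta3_sq \<Y> M \<phi>)"
    by (rule enn2real_mono) (use fin in \<open>simp add: infinity_ennreal_def\<close>)
  then have "?s \<le> enn2real (eta3_sq \<Y> M \<phi>)" by (simp add: sum_nonneg)
  then show ?thesis unfolding eta3_def L2_set_def
    by (intro real_sqrt_le_mono) (simp add: sum.cartesian_product split_def)
qed

text \<open>For the empirical moments as parts of the summed tensor: \<open>h\<close> puts 0 at the
  positions where a moment has no index, and division by \<open>p\<close> turns the sum into a
  mean.\<close>

lemma L2_set_reindex_le:
  assumes "inj_on h A" "h ` A \<subseteq> B" "finite B" "\<And>i. i \<in> A \<Longrightarrow> g i = F (h i) / p" "0 < p"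
  shows "L2_set g A \<le> L2_set F B / p"
proof -
  have "(\<Sum>i\<in>A. (F (h i))\<^sup>2) = (\<Sum>j\<in>h ` A. (F j)\<^sup>2)" using assms(1) by (simp add: sum.reindex)
  also have "\<dots> \<le> (\<Sum>j\<in>B. (F j)\<^sup>2)" using assms(2,3) by (intro sum_mono2) auto
  finally have *: "sqrt (\<Sum>i\<in>A. (F (h i))\<^sup>2) \<le> L2_set F B" unfolding L2_set_def by (rule real_sqrt_le_mono)
  have "(\<Sum>i\<in>A. (g i)\<^sup>2) = (\<Sum>i\<in>A. (F (h i))\<^sup>2) / p\<^sup>2"
    using assms(4) by (simp add: power_divide sum_divide_distrib)
  then have "L2_set g A = sqrt (\<Sum>i\<in>A. (F (h i))\<^sup>2) / p"
    using assms(5) by (simp add: L2_set_def real_sqrt_divide)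
  then show ?thesis using * assms(5) by (simp add: divide_right_mono)
qed

section \<open>The moments of the algorithm as slices of one tensor\<close>

context hmm_features
begin

definition feature_means :: "nat \<Rightarrow> real^'k" where "feature_means a = (\<chi> x. mean a x)"

lemma mean1_eq: "mean1 c x = (Q *v feature_means c) $ x"
  by (simp add: mean1_def feature_means_def matrix_vector_mult_def)

lemma mean2_eq: "mean2 b c x = (Q *v (diag_mat (feature_means b) *v (Q *v feature_means c))) $ x"
  by (simp add: mean2_def matrix_vector_mult_def[of Q] diag_mat_mult_vec mean1_eq feature_means_def)

lemma tm_eq: "tm (a, b, c) = population_M \<pi> Q feature_means a b c"
  unfolding population_M_def
  by (simp add: matrix_vector_mul_assoc[symmetric] inner_vec_def tm_def t3_def mean2_eq diag_mat_mult_vec feature_means_def mult_ac)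

context
  assumes const: "\<phi> 0 = (\<lambda>_. 1)"
begin

lemma feature_means_0: "feature_means 0 = (\<chi> x. 1)"
  by (simp add: feature_means_def mean_def const)

lemma diag_feature_means_0: "diag_mat (feature_means 0) = mat 1"
  by (simp add: feature_means_0 diag_mat_def mat_def vec_eq_iff)

lemma Q_feature_means_0: "Q *v feature_means 0 = feature_means 0"
  unfolding feature_means_0 by (rule transition_matrix_mult_1[OF transition])

lemma tm_P: "tm (a, 0, c) = population_P \<pi> Q feature_means a c"
  unfolding tm_eq population_M_def population_P_def diag_feature_means_0 by simp

lemma tm_N: "tm (a, b, 0) = population_N \<pi> Q feature_means a b"
proof -
  have "diag_mat (feature_means b) *v feature_means 0 = feature_means b"
    by (simp add: vec_eq_iff diag_mat_mult_vec feature_means_0)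
  then show ?thesis
    unfolding tm_eq population_M_def population_N_def by (simp add: matrix_vector_mul_assoc[symmetric] Q_feature_means_0)
qed

lemma tm_L: "tm (a, 0, 0) = feature_means a \<bullet> \<pi>"
  unfolding tm_N population_N_def
  by (simp add: matrix_vector_mul_assoc[symmetric] Q_feature_means_0) (simp add: feature_means_0 inner_vec_def diag_mat_mult_vec)

lemma empirical_moments_close:
  assumes p: "1 \<le> p" and \<psi>: "\<And>a. a \<in> {1..M} \<Longrightarrow> \<psi> a = \<phi> a"
    and R: "L2_set (\<lambda>i. \<Sum>s=1..p. t0 (Y s \<omega>) (Y (s + 1) \<omega>) (Y (s + 2) \<omega>) i - tm i) II \<le> R"
  defines "y \<equiv> \<lambda>j\<in>{1..p + 2}. Y j \<omega>"
  shows "L2_set (\<lambda>a. L_hat \<psi> p y a - feature_means a \<bullet> \<pi>) {1..M} \<le> R / p"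
    "L2_set (\<lambda>(a, b). N_hat \<psi> p y a b - population_N \<pi> Q feature_means a b) ({1..M} \<times> {1..M}) \<le> R / p"
    "L2_set (\<lambda>(a, c). P_hat \<psi> p y a c - population_P \<pi> Q feature_means a c) ({1..M} \<times> {1..M}) \<le> R / p"
    "L2_set (\<lambda>(a, b, c). M_hat \<psi> p y a b c - population_M \<pi> Q feature_means a b c) ({1..M} \<times> {1..M} \<times> {1..M}) \<le> R / p"
proof -
  define S where "S i = (\<Sum>s=1..p. t0 (Y s \<omega>) (Y (s + 1) \<omega>) (Y (s + 2) \<omega>) i - tm i)" for i
  have p1: "0 < p" using p by simp
  then have p0: "0 < real p" by simp
  have R': "L2_set S II / p \<le> R / p" using R p unfolding S_def by (simp add: divide_right_mono)
  have y: "y s = Y s \<omega>" "y (s + 1) = Y (s + 1) \<omega>" "y (s + 2) = Y (s + 2) \<omega>" if "s \<in> {1..p}" for s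
    using that by (auto simp: y_def)
  have S: "S (a, b, c) / p = (\<Sum>s=1..p. \<phi> a (y s) * \<phi> b (y (s + 1)) * \<phi> c (y (s + 2))) / p - tm (a, b, c)" for a b c
  proof -
    have "S (a, b, c) = (\<Sum>s=1..p. \<phi> a (y s) * \<phi> b (y (s + 1)) * \<phi> c (y (s + 2))) - p * tm (a, b, c)"
    proof -
      have "(\<Sum>s=1..p. \<phi> a (Y s \<omega>) * \<phi> b (Y (s + 1) \<omega>) * \<phi> c (Y (s + 2) \<omega>))
        = (\<Sum>s=1..p. \<phi> a (y s) * \<phi> b (y (s + 1)) * \<phi> c (y (s + 2)))"
        by (intro sum.cong refl) (simp only: y)
      then show ?thesis unfolding S_def t0_def sum_subtractf prod.case by (simp only: sum_constant card_atLeastAtMost diff_Suc_1 add_diff_cancel_right' Suc_eq_plus1)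
    qed
    then show ?thesis using p0 by (simp add: diff_divide_distrib)
  qed
  show "L2_set (\<lambda>a. L_hat \<psi> p y a - feature_means a \<bullet> \<pi>) {1..M} \<le> R / p"
    by (rule order_trans[OF L2_set_reindex_le[where h = "\<lambda>a. (a, 0, 0)" and F = S and B = II and p = p] R'])
      (auto simp: inj_on_def S L_hat_def \<psi> tm_L const p1)
  show "L2_set (\<lambda>(a, b). N_hat \<psi> p y a b - population_N \<pi> Q feature_means a b) ({1..M} \<times> {1..M}) \<le> R / p"
    by (rule order_trans[OF L2_set_reindex_le[where h = "\<lambda>(a, b). (a, b, 0)" and F = S and B = II and p = p] R'])
      (auto simp: inj_on_def S N_hat_def \<psi> tm_N const p1)
  show "L2_set (\<lambda>(a, c). P_hat \<psi> p y a c - population_P \<pi> Q feature_means a c) ({1..M} \<times> {1..M}) \<le> R / p"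
    by (rule order_trans[OF L2_set_reindex_le[where h = "\<lambda>(a, c). (a, 0, c)" and F = S and B = II and p = p] R'])
      (auto simp: inj_on_def S P_hat_def \<psi> tm_P const p1)
  show "L2_set (\<lambda>(a, b, c). M_hat \<psi> p y a b c - population_M \<pi> Q feature_means a b c) ({1..M} \<times> {1..M} \<times> {1..M}) \<le> R / p"
    by (rule order_trans[OF L2_set_reindex_le[where h = "\<lambda>i. i" and F = S and B = II and p = p] R'])
      (auto simp: inj_on_def S M_hat_def \<psi> tm_eq p1)
qed

end

end

lemma stationary_distribution_perm:
  assumes \<tau>: "\<tau> permutes UNIV" and s: "stationary_distribution Q \<pi>"
  shows "stationary_distribution (perm_mat \<tau> ** Q ** transpose (perm_mat \<tau>)) (perm_mat \<tau> *v \<pi>)"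
proof -
  have "(\<Sum>x\<in>UNIV. Q $ \<tau> x $ y * \<pi> $ \<tau> x) = \<pi> $ y" for y
  proof -
    have "(\<Sum>x\<in>UNIV. Q $ \<tau> x $ y * \<pi> $ \<tau> x) = (\<Sum>x\<in>UNIV. Q $ x $ y * \<pi> $ x)" by (rule sum_permute[OF \<tau>])
    also have "\<dots> = (\<pi> v* Q) $ y" by (simp add: vector_matrix_mult_def mult.commute)
    finally show ?thesis using s by (simp add: stationary_distribution_def)
  qed
  then have "(perm_mat \<tau> *v \<pi>) v* (perm_mat \<tau> ** Q ** transpose (perm_mat \<tau>)) = perm_mat \<tau> *v \<pi>"
    unfolding vector_matrix_mult_def mult_perm_mat_transpose perm_mat_mult perm_mat_mult_vec
    by (simp add: vec_eq_iff perm_mat_mult_vec mult.commute)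
  moreover have "(\<Sum>x\<in>UNIV. \<pi> $ \<tau> x) = 1"
    using sum_permute[OF \<tau>, of "($) \<pi>"] s by (simp add: stationary_distribution_def)
  ultimately show ?thesis using s by (simp add: stationary_distribution_def perm_mat_mult_vec)
qed

lemma norm_stationary_distribution_le:
  assumes "stationary_distribution Q (\<pi> :: real^'k)" shows "norm \<pi> \<le> real CARD('k)" "\<pi> $ x \<le> 1"
proof -
  have le: "\<pi> $ x \<le> 1" for x
    using assms member_le_sum[of x UNIV "($) \<pi>"] by (auto simp: stationary_distribution_def)
  then have "\<bar>\<pi> $ x\<bar> \<le> 1" for x using assms by (simp add: stationary_distribution_def)
  from norm_vec_le_entries[OF this] show "norm \<pi> \<le> real CARD('k)" by simp
  show "\<pi> $ x \<le> 1" by (rule le)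
qed

text \<open>The sample size is finite and \<open>a\<close> is positive, so the condition on
  \<open>p\<close> itself excludes an infinite \<open>eta3_sq\<close>, for which \<open>eta3\<close>
  would be meaningless.\<close>

lemma threshold_real:
  assumes N: "0 < a" and le: "ennreal a * eta3_sq \<Y> M \<phi> \<le> of_nat p"
  shows "eta3_sq \<Y> M \<phi> < \<infinity>" "a * (eta3 \<Y> M \<phi>)\<^sup>2 \<le> real p"
proof -
  show fin: "eta3_sq \<Y> M \<phi> < \<infinity>"
  proof (rule ccontr)
    assume "\<not> ?thesis"
    then have "eta3_sq \<Y> M \<phi> = top" by (simp add: less_top[symmetric] infinity_ennreal_def)
    then have "ennreal a * eta3_sq \<Y> M \<phi> = top" using N by (simp add: ennreal_mult_top)
    then show False using le by (simp add: top_unique)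
  qed
  have "eta3_sq \<Y> M \<phi> = ennreal ((eta3 \<Y> M \<phi>)\<^sup>2)"
    using fin by (simp add: eta3_def infinity_ennreal_def)
  then have "ennreal (a * (eta3 \<Y> M \<phi>)\<^sup>2) \<le> ennreal (real p)"
    using le N by (simp add: ennreal_mult ennreal_of_nat_eq_real_of_nat)
  then show "a * (eta3 \<Y> M \<phi>)\<^sup>2 \<le> real p" by (simp add: ennreal_le_iff)
qed

lemma sqrt_neg_ln_ge:
  assumes "0 < \<delta>" "\<delta> < 1 / 2" shows "1 / 2 \<le> sqrt (- ln \<delta>)" "1 / 2 \<le> - ln \<delta>"
proof -
  have "ln \<delta> \<le> ln (1 / 2)" by (rule ln_le_cancel_iff[THEN iffD2]) (use assms in linarith)+
  moreover have "ln (1 / 2 :: real) = - ln 2" by (simp only: inverse_eq_divide[symmetric] ln_inverse)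
  moreover have "2 / 3 \<le> ln (2 :: real)" by (rule ln2_ge_two_thirds)
  ultimately show *: "1 / 2 \<le> - ln \<delta>" by linarith
  have "(1 / 2)\<^sup>2 = (1 / 4 :: real)" by (simp add: power2_eq_square)
  then have "(1 / 2)\<^sup>2 \<le> - ln \<delta>" using * by linarith
  then show "1 / 2 \<le> sqrt (- ln \<delta>)" by (rule real_le_rsqrt)
qed

text \<open>Union bound over the K^2 ordered pairs, each failing with probability at most 2 t
  K.\<close>

lemma gap_event:
  fixes \<Theta> :: "'w \<Rightarrow> real^'k^'k" and w :: "'k \<Rightarrow> 'k \<Rightarrow> 'z \<Rightarrow> real^'k"
  assumes ps: "prob_space \<Omega>" and u: "uniform_orthogonal \<Omega> \<Theta>" and t: "0 \<le> t"
    and Z: "Z \<in> measurable \<Omega> S"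
    and ind: "\<And>A B. A \<in> sets S \<Longrightarrow> B \<in> sets borel \<Longrightarrow>
      measure \<Omega> ((Z -` A \<inter> space \<Omega>) \<inter> (\<Theta> -` B \<inter> space \<Omega>)) = measure \<Omega> (Z -` A \<inter> space \<Omega>) * measure \<Omega> (\<Theta> -` B \<inter> space \<Omega>)"
    and w: "\<And>i j. w i j \<in> borel_measurable S"
  obtains B where "B \<in> sets \<Omega>" "measure \<Omega> B \<le> 2 * t * real CARD('k) ^ 3"
    "\<And>\<omega> i j. \<omega> \<in> space \<Omega> - B \<Longrightarrow> t * norm (w i j (Z \<omega>)) \<le> \<bar>column x (\<Theta> \<omega>) \<bullet> w i j (Z \<omega>)\<bar>"
proof -
  interpret prob_space \<Omega> by fact
  define B where "B = (\<lambda>(i, j). {\<omega> \<in> space \<Omega>. \<bar>column x (\<Theta> \<omega>) \<bullet> w i j (Z \<omega>)\<bar> < t * norm (w i j (Z \<omega>))})"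
  have Bm: "B ij \<in> events" and Bp: "prob (B ij) \<le> 2 * t * CARD('k)" for ij
  proof -
    obtain i j where ij: "ij = (i, j)" by (cases ij)
    show "B ij \<in> events" "prob (B ij) \<le> 2 * t * CARD('k)"
      unfolding B_def ij prod.case by (rule independent_small_ball[OF ps u t Z ind w], assumption+)+
  qed
  show ?thesis
  proof (rule that[of "\<Union> (range B)"])
    show "\<Union> (range B) \<in> events" using Bm by (intro sets.finite_UN) auto
    have "prob (\<Union> (range B)) \<le> (\<Sum>ij\<in>UNIV. prob (B ij))"
      using Bm by (intro finite_measure_subadditive_finite) auto
    also have "\<dots> \<le> (\<Sum>ij\<in>(UNIV :: ('k \<times> 'k) set). 2 * t * CARD('k))" by (intro sum_mono Bp)
    also have "\<dots> = 2 * t * real CARD('k) ^ 3" by (simp add: power3_eq_cube)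
    finally show "prob (\<Union> (range B)) \<le> 2 * t * real CARD('k) ^ 3" .
    fix \<omega> i j assume "\<omega> \<in> space \<Omega> - \<Union> (range B)"
    then have "\<omega> \<in> space \<Omega>" "\<omega> \<notin> B (i, j)" by auto
    then show "t * norm (w i j (Z \<omega>)) \<le> \<bar>column x (\<Theta> \<omega>) \<bullet> w i j (Z \<omega>)\<bar>" unfolding B_def by auto
  qed
qed

subsection \<open>The main result\<close>

text \<open>All randomness is confined to two events, a small deviation of the tensor and a
  sufficient gap. On their intersection the bounds are deterministic consequences of
  \<open>spectral_algorithm_error\<close>, so a permutation can be found for each outcome
  separately.\<close>

lemma spectral_estimators_event:
  fixes Q :: "real^'k^'k" and \<pi> :: "real^'k" and x1 :: 'k and \<Y> :: "(real^'d) set" and f :: "'k \<Rightarrow> real^'d \<Rightarrow> real"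
  assumes Q: "transition_matrix Q" "invertible Q" "irreducible_chain Q" and \<pi>: "stationary_distribution Q \<pi>"
    and \<Y>: "\<Y> \<in> sets borel" and dens: "\<And>x. prob_density \<Y> (f x)" and L2: "\<And>x. L2_fun \<Y> (f x)"
    and ind: "lin_indep_family \<Y> f"
  obtains C N where "0 < C" "0 < N"
    "\<And>(\<Omega> :: 'w measure) X Y \<Theta> Ms \<phi> M0 u \<delta> r Uh fh \<pi>h Qh p.
      hidden_markov_model \<Omega> \<pi> Q \<Y> f X Y \<Longrightarrow> uniform_orthogonal \<Omega> \<Theta> \<Longrightarrow> indep_of_observations \<Omega> \<Y> Y \<Theta> \<Longrightarrow>
      approximation_spaces \<Y> Ms \<phi> \<Longrightarrow> gram_threshold \<Y> f Ms \<phi> M0 \<Longrightarrow> 1 \<le> u \<Longrightarrow> 0 < \<delta> \<Longrightarrow> \<delta> < 1 \<Longrightarrow> M0 \<le> Ms r \<Longrightarrow>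
      1 \<le> p \<Longrightarrow> spectral_estimators \<Y> (\<phi> r) (Ms r) p x1 Uh fh \<pi>h Qh \<Longrightarrow>
      ennreal (N * u * (- ln \<delta>) / \<delta>\<^sup>2) * eta3_sq \<Y> (Ms r) (\<phi> r) \<le> of_nat p \<Longrightarrow>
      \<exists>E\<in>sets \<Omega>. measure \<Omega> E > 1 - 2 * \<delta> - 4 * exp (- u) \<and>
        (\<forall>\<omega>\<in>E. \<exists>t. t permutes UNIV \<and>
          (let y = (\<lambda>j\<in>{1..p + 2}. Y j \<omega>);
               bound = C * (sqrt (- ln \<delta>) / \<delta>) * (eta3 \<Y> (Ms r) (\<phi> r) / sqrt (real p)) * sqrt u
           in (MAX x. L2_norm \<Y> (\<lambda>z. L2_proj \<Y> (Ms r) (\<phi> r) (f x) z - fh y (\<Theta> \<omega>) (t x) z)) \<le> bound \<and>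
              norm (\<pi> - perm_mat t *v \<pi>h y (\<Theta> \<omega>)) \<le> bound \<and>
              op_norm (Q - perm_mat t ** Qh y (\<Theta> \<omega>) ** transpose (perm_mat t)) \<le> bound))"
proof -
  define K where "K = real CARD('k)"
  have K: "1 \<le> K" unfolding K_def by (simp add: Suc_leI One_nat_def)
  define q where "q = Min (range (($) \<pi>))"
  have "q \<in> range (($) \<pi>)" unfolding q_def by (rule Min_in) auto
  then have q: "0 < q" using stationary_distribution_pos[OF Q(1,3) \<pi>] by auto
  have q\<pi>: "q \<le> \<pi> $ x" for x unfolding q_def by (rule Min_le) auto
  note \<pi>1 = norm_stationary_distribution_le(2)[OF \<pi>]
  obtain H where poisson: "\<And>g. \<pi> \<bullet> g = 0 \<Longrightarrow> H *v g - Q *v (H *v g) = g"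
    and pert: "\<And>\<pi>' (Q' :: real^'k^'k). stationary_distribution Q' \<pi>' \<Longrightarrow> \<pi>' - \<pi> = (\<pi>' v* (Q' - Q)) v* H"
    using fundamental_matrix[OF Q(1,3) \<pi>] by blast
  obtain c0 C0 where c0: "0 < c0" and C0: "0 < C0" and
    cond: "\<And>Ms \<phi> M0 r v. approximation_spaces \<Y> Ms \<phi> \<Longrightarrow> gram_threshold \<Y> f Ms \<phi> M0 \<Longrightarrow> M0 \<le> Ms r \<Longrightarrow>
      c0 * norm (v :: real^'k) \<le> L2_set (\<lambda>m. (\<chi> x. L2_inner \<Y> (f x) (\<phi> r m)) \<bullet> v) {1..Ms r} \<and>
      L2_set (\<lambda>m. (\<chi> x. L2_inner \<Y> (f x) (\<phi> r m)) \<bullet> v) {1..Ms r} \<le> C0 * norm v"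
  proof (rule projected_features_conditioning[OF L2 ind], goal_cases)
    case (1 c0 C0)
    show ?case by (rule 1(1)[OF 1(2,3)], rule 1(4))
  qed
  obtain C1 e0 where C1: "0 < C1" and e0: "0 < e0" and alg:
    "\<And>M (\<phi> :: nat \<Rightarrow> real^'d \<Rightarrow> real) p y (U :: nat \<Rightarrow> real^'k) \<Theta> X t e.
      top_right_singular_vectors M (P_hat \<phi> p y) U \<Longrightarrow> orthogonal_matrix \<Theta> \<Longrightarrow>
      (\<And>v. c0 * norm v \<le> L2_set (\<lambda>a. X a \<bullet> v) {1..M}) \<Longrightarrow>
      (\<And>v. L2_set (\<lambda>a. X a \<bullet> v) {1..M} \<le> C0 * norm v) \<Longrightarrow>
      0 < t \<Longrightarrow> t \<le> 1 \<Longrightarrow>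
      (\<And>i j. i \<noteq> j \<Longrightarrow> t * norm (tr_mult M U X *v (axis i 1 - axis j 1)) \<le>
         \<bar>column x1 \<Theta> \<bullet> (tr_mult M U X *v (axis i 1 - axis j 1))\<bar>) \<Longrightarrow>
      L2_set (\<lambda>a. L_hat \<phi> p y a - X a \<bullet> \<pi>) {1..M} \<le> e \<Longrightarrow>
      L2_set (\<lambda>(a, b). N_hat \<phi> p y a b - population_N \<pi> Q X a b) ({1..M} \<times> {1..M}) \<le> e \<Longrightarrow>
      L2_set (\<lambda>(a, c). P_hat \<phi> p y a c - population_P \<pi> Q X a c) ({1..M} \<times> {1..M}) \<le> e \<Longrightarrow>
      L2_set (\<lambda>(a, b, c). M_hat \<phi> p y a b c - population_M \<pi> Q X a b c) ({1..M} \<times> {1..M} \<times> {1..M}) \<le> e \<Longrightarrow>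
      e \<le> e0 * t \<Longrightarrow>
      (\<exists>f' \<pi>' Q'. spectral_output \<phi> M p x1 y U \<Theta> f' \<pi>' Q') \<and>
      (\<forall>f' \<pi>' Q'. spectral_output \<phi> M p x1 y U \<Theta> f' \<pi>' Q' \<longrightarrow>
         transition_matrix Q' \<and> stationary_distribution Q' \<pi>' \<and>
         (\<exists>\<tau>. \<tau> permutes UNIV \<and>
           (\<forall>x. \<exists>w. f' (\<tau> x) = (\<lambda>z. \<Sum>m=1..M. w m * \<phi> m z) \<and> L2_set (\<lambda>m. X m $ x - w m) {1..M} \<le> C1 * e / t) \<and>
           norm (perm_mat \<tau> ** Q' ** transpose (perm_mat \<tau>) - Q) \<le> C1 * e / t))"
  proof (rule spectral_algorithm_error[where 'd = 'd and ?x1.0 = x1, OF Q(1,2) q q\<pi> \<pi>1 c0 C0], goal_cases)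
    case (1 C e0)
    show ?case by (rule 1(1)[OF 1(2,3)], rule 1(4)) blast+
  qed
  \<comment> \<open>A lower bound for the norm of the features at some point \<open>w0\<close>, as
    \<open>extended_feature_diameter\<close> requires.\<close>
  define s where "s = c0 / 2"
  have s: "0 < s" using c0 by (simp add: s_def)
  define \<kappa> where "\<kappa> = 3 * (1 + 1 / s\<^sup>2)"
  have \<kappa>: "0 < \<kappa>" using s by (simp add: \<kappa>_def add_pos_pos)
  define c where "c = 6 + 4 * (K * norm (Q ** H))"
  have c: "0 < c" using K by (simp add: c_def add_pos_nonneg)
  define E1 where "E1 = 5 * c * \<kappa>"
  have E1: "0 < E1" using c \<kappa> by (simp add: E1_def)
  \<comment> \<open>With t = \<delta> / T the gap fails with probability at most 2 t K^3 =
    \<delta>.\<close>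
  define T where "T = 2 * K ^ 3"
  have T: "1 \<le> T" using one_le_power[OF K, of 3] by (simp add: T_def)
  \<comment> \<open>Chosen so that the error \<open>e\<close> is at most e0 t; the factor 2
    compensates for -ln \<delta> >= 1/2.\<close>
  define N where "N = 2 * (E1 * T / e0)\<^sup>2"
  have N: "0 < N" using E1 T e0 by (simp add: N_def)
  \<comment> \<open>The factor 2 compensates for sqrt(-ln \<delta>) >= 1/2, and 1 + K |H| makes room
    for the error of the stationary distribution.\<close>
  define C where "C = 2 * (C1 * E1 * T) * (1 + K * norm H)"
  have C: "0 < C" using C1 E1 T K by (simp add: C_def add_pos_nonneg)
  show ?thesis
  proof (rule that[OF C N])
    fix \<Omega> :: "'w measure" and X Y and \<Theta> :: "'w \<Rightarrow> real^'k^'k" and Ms :: "nat \<Rightarrow> nat" and \<phi> M0 and u \<delta> :: real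
      and r :: nat and Uh fh \<pi>h Qh and p :: nat
    assume model: "hidden_markov_model \<Omega> \<pi> Q \<Y> f X Y" and unif: "uniform_orthogonal \<Omega> \<Theta>"
      and indep: "indep_of_observations \<Omega> \<Y> Y \<Theta>" and ap: "approximation_spaces \<Y> Ms \<phi>"
      and gt: "gram_threshold \<Y> f Ms \<phi> M0" and u: "1 \<le> u" and \<delta>: "0 < \<delta>" "\<delta> < 1" and M0: "M0 \<le> Ms r"
      and p: "1 \<le> p" and est: "spectral_estimators \<Y> (\<phi> r) (Ms r) p x1 Uh fh \<pi>h Qh"
      and thr: "ennreal (N * u * (- ln \<delta>) / \<delta>\<^sup>2) * eta3_sq \<Y> (Ms r) (\<phi> r) \<le> of_nat p"
    let ?M = "Ms r" and ?\<eta> = "eta3 \<Y> (Ms r) (\<phi> r)"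
    define good where "good \<omega> t \<longleftrightarrow>
          (let y = (\<lambda>j\<in>{1..p + 2}. Y j \<omega>);
               bound = C * (sqrt (- ln \<delta>) / \<delta>) * (eta3 \<Y> (Ms r) (\<phi> r) / sqrt (real p)) * sqrt u
           in (MAX x. L2_norm \<Y> (\<lambda>z. L2_proj \<Y> (Ms r) (\<phi> r) (f x) z - fh y (\<Theta> \<omega>) (t x) z)) \<le> bound \<and>
              norm (\<pi> - perm_mat t *v \<pi>h y (\<Theta> \<omega>)) \<le> bound \<and>
              op_norm (Q - perm_mat t ** Qh y (\<Theta> \<omega>) ** transpose (perm_mat t)) \<le> bound)" for \<omega> t
    have "\<exists>E\<in>sets \<Omega>. measure \<Omega> E > 1 - 2 * \<delta> - 4 * exp (- u) \<and> (\<forall>\<omega>\<in>E. \<exists>t. t permutes UNIV \<and> good \<omega> t)"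
    \<comment> \<open>For \<delta> >= 1/2 the required probability is negative and the empty event
      suffices. Otherwise -ln \<delta> is bounded away from 0, and this lower bound is how the
      logarithmic factors enter the estimates.\<close>
    proof (cases "\<delta> < 1 / 2")
      case False
      then have "1 - 2 * \<delta> - 4 * exp (- u) < 0" using exp_gt_zero[of "- u"] by linarith
      then show ?thesis by (intro bexI[of _ "{}"]) auto
    next
      case True
      note ln\<delta> = sqrt_neg_ln_ge[OF \<delta>(1) True]
      interpret h: hmm \<Omega> \<pi> Q \<Y> f X Y
        unfolding hmm_def hmm_axioms_def using model Q(1) \<pi> \<Y> dens unfolding hidden_markov_model_def by blast
      define a where "a = N * u * (- ln \<delta>) / \<delta>\<^sup>2"
      have a: "0 < a" unfolding a_def using N u ln\<delta>(2) \<delta> by (intro divide_pos_pos mult_pos_pos) auto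
      note fin = threshold_real[OF a thr[folded a_def]]
      have \<eta>0: "0 \<le> ?\<eta>" by (simp add: eta3_def)
      note \<phi>2 = approximation_spacesD(1)[OF ap, of _ r] and on = approximation_spacesD(2)[OF ap, of _ r]
      define O' where "O' m = (\<chi> x. L2_inner \<Y> (f x) (\<phi> r m))" for m
      have low: "c0 * norm v \<le> L2_set (\<lambda>m. O' m \<bullet> v) {1..?M}" and up: "L2_set (\<lambda>m. O' m \<bullet> v) {1..?M} \<le> C0 * norm v" for v
        using cond[OF ap gt M0, of v] unfolding O'_def by blast+
      have \<phi>m: "\<phi> r m \<in> borel_measurable (leb \<Y>)" if "m \<in> {1..?M}" for m using \<phi>2[OF that] by (simp add: L2_fun_def)
      have \<phi>int: "integrable (h.em x) (\<phi> r m)" if "m \<in> {1..?M}" for m x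
        using L2_fun_mult_integrable[OF L2 \<phi>2[OF that]] h.integrable_em[OF \<phi>m[OF that]] by blast
      have O'em: "O' m $ x = (\<integral>y. \<phi> r m y \<partial>h.em x)" if "m \<in> {1..?M}" for m x
        using h.integral_em[OF \<phi>m[OF that], of x] by (simp add: O'_def L2_inner_def)
      \<comment> \<open>The mean feature vector in state \<open>x1\<close> has norm at least
        \<open>c0\<close> by \<open>low\<close>. Being an average over points of \<Y>, it would have
        norm at most c0 / 2 if all of those feature vectors did.\<close>
      have "\<exists>w0\<in>\<Y>. s \<le> L2_set (\<lambda>m. \<phi> r m w0) {1..?M}"
      proof (rule ccontr)
        assume "\<not> ?thesis"
        then have le: "L2_set (\<lambda>m. \<phi> r m w) {1..?M} \<le> s" if "w \<in> \<Y>" for w using that by force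
        have "L2_set (\<lambda>m. \<integral>y. \<phi> r m y \<partial>h.em x1) {1..?M} \<le> s"
          by (rule L2_set_integral_le[OF h.prob_space_em]) (use \<phi>int le in auto)
        moreover have "L2_set (\<lambda>m. O' m \<bullet> axis x1 1) {1..?M} = L2_set (\<lambda>m. \<integral>y. \<phi> r m y \<partial>h.em x1) {1..?M}"
          by (intro L2_set_cong refl) (simp only: inner_axis O'em inner_real_def mult_1_right)
        ultimately show False using low[of "axis x1 1"] c0 by (simp add: s_def)
      qed
      then obtain w0 where w0: "w0 \<in> \<Y>" "s \<le> L2_set (\<lambda>m. \<phi> r m w0) {1..?M}" by blast
      define \<phi>' where "\<phi>' = (\<lambda>a. if a = 0 then \<lambda>_. 1 else \<phi> r a)"
      have \<phi>': "\<phi>' m = \<phi> r m" if "m \<in> {1..?M}" for m using that by (auto simp: \<phi>'_def)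
      interpret g: hmm_features \<Omega> \<pi> Q \<Y> f X Y \<phi>' ?M "\<kappa> * ?\<eta>" H
      proof
        fix m assume "m \<le> ?M"
        then have m: "m = 0 \<or> m \<in> {1..?M}" by auto
        then show "\<phi>' m \<in> borel_measurable (leb \<Y>)" using \<phi>m \<phi>' by (auto simp: \<phi>'_def)
        fix x
        interpret E: prob_space "h.em x" by (rule h.prob_space_em)
        show "integrable (h.em x) (\<phi>' m)" using m \<phi>int \<phi>' by (auto simp: \<phi>'_def)
      next
        show "L2_set (\<lambda>(a, b, c). \<phi>' a y1 * \<phi>' b y2 * \<phi>' c y3 - \<phi>' a z1 * \<phi>' b z2 * \<phi>' c z3) ({..?M} \<times> {..?M} \<times> {..?M}) \<le> \<kappa> * ?\<eta>"
          if "y1 \<in> \<Y>" "y2 \<in> \<Y>" "y3 \<in> \<Y>" "z1 \<in> \<Y>" "z2 \<in> \<Y>" "z3 \<in> \<Y>" for y1 y2 y3 z1 z2 z3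
          unfolding \<kappa>_def \<phi>'_def by (rule extended_feature_diameter[where \<phi> = "\<phi> r" and \<Y> = \<Y> and \<eta> = ?\<eta> and M = ?M, OF eta3_bound[where \<phi> = "\<phi> r", OF fin(1)] w0 s that])
        show "H *v g - Q *v (H *v g) = g" if "\<pi> \<bullet> g = 0" for g using poisson[OF that] .
      qed
      have const: "\<phi>' 0 = (\<lambda>_. 1)" by (simp add: \<phi>'_def)
      have fm: "g.feature_means m = O' m" if "m \<in> {1..?M}" for m
        using \<phi>'[OF that] O'em[OF that] by (simp add: vec_eq_iff g.feature_means_def g.mean_def)
      \<comment> \<open>The deviation bound for the summed tensor, divided by \<open>p\<close>; it
        bounds the errors of all four empirical moments.\<close>
      define e where "e = E1 * ?\<eta> * sqrt u / sqrt p"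
      have p0: "0 < real p" using p by simp
      have u0: "0 < u" using u by simp
      have e_nonneg: "0 \<le> e" unfolding e_def using E1 \<eta>0 u0 p0 by simp
      have eq_e: "5 * ((6 + 4 * g.cH) * (\<kappa> * ?\<eta>)) * sqrt (p * u) / p = e"
      proof -
        have "sqrt (p * u) / p = sqrt u / sqrt p"
          using p0 by (simp add: real_sqrt_mult field_simps)
        then have "5 * ((6 + 4 * g.cH) * (\<kappa> * ?\<eta>)) * (sqrt (p * u) / p) = 5 * ((6 + 4 * g.cH) * (\<kappa> * ?\<eta>)) * (sqrt u / sqrt p)" by simp
        then show ?thesis by (simp add: e_def E1_def c_def g.cH_def K_def)
      qed
      define t where "t = \<delta> / T"
      have t: "0 < t" "t \<le> 1" using \<delta> T by (auto simp: t_def)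
      have e_small: "e \<le> e0 * t"
      proof (rule power2_le_imp_le)
        have "N * u / (2 * \<delta>\<^sup>2) = N * u / \<delta>\<^sup>2 * (1 / 2)" by simp
        also have "\<dots> \<le> N * u / \<delta>\<^sup>2 * (- ln \<delta>)" using N u0 by (intro mult_left_mono ln\<delta>(2)) simp
        also have "\<dots> = a" by (simp add: a_def)
        finally have "N * u / (2 * \<delta>\<^sup>2) \<le> a" .
        then have "N * u / (2 * \<delta>\<^sup>2) * ?\<eta>\<^sup>2 \<le> a * ?\<eta>\<^sup>2" by (rule mult_right_mono) simp
        then have le: "N * u / (2 * \<delta>\<^sup>2) * ?\<eta>\<^sup>2 \<le> p" using fin(2) by linarith
        have "e\<^sup>2 = (E1\<^sup>2 / p) * (u * ?\<eta>\<^sup>2)" using u0 p0 by (simp add: e_def power_mult_distrib power_divide)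
        also have "u * ?\<eta>\<^sup>2 = (2 * \<delta>\<^sup>2 / N) * (N * u / (2 * \<delta>\<^sup>2) * ?\<eta>\<^sup>2)" using N \<delta> by simp
        also have "(E1\<^sup>2 / p) * ((2 * \<delta>\<^sup>2 / N) * (N * u / (2 * \<delta>\<^sup>2) * ?\<eta>\<^sup>2)) \<le> (E1\<^sup>2 / p) * ((2 * \<delta>\<^sup>2 / N) * p)"
          using N by (intro mult_left_mono le) auto
        also have "\<dots> = E1\<^sup>2 * 2 * \<delta>\<^sup>2 / N" using p0 by simp
        also have "\<dots> = (e0 * t)\<^sup>2" using E1 T e0 by (simp add: N_def t_def power_mult_distrib power_divide field_simps)
        finally show "e\<^sup>2 \<le> (e0 * t)\<^sup>2" .
        show "0 \<le> e0 * t" using e0 t by simp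
      qed
      define D where "D = {\<omega> \<in> space \<Omega>. L2_set (\<lambda>i. \<Sum>s=1..p. g.t0 (Y s \<omega>) (Y (s + 1) \<omega>) (Y (s + 2) \<omega>) i - g.tm i) ({..?M} \<times> {..?M} \<times> {..?M})
          \<le> 5 * ((6 + 4 * g.cH) * (\<kappa> * ?\<eta>)) * sqrt (p * u)}"
      have D: "D \<in> sets \<Omega>" "measure \<Omega> (space \<Omega> - D) \<le> exp (- u)"
        unfolding D_def by (rule g.deviation_probability[OF p u])+
      define Z where "Z \<omega> = (\<lambda>j\<in>{1..p + 2}. Y j \<omega>)" for \<omega>
      have Z: "Z \<in> measurable \<Omega> (sample_space \<Y> p)"
        unfolding Z_def sample_space_def by (rule measurable_restrict) auto
      \<comment> \<open>This direction depends on the observations through the singular vectors but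
        not on \<Theta>, as \<open>gap_event\<close> demands.\<close>
      define w where "w i j y = tr_mult ?M (Uh y) O' *v (axis i 1 - axis j 1)" for i j :: 'k and y
      have Um: "(\<lambda>y. Uh y b) \<in> borel_measurable (sample_space \<Y> p)" if "b \<in> {1..?M}" for b
        using est that unfolding spectral_estimators_def by blast
      have wm: "w i j \<in> borel_measurable (sample_space \<Y> p)" for i j
      proof -
        have "tr_mult ?M (Uh y) O' *v v = (\<Sum>b=1..?M. (O' b \<bullet> v) *\<^sub>R Uh y b)" for y v
          by (simp add: vec_eq_iff tr_mult_def matrix_vector_mult_def inner_vec_def sum_distrib_left sum_distrib_right mult_ac)
            (rule allI, rule sum.swap)
        then have "w i j = (\<lambda>y. \<Sum>b=1..?M. (O' b \<bullet> (axis i 1 - axis j 1)) *\<^sub>R Uh y b)" by (simp add: w_def fun_eq_iff)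
        then show ?thesis using Um by (simp only:) (intro borel_measurable_sum borel_measurable_scaleR borel_measurable_const)
      qed
      have indep': "measure \<Omega> ((Z -` A \<inter> space \<Omega>) \<inter> (\<Theta> -` B \<inter> space \<Omega>)) = measure \<Omega> (Z -` A \<inter> space \<Omega>) * measure \<Omega> (\<Theta> -` B \<inter> space \<Omega>)"
        if "A \<in> sets (sample_space \<Y> p)" "B \<in> sets borel" for A B
        unfolding Z_def
        by (rule indep_of_observationsD[OF h.prob_space_axioms h.Y_measurable indep that(1)[unfolded sample_space_def] that(2)])
      obtain B where B: "B \<in> sets \<Omega>" "measure \<Omega> B \<le> 2 * t * real CARD('k) ^ 3"
        and gap: "\<And>\<omega> i j. \<omega> \<in> space \<Omega> - B \<Longrightarrow> t * norm (w i j (Z \<omega>)) \<le> \<bar>column x1 (\<Theta> \<omega>) \<bullet> w i j (Z \<omega>)\<bar>"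
      proof (rule gap_event[where x = x1 and w = w and S = "sample_space \<Y> p" and Z = Z, OF h.prob_space_axioms unif less_imp_le[OF t(1)] Z], goal_cases)
        case (1 A B)
        show ?case by (rule indep') fact+
      next
        case (2 i j)
        show ?case by (rule wm)
      next
        case (3 B)
        show ?case by (rule 3(1)[OF 3(2,3)], rule 3(4))
      qed
      have "2 * t * real CARD('k) ^ 3 = \<delta>" using T by (simp add: t_def T_def K_def)
      then have B\<delta>: "measure \<Omega> B \<le> \<delta>" using B(2) by simp
      \<comment> \<open>The excluded events have probabilities at most exp(-u) and \<delta>; the
        strict inequality comes from the positivity of \<delta> and of the exponential.\<close>
      have prob: "1 - 2 * \<delta> - 4 * exp (- u) < measure \<Omega> (D - B)"
      proof -
        have "measure \<Omega> (space \<Omega> - (D - B)) \<le> measure \<Omega> ((space \<Omega> - D) \<union> B)"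
          using D(1) B(1) sets.sets_into_space[OF B(1)] by (intro h.finite_measure_mono) auto
        also have "\<dots> \<le> measure \<Omega> (space \<Omega> - D) + measure \<Omega> B"
          using D(1) B(1) by (intro measure_Un_le) auto
        finally have "1 - measure \<Omega> (D - B) \<le> exp (- u) + \<delta>"
          using D B\<delta> B(1) by (simp add: h.prob_compl)
        then show ?thesis using \<delta>(1) exp_gt_zero[of "- u"] by linarith
      qed
      have "\<exists>\<tau>. \<tau> permutes UNIV \<and> good \<omega> \<tau>" if \<omega>: "\<omega> \<in> D - B" for \<omega>
      proof -
        have wsp: "\<omega> \<in> space \<Omega>" using \<omega> by (simp add: D_def)
        define y where "y = Z \<omega>"
        have y: "y \<in> space (sample_space \<Y> p)" unfolding y_def using measurable_space[OF Z wsp] .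
        have "L2_set (\<lambda>i. \<Sum>s=1..p. g.t0 (Y s \<omega>) (Y (s + 1) \<omega>) (Y (s + 2) \<omega>) i - g.tm i) ({..?M} \<times> {..?M} \<times> {..?M})
          \<le> 5 * ((6 + 4 * g.cH) * (\<kappa> * ?\<eta>)) * sqrt (p * u)" using \<omega> by (simp add: D_def)
        note close = g.empirical_moments_close[where \<psi> = "\<phi> r", OF const p \<phi>'[symmetric] this, folded Z_def, folded y_def, unfolded eq_e]
        have pops: "population_N \<pi> Q g.feature_means a b = population_N \<pi> Q O' a b"
          "population_P \<pi> Q g.feature_means a b = population_P \<pi> Q O' a b"
          if "a \<in> {1..?M}" "b \<in> {1..?M}" for a b
          using fm that by (simp_all add: population_N_def population_P_def)
        have popM: "population_M \<pi> Q g.feature_means a b c = population_M \<pi> Q O' a b c"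
          if "a \<in> {1..?M}" "b \<in> {1..?M}" "c \<in> {1..?M}" for a b c
          using fm that by (simp add: population_M_def)
        have cL: "L2_set (\<lambda>a. L_hat (\<phi> r) p y a - O' a \<bullet> \<pi>) {1..?M} \<le> e"
          by (rule order_trans[OF eq_refl[OF L2_set_cong] close(1)]) (auto simp: fm)
        have cN: "L2_set (\<lambda>(a, b). N_hat (\<phi> r) p y a b - population_N \<pi> Q O' a b) ({1..?M} \<times> {1..?M}) \<le> e"
          by (rule order_trans[OF eq_refl[OF L2_set_cong] close(2)]) (auto simp: pops)
        have cP: "L2_set (\<lambda>(a, c). P_hat (\<phi> r) p y a c - population_P \<pi> Q O' a c) ({1..?M} \<times> {1..?M}) \<le> e"
          by (rule order_trans[OF eq_refl[OF L2_set_cong] close(3)]) (auto simp: pops)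
        have cM: "L2_set (\<lambda>(a, b, c). M_hat (\<phi> r) p y a b c - population_M \<pi> Q O' a b c) ({1..?M} \<times> {1..?M} \<times> {1..?M}) \<le> e"
          by (rule order_trans[OF eq_refl[OF L2_set_cong] close(4)]) (auto simp: popM)
        have svd: "top_right_singular_vectors ?M (P_hat (\<phi> r) p y) (Uh y)"
          using est y unfolding spectral_estimators_def by blast
        have orth: "orthogonal_matrix (\<Theta> \<omega>)" using unif wsp by (simp add: uniform_orthogonal_def)
        have gap': "t * norm (tr_mult ?M (Uh y) O' *v (axis i 1 - axis j 1)) \<le>
         \<bar>column x1 (\<Theta> \<omega>) \<bullet> (tr_mult ?M (Uh y) O' *v (axis i 1 - axis j 1))\<bar>" for i j
          using gap[of \<omega> i j] \<omega> wsp unfolding w_def y_def by blast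
        note out = alg[OF svd orth low up t gap' cL cN cP cM e_small]
        have so: "spectral_output (\<phi> r) ?M p x1 y (Uh y) (\<Theta> \<omega>) (fh y (\<Theta> \<omega>)) (\<pi>h y (\<Theta> \<omega>)) (Qh y (\<Theta> \<omega>))"
          using est y orth conjunct1[OF out] unfolding spectral_estimators_def by blast
        let ?Q = "Qh y (\<Theta> \<omega>)"
        from conjunct2[OF out, rule_format, OF so]
        obtain \<tau> where st: "stationary_distribution ?Q (\<pi>h y (\<Theta> \<omega>))" and \<tau>: "\<tau> permutes UNIV"
          and f\<tau>: "\<And>x. \<exists>w. fh y (\<Theta> \<omega>) (\<tau> x) = (\<lambda>z. \<Sum>m=1..?M. w m * \<phi> r m z) \<and> L2_set (\<lambda>m. O' m $ x - w m) {1..?M} \<le> C1 * e / t"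
          and Q\<tau>: "norm (perm_mat \<tau> ** ?Q ** transpose (perm_mat \<tau>) - Q) \<le> C1 * e / t"
          by blast
        define bound where "bound = C * (sqrt (- ln \<delta>) / \<delta>) * (?\<eta> / sqrt (real p)) * sqrt u"
        define b1 where "b1 = C1 * e / t"
        have b1: "0 \<le> b1" unfolding b1_def using C1 e_nonneg t by simp
        have bnd: "b1 * (1 + K * norm H) \<le> bound"
        proof -
          define z where "z = ?\<eta> / sqrt (real p) * sqrt u / \<delta>"
          have z: "0 \<le> z" unfolding z_def using \<eta>0 u0 \<delta> by simp
          have "b1 * (1 + K * norm H) = C / 2 * z"
            using T \<delta> by (simp add: b1_def e_def t_def z_def C_def)
          also have "\<dots> = 1 / 2 * (C * z)" by simp
          also have "\<dots> \<le> sqrt (- ln \<delta>) * (C * z)" using ln\<delta>(1) C z by (intro mult_right_mono) auto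
          also have "\<dots> = bound" by (simp add: bound_def z_def mult_ac)
          finally show ?thesis .
        qed
        have KH: "0 \<le> K * norm H" using K by simp
        then have b1b: "b1 \<le> bound" using bnd mult_left_mono[of 1 "1 + K * norm H" b1] b1 by simp
        have "L2_norm \<Y> (\<lambda>z. L2_proj \<Y> ?M (\<phi> r) (f x) z - fh y (\<Theta> \<omega>) (\<tau> x) z) \<le> bound" for x
        proof -
          obtain v where v: "fh y (\<Theta> \<omega>) (\<tau> x) = (\<lambda>z. \<Sum>m=1..?M. v m * \<phi> r m z)" and vb: "L2_set (\<lambda>m. O' m $ x - v m) {1..?M} \<le> b1"
            using f\<tau>[of x] unfolding b1_def by blast
          have "(\<lambda>z. L2_proj \<Y> ?M (\<phi> r) (f x) z - fh y (\<Theta> \<omega>) (\<tau> x) z) = (\<lambda>z. \<Sum>m=1..?M. (O' m $ x - v m) * \<phi> r m z)"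
            by (simp add: v L2_proj_def O'_def left_diff_distrib sum_subtractf fun_eq_iff)
          then have "L2_norm \<Y> (\<lambda>z. L2_proj \<Y> ?M (\<phi> r) (f x) z - fh y (\<Theta> \<omega>) (\<tau> x) z) = sqrt (\<Sum>m=1..?M. (O' m $ x - v m) * (O' m $ x - v m))"
            unfolding L2_norm_def by (simp only:) (subst L2_inner_orthonormal, (rule \<phi>2 on, assumption+)+, rule refl)
          also have "\<dots> = L2_set (\<lambda>m. O' m $ x - v m) {1..?M}" by (simp add: L2_set_def power2_eq_square)
          finally show ?thesis using vb b1b by linarith
        qed
        moreover have "op_norm (Q - perm_mat \<tau> ** ?Q ** transpose (perm_mat \<tau>)) \<le> bound"
          using op_norm_le_norm[of "Q - perm_mat \<tau> ** ?Q ** transpose (perm_mat \<tau>)"] Q\<tau> b1b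
          unfolding b1_def norm_minus_commute[of Q] by linarith
        \<comment> \<open>\<open>pert\<close>, applied to the relabelled estimate, converts the
          error of \<open>Q\<close> into one of \<pi>, whichever stationary distribution was
          returned. K bounds the norm of a probability vector.\<close>
        moreover have "norm (\<pi> - perm_mat \<tau> *v \<pi>h y (\<Theta> \<omega>)) \<le> bound"
        proof -
          let ?P = "perm_mat \<tau> *v \<pi>h y (\<Theta> \<omega>)" and ?Q' = "perm_mat \<tau> ** ?Q ** transpose (perm_mat \<tau>)"
          have s': "stationary_distribution ?Q' ?P" by (rule stationary_distribution_perm[OF \<tau> st])
          have "norm (\<pi> - ?P) = norm ((?P v* (?Q' - Q)) v* H)" unfolding pert[OF s', symmetric] by (rule norm_minus_commute)
          also have "\<dots> \<le> norm (?P v* (?Q' - Q)) * norm H" by (rule norm_vector_matrix_mult_le)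
          also have "\<dots> \<le> (norm ?P * norm (?Q' - Q)) * norm H" by (intro mult_right_mono norm_vector_matrix_mult_le) simp
          also have "\<dots> \<le> (K * b1) * norm H"
            using norm_stationary_distribution_le(1)[OF s'] Q\<tau> K unfolding K_def b1_def by (intro mult_right_mono mult_mono) auto
          also have "\<dots> \<le> b1 * (1 + K * norm H)" using b1 by (simp add: distrib_left)
          finally show ?thesis using bnd by linarith
        qed
        moreover have "(\<lambda>j\<in>{1..p + 2}. Y j \<omega>) = y" by (simp add: y_def Z_def)
        ultimately have "good \<omega> \<tau>"
          unfolding good_def Let_def bound_def[symmetric] by (simp add: Max_le_iff)
        then show ?thesis using \<tau> by blast
      qed
      then show ?thesis using prob D(1) B(1) by (intro bexI[of _ "D - B"]) auto
    qed
    then show "\<exists>E\<in>sets \<Omega>. measure \<Omega> E > 1 - 2 * \<delta> - 4 * exp (- u) \<and>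
        (\<forall>\<omega>\<in>E. \<exists>t. t permutes UNIV \<and>
          (let y = (\<lambda>j\<in>{1..p + 2}. Y j \<omega>);
               bound = C * (sqrt (- ln \<delta>) / \<delta>) * (eta3 \<Y> (Ms r) (\<phi> r) / sqrt (real p)) * sqrt u
           in (MAX x. L2_norm \<Y> (\<lambda>z. L2_proj \<Y> (Ms r) (\<phi> r) (f x) z - fh y (\<Theta> \<omega>) (t x) z)) \<le> bound \<and>
              norm (\<pi> - perm_mat t *v \<pi>h y (\<Theta> \<omega>)) \<le> bound \<and>
              op_norm (Q - perm_mat t ** Qh y (\<Theta> \<omega>) ** transpose (perm_mat t)) \<le> bound))"
      unfolding good_def .
  qed
qed

text \<open>The estimated states are ordered by the columns of \<open>R\<close>, which vary with the
  data and with \<Theta>, so the matching permutation is a function of the outcome. It is selected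
  outcome by outcome on an event whose measurability is established without reference to it.\<close>

theorem theorem3p1:
  fixes Q :: "real^'k^'k" and \<pi> :: "real^'k" and x1 :: 'k
  assumes "transition_matrix Q"
    and "rank Q = CARD('k)"
    and "irreducible_chain Q" and "aperiodic_chain Q"
    and "stationary_distribution Q \<pi>"
  shows "\<exists>u0 > 0. \<forall>(\<Y> :: (real^'d) set) (f :: 'k \<Rightarrow> real^'d \<Rightarrow> real).
    \<Y> \<in> sets borel \<and> (\<forall>x. prob_density \<Y> (f x)) \<and> (\<forall>x. L2_fun \<Y> (f x)) \<and> lin_indep_family \<Y> f \<longrightarrow>
    (\<exists>C > 0. \<exists>N > 0.
      \<forall>(\<Omega> :: 'w measure) X Y \<Theta> Ms \<phi> M0.
        hidden_markov_model \<Omega> \<pi> Q \<Y> f X Y \<and>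
        uniform_orthogonal \<Omega> \<Theta> \<and> indep_of_observations \<Omega> \<Y> Y \<Theta> \<and>
        approximation_spaces \<Y> Ms \<phi> \<and> gram_threshold \<Y> f Ms \<phi> M0 \<longrightarrow>
        (\<forall>u \<delta> r. u0 \<le> u \<and> 0 < \<delta> \<and> \<delta> < 1 \<and> M0 \<le> Ms r \<longrightarrow>
          (\<forall>Uh fh \<pi>h Qh.
            (\<forall>p\<ge>1. spectral_estimators \<Y> (\<phi> r) (Ms r) p x1 (Uh p) (fh p) (\<pi>h p) (Qh p)) \<longrightarrow>
            (\<exists>\<tau> :: nat \<Rightarrow> 'w \<Rightarrow> 'k \<Rightarrow> 'k. (\<forall>p \<omega>. \<tau> p \<omega> permutes UNIV) \<and>
              (\<forall>p\<ge>1. ennreal (N * u * (- ln \<delta>) / \<delta>\<^sup>2) * eta3_sq \<Y> (Ms r) (\<phi> r) \<le> of_nat p \<longrightarrow>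
                (\<exists>E\<in>sets \<Omega>. measure \<Omega> E > 1 - 2 * \<delta> - 4 * exp (- u) \<and>
                  (\<forall>\<omega>\<in>E.
                    let y = (\<lambda>j\<in>{1..p + 2}. Y j \<omega>);
                        t = \<tau> p \<omega>;
                        bound = C * (sqrt (- ln \<delta>) / \<delta>) * (eta3 \<Y> (Ms r) (\<phi> r) / sqrt (real p)) * sqrt u
                    in (MAX x. L2_norm \<Y> (\<lambda>z. L2_proj \<Y> (Ms r) (\<phi> r) (f x) z
                                               - fh p y (\<Theta> \<omega>) (t x) z)) \<le> bound \<and>
                       norm (\<pi> - perm_mat t *v \<pi>h p y (\<Theta> \<omega>)) \<le> bound \<and>
                       op_norm (Q - perm_mat t ** Qh p y (\<Theta> \<omega>) ** transpose (perm_mat t))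
                         \<le> bound)))))))"
proof -
  have inv: "invertible Q"
    using assms(2) full_rank_injective[of Q] matrix_left_invertible_injective[of Q] invertible_left_inverse[of Q] by blast
  show ?thesis
  \<comment> \<open>The value u0 = 1 comes from \<open>deviation_probability\<close>, where it
    serves to absorb a factor 2 and to make p u at least 1.\<close>
  proof (rule exI[of _ 1], intro conjI allI impI, simp)
    fix \<Y> :: "(real^'d) set" and f :: "'k \<Rightarrow> real^'d \<Rightarrow> real"
    assume a: "\<Y> \<in> sets borel \<and> (\<forall>x. prob_density \<Y> (f x)) \<and> (\<forall>x. L2_fun \<Y> (f x)) \<and> lin_indep_family \<Y> f"
    then have \<Y>: "\<Y> \<in> sets borel" and dens: "\<And>x. prob_density \<Y> (f x)" and L2: "\<And>x. L2_fun \<Y> (f x)"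
      and ind: "lin_indep_family \<Y> f" by auto
    show "\<exists>C > 0. \<exists>N > 0.
      \<forall>(\<Omega> :: 'w measure) X Y \<Theta> Ms \<phi> M0.
        hidden_markov_model \<Omega> \<pi> Q \<Y> f X Y \<and>
        uniform_orthogonal \<Omega> \<Theta> \<and> indep_of_observations \<Omega> \<Y> Y \<Theta> \<and>
        approximation_spaces \<Y> Ms \<phi> \<and> gram_threshold \<Y> f Ms \<phi> M0 \<longrightarrow>
        (\<forall>u \<delta> r. 1 \<le> u \<and> 0 < \<delta> \<and> \<delta> < 1 \<and> M0 \<le> Ms r \<longrightarrow>
          (\<forall>Uh fh \<pi>h Qh.
            (\<forall>p\<ge>1. spectral_estimators \<Y> (\<phi> r) (Ms r) p x1 (Uh p) (fh p) (\<pi>h p) (Qh p)) \<longrightarrow>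
            (\<exists>\<tau> :: nat \<Rightarrow> 'w \<Rightarrow> 'k \<Rightarrow> 'k. (\<forall>p \<omega>. \<tau> p \<omega> permutes UNIV) \<and>
              (\<forall>p\<ge>1. ennreal (N * u * (- ln \<delta>) / \<delta>\<^sup>2) * eta3_sq \<Y> (Ms r) (\<phi> r) \<le> of_nat p \<longrightarrow>
                (\<exists>E\<in>sets \<Omega>. measure \<Omega> E > 1 - 2 * \<delta> - 4 * exp (- u) \<and>
                  (\<forall>\<omega>\<in>E.
                    let y = (\<lambda>j\<in>{1..p + 2}. Y j \<omega>);
                        t = \<tau> p \<omega>;
                        bound = C * (sqrt (- ln \<delta>) / \<delta>) * (eta3 \<Y> (Ms r) (\<phi> r) / sqrt (real p)) * sqrt u
                    in (MAX x. L2_norm \<Y> (\<lambda>z. L2_proj \<Y> (Ms r) (\<phi> r) (f x) z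
                                               - fh p y (\<Theta> \<omega>) (t x) z)) \<le> bound \<and>
                       norm (\<pi> - perm_mat t *v \<pi>h p y (\<Theta> \<omega>)) \<le> bound \<and>
                       op_norm (Q - perm_mat t ** Qh p y (\<Theta> \<omega>) ** transpose (perm_mat t))
                         \<le> bound))))))"
    proof (rule spectral_estimators_event[where 'w = 'w and ?x1.0 = x1, OF assms(1) inv assms(3,5) \<Y> dens L2 ind], goal_cases)
      case (1 C N)
      note event = 1(3)
      show ?case
      proof (rule exI[of _ C], rule conjI, rule 1(1), rule exI[of _ N], rule conjI, rule 1(2), intro allI impI, goal_cases)
        case (1 \<Omega> X Y \<Theta> Ms \<phi> M0 u \<delta> r Uh fh \<pi>h Qh)
        define good where "good p \<omega> t \<longleftrightarrow>
          (let y = (\<lambda>j\<in>{1..p + 2}. Y j \<omega>);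
               bound = C * (sqrt (- ln \<delta>) / \<delta>) * (eta3 \<Y> (Ms r) (\<phi> r) / sqrt (real p)) * sqrt u
           in (MAX x. L2_norm \<Y> (\<lambda>z. L2_proj \<Y> (Ms r) (\<phi> r) (f x) z - fh p y (\<Theta> \<omega>) (t x) z)) \<le> bound \<and>
              norm (\<pi> - perm_mat t *v \<pi>h p y (\<Theta> \<omega>)) \<le> bound \<and>
              op_norm (Q - perm_mat t ** Qh p y (\<Theta> \<omega>) ** transpose (perm_mat t)) \<le> bound)" for p \<omega> t
        have ev: "\<exists>E\<in>sets \<Omega>. measure \<Omega> E > 1 - 2 * \<delta> - 4 * exp (- u) \<and> (\<forall>\<omega>\<in>E. \<exists>t. t permutes UNIV \<and> good p \<omega> t)"
          if "1 \<le> p" "ennreal (N * u * (- ln \<delta>) / \<delta>\<^sup>2) * eta3_sq \<Y> (Ms r) (\<phi> r) \<le> of_nat p" for p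
          unfolding good_def
          by (rule event[of \<Omega> X Y \<Theta> Ms \<phi> M0 u \<delta> r p "Uh p" "fh p" "\<pi>h p" "Qh p"]) (use 1 that in simp_all)
        \<comment> \<open>The identity is a default for outcomes without a suitable permutation, so
          that \<open>\<tau> p \<omega>\<close> is always a permutation.\<close>
        define \<tau> where "\<tau> p \<omega> = (if \<exists>t. t permutes UNIV \<and> good p \<omega> t then SOME t. t permutes UNIV \<and> good p \<omega> t else id)" for p \<omega>
        have \<tau>: "\<tau> p \<omega> permutes UNIV \<and> good p \<omega> (\<tau> p \<omega>)" if "\<exists>t. t permutes UNIV \<and> good p \<omega> t" for p \<omega>
          unfolding \<tau>_def if_P[OF that] by (rule someI_ex[OF that])
        show ?case
        proof (intro exI[of _ \<tau>] conjI allI impI)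
          fix p \<omega> show "\<tau> p \<omega> permutes UNIV"
            using \<tau>[of p \<omega>] permutes_id[of UNIV] by (cases "\<exists>t. t permutes UNIV \<and> good p \<omega> t") (auto simp: \<tau>_def)
        next
          fix p assume "1 \<le> p" "ennreal (N * u * (- ln \<delta>) / \<delta>\<^sup>2) * eta3_sq \<Y> (Ms r) (\<phi> r) \<le> of_nat p"
          from ev[OF this] obtain E where E: "E \<in> sets \<Omega>" "measure \<Omega> E > 1 - 2 * \<delta> - 4 * exp (- u)"
            and ex: "\<forall>\<omega>\<in>E. \<exists>t. t permutes UNIV \<and> good p \<omega> t" by (elim bexE conjE) (rule that)
          have good: "good p \<omega> (\<tau> p \<omega>)" if "\<omega> \<in> E" for \<omega>
            using \<tau>[OF bspec[OF ex that]] by (rule conjunct2)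
          show "\<exists>E\<in>sets \<Omega>. measure \<Omega> E > 1 - 2 * \<delta> - 4 * exp (- u) \<and>
                  (\<forall>\<omega>\<in>E.
                    let y = (\<lambda>j\<in>{1..p + 2}. Y j \<omega>);
                        t = \<tau> p \<omega>;
                        bound = C * (sqrt (- ln \<delta>) / \<delta>) * (eta3 \<Y> (Ms r) (\<phi> r) / sqrt (real p)) * sqrt u
                    in (MAX x. L2_norm \<Y> (\<lambda>z. L2_proj \<Y> (Ms r) (\<phi> r) (f x) z
                                               - fh p y (\<Theta> \<omega>) (t x) z)) \<le> bound \<and>
                       norm (\<pi> - perm_mat t *v \<pi>h p y (\<Theta> \<omega>)) \<le> bound \<and>
                       op_norm (Q - perm_mat t ** Qh p y (\<Theta> \<omega>) ** transpose (perm_mat t))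
                         \<le> bound)"
            using good unfolding good_def Let_def
            by (intro bexI[OF _ E(1)] conjI[OF E(2)] ballI)
        qed
      qed
    qed
  qed
qed

end
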